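(* Let $I=[0,2\pi]$, let $w$ satisfy Assumption A, and let $\rho\in\mathcal P(I)$ with $\sqrt\rho\in\mathrm H^1_{\rm per}(I)$. Then $\lim_{\varepsilon\downarrow0}F^\varepsilon_{\rm per}(\rho)=F_{\rm OT}(\rho)$. Moreover, if for each $\varepsilon>0$, $\Gamma_\varepsilon=\sum_k\lambda_k^\varepsilon|\Psi_k^\varepsilon\rangle\langle\Psi_k^\varepsilon|$ is a minimizer of $F^\varepsilon_{\rm per}(\rho)$, then along a subsequence the $n$-particle densities $\Gamma_\varepsilon(x,x)=\sum_k\lambda_k^\varepsilon|\Psi_k^\varepsilon(x)|^2$ converge weakly as measures on $I^n$ to a symmetric optimizer $\gamma_{\rm opt}$ of $F_{\rm OT}(\rho)$. In particular, if $w$ is strictly well-ordering on $I$, then $\Gamma_\varepsilon(x,x)$ converges weakly to the symmetrization of the Seidl plan $\gamma_\rho$.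
   Context: $|t|_{\mathbb T}=\min\{|t-k|:k\in2\pi\mathbb Z\}$. Assumption A: $w:I\times I\to[0,+\infty]$ is symmetric and continuous (with the topology of $[0,+\infty]$) and $\{w=\infty\}=\{(x,y)\in I\times I:|x-y|_{\mathbb T}=0\}$. $I_n=[0,2\pi]^n$, $c_n(x)=\sum_{i\neq j}w(x_i,x_j)$ (ordered pairs), $\Pi(\rho)$ = probability measures on $I_n$ with all one-dimensional marginals equal to $\rho$, $F_{\rm OT}(\rho)=\min_{\gamma\in\Pi(\rho)}\int c_n\,d\gamma$. $\mathrm H^1_{\rm per}(I_n)$ is the space of restrictions to $I_n$ of $2\pi\mathbb Z^n$-periodic $\mathrm H^1_{\rm loc}(\mathbb R^n)$ functions; $\mathcal H_n=\wedge^n\mathrm L^2(I)$ (antisymmetric functions). For $\Psi\in\mathcal H_n$ normalized, $\rho_\Psi(x)=n\int_{I^{n-1}}|\Psi(x,x_2,\dots,x_n)|^2dx_2\cdots dx_n$. Periodic Lieb functional: $F^\varepsilon_{\rm per}(\rho)=\inf\{\sum_k\lambda_k\int_{I_n}(\varepsilon|\nabla\Psi_k|^2+c_n|\Psi_k|^2)\,dx\}$, infimum over orthonormal families $\Psi_k\in\mathcal H_n\cap\mathrm H^1_{\rm per}(I_n)$ and weights $\lambda_k\ge0$, $\sum_k\lambda_k=1$, with $\sum_k\lambda_k\rho_{\Psi_k}=n\rho$; a minimizer is a density matrix $\sum_k\lambda_k|\Psi_k\rangle\langle\Psi_k|$ attaining it. Strictly well-ordering and Seidl plan: for $x_1\le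 x_2\le x_3\le x_4$ in $I$, $w(x_1,x_3)+w(x_2,x_4)$ is the minimum over permutations $\sigma$ of $w(x_{\sigma(1)},x_{\sigma(2)})+w(x_{\sigma(3)},x_{\sigma(4)})$ (well-ordering), with equality for some $\sigma$ only if the sum is infinite or $\delta_{x_1}+\delta_{x_3}$ equals $\delta_{x_{\sigma(1)}}+\delta_{x_{\sigma(2)}}$ or $\delta_{x_{\sigma(3)}}+\delta_{x_{\sigma(4)}}$ (strict). Seidl plan: choose $0=d_0<\dots<d_n=2\pi$ with $\rho([d_i,d_{i+1}])=1/n$; $T$ is the $\rho$-a.e. unique map increasing on each $(d_i,d_{i+1})$ with $T^\#(\mathbb 1_{[d_i,d_{i+1}]}\rho)=\mathbb 1_{[d_{i+1},d_{i+2}]}\rho$ ($i\le n-2$), $T^\#(\mathbb 1_{[d_{n-1},d_n]}\rho)=\mathbb 1_{[d_0,d_1]}\rho$; $\gamma_\rho=(\mathrm{id},T,\dots,T^{(n-1)})^\#\rho$, and its symmetrization is $\frac1{n!}\sum_{\sigma\in S_n}\sigma^\#\gamma_\rho$. *)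

theory Defs
  imports "HOL-Probability.Probability" "HOL-Library.Multiset"
begin

definition Iper :: "real set" where
  "Iper = {0..2*pi}"

definition tnorm :: "real \<Rightarrow> real" where
  "tnorm t = (INF k::int. \<bar>t - 2 * pi * of_int k\<bar>)"

definition assumptionA :: "(real \<Rightarrow> real \<Rightarrow> ennreal) \<Rightarrow> bool" where
  "assumptionA w \<longleftrightarrow>
     (\<forall>x\<in>Iper. \<forall>y\<in>Iper. w x y = w y x) \<and>
     continuous_on (Iper \<times> Iper) (\<lambda>(x,y). w x y) \<and>
     {(x,y) \<in> Iper \<times> Iper. w x y = \<infinity>} = {(x,y) \<in> Iper \<times> Iper. tnorm (x - y) = 0}"

text \<open>Points of I_n (and of R^n) are extensional functions on the index set {..<n}.\<close>
definition cn :: "nat \<Rightarrow> (real \<Rightarrow> real \<Rightarrow> ennreal) \<Rightarrow> (nat \<Rightarrow> real) \<Rightarrow> ennreal" where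
  "cn n w x = (\<Sum>i<n. \<Sum>j\<in>{..<n} - {i}. w (x i) (x j))"

definition mI :: "real measure" where
  "mI = restrict_space lborel Iper"

definition Mn :: "nat \<Rightarrow> (nat \<Rightarrow> real) measure" where
  "Mn n = PiM {..<n} (\<lambda>_. mI)"

definition Rn :: "nat \<Rightarrow> (nat \<Rightarrow> real) measure" where
  "Rn n = PiM {..<n} (\<lambda>_. lborel)"

definition In :: "nat \<Rightarrow> (nat \<Rightarrow> real) set" where
  "In n = PiE {..<n} (\<lambda>_. Iper)"

definition Rspace :: "nat \<Rightarrow> (nat \<Rightarrow> real) set" where
  "Rspace n = PiE {..<n} (\<lambda>_. (UNIV :: real set))"

definition pdir :: "nat \<Rightarrow> ((nat \<Rightarrow> real) \<Rightarrow> real) \<Rightarrow> (nat \<Rightarrow> real) \<Rightarrow> real" where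
  "pdir i f x = deriv (\<lambda>t. f (x(i := x i + t))) 0"

fun iter_pd :: "nat list \<Rightarrow> ((nat \<Rightarrow> real) \<Rightarrow> real) \<Rightarrow> (nat \<Rightarrow> real) \<Rightarrow> real" where
  "iter_pd [] f = f"
| "iter_pd (i # is) f = pdir i (iter_pd is f)"

definition test_fun :: "nat \<Rightarrow> ((nat \<Rightarrow> real) \<Rightarrow> real) \<Rightarrow> bool" where
  "test_fun n \<phi> \<longleftrightarrow>
     (\<forall>is. set is \<subseteq> {..<n} \<longrightarrow>
        continuous_on (Rspace n) (iter_pd is \<phi>) \<and>
        (\<forall>x\<in>Rspace n. \<forall>i<n. (\<lambda>t. iter_pd is \<phi> (x(i := x i + t))) differentiable (at 0))) \<and>
     (\<exists>R. \<forall>x\<in>Rspace n. (\<exists>i<n. R < \<bar>x i\<bar>) \<longrightarrow> \<phi> x = 0)"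

definition weak_pderiv :: "nat \<Rightarrow> nat \<Rightarrow> ((nat \<Rightarrow> real) \<Rightarrow> complex) \<Rightarrow> ((nat \<Rightarrow> real) \<Rightarrow> complex) \<Rightarrow> bool" where
  "weak_pderiv n i f g \<longleftrightarrow>
     (\<forall>\<phi>. test_fun n \<phi> \<longrightarrow>
        integral\<^sup>L (Rn n) (\<lambda>x. f x * complex_of_real (pdir i \<phi> x))
        = - integral\<^sup>L (Rn n) (\<lambda>x. g x * complex_of_real (\<phi> x)))"

definition L2loc :: "nat \<Rightarrow> ((nat \<Rightarrow> real) \<Rightarrow> complex) \<Rightarrow> bool" where
  "L2loc n f \<longleftrightarrow> f \<in> borel_measurable (Rn n) \<and>
     (\<forall>R::real. (\<integral>\<^sup>+ x. indicator {x. \<forall>i<n. \<bar>x i\<bar> \<le> R} x * ennreal ((cmod (f x))\<^sup>2) \<partial>Rn n) < \<infinity>)"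

definition periodic_fun :: "nat \<Rightarrow> ((nat \<Rightarrow> real) \<Rightarrow> 'a) \<Rightarrow> bool" where
  "periodic_fun n f \<longleftrightarrow> (\<forall>x\<in>Rspace n. \<forall>i<n. f (x(i := x i + 2*pi)) = f x)"

definition H1per_grad :: "nat \<Rightarrow> ((nat \<Rightarrow> real) \<Rightarrow> complex) \<Rightarrow> (nat \<Rightarrow> (nat \<Rightarrow> real) \<Rightarrow> complex) \<Rightarrow> bool" where
  "H1per_grad n \<Psi> G \<longleftrightarrow>
     (\<exists>f Gf. periodic_fun n f \<and> L2loc n f \<and>
        (\<forall>i<n. L2loc n (Gf i) \<and> weak_pderiv n i f (Gf i)) \<and>
        (\<forall>x\<in>In n. \<Psi> x = f x \<and> (\<forall>i<n. G i x = Gf i x)))"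

definition H1per :: "nat \<Rightarrow> ((nat \<Rightarrow> real) \<Rightarrow> complex) \<Rightarrow> bool" where
  "H1per n \<Psi> \<longleftrightarrow> (\<exists>G. H1per_grad n \<Psi> G)"

definition antisym_fun :: "nat \<Rightarrow> ((nat \<Rightarrow> real) \<Rightarrow> complex) \<Rightarrow> bool" where
  "antisym_fun n \<Psi> \<longleftrightarrow>
     (\<forall>\<sigma>. \<sigma> permutes {..<n} \<longrightarrow> (AE x in Mn n. \<Psi> (x \<circ> \<sigma>) = of_int (sign \<sigma>) * \<Psi> x))"

definition in_Hn :: "nat \<Rightarrow> ((nat \<Rightarrow> real) \<Rightarrow> complex) \<Rightarrow> bool" where
  "in_Hn n \<Psi> \<longleftrightarrow> \<Psi> \<in> borel_measurable (Mn n) \<and>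
     (\<integral>\<^sup>+ x. ennreal ((cmod (\<Psi> x))\<^sup>2) \<partial>Mn n) < \<infinity> \<and> antisym_fun n \<Psi>"

definition rhoPsi :: "nat \<Rightarrow> ((nat \<Rightarrow> real) \<Rightarrow> complex) \<Rightarrow> real \<Rightarrow> ennreal" where
  "rhoPsi n \<Psi> t = of_nat n * (\<integral>\<^sup>+ y. ennreal ((cmod (\<Psi> (y(0 := t))))\<^sup>2) \<partial>PiM {1..<n} (\<lambda>_. mI))"

definition lieb_admissible ::
  "nat \<Rightarrow> (real \<Rightarrow> real) \<Rightarrow> (nat \<Rightarrow> real) \<Rightarrow> (nat \<Rightarrow> (nat \<Rightarrow> real) \<Rightarrow> complex)
     \<Rightarrow> (nat \<Rightarrow> nat \<Rightarrow> (nat \<Rightarrow> real) \<Rightarrow> complex) \<Rightarrow> bool" where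
  "lieb_admissible n \<rho> lam Psi G \<longleftrightarrow>
     (\<forall>k. in_Hn n (Psi k) \<and> H1per_grad n (Psi k) (G k)) \<and>
     (\<forall>k l. integral\<^sup>L (Mn n) (\<lambda>x. Psi k x * cnj (Psi l x)) = (if k = l then 1 else 0)) \<and>
     (\<forall>k. 0 \<le> lam k) \<and> lam sums 1 \<and>
     (AE t in lborel. t \<in> Iper \<longrightarrow>
        (\<Sum>k. ennreal (lam k) * rhoPsi n (Psi k) t) = of_nat n * ennreal (\<rho> t))"

definition lieb_energy ::
  "nat \<Rightarrow> (real \<Rightarrow> real \<Rightarrow> ennreal) \<Rightarrow> real \<Rightarrow> (nat \<Rightarrow> real) \<Rightarrow> (nat \<Rightarrow> (nat \<Rightarrow> real) \<Rightarrow> complex)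
     \<Rightarrow> (nat \<Rightarrow> nat \<Rightarrow> (nat \<Rightarrow> real) \<Rightarrow> complex) \<Rightarrow> ennreal" where
  "lieb_energy n w \<epsilon> lam Psi G =
     (\<Sum>k. ennreal (lam k) *
        (\<integral>\<^sup>+ x. ennreal \<epsilon> * ennreal (\<Sum>i<n. (cmod (G k i x))\<^sup>2)
                 + cn n w x * ennreal ((cmod (Psi k x))\<^sup>2) \<partial>Mn n))"

definition F_per :: "nat \<Rightarrow> (real \<Rightarrow> real \<Rightarrow> ennreal) \<Rightarrow> real \<Rightarrow> (real \<Rightarrow> real) \<Rightarrow> ennreal" where
  "F_per n w \<epsilon> \<rho> =
     (INF t \<in> {(lam, Psi, G). lieb_admissible n \<rho> lam Psi G}.
        (case t of (lam, Psi, G) \<Rightarrow> lieb_energy n w \<epsilon> lam Psi G))"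

text \<open>A minimizer of F_per: the density matrix given by weights lam and states Psi.\<close>
definition lieb_minimizer ::
  "nat \<Rightarrow> (real \<Rightarrow> real \<Rightarrow> ennreal) \<Rightarrow> real \<Rightarrow> (real \<Rightarrow> real) \<Rightarrow> (nat \<Rightarrow> real)
     \<Rightarrow> (nat \<Rightarrow> (nat \<Rightarrow> real) \<Rightarrow> complex) \<Rightarrow> bool" where
  "lieb_minimizer n w \<epsilon> \<rho> lam Psi \<longleftrightarrow>
     (\<exists>G. lieb_admissible n \<rho> lam Psi G \<and> lieb_energy n w \<epsilon> lam Psi G = F_per n w \<epsilon> \<rho>)"

definition Gamma_dens :: "nat \<Rightarrow> (nat \<Rightarrow> real) \<Rightarrow> (nat \<Rightarrow> (nat \<Rightarrow> real) \<Rightarrow> complex) \<Rightarrow> (nat \<Rightarrow> real) measure" where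
  "Gamma_dens n lam Psi = density (Mn n) (\<lambda>x. \<Sum>k. ennreal (lam k) * ennreal ((cmod (Psi k x))\<^sup>2))"

definition prob_density_on_I :: "(real \<Rightarrow> real) \<Rightarrow> bool" where
  "prob_density_on_I \<rho> \<longleftrightarrow> \<rho> \<in> borel_measurable borel \<and> (\<forall>t\<in>Iper. 0 \<le> \<rho> t) \<and>
     (\<integral>\<^sup>+ t\<in>Iper. ennreal (\<rho> t) \<partial>lborel) = 1"

definition rho_measure :: "(real \<Rightarrow> real) \<Rightarrow> real measure" where
  "rho_measure \<rho> = density lborel (\<lambda>t. indicator Iper t * ennreal (\<rho> t))"

definition Pi_rho :: "nat \<Rightarrow> (real \<Rightarrow> real) \<Rightarrow> (nat \<Rightarrow> real) measure set" where
  "Pi_rho n \<rho> = {\<gamma>. sets \<gamma> = sets (Mn n) \<and> prob_space \<gamma> \<and>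
      (\<forall>i<n. distr \<gamma> borel (\<lambda>x. x i) = rho_measure \<rho>)}"

definition F_OT :: "nat \<Rightarrow> (real \<Rightarrow> real \<Rightarrow> ennreal) \<Rightarrow> (real \<Rightarrow> real) \<Rightarrow> ennreal" where
  "F_OT n w \<rho> = (INF \<gamma> \<in> Pi_rho n \<rho>. \<integral>\<^sup>+ x. cn n w x \<partial>\<gamma>)"

definition OT_optimizer :: "nat \<Rightarrow> (real \<Rightarrow> real \<Rightarrow> ennreal) \<Rightarrow> (real \<Rightarrow> real) \<Rightarrow> (nat \<Rightarrow> real) measure \<Rightarrow> bool" where
  "OT_optimizer n w \<rho> \<gamma> \<longleftrightarrow> \<gamma> \<in> Pi_rho n \<rho> \<and> (\<integral>\<^sup>+ x. cn n w x \<partial>\<gamma>) = F_OT n w \<rho>"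

definition sym_plan :: "nat \<Rightarrow> (nat \<Rightarrow> real) measure \<Rightarrow> bool" where
  "sym_plan n \<gamma> \<longleftrightarrow> (\<forall>\<sigma>. \<sigma> permutes {..<n} \<longrightarrow> distr \<gamma> (Mn n) (\<lambda>x. x \<circ> \<sigma>) = \<gamma>)"

definition symmetrization :: "nat \<Rightarrow> (nat \<Rightarrow> real) measure \<Rightarrow> (nat \<Rightarrow> real) measure" where
  "symmetrization n \<gamma> = measure_of (space (Mn n)) (sets (Mn n))
     (\<lambda>A. (\<Sum>\<sigma>\<in>{\<sigma>. \<sigma> permutes {..<n}}. emeasure (distr \<gamma> (Mn n) (\<lambda>x. x \<circ> \<sigma>)) A) / of_nat (fact n))"

definition weak_conv_In :: "nat \<Rightarrow> ('b \<Rightarrow> (nat \<Rightarrow> real) measure) \<Rightarrow> (nat \<Rightarrow> real) measure \<Rightarrow> 'b filter \<Rightarrow> bool" where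
  "weak_conv_In n \<mu> \<nu> F \<longleftrightarrow>
     (\<forall>f :: (nat \<Rightarrow> real) \<Rightarrow> real. continuous_on (In n) f \<longrightarrow>
        ((\<lambda>j. integral\<^sup>L (\<mu> j) f) \<longlongrightarrow> integral\<^sup>L \<nu> f) F)"

definition strictly_well_ordering :: "(real \<Rightarrow> real \<Rightarrow> ennreal) \<Rightarrow> bool" where
  "strictly_well_ordering w \<longleftrightarrow>
     (\<forall>x1 x2 x3 x4. x1 \<in> Iper \<and> x2 \<in> Iper \<and> x3 \<in> Iper \<and> x4 \<in> Iper \<and>
        x1 \<le> x2 \<and> x2 \<le> x3 \<and> x3 \<le> x4 \<longrightarrow>
        (\<forall>\<sigma>. \<sigma> permutes {0..<4::nat} \<longrightarrow>
           (let p = (\<lambda>i. [x1, x2, x3, x4] ! \<sigma> i);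
                s = w (p 0) (p 1) + w (p 2) (p 3) in
              w x1 x3 + w x2 x4 \<le> s \<and>
              (s = w x1 x3 + w x2 x4 \<longrightarrow>
                 w x1 x3 + w x2 x4 = \<infinity> \<or> {#x1, x3#} = {#p 0, p 1#} \<or> {#x1, x3#} = {#p 2, p 3#}))))"

definition seidl_plan :: "nat \<Rightarrow> (real \<Rightarrow> real) \<Rightarrow> (nat \<Rightarrow> real) measure \<Rightarrow> bool" where
  "seidl_plan n \<rho> \<gamma> \<longleftrightarrow>
     (\<exists>(d :: nat \<Rightarrow> real) (T :: real \<Rightarrow> real).
        d 0 = 0 \<and> d n = 2*pi \<and> (\<forall>i<n. d i < d (Suc i)) \<and>
        (\<forall>i<n. (\<integral>\<^sup>+ t\<in>{d i..d (Suc i)}. ennreal (\<rho> t) \<partial>lborel) = ennreal (1 / real n)) \<and>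
        T \<in> borel_measurable borel \<and> T \<in> Iper \<rightarrow> Iper \<and>
        (\<forall>i<n. mono_on {d i<..<d (Suc i)} T) \<and>
        (\<forall>i<n. distr (density lborel (\<lambda>t. indicator {d i..d (Suc i)} t * ennreal (\<rho> t))) borel T
               = density lborel (\<lambda>t. indicator {d (Suc i mod n)..d (Suc (Suc i mod n))} t * ennreal (\<rho> t))) \<and>
        \<gamma> = distr (density mI (\<lambda>t. ennreal (\<rho> t))) (Mn n) (\<lambda>x. \<lambda>i\<in>{..<n}. (T ^^ i) x))"

end

theory Submission
  imports Defs
begin

text \<open>The density of an admissible mixed state is a symmetric transport plan whose cost is at most its energy, so
  \<open>F\<^sub>O\<^sub>T \<le> F\<^sub>p\<^sub>e\<^sub>r\<close>. Conversely, a plan of finite cost is discretized on small arcs of the circle and modified, keeping its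
  marginals, so that any two of its points stay at a fixed distance. A smooth periodic partition \<open>\<Sum>\<^sub>j \<chi>\<^sub>j\<^sup>2 = 1\<close> whose angles are
  chosen by the intermediate value theorem makes the orbitals \<open>\<surd>\<rho> \<chi>\<^sub>j\<close> orthogonal, and the mixture of their Slater
  determinants has density exactly \<open>n\<rho>\<close>, finite kinetic energy and almost the cost of the plan; letting \<open>\<epsilon> \<rightarrow> 0\<close>
  gives the limit, and weak compactness of the plans gives the convergence of minimizers along subsequences.

  If \<open>w\<close> is strictly well-ordering, take two independent samples of an optimal plan and redistribute the \<open>2n\<close> sorted
  points alternately. Summation by parts writes the cost as \<open>\<Sum> \<alpha>\<^sub>i\<^sub>j (S\<^sub>i - S\<^sub>j)\<^sup>2\<close> with \<open>\<alpha>\<^sub>i\<^sub>j > 0\<close>, where \<open>S\<close> counts the points of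
  the first sample minus those of the second; so the cost strictly decreases unless the counting functions of the two
  samples differ by oscillations of size at most one. This balance property fixes the law of the sorted points
  in terms of \<open>\<rho>\<close>, and the Seidl plan has it too, because its points sit at the quantiles \<open>v + k/n\<close>.\<close>

section \<open>Densities of mixed states as transport plans\<close>

text \<open>The density of a trial state must be exactly \<open>n\<close> times \<rho>, so
  mollifying a plan and repairing its marginals is avoided. The squared orbitals
  \<open>\<rho> \<chi>_j^2 / m_j\<close> recombine to \<rho> under any weights on index tuples whose
  marginals are the cell masses \<open>m_j\<close>; all regularization thus becomes finite
  combinatorics on tuples. Two features of the definitions shape the rest. Admissible families are
  infinite and orthonormal: determinants must be orthogonal although neighbouring cells overlap,
  tuples with the same entries must be merged, and states of weight zero must be supplied. And
  \<open>w\<close> is continuous on the square but not assumed periodic, while orbitals must be: the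
  one cell across the seam is short on the circle but not in \<open>I\<close>, so \<open>w\<close>
  need not have small oscillation there. Tuples touching it are exchanged together with those that
  come too close to the diagonal. The kinetic constant depends on the discretization and not on
  \<epsilon>, so \<epsilon> tends to zero only after the discretization error has been
  fixed.\<close>

lemma Iper_borel [measurable]: "Iper \<in> sets borel"
 by (simp add: Iper_def)

lemma space_mI [simp]: "space mI = Iper"
 by (simp add: mI_def)

lemma sets_mI: "sets mI = sets (restrict_space borel Iper)"
 by (simp add: mI_def sets_restrict_space)

lemma finite_measure_mI: "finite_measure mI"
 by (rule finite_measureI)
   (simp add: mI_def emeasure_restrict_space Iper_def)

interpretation mI: finite_measure mI by (rule finite_measure_mI)
interpretation PM: product_sigma_finite "%_::nat. mI" ..
interpretation PR: product_sigma_finite "%_::nat. lborel :: real measure" ..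

lemma space_Mn [simp]: "space (Mn n) = In n"
 by (simp add: Mn_def In_def space_PiM)

lemma space_Rn [simp]: "space (Rn n) = Rspace n"
 by (simp add: Rn_def Rspace_def space_PiM)

lemma In_subset_Rspace: "In n \<subseteq> Rspace n"
 by (auto simp: In_def Rspace_def PiE_def)

lemma In_coord: "x \<in> In n ==> i < n ==> x i \<in> Iper"
 by (auto simp: In_def PiE_def Pi_def)

lemma measurable_mI_borel [measurable]: "(%x. x) \<in> measurable mI borel"
 by (simp add: mI_def measurable_restrict_space1)

lemma measurable_coord_mI: "i < n ==> (%x. x i) \<in> measurable (Mn n) mI"
 unfolding Mn_def by (rule measurable_component_singleton) auto

text \<open>Beyond the index set a point of the cube has the constant value
  \<open>undefined\<close>, which lets later measurability arguments run over all
  \<open>i\<close>.\<close>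

lemma measurable_coord [measurable]: "(%x. x i) \<in> measurable (Mn n) borel"
proof (cases "i < n")
 case True
 have "(%t. t) \<circ> (%x. x i) \<in> measurable (Mn n) borel"
  using True by (intro measurable_comp[OF measurable_coord_mI measurable_mI_borel])
 thus ?thesis by (simp add: o_def)
next
 case False
 have "(%x. x i) \<in> measurable (Mn n) borel \<longleftrightarrow> (%x::nat=>real. undefined::real) \<in> measurable (Mn n) borel"
  using False by (intro measurable_cong) (auto simp: In_def PiE_def extensional_def)
 thus ?thesis by simp
qed

text \<open>The bridge from the finite product sigma-algebra to the topology of functions on all of
  \<open>nat\<close>, whose Borel sets are generated by the coordinates. Continuity on
  \<open>In n\<close> thereby gives measurability on \<open>Mn n\<close>.\<close>

lemma measurable_Mn_borel: "(%x. x) \<in> measurable (Mn n) (borel :: (nat => real) measure)"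
proof -
 have "(%x. x) \<in> measurable (Mn n) (PiM UNIV (%_. borel))"
  by (rule measurable_PiM_single') (auto simp: measurable_coord)
 thus ?thesis
  using measurable_cong_sets[OF refl sets_PiM_equal_borel] by blast
qed

lemma measurable_into_Mn:
 assumes "!!i. i < n ==> (%x. f x i) \<in> borel_measurable M" "!!x. x \<in> space M ==> f x \<in> In n"
 shows "f \<in> measurable M (Mn n)"
 unfolding Mn_def
proof (rule measurable_PiM_single')
 fix i assume i: "i \<in> {..<n}"
 have "(%x. f x i) \<in> measurable M (restrict_space borel Iper)"
  using assms i by (intro measurable_restrict_space2) (auto intro!: In_coord[of "f _" n])
 thus "(%x. f x i) \<in> measurable M mI"
  using measurable_cong_sets[OF refl sets_mI] by blast
qed (use assms(2) in \<open>auto simp: In_def\<close>)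

lemma borel_measurable_continuous_In:
 fixes f :: "(nat => real) => 'a::topological_space"
 assumes "continuous_on (In n) f"
 shows "f \<in> borel_measurable (Mn n)"
proof -
 have "f \<in> borel_measurable (restrict_space borel (In n))"
  by (rule borel_measurable_continuous_on_restrict[OF assms])
 moreover have "(%x. x) \<in> measurable (Mn n) (restrict_space borel (In n))"
  by (rule measurable_restrict_space2[OF _ measurable_Mn_borel]) auto
 ultimately have "f \<circ> (%x. x) \<in> borel_measurable (Mn n)"
  by (rule measurable_comp[rotated])
 thus ?thesis by (simp add: o_def)
qed

lemma permute_In: "\<sigma> permutes {..<n} ==> x \<in> In n ==> x \<circ> \<sigma> \<in> In n"
 by (auto simp: In_def PiE_def Pi_def extensional_def permutes_not_in dest: permutes_in_image)

lemma measurable_permute: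
 assumes "\<sigma> permutes {..<n}"
 shows "(%x. x \<circ> \<sigma>) \<in> measurable (Mn n) (Mn n)"
 by (rule measurable_into_Mn) (auto simp: permute_In[OF assms])

text \<open>A permutation of coordinates sends a rectangle to the rectangle with permuted sides, and
  the product of the side measures does not see the order.\<close>

lemma distr_Mn_permute:
 assumes s: "\<sigma> permutes {..<n}"
 shows "distr (Mn n) (Mn n) (%x. x \<circ> \<sigma>) = Mn n"
proof -
 have "distr (Mn n) (Mn n) (%x. x \<circ> \<sigma>) = PiM {..<n} (%_. mI)"
 proof (rule PM.PiM_eqI)
  fix A :: "nat => real set" assume A: "!!i. i \<in> {..<n} ==> A i \<in> sets mI"
  have in': "\<sigma> i < n \<longleftrightarrow> i < n" for i using permutes_in_image[OF s, of i] by auto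
  have si: "inv \<sigma> permutes {..<n}" by (rule permutes_inv[OF s])
  have in'': "inv \<sigma> i < n \<longleftrightarrow> i < n" for i using permutes_in_image[OF si, of i] by auto
  have sub: "A i \<subseteq> Iper" if "i < n" for i using sets.sets_into_space[OF A[of i]] that by auto
  have pre: "(%x. x \<circ> \<sigma>) -` PiE {..<n} A \<inter> space (Mn n) = PiE {..<n} (A \<circ> inv \<sigma>)"
  proof (intro set_eqI iffI)
   fix x assume x: "x \<in> (%x. x \<circ> \<sigma>) -` PiE {..<n} A \<inter> space (Mn n)"
   have "x i \<in> A (inv \<sigma> i)" if "i < n" for i
   proof -
    have "(x \<circ> \<sigma>) (inv \<sigma> i) \<in> A (inv \<sigma> i)" using x that in'' by (auto simp: PiE_def Pi_def)
    thus ?thesis by (simp add: permutes_inverses(1)[OF s])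
   qed
   thus "x \<in> PiE {..<n} (A \<circ> inv \<sigma>)" using x by (auto simp: In_def PiE_def)
  next
   fix x assume x: "x \<in> PiE {..<n} (A \<circ> inv \<sigma>)"
   have xi: "x i \<in> A (inv \<sigma> i)" if "i < n" for i using x that by (auto simp: PiE_def Pi_def)
   have "x \<in> In n" using x xi sub in'' by (auto simp: In_def PiE_def Pi_def)
   moreover have "(x \<circ> \<sigma>) i \<in> A i" if "i < n" for i
    using xi[of "\<sigma> i"] that in' by (simp add: permutes_inverses(2)[OF s])
   ultimately show "x \<in> (%x. x \<circ> \<sigma>) -` PiE {..<n} A \<inter> space (Mn n)"
    using permute_In[OF s, of x] by (auto simp: PiE_def In_def)
  qed
  have "emeasure (distr (Mn n) (Mn n) (%x. x \<circ> \<sigma>)) (PiE {..<n} A) = emeasure (Mn n) (PiE {..<n} (A \<circ> inv \<sigma>))"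
   unfolding pre[symmetric] using A
   by (intro emeasure_distr measurable_permute[OF s]) (auto simp: Mn_def intro!: sets_PiM_I_finite)
  also have "\<dots> = (\<Prod>i\<in>{..<n}. emeasure mI (A (inv \<sigma> i)))"
   unfolding Mn_def using A in'' by (subst PM.emeasure_PiM) auto
  also have "\<dots> = (\<Prod>i\<in>{..<n}. emeasure mI (A i))"
   using prod.permute[OF si, of "%i. emeasure mI (A i)"] by (simp add: o_def)
  finally show "emeasure (distr (Mn n) (Mn n) (%x. x \<circ> \<sigma>)) (PiE {..<n} A) = (\<Prod>i\<in>{..<n}. emeasure mI (A i))" .
 qed (auto simp: Mn_def)
 thus ?thesis by (simp add: Mn_def)
qed

lemma nn_integral_Mn_permute:
 assumes s: "\<sigma> permutes {..<n}" and f: "f \<in> borel_measurable (Mn n)"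
 shows "(\<integral>\<^sup>+ x. f (x \<circ> \<sigma>) \<partial>Mn n) = (\<integral>\<^sup>+ x. f x \<partial>Mn n)"
 using nn_integral_distr[OF measurable_permute[OF s], of f] f distr_Mn_permute[OF s] by simp

lemma continuous_on_pair_cost:
 assumes "assumptionA w" "i < n" "j < n"
 shows "continuous_on (In n) (%x. w (x i) (x j))"
proof -
 have "continuous_on (In n) (%x. (%(x,y). w x y) (x i, x j))"
  by (rule continuous_on_compose2[of "Iper \<times> Iper" "%(x,y). w x y"])
    (use assms in \<open>auto simp: assumptionA_def In_coord
     intro!: continuous_intros continuous_on_subset[OF continuous_on_product_coordinates]\<close>)
 thus ?thesis by simp
qed

lemma continuous_on_cn: "assumptionA w ==> continuous_on (In n) (cn n w)"
 unfolding cn_def by (intro continuous_on_sum continuous_on_pair_cost) auto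

lemma measurable_cn [measurable]: "assumptionA w ==> cn n w \<in> borel_measurable (Mn n)"
 by (intro borel_measurable_continuous_In continuous_on_cn)

text \<open>Coordinate 0 is split off because \<open>rhoPsi\<close> freezes exactly that
  one.\<close>

lemma nn_integral_Mn_split:
 assumes "1 <= n" "f \<in> borel_measurable (Mn n)"
 shows "(\<integral>\<^sup>+ x. f x \<partial>Mn n) = (\<integral>\<^sup>+ t. (\<integral>\<^sup>+ y. f (y(0 := t)) \<partial>PiM {1..<n} (%_. mI)) \<partial>mI)"
proof -
 have i: "{..<n} = insert 0 {1..<n}" using assms by auto
 show ?thesis
  using PM.product_nn_integral_insert_rev[of "{1..<n}" 0 f] assms(2) unfolding Mn_def i by simp
qed

lemma measurable_insert_coord:
 assumes "1 <= n"
 shows "(%(t, y). y(0 := t)) \<in> measurable (mI \<Otimes>\<^sub>M PiM {1..<n} (%_. mI)) (Mn n)"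
proof -
 have i: "{..<n} = insert 0 {1..<n}" using assms by auto
 show ?thesis unfolding Mn_def i by measurable
qed

lemma in_Hn_meas [measurable_dest]: "in_Hn n \<Psi> ==> \<Psi> \<in> borel_measurable (Mn n)"
 by (simp add: in_Hn_def)

lemma measurable_rhoPsi:
 assumes n: "1 <= n" and m: "\<Psi> \<in> borel_measurable (Mn n)"
 shows "(%t. \<integral>\<^sup>+ y. ennreal ((cmod (\<Psi> (y(0 := t))))\<^sup>2) \<partial>PiM {1..<n} (%_. mI)) \<in> borel_measurable mI"
proof -
 interpret f: finite_product_sigma_finite "%_. mI" "{1..<n}" by unfold_locales auto
 have [measurable]: "\<Psi> \<in> borel_measurable (Mn n)" by fact
 have [measurable]: "(%x. ennreal ((cmod (\<Psi> x))\<^sup>2)) \<in> borel_measurable (Mn n)" by measurable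
 have "(%x. ennreal ((cmod (\<Psi> x))\<^sup>2)) \<circ> (%(t, y). y(0 := t)) \<in> borel_measurable (mI \<Otimes>\<^sub>M PiM {1..<n} (%_. mI))"
  by (rule measurable_comp[OF measurable_insert_coord[OF n]]) measurable
 thus ?thesis
  by (intro f.borel_measurable_nn_integral) (simp add: o_def split_beta')
qed

section \<open>The diagonal density of an admissible mixture\<close>

locale lieb_state =
 fixes n :: nat and \<rho> lam Psi G
 assumes n1: "1 <= n" and \<rho>: "prob_density_on_I \<rho>"
  and adm: "lieb_admissible n \<rho> lam Psi G"
begin

lemma Psi_Hn: "in_Hn n (Psi k)"
 using adm by (simp add: lieb_admissible_def)

lemma Psi_meas [measurable]: "Psi k \<in> borel_measurable (Mn n)"
 using Psi_Hn by (simp add: in_Hn_def)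

lemma lam_nonneg: "0 <= lam k"
 using adm by (simp add: lieb_admissible_def)

definition "dens x = (\<Sum>k. ennreal (lam k) * ennreal ((cmod (Psi k x))\<^sup>2))"

lemma dens_meas [measurable]: "dens \<in> borel_measurable (Mn n)"
 unfolding dens_def by measurable

lemma Gamma_eq: "Gamma_dens n lam Psi = density (Mn n) dens"
 by (simp add: Gamma_dens_def dens_def[abs_def])

lemma sets_Gamma [simp, measurable_cong]: "sets (Gamma_dens n lam Psi) = sets (Mn n)"
 by (simp add: Gamma_eq)

lemma Psi_norm: "(\<integral>\<^sup>+ x. ennreal ((cmod (Psi k x))\<^sup>2) \<partial>Mn n) = 1"
proof -
 have fin: "(\<integral>\<^sup>+ x. ennreal ((cmod (Psi k x))\<^sup>2) \<partial>Mn n) < \<infinity>"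
  using Psi_Hn by (simp add: in_Hn_def)
 hence int: "integrable (Mn n) (%x. (cmod (Psi k x))\<^sup>2)"
  by (intro integrableI_bounded) auto
 have "integral\<^sup>L (Mn n) (%x. Psi k x * cnj (Psi k x)) = 1"
  using adm by (simp add: lieb_admissible_def)
 hence "integral\<^sup>L (Mn n) (%x. complex_of_real ((cmod (Psi k x))\<^sup>2)) = 1"
  by (simp add: complex_norm_square flip: of_real_power)
 hence "integral\<^sup>L (Mn n) (%x. (cmod (Psi k x))\<^sup>2) = 1"
  unfolding integral_complex_of_real by (simp only: of_real_eq_1_iff)
 thus ?thesis
  using nn_integral_eq_integral[OF int] by simp
qed

lemma nn_integral_dens:
 assumes [measurable]: "h \<in> borel_measurable (Mn n)"
 shows "(\<integral>\<^sup>+ x. h x \<partial>Gamma_dens n lam Psi) = (\<Sum>k. ennreal (lam k) * (\<integral>\<^sup>+ x. h x * ennreal ((cmod (Psi k x))\<^sup>2) \<partial>Mn n))"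
proof -
 have "(\<integral>\<^sup>+ x. h x \<partial>Gamma_dens n lam Psi) = (\<integral>\<^sup>+ x. dens x * h x \<partial>Mn n)"
  unfolding Gamma_eq by (rule nn_integral_density) auto
 also have "\<dots> = (\<integral>\<^sup>+ x. (\<Sum>k. ennreal (lam k) * (h x * ennreal ((cmod (Psi k x))\<^sup>2))) \<partial>Mn n)"
  unfolding dens_def ennreal_suminf_multc[symmetric] by (simp add: ac_simps)
 also have "\<dots> = (\<Sum>k. \<integral>\<^sup>+ x. ennreal (lam k) * (h x * ennreal ((cmod (Psi k x))\<^sup>2)) \<partial>Mn n)"
  by (rule nn_integral_suminf) measurable
 finally show ?thesis by (simp add: nn_integral_cmult)
qed

lemma prob_Gamma: "prob_space (Gamma_dens n lam Psi)"
proof (rule prob_spaceI)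
 have "emeasure (Gamma_dens n lam Psi) (space (Gamma_dens n lam Psi)) = (\<integral>\<^sup>+ x. 1 \<partial>Gamma_dens n lam Psi)"
  by simp
 also have "\<dots> = (\<Sum>k. ennreal (lam k))"
  by (subst nn_integral_dens) (auto simp: Psi_norm)
 also have "\<dots> = 1"
  using adm lam_nonneg by (subst suminf_ennreal_eq[of lam 1]) (auto simp: lieb_admissible_def)
 finally show "emeasure (Gamma_dens n lam Psi) (space (Gamma_dens n lam Psi)) = 1" .
qed

text \<open>The sign has modulus one. Antisymmetry holds off a null set for each state, and there
  are countably many states.\<close>

lemma dens_permute:
 assumes s: "\<sigma> permutes {..<n}"
 shows "AE x in Mn n. dens (x \<circ> \<sigma>) = dens x"
proof -
 have "AE x in Mn n. \<forall>k. Psi k (x \<circ> \<sigma>) = of_int (sign \<sigma>) * Psi k x"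
  unfolding AE_all_countable using Psi_Hn s by (auto simp: in_Hn_def antisym_fun_def)
 moreover have "cmod (of_int (sign \<sigma>)) = 1" by (simp add: sign_def)
 ultimately show ?thesis
  by (elim AE_mp) (auto simp: dens_def norm_mult intro!: AE_I2)
qed

lemma sym_Gamma: "sym_plan n (Gamma_dens n lam Psi)"
 unfolding sym_plan_def
proof (intro allI impI)
 fix \<sigma> assume s: "\<sigma> permutes {..<n}"
 let ?G = "Gamma_dens n lam Psi"
 note [measurable] = measurable_permute[OF s]
 show "distr ?G (Mn n) (%x. x \<circ> \<sigma>) = ?G"
 proof (rule measure_eqI)
  fix A assume "A \<in> sets (distr ?G (Mn n) (%x. x \<circ> \<sigma>))"
  hence A[measurable]: "A \<in> sets (Mn n)" by simp
  have "emeasure (distr ?G (Mn n) (%x. x \<circ> \<sigma>)) A = (\<integral>\<^sup>+ x. indicator A x \<partial>distr ?G (Mn n) (%x. x \<circ> \<sigma>))"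
   by simp
  also have "\<dots> = (\<integral>\<^sup>+ x. indicator A (x \<circ> \<sigma>) \<partial>?G)"
   by (rule nn_integral_distr) measurable
  also have "\<dots> = (\<integral>\<^sup>+ x. dens x * indicator A (x \<circ> \<sigma>) \<partial>Mn n)"
   unfolding Gamma_eq by (rule nn_integral_density) measurable
  also have "\<dots> = (\<integral>\<^sup>+ x. dens (x \<circ> \<sigma>) * indicator A (x \<circ> \<sigma>) \<partial>Mn n)"
   by (rule nn_integral_cong_AE) (use dens_permute[OF s] in \<open>elim AE_mp, auto intro!: AE_I2\<close>)
  also have "\<dots> = (\<integral>\<^sup>+ x. dens x * indicator A x \<partial>Mn n)"
   by (rule nn_integral_Mn_permute[OF s, of "%x. dens x * indicator A x"]) measurable
  also have "\<dots> = emeasure ?G A"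
   unfolding Gamma_eq by (rule emeasure_density[symmetric]) auto
  finally show "emeasure (distr ?G (Mn n) (%x. x \<circ> \<sigma>)) A = emeasure ?G A" .
 qed simp
qed

text \<open>The weighted sum of the \<open>rhoPsi\<close> is prescribed as \<open>n\<close> times
  \<rho>; the factor \<open>n\<close> inside \<open>rhoPsi\<close> cancels, so coordinate 0 carries
  the law \<rho>.\<close>

lemma marginal_0:
 assumes B[measurable]: "B \<in> sets borel"
 shows "(\<integral>\<^sup>+ x. indicator B (x 0) \<partial>Gamma_dens n lam Psi) = emeasure (rho_measure \<rho>) B"
proof -
 define r where "r k t = (\<integral>\<^sup>+ y. ennreal ((cmod (Psi k (y(0 := t))))\<^sup>2) \<partial>PiM {1..<n} (%_. mI))" for k t
 have rm[measurable]: "r k \<in> borel_measurable mI" for k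
  unfolding r_def by (rule measurable_rhoPsi[OF n1 Psi_meas])
 have \<rho>m[measurable]: "\<rho> \<in> borel_measurable borel" using \<rho> by (simp add: prob_density_on_I_def)
 have "(\<integral>\<^sup>+ x. indicator B (x 0) \<partial>Gamma_dens n lam Psi)
   = (\<Sum>k. ennreal (lam k) * (\<integral>\<^sup>+ x. indicator B (x 0) * ennreal ((cmod (Psi k x))\<^sup>2) \<partial>Mn n))"
  by (rule nn_integral_dens) measurable
 moreover have "(\<integral>\<^sup>+ x. indicator B (x 0) * ennreal ((cmod (Psi k x))\<^sup>2) \<partial>Mn n) = (\<integral>\<^sup>+ t. indicator B t * r k t \<partial>mI)" for k
 proof -
  have "(\<integral>\<^sup>+ x. indicator B (x 0) * ennreal ((cmod (Psi k x))\<^sup>2) \<partial>Mn n)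
    = (\<integral>\<^sup>+ t. (\<integral>\<^sup>+ y. indicator B ((y(0 := t)) 0) * ennreal ((cmod (Psi k (y(0 := t))))\<^sup>2) \<partial>PiM {1..<n} (%_. mI)) \<partial>mI)"
   by (rule nn_integral_Mn_split[OF n1]) measurable
  also have "\<dots> = (\<integral>\<^sup>+ t. indicator B t * r k t \<partial>mI)"
  proof (rule nn_integral_cong)
   fix t assume "t \<in> space mI"
   show "(\<integral>\<^sup>+ y. indicator B ((y(0 := t)) 0) * ennreal ((cmod (Psi k (y(0 := t))))\<^sup>2) \<partial>PiM {1..<n} (%_. mI)) = indicator B t * r k t"
    unfolding r_def by (cases "t \<in> B") auto
  qed
  finally show ?thesis .
 qed
 ultimately have "(\<integral>\<^sup>+ x. indicator B (x 0) \<partial>Gamma_dens n lam Psi)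
   = (\<Sum>k. ennreal (lam k) * (\<integral>\<^sup>+ t. indicator B t * r k t \<partial>mI))" by simp
 also have "(\<Sum>k. ennreal (lam k) * (\<integral>\<^sup>+ t. indicator B t * r k t \<partial>mI))
   = (\<integral>\<^sup>+ t. indicator B t * (\<Sum>k. ennreal (lam k) * r k t) \<partial>mI)"
 proof -
  have "(\<integral>\<^sup>+ t. indicator B t * (\<Sum>k. ennreal (lam k) * r k t) \<partial>mI) = (\<integral>\<^sup>+ t. (\<Sum>k. ennreal (lam k) * (indicator B t * r k t)) \<partial>mI)"
   unfolding ennreal_suminf_cmult[symmetric] by (simp add: ac_simps)
  also have "\<dots> = (\<Sum>k. \<integral>\<^sup>+ t. ennreal (lam k) * (indicator B t * r k t) \<partial>mI)"
   by (rule nn_integral_suminf) measurable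
  finally show ?thesis by (simp add: nn_integral_cmult)
 qed
 also have "\<dots> = (\<integral>\<^sup>+ t. indicator B t * ennreal (\<rho> t) \<partial>mI)"
 proof (rule nn_integral_cong_AE)
  have "AE t in lborel. t \<in> Iper --> (\<Sum>k. ennreal (lam k) * rhoPsi n (Psi k) t) = of_nat n * ennreal (\<rho> t)"
   using adm by (simp add: lieb_admissible_def)
  hence "AE t in mI. (\<Sum>k. ennreal (lam k) * rhoPsi n (Psi k) t) = of_nat n * ennreal (\<rho> t)"
   unfolding mI_def by (subst AE_restrict_space_iff) auto
  thus "AE t in mI. indicator B t * (\<Sum>k. ennreal (lam k) * r k t) = indicator B t * ennreal (\<rho> t)"
  proof (elim AE_mp, intro AE_I2 impI)
   fix t assume "(\<Sum>k. ennreal (lam k) * rhoPsi n (Psi k) t) = of_nat n * ennreal (\<rho> t)"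
   hence "(\<Sum>k. of_nat n * (ennreal (lam k) * r k t)) = of_nat n * ennreal (\<rho> t)"
    by (simp add: rhoPsi_def r_def ac_simps)
   hence "of_nat n * (\<Sum>k. ennreal (lam k) * r k t) = of_nat n * ennreal (\<rho> t)"
    by simp
   hence "(\<Sum>k. ennreal (lam k) * r k t) = ennreal (\<rho> t)"
    using n1 by (subst (asm) ennreal_mult_cancel_left) (auto simp: ennreal_of_nat_eq_real_of_nat)
   thus "indicator B t * (\<Sum>k. ennreal (lam k) * r k t) = indicator B t * ennreal (\<rho> t)" by simp
  qed
 qed
 also have "\<dots> = (\<integral>\<^sup>+ t. indicator B t * ennreal (\<rho> t) * indicator Iper t \<partial>lborel)"
  unfolding mI_def by (subst nn_integral_restrict_space) auto
 also have "\<dots> = emeasure (rho_measure \<rho>) B"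
  unfolding rho_measure_def by (subst emeasure_density) (auto intro!: nn_integral_cong simp: ac_simps)
 finally show ?thesis .
qed

text \<open>By symmetry of the density, the transposition of 0 and \<open>i\<close> turns the
  \<open>i\<close>-th marginal into the one already computed.\<close>

lemma Gamma_in_Pi: "Gamma_dens n lam Psi \<in> Pi_rho n \<rho>"
 unfolding Pi_rho_def
proof (intro CollectI conjI allI impI)
 fix i assume i: "i < n"
 let ?G = "Gamma_dens n lam Psi" and ?s = "Transposition.transpose 0 i"
 have s: "?s permutes {..<n}" using n1 i by (intro permutes_swap_id) auto
 show "distr ?G borel (%x. x i) = rho_measure \<rho>"
 proof (rule measure_eqI)
  fix B assume "B \<in> sets (distr ?G borel (%x. x i))"
  hence B[measurable]: "B \<in> sets borel" by simp
  have "emeasure (distr ?G borel (%x. x i)) B = (\<integral>\<^sup>+ x. indicator B x \<partial>distr ?G borel (%x. x i))" by simp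
  also have "\<dots> = (\<integral>\<^sup>+ x. indicator B (x i) \<partial>?G)"
   by (subst nn_integral_distr) auto
  also have "\<dots> = (\<integral>\<^sup>+ x. indicator B (x i) \<partial>distr ?G (Mn n) (%x. x \<circ> ?s))"
   using sym_Gamma s by (simp add: sym_plan_def)
  also have "\<dots> = (\<integral>\<^sup>+ x. indicator B ((x \<circ> ?s) i) \<partial>?G)"
   using measurable_permute[OF s] by (intro nn_integral_distr) auto
  also have "\<dots> = emeasure (rho_measure \<rho>) B"
   using marginal_0[OF B] by simp
  finally show "emeasure (distr ?G borel (%x. x i)) B = emeasure (rho_measure \<rho>) B" .
 qed (simp add: rho_measure_def)
qed (auto simp: prob_Gamma)

text \<open>The kinetic term is nonnegative and is dropped.\<close>

lemma cost_Gamma_le: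
 assumes "assumptionA w"
 shows "(\<integral>\<^sup>+ x. cn n w x \<partial>Gamma_dens n lam Psi) <= lieb_energy n w \<epsilon> lam Psi G"
proof -
 have "(\<integral>\<^sup>+ x. cn n w x \<partial>Gamma_dens n lam Psi) = (\<Sum>k. ennreal (lam k) * (\<integral>\<^sup>+ x. cn n w x * ennreal ((cmod (Psi k x))\<^sup>2) \<partial>Mn n))"
  by (rule nn_integral_dens) (use assms in measurable)
 also have "\<dots> <= lieb_energy n w \<epsilon> lam Psi G"
  unfolding lieb_energy_def by (intro suminf_le mult_left_mono nn_integral_mono) auto
 finally show ?thesis .
qed

end

lemma F_OT_le_F_per:
 assumes "1 <= n" "assumptionA w" "prob_density_on_I \<rho>"
 shows "F_OT n w \<rho> <= F_per n w \<epsilon> \<rho>"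
 unfolding F_per_def
proof (rule INF_greatest, clarsimp)
 fix lam Psi G assume a: "lieb_admissible n \<rho> lam Psi G"
 interpret lieb_state n \<rho> lam Psi G using assms a by unfold_locales
 show "F_OT n w \<rho> <= lieb_energy n w \<epsilon> lam Psi G"
  unfolding F_OT_def using Gamma_in_Pi cost_Gamma_le[OF assms(2)] by (meson INF_lower2)
qed

declare measurable_mI_borel [measurable del] measurable_coord [measurable del]

section \<open>Weak compactness of plans\<close>

text \<open>Schoenberg's plateau function: of period 2, equal to 0 on [0,1/3] and to 1 on [2/3,1],
  because the cosine is at least 1/2 on the first plateau and at most -1/2 on the second.\<close>

definition phi :: "real => real" where "phi t = max 0 (min 1 (1/2 - cos (pi * t)))"

lemma phi_bounds: "0 <= phi t" "phi t <= 1" by (auto simp: phi_def)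

lemma continuous_phi: "continuous_on A phi"
 unfolding phi_def by (intro continuous_intros)

lemma phi_digit:
 fixes k :: int
 assumes "d = 0 \<or> d = (1::real)" "0 <= \<theta>" "\<theta> <= 1/3"
 shows "phi (2 * of_int k + 2 * d / 3 + \<theta>) = d"
proof -
 have *: "cos (pi * (2 * of_int k + \<tau>)) = cos (pi * \<tau>)" for \<tau>
 proof -
  have "cos (pi * (2 * of_int k + \<tau>)) = cos (pi * \<tau> + 2 * pi * of_int k)" by (simp add: algebra_simps)
  also have "\<dots> = cos (pi * \<tau>)" by (simp add: cos_add)
  finally show ?thesis .
 qed
 have "cos (pi * \<theta>) \<ge> cos (pi / 3)" if "d = 0"
  using assms by (intro cos_monotone_0_pi_le) (auto simp: field_simps)
 moreover have "cos (pi * (2/3 + \<theta>)) <= cos (2 * pi / 3)" if "d = 1"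
 proof (intro cos_monotone_0_pi_le)
  have "pi * (2/3 + \<theta>) <= pi * 1" using assms by (intro mult_left_mono) auto
  thus "pi * (2/3 + \<theta>) <= pi" by simp
 qed (use assms in \<open>auto simp: field_simps\<close>)
 ultimately show ?thesis
  using assms(1) *[of "2 * d / 3 + \<theta>"] by (auto simp: phi_def cos_60 cos_120 add.assoc)
qed

definition dig :: "real => nat => real" where
 "dig y m = of_int (\<lfloor>2 ^ Suc m * y\<rfloor> mod 2)"

lemma dig_01: "dig y m = 0 \<or> dig y m = 1"
 by (auto simp: dig_def)

text \<open>The partial sums are the floors of \<open>2^M * y\<close> divided by \<open>2^M\<close>;
  the bounds on \<open>y\<close> make the zeroth floor vanish.\<close>

lemma dig_sums:
 assumes "0 <= y" "y < 1"
 shows "(%m. dig y m / 2 ^ Suc m) sums y"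
proof -
 have fl: "\<lfloor>2 * z\<rfloor> = 2 * \<lfloor>z\<rfloor> + \<lfloor>2 * z\<rfloor> mod 2" for z :: real
 proof -
  have "\<lfloor>2 * z\<rfloor> div 2 = \<lfloor>z\<rfloor>"
   using floor_divide_real_eq_div[of 2 "2*z"] by simp
  thus ?thesis by (metis mult_div_mod_eq)
 qed
 have part: "(\<Sum>m<M. dig y m / 2 ^ Suc m) = of_int \<lfloor>2 ^ M * y\<rfloor> / 2 ^ M" for M
 proof (induction M)
  case 0 show ?case using assms by (simp add: floor_eq_iff)
 next
  case (Suc M)
  have "real_of_int \<lfloor>2 ^ Suc M * y\<rfloor> = 2 * of_int \<lfloor>2 ^ M * y\<rfloor> + dig y M"
   unfolding dig_def using fl[of "2 ^ M * y"] by (simp add: mult.assoc)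
  thus ?case using Suc by (simp add: field_simps)
 qed
 have "(%M. of_int \<lfloor>2 ^ M * y\<rfloor> / 2 ^ M) \<longlonglongrightarrow> y"
 proof (rule tendsto_sandwich)
  show "(%M. y - (1/2) ^ M) \<longlonglongrightarrow> y"
   by (rule tendsto_eq_intros LIMSEQ_realpow_zero | simp)+
  show "\<forall>\<^sub>F M in sequentially. y - (1/2) ^ M <= of_int \<lfloor>2 ^ M * y\<rfloor> / 2 ^ M"
  proof (intro always_eventually allI)
   fix M :: nat
   have "2 ^ M * y - 1 <= of_int \<lfloor>2 ^ M * y\<rfloor>" by linarith
   hence "(2 ^ M * y - 1) / 2 ^ M <= of_int \<lfloor>2 ^ M * y\<rfloor> / 2 ^ M" by (rule divide_right_mono) simp
   thus "y - (1/2) ^ M <= of_int \<lfloor>2 ^ M * y\<rfloor> / 2 ^ M" by (simp add: diff_divide_distrib power_one_over)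
  qed
  show "\<forall>\<^sub>F M in sequentially. of_int \<lfloor>2 ^ M * y\<rfloor> / 2 ^ M <= y"
   by (intro always_eventually allI) (simp add: field_simps)
 qed auto
 thus ?thesis unfolding sums_def part .
qed

text \<open>The point of the Cantor set whose ternary digits 0 and 2 encode the bits
  \<open>d\<close>.\<close>

definition code3 :: "(nat => real) => real" where
 "code3 d = (\<Sum>k. 2 * d k / 3 ^ Suc k)"

context
 fixes d :: "nat => real" assumes d: "!!k. d k = 0 \<or> d k = 1"
begin

lemma d_bounds: "0 <= d k" "d k <= 1" using d[of k] by auto

lemma sums_third: "(%k. 2 / 3 ^ Suc k) sums (1::real)"
proof -
 have "(%k. (2/3) * (1/3) ^ k) sums ((2/3) * (1 / (1 - 1/3)) :: real)"
  by (intro sums_mult geometric_sums) auto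
 thus ?thesis by (simp add: power_divide)
qed

lemma code3_summable: "summable (%k. 2 * d k / 3 ^ Suc k)"
 by (rule summable_comparison_test'[OF sums_summable[OF sums_third], of 0])
   (use d_bounds in \<open>auto simp: abs_mult divide_right_mono\<close>)

lemma code3_bounds: "0 <= code3 d" "code3 d <= 1"
proof -
 show "0 <= code3 d" unfolding code3_def
  by (rule suminf_nonneg[OF code3_summable]) (simp add: d_bounds)
 have "code3 d <= (\<Sum>k. 2 / 3 ^ Suc k)" unfolding code3_def
  by (rule suminf_le[OF _ code3_summable sums_summable[OF sums_third]])
    (use d_bounds in \<open>auto simp: divide_right_mono\<close>)
 thus "code3 d <= 1" using sums_unique[OF sums_third] by simp
qed

end

text \<open>Multiplication by \<open>3^k\<close> shifts the ternary expansion. As the digits are 0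
  or 2, the integer part is even and lost to the period of \<open>phi\<close>; the next digit puts
  the remainder in [0,1/3] or [2/3,1], since the tail is at most 1/3.\<close>

lemma phi_code3:
 fixes d :: "nat => real"
 assumes d: "!!k. d k = 0 \<or> d k = 1"
 shows "phi (3 ^ k * code3 d) = d k"
proof -
 define e where "e j = d (j + Suc k)" for j
 have e: "e j = 0 \<or> e j = 1" for j using d by (auto simp: e_def)
 have "code3 d = (\<Sum>j. 2 * d (j + Suc k) / 3 ^ Suc (j + Suc k)) + (\<Sum>i<Suc k. 2 * d i / 3 ^ Suc i)"
  unfolding code3_def by (rule suminf_split_initial_segment[OF code3_summable[OF d]])
 also have "(\<Sum>j. 2 * d (j + Suc k) / 3 ^ Suc (j + Suc k)) = (\<Sum>j. (1 / 3 ^ Suc k) * (2 * e j / 3 ^ Suc j))"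
  by (simp add: e_def power_add field_simps)
 also have "\<dots> = code3 e / 3 ^ Suc k"
  unfolding code3_def by (subst suminf_mult[OF code3_summable[OF e]]) simp
 finally have "3 ^ k * code3 d = (\<Sum>i<k. 3 ^ k * (2 * d i / 3 ^ Suc i)) + 2 * d k / 3 + code3 e / 3"
  by (simp add: algebra_simps sum_distrib_left)
 also have "(\<Sum>i<k. 3 ^ k * (2 * d i / 3 ^ Suc i)) = (\<Sum>i<k. 2 * of_int (\<lfloor>d i\<rfloor> * 3 ^ (k - Suc i)))"
 proof (rule sum.cong[OF refl])
  fix i assume "i \<in> {..<k}"
  hence "(3::real) ^ k = 3 ^ (k - Suc i) * 3 ^ Suc i" unfolding power_add[symmetric] by simp
  moreover have "of_int \<lfloor>d i\<rfloor> = d i" using d[of i] by auto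
  ultimately show "3 ^ k * (2 * d i / 3 ^ Suc i) = 2 * of_int (\<lfloor>d i\<rfloor> * 3 ^ (k - Suc i))"
   by (simp del: of_int_floor_cancel)
 qed
 also have "\<dots> = 2 * of_int (\<Sum>i<k. \<lfloor>d i\<rfloor> * 3 ^ (k - Suc i))" by (simp add: sum_distrib_left)
 finally have "3 ^ k * code3 d = 2 * of_int (\<Sum>i<k. \<lfloor>d i\<rfloor> * 3 ^ (k - Suc i)) + 2 * d k / 3 + code3 e / 3" .
 moreover have "0 <= code3 e / 3" "code3 e / 3 <= 1 / 3" using code3_bounds[of e] e by auto
 ultimately show ?thesis
  using phi_digit[OF d[of k], of "code3 e / 3"] by (simp only:)
qed

text \<open>Schoenberg's space-filling curve, with its Borel right inverse obtained by interleaving binary digits.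
 The factor 8 keeps the rescaled coordinates below 1, where binary expansions need no exception.\<close>

definition curve :: "nat => real => nat => real" where
 "curve n t = (\<lambda>i\<in>{..<n}. min (2*pi) (8 * (\<Sum>m. phi (3 ^ (n * m + i) * max 0 (min 1 t)) / 2 ^ Suc m)))"

definition csec :: "nat => (nat => real) => real" where
 "csec n x = code3 (%k. dig (x (k mod n) / 8) (k div n))"

lemma csec_01: "0 <= csec n x" "csec n x <= 1"
 unfolding csec_def using code3_bounds dig_01 by auto

lemma curve_csec:
 assumes "x \<in> In n"
 shows "curve n (csec n x) = x"
proof (rule ext)
 fix i show "curve n (csec n x) i = x i"
 proof (cases "i < n")
  case True
  have xi: "0 <= x i" "x i <= 2 * pi" using In_coord[OF assms True] by (auto simp: Iper_def)
  have "phi (3 ^ (n * m + i) * max 0 (min 1 (csec n x))) = dig (x i / 8) m" for m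
  proof -
   have "max 0 (min 1 (csec n x)) = csec n x" using csec_01[of n x] by auto
   hence "phi (3 ^ (n * m + i) * max 0 (min 1 (csec n x))) = phi (3 ^ (n * m + i) * csec n x)" by simp
   also have "\<dots> = dig (x ((n * m + i) mod n) / 8) ((n * m + i) div n)"
    unfolding csec_def by (rule phi_code3) (rule dig_01)
   finally show ?thesis using True by simp
  qed
  moreover have "(%m. dig (x i / 8) m / 2 ^ Suc m) sums (x i / 8)"
   using xi pi_less_4 by (intro dig_sums) auto
  ultimately show ?thesis using True xi by (simp add: curve_def sums_unique[symmetric])
 next
  case False thus ?thesis using assms by (auto simp: curve_def In_def PiE_def extensional_def)
 qed
qed

lemma sums_half: "(%m. 1 / 2 ^ Suc m) sums (1::real)"
 using power_half_series by (simp add: power_divide)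

lemma curve_summable: "summable (%m. phi (g m) / 2 ^ Suc m)"
 by (rule summable_comparison_test'[OF sums_summable[OF sums_half], of 0])
   (use phi_bounds in \<open>auto simp: divide_right_mono\<close>)

lemma curve_In: "curve n t \<in> In n"
proof -
 have "0 <= (\<Sum>m. phi (3 ^ (n * m + i) * max 0 (min 1 t)) / 2 ^ Suc m)" for i
  by (rule suminf_nonneg[OF curve_summable]) (simp add: phi_bounds)
 thus ?thesis by (auto simp: In_def curve_def Iper_def)
qed

lemma continuous_curve: "continuous_on UNIV (curve n)"
proof (rule continuous_on_coordinatewise_then_product)
 fix i
 have "continuous_on UNIV (%t. \<Sum>m. phi (3 ^ (n * m + i) * max 0 (min 1 t)) / 2 ^ Suc m)"
 proof (rule uniform_limit_theorem)
  show "uniform_limit UNIV (%N t. \<Sum>m<N. phi (3 ^ (n * m + i) * max 0 (min 1 t)) / 2 ^ Suc m)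
    (%t. \<Sum>m. phi (3 ^ (n * m + i) * max 0 (min 1 t)) / 2 ^ Suc m) sequentially"
   by (rule Weierstrass_m_test[OF _ sums_summable[OF sums_half]])
     (use phi_bounds in \<open>auto simp: divide_right_mono\<close>)
  show "\<forall>\<^sub>F N in sequentially. continuous_on UNIV (%t. \<Sum>m<N. phi (3 ^ (n * m + i) * max 0 (min 1 t)) / 2 ^ Suc m)"
   by (intro always_eventually allI continuous_intros continuous_on_compose2[OF continuous_phi[of UNIV]]) auto
 qed auto
 thus "continuous_on UNIV (%t. curve n t i)"
  by (cases "i < n") (auto simp: curve_def intro!: continuous_intros)
qed

lemma measurable_csec: "csec n \<in> borel_measurable (Mn n)"
proof -
 have "(%y. dig y m) \<in> borel_measurable borel" for m unfolding dig_def by measurable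
 hence "(%x. dig (x i / 8) m) \<in> borel_measurable (Mn n)" for i m
  by (rule measurable_compose[rotated]) (intro borel_measurable_divide measurable_coord borel_measurable_const)
 thus ?thesis unfolding csec_def code3_def
  by (intro borel_measurable_suminf borel_measurable_divide borel_measurable_times borel_measurable_const)
qed

lemma measurable_curve: "curve n \<in> measurable borel (Mn n)"
proof (rule measurable_into_Mn)
 fix i show "(%t. curve n t i) \<in> borel_measurable borel"
  using continuous_on_product_then_coordinatewise[OF continuous_curve]
  by (intro borel_measurable_continuous_onI) auto
qed (rule curve_In)

lemma continuous_comp_curve:
 assumes "continuous_on (In n) f" shows "continuous_on UNIV (%t. f (curve n t))"
 by (rule continuous_on_compose2[OF assms continuous_curve]) (auto simp: curve_In)

text \<open>The curve maps [0,1] onto the cube, so boundedness comes from compactness of an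
  interval.\<close>

lemma bounded_continuous_In:
 fixes f :: "(nat => real) => real"
 assumes "continuous_on (In n) f"
 obtains B where "!!x. x \<in> In n ==> \<bar>f x\<bar> <= B" "!!t. \<bar>f (curve n t)\<bar> <= B"
proof -
 have "compact ((%t. f (curve n t)) ` {0..1})"
  by (rule compact_continuous_image) (auto intro: continuous_on_subset[OF continuous_comp_curve[OF assms]])
 then obtain B where "\<forall>x\<in>(%t. f (curve n t)) ` {0..1}. norm x <= B"
  using compact_imp_bounded bounded_iff by blast
 hence B: "!!t. t \<in> {0..1} ==> \<bar>f (curve n t)\<bar> <= B" by auto
 have *: "\<bar>f x\<bar> <= B" if "x \<in> In n" for x using B[of "csec n x"] csec_01[of n x] that by (simp add: curve_csec)
 show ?thesis by (rule that[of B]) (auto simp: * curve_In)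
qed

lemma integrable_continuous_In:
 fixes f :: "(nat => real) => real"
 assumes "continuous_on (In n) f" "sets \<mu> = sets (Mn n)" "prob_space \<mu>"
 shows "integrable \<mu> f"
proof -
 interpret prob_space \<mu> by fact
 obtain B where B: "!!x. x \<in> In n ==> \<bar>f x\<bar> <= B" using bounded_continuous_In[OF assms(1)] by blast
 have "f \<in> borel_measurable \<mu>"
  using borel_measurable_continuous_In[OF assms(1)] measurable_cong_sets[OF assms(2) refl] by blast
 thus ?thesis
  using B sets_eq_imp_space_eq[OF assms(2)]
  by (intro integrable_const_bound[of _ B]) (auto intro!: AE_I2)
qed

text \<open>Compactness is imported from the line. The Borel map \<open>csec\<close> pushes the
  measures to [0,1], where tightness gives a convergent subsequence, and the continuous
  \<open>curve\<close> brings the limit back. A test function \<open>f\<close> becomes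
  \<open>f\<close> after \<open>curve\<close>, which is continuous, and \<open>curve\<close> after
  \<open>csec\<close> is the identity, so integrals agree; \<open>csec\<close> itself may be
  discontinuous.\<close>

lemma weakly_compact_In:
 fixes \<mu> :: "nat => (nat => real) measure"
 assumes s: "!!j. sets (\<mu> j) = sets (Mn n)" and p: "!!j. prob_space (\<mu> j)"
 shows "\<exists>r \<gamma>. strict_mono r \<and> sets \<gamma> = sets (Mn n) \<and> prob_space \<gamma> \<and> weak_conv_In n (%j. \<mu> (r j)) \<gamma> sequentially"
proof -
 define \<nu> where "\<nu> j = distr (\<mu> j) borel (csec n)" for j
 have m[measurable]: "csec n \<in> borel_measurable (\<mu> j)" for j
  using measurable_csec measurable_cong_sets[OF s refl] by blast
 have rd: "real_distribution (\<nu> j)" for j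
  unfolding \<nu>_def using prob_space.real_distribution_distr[OF p m] .
 have "tight \<nu>"
  unfolding tight_def
 proof (intro conjI allI impI rd)
  fix e :: real assume "e > 0"
  \<comment> \<open>The laws live on [0,1]; the left end -1 accommodates the half-open intervals of
    \<open>tight\<close>.\<close>
  have "measure (\<nu> j) {-1<..1} = 1" for j
  proof -
   interpret prob_space "\<mu> j" by (rule p)
   have "measure (\<nu> j) {-1<..1} = prob (csec n -` {-1<..1} \<inter> space (\<mu> j))"
    unfolding \<nu>_def by (rule measure_distr) auto
   also have "csec n -` {-1<..1} \<inter> space (\<mu> j) = space (\<mu> j)" using csec_01 by (auto simp: less_le_trans[of "-1" 0])
   finally show ?thesis by (simp add: prob_space)
  qed
  thus "\<exists>a b. a < b \<and> (\<forall>j. 1 - e < measure (\<nu> j) {a<..b})"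
   using \<open>e > 0\<close> by (intro exI[of _ "-1"] exI[of _ 1]) auto
 qed
 from tight_imp_convergent_subsubsequence[OF this strict_mono_id] obtain r M where
  r: "strict_mono (r::nat=>nat)" and M: "real_distribution M" and wc: "weak_conv_m (%j. \<nu> (r j)) M"
  by (auto simp: o_def id_def)
 interpret M: real_distribution M by fact
 have mc: "curve n \<in> measurable M (Mn n)"
  using measurable_curve measurable_cong_sets[OF M.events_eq_borel refl] by blast
 define \<gamma> where "\<gamma> = distr M (Mn n) (curve n)"
 have "weak_conv_In n (%j. \<mu> (r j)) \<gamma> sequentially"
  unfolding weak_conv_In_def
 proof (intro allI impI)
  fix f :: "(nat => real) => real" assume f: "continuous_on (In n) f"
  note fm = borel_measurable_continuous_In[OF f]
  obtain B where B: "!!t. \<bar>f (curve n t)\<bar> <= B" using bounded_continuous_In[OF f] by blast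
  have cf: "continuous_on UNIV (%t. f (curve n t))" by (rule continuous_comp_curve[OF f])
  have "(%j. integral\<^sup>L (\<nu> (r j)) (%t. f (curve n t))) \<longlonglongrightarrow> integral\<^sup>L M (%t. f (curve n t))"
   using cf B by (intro weak_conv_imp_integral_bdd_continuous_conv[OF rd M wc, where B=B])
    (auto simp: continuous_on_eq_continuous_at)
  moreover have "integral\<^sup>L (\<nu> j) (%t. f (curve n t)) = integral\<^sup>L (\<mu> j) f" for j
  proof -
   have "integral\<^sup>L (\<nu> j) (%t. f (curve n t)) = integral\<^sup>L (\<mu> j) (%x. f (curve n (csec n x)))"
    unfolding \<nu>_def by (rule integral_distr[OF m]) (rule borel_measurable_continuous_onI[OF cf])
   also have "\<dots> = integral\<^sup>L (\<mu> j) f"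
    using sets_eq_imp_space_eq[OF s[of j]] by (intro Bochner_Integration.integral_cong) (auto simp: curve_csec)
   finally show ?thesis .
  qed
  moreover have "integral\<^sup>L \<gamma> f = integral\<^sup>L M (%t. f (curve n t))"
   unfolding \<gamma>_def by (rule integral_distr[OF mc fm])
  ultimately show "(%j. integral\<^sup>L (\<mu> (r j)) f) \<longlonglongrightarrow> integral\<^sup>L \<gamma> f" by simp
 qed
 thus ?thesis
  using r M.prob_space_distr[OF mc] by (intro exI[of _ r] exI[of _ \<gamma>]) (auto simp: \<gamma>_def)
qed

section \<open>Measures on the cube determined by boxes and by continuous functions\<close>

definition obox :: "nat => (nat => real) => (nat => real) set" where
 "obox n t = {x \<in> In n. \<forall>i<n. x i <= t i}"

lemma obox_sets [measurable]: "obox n t \<in> sets (Mn n)"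
proof -
 note [measurable] = measurable_coord
 have "obox n t = {x \<in> space (Mn n). \<forall>i\<in>{..<n}. x i <= t i}" by (auto simp: obox_def)
 also have "\<dots> \<in> sets (Mn n)" by measurable
 finally show ?thesis .
qed

text \<open>Setting all other corners to \<open>2*pi\<close> turns a box into a half-space of the
  cube, and half-spaces generate the sigma-algebra.\<close>

lemma sets_Mn_boxes: "sets (Mn n) = sigma_sets (In n) (range (obox n))"
proof
 have sub: "range (obox n) \<subseteq> Pow (In n)" by (auto simp: obox_def)
 show "sigma_sets (In n) (range (obox n)) \<subseteq> sets (Mn n)"
 proof -
  have "range (obox n) \<subseteq> sets (Mn n)" by auto
  from sets.sigma_sets_subset[OF this] show ?thesis by simp
 qed
 let ?N = "sigma (In n) (range (obox n))"
 have N: "space ?N = In n" "sets ?N = sigma_sets (In n) (range (obox n))" using sub by auto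
 have co: "(%x. x i) \<in> borel_measurable ?N" if "i < n" for i
 proof (rule borel_measurable_iff_le[THEN iffD2], intro allI)
  fix a
  have "{x \<in> space ?N. x i <= a} = obox n (%j. if j = i then a else 2*pi)"
   unfolding N using that by (auto simp: obox_def In_def Iper_def PiE_def Pi_def)
  also have "\<dots> \<in> sets ?N" unfolding N by (rule sigma_sets.Basic) auto
  finally show "{x \<in> space ?N. x i <= a} \<in> sets ?N" .
 qed
 have "sets (PiM {..<n} (%_. mI)) \<subseteq> sets ?N"
 proof (rule sets_PiM_in_sets)
  show "space ?N = (\<Pi>\<^sub>E i\<in>{..<n}. space mI)" unfolding N by (simp add: In_def)
  fix i A assume i: "i \<in> {..<n}" and "A \<in> sets mI"
  then obtain B where B: "B \<in> sets borel" "A = Iper \<inter> B" by (auto simp: sets_mI sets_restrict_space)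
  have "(%x. x i) -` B \<inter> space ?N \<in> sets ?N" using co i B by (intro measurable_sets) auto
  also have "(%x. x i) -` B \<inter> space ?N = {x \<in> space ?N. x i \<in> A}"
   using i B In_coord by (auto simp: N)
  finally show "{x \<in> space ?N. x i \<in> A} \<in> sets ?N" .
 qed
 thus "sets (Mn n) \<subseteq> sigma_sets (In n) (range (obox n))" by (simp add: Mn_def N)
qed

lemma measure_eqI_boxes:
 assumes "sets \<mu> = sets (Mn n)" "sets \<nu> = sets (Mn n)" "prob_space \<mu>"
  and eq: "!!t. emeasure \<mu> (obox n t) = emeasure \<nu> (obox n t)"
 shows "\<mu> = \<nu>"
proof (rule measure_eqI_generator_eq[where E="range (obox n)" and \<Omega>="In n" and A="%_. obox n (%_. 2*pi)"])
 interpret prob_space \<mu> by fact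
 show "Int_stable (range (obox n))"
 proof (rule Int_stableI, clarsimp)
  fix s t
  have "obox n s \<inter> obox n t = obox n (%i. min (s i) (t i))" by (auto simp: obox_def)
  thus "obox n s \<inter> obox n t \<in> range (obox n)" by auto
 qed
 show "range (obox n) \<subseteq> Pow (In n)" by (auto simp: obox_def)
 show "(\<Union>i::nat. obox n (%_. 2 * pi)) = In n"
  by (auto simp: obox_def In_def Iper_def PiE_def Pi_def)
 show "emeasure \<mu> (obox n (%_. 2 * pi)) \<noteq> \<infinity>" by simp
qed (use assms in \<open>auto simp: sets_Mn_boxes\<close>)

text \<open>Products of clamped ramps of slope \<open>-k\<close> are continuous and converge to the
  indicator of a box; dominated convergence then compares the masses of boxes.\<close>

lemma measure_eqI_continuous:
 assumes s: "sets \<mu> = sets (Mn n)" "sets \<nu> = sets (Mn n)" and p: "prob_space \<mu>" "prob_space \<nu>"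
  and eq: "!!f :: (nat => real) => real. continuous_on (In n) f ==> integral\<^sup>L \<mu> f = integral\<^sup>L \<nu> f"
 shows "\<mu> = \<nu>"
proof (rule measure_eqI_boxes[OF s p(1)])
 fix t
 define g :: "nat => (nat => real) => real" where
  "g k x = (\<Prod>i<n. max 0 (min 1 (1 - real k * (x i - t i))))" for k x
 have gc: "continuous_on (In n) (g k)" for k
  unfolding g_def by (intro continuous_intros continuous_on_subset[OF continuous_on_product_coordinates]) auto
 have lim: "(%k. g k x) \<longlonglongrightarrow> indicator (obox n t) x" if x: "x \<in> In n" for x
 proof (cases "x \<in> obox n t")
  case True
  have "g k x = 1" for k
   unfolding g_def
  proof (rule prod.neutral, intro ballI)
   fix i assume "i \<in> {..<n}"
   hence "real k * (x i - t i) <= 0" using True by (auto simp: obox_def intro!: mult_nonneg_nonpos)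
   thus "max 0 (min 1 (1 - real k * (x i - t i))) = 1" by auto
  qed
  thus ?thesis using True by simp
 next
  case False
  then obtain i where i: "i < n" "t i < x i" using x by (auto simp: obox_def)
  obtain K :: nat where K: "1 / (x i - t i) < K" using reals_Archimedean2 by blast
  have "\<forall>\<^sub>F k in sequentially. g k x = 0"
  proof (rule eventually_sequentiallyI)
   fix k assume "K <= k"
   hence "1 / (x i - t i) < k" using K by linarith
   hence "1 < real k * (x i - t i)" using i by (simp add: field_simps)
   thus "g k x = 0" unfolding g_def using i by (intro prod_zero) (auto intro!: bexI[of _ i])
  qed
  thus ?thesis using False by (auto intro: tendsto_eventually)
 qed
 have *: "(%k. integral\<^sup>L \<kappa> (g k)) \<longlonglongrightarrow> measure \<kappa> (obox n t)" if sl: "sets \<kappa> = sets (Mn n)" and "prob_space \<kappa>" for \<kappa>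
 proof -
  interpret prob_space \<kappa> by fact
  have sp: "space \<kappa> = In n" using sets_eq_imp_space_eq[OF sl] by simp
  have bs: "obox n t \<in> sets \<kappa>" using sl by simp
  have gm: "g k \<in> borel_measurable \<kappa>" for k
   using borel_measurable_continuous_In[OF gc] measurable_cong_sets[OF sl refl] by blast
  have b: "norm (g k x) <= 1" for k x
   unfolding g_def prod_norm[symmetric] by (rule prod_le_1) auto
  have "(%k. integral\<^sup>L \<kappa> (g k)) \<longlonglongrightarrow> integral\<^sup>L \<kappa> (indicator (obox n t) :: _ => real)"
   by (rule integral_dominated_convergence[where w="%_. 1"])
     (use gm b bs lim sp in \<open>auto intro!: AE_I2\<close>)
  thus ?thesis using bs by simp
 qed
 interpret a: prob_space \<mu> by fact
 interpret b: prob_space \<nu> by fact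
 have "measure \<mu> (obox n t) = measure \<nu> (obox n t)"
  using LIMSEQ_unique[OF *[OF s(1) p(1)]] *[OF s(2) p(2)] by (simp add: eq[OF gc])
 thus "emeasure \<mu> (obox n t) = emeasure \<nu> (obox n t)"
  by (simp add: a.emeasure_eq_measure b.emeasure_eq_measure)
qed

section \<open>The one-particle measure and weak limits of plans\<close>

lemma sets_rho_measure [simp, measurable_cong]: "sets (rho_measure \<rho>) = sets borel"
 by (simp add: rho_measure_def)

lemma space_rho_measure [simp]: "space (rho_measure \<rho>) = UNIV"
 by (simp add: rho_measure_def)

lemma emeasure_rho_measure:
 assumes "prob_density_on_I \<rho>" "A \<in> sets borel"
 shows "emeasure (rho_measure \<rho>) A = (\<integral>\<^sup>+ t. indicator Iper t * ennreal (\<rho> t) * indicator A t \<partial>lborel)"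
proof -
 have [measurable]: "\<rho> \<in> borel_measurable borel" using assms by (simp add: prob_density_on_I_def)
 show ?thesis unfolding rho_measure_def by (rule emeasure_density) (use assms in auto)
qed

lemma prob_rho_measure:
 assumes "prob_density_on_I \<rho>" shows "prob_space (rho_measure \<rho>)"
proof (rule prob_spaceI)
 have "emeasure (rho_measure \<rho>) UNIV = (\<integral>\<^sup>+ t\<in>Iper. ennreal (\<rho> t) \<partial>lborel)"
  by (subst emeasure_rho_measure[OF assms]) (auto intro!: nn_integral_cong simp: mult.commute)
 thus "emeasure (rho_measure \<rho>) (space (rho_measure \<rho>)) = 1"
  using assms by (simp add: prob_density_on_I_def)
qed

lemma real_distribution_rho:
 assumes "prob_density_on_I \<rho>" shows "real_distribution (rho_measure \<rho>)"
 using prob_rho_measure[OF assms] by (simp add: real_distribution_def real_distribution_axioms_def)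

lemma rho_measure_singleton:
 assumes "prob_density_on_I \<rho>" shows "measure (rho_measure \<rho>) {a} = 0"
proof -
 have "AE t in lborel. indicator Iper t * ennreal (\<rho> t) * indicator {a} t = 0"
  using AE_lborel_singleton[of a] by (elim AE_mp) (auto intro!: AE_I2 split: split_indicator)
 hence "(\<integral>\<^sup>+ t. indicator Iper t * ennreal (\<rho> t) * indicator {a} t \<partial>lborel) = (\<integral>\<^sup>+ t. 0 \<partial>(lborel :: real measure))"
  by (rule nn_integral_cong_AE)
 hence "emeasure (rho_measure \<rho>) {a} = 0"
  using emeasure_rho_measure[OF assms, of "{a}"] by simp
 thus ?thesis by (simp add: measure_def)
qed

lemma isCont_cdf_rho:
 assumes "prob_density_on_I \<rho>" shows "isCont (cdf (rho_measure \<rho>)) x"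
proof -
 interpret real_distribution "rho_measure \<rho>" by (rule real_distribution_rho[OF assms])
 show ?thesis unfolding isCont_cdf by (rule rho_measure_singleton[OF assms])
qed

text \<open>Test functions of one coordinate pass the marginal integrals to the limit. They
  determine the law through its distribution function, and that of \<rho> is continuous, so weak
  convergence yields equality at every point.\<close>

lemma weak_limit_in_Pi:
 assumes \<rho>: "prob_density_on_I \<rho>" and \<mu>: "!!j. \<mu> j \<in> Pi_rho n \<rho>"
  and \<gamma>: "sets \<gamma> = sets (Mn n)" "prob_space \<gamma>" and wc: "weak_conv_In n \<mu> \<gamma> sequentially"
 shows "\<gamma> \<in> Pi_rho n \<rho>"
 unfolding Pi_rho_def
proof (intro CollectI conjI allI impI \<gamma>)
 fix i assume i: "i < n"
 interpret R: real_distribution "rho_measure \<rho>" by (rule real_distribution_rho[OF \<rho>])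
 interpret g: prob_space \<gamma> by fact
 have mi[measurable]: "(%x. x i) \<in> borel_measurable \<gamma>"
  using measurable_coord measurable_cong_sets[OF \<gamma>(1) refl] by blast
 let ?D = "distr \<gamma> borel (%x. x i)"
 interpret D: real_distribution ?D by (rule g.real_distribution_distr[OF mi])
 have eq: "integral\<^sup>L ?D f = integral\<^sup>L (rho_measure \<rho>) f" if f: "continuous_on UNIV f" for f :: "real => real"
 proof -
  have fi: "continuous_on (In n) (%x. f (x i))"
   by (rule continuous_on_compose2[OF f]) (auto intro!: continuous_on_subset[OF continuous_on_product_coordinates])
  have fm[measurable]: "f \<in> borel_measurable borel" using f by (rule borel_measurable_continuous_onI)
  have "integral\<^sup>L (\<mu> j) (%x. f (x i)) = integral\<^sup>L (rho_measure \<rho>) f" for j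
  proof -
   have sj: "sets (\<mu> j) = sets (Mn n)" and "distr (\<mu> j) borel (%x. x i) = rho_measure \<rho>"
    using \<mu>[of j] i by (auto simp: Pi_rho_def)
   moreover have "(%x. x i) \<in> borel_measurable (\<mu> j)"
    using measurable_coord measurable_cong_sets[OF sj refl] by blast
   ultimately show ?thesis using integral_distr[of "%x. x i" "\<mu> j" borel f] by simp
  qed
  hence "integral\<^sup>L \<gamma> (%x. f (x i)) = integral\<^sup>L (rho_measure \<rho>) f"
   using wc fi by (auto simp: weak_conv_In_def LIMSEQ_const_iff)
  thus ?thesis by (subst integral_distr) auto
 qed
 \<comment> \<open>Weak convergence of a constant sequence serves as a proof of equality.\<close>
 have "weak_conv_m (%_. ?D) (rho_measure \<rho>)"
  by (rule integral_bdd_continuous_conv_imp_weak_conv)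
    (auto simp: D.real_distribution_axioms R.real_distribution_axioms eq continuous_on_eq_continuous_at)
 hence "cdf ?D x = cdf (rho_measure \<rho>) x" for x
  using isCont_cdf_rho[OF \<rho>] by (simp add: weak_conv_m_def weak_conv_def LIMSEQ_const_iff)
 thus "?D = rho_measure \<rho>"
  by (intro cdf_unique) (auto simp: D.real_distribution_axioms R.real_distribution_axioms)
qed

lemma weak_limit_sym:
 assumes \<mu>: "!!j. sets (\<mu> j) = sets (Mn n)" "!!j. sym_plan n (\<mu> j)"
  and \<gamma>: "sets \<gamma> = sets (Mn n)" "prob_space \<gamma>" and wc: "weak_conv_In n \<mu> \<gamma> sequentially"
 shows "sym_plan n \<gamma>"
 unfolding sym_plan_def
proof (intro allI impI)
 fix \<sigma> assume s: "\<sigma> permutes {..<n}"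
 interpret g: prob_space \<gamma> by fact
 have m: "(%x. x \<circ> \<sigma>) \<in> measurable \<kappa> (Mn n)" if "sets \<kappa> = sets (Mn n)" for \<kappa>
  using measurable_permute[OF s] measurable_cong_sets[OF that refl] by blast
 show "distr \<gamma> (Mn n) (%x. x \<circ> \<sigma>) = \<gamma>"
 proof (rule measure_eqI_continuous[OF _ \<gamma>(1) g.prob_space_distr[OF m[OF \<gamma>(1)]] \<gamma>(2)])
  fix f :: "(nat => real) => real" assume f: "continuous_on (In n) f"
  note fm = borel_measurable_continuous_In[OF f]
  have fs: "continuous_on (In n) (%x. f (x \<circ> \<sigma>))"
   by (rule continuous_on_compose2[OF f])
     (auto simp: permute_In[OF s] intro!: continuous_on_coordinatewise_then_product continuous_on_subset[OF continuous_on_product_coordinates])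
  have e: "integral\<^sup>L (\<mu> j) (%x. f (x \<circ> \<sigma>)) = integral\<^sup>L (\<mu> j) f" for j
   using integral_distr[OF m[OF \<mu>(1)] fm, of j] \<mu>(2)[of j] s by (simp add: sym_plan_def)
  have "(%j. integral\<^sup>L (\<mu> j) f) \<longlonglongrightarrow> integral\<^sup>L \<gamma> f"
   using wc f by (auto simp: weak_conv_In_def)
  moreover have "(%j. integral\<^sup>L (\<mu> j) (%x. f (x \<circ> \<sigma>))) \<longlonglongrightarrow> integral\<^sup>L \<gamma> (%x. f (x \<circ> \<sigma>))"
   using wc fs unfolding weak_conv_In_def by blast
  ultimately have "integral\<^sup>L \<gamma> (%x. f (x \<circ> \<sigma>)) = integral\<^sup>L \<gamma> f"
   unfolding e by (metis LIMSEQ_unique)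
  thus "integral\<^sup>L (distr \<gamma> (Mn n) (%x. x \<circ> \<sigma>)) f = integral\<^sup>L \<gamma> f"
   using integral_distr[OF m[OF \<gamma>(1)] fm] by simp
 qed simp
qed

text \<open>Truncation at \<open>M\<close> makes the cost a bounded continuous real function, to
  which weak convergence applies; monotone convergence in \<open>M\<close> removes the cutoff. This
  is lower semicontinuity of the cost.\<close>

lemma weak_limit_cost:
 assumes w: "assumptionA w" and \<mu>: "!!j. sets (\<mu> j) = sets (Mn n)" "!!j. prob_space (\<mu> j)"
  and \<gamma>: "sets \<gamma> = sets (Mn n)" "prob_space \<gamma>" and wc: "weak_conv_In n \<mu> \<gamma> sequentially"
  and le: "!!j. (\<integral>\<^sup>+ x. cn n w x \<partial>\<mu> j) <= c j" and c: "c \<longlonglongrightarrow> C"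
 shows "(\<integral>\<^sup>+ x. cn n w x \<partial>\<gamma>) <= C"
proof -
 define f where "f M x = enn2real (min (cn n w x) (ennreal (real M)))" for M :: nat and x
 have ef: "ennreal (f M x) = min (cn n w x) (ennreal (real M))" for M x
  unfolding f_def by (rule ennreal_enn2real) (auto simp: min_less_iff_disj)
 have fc: "continuous_on (In n) (f M)" for M
 proof -
  have "continuous_on (In n) (%x. min (cn n w x) (ennreal (real M)))"
   by (intro continuous_on_min continuous_on_cn[OF w] continuous_intros)
  hence "((%x. min (cn n w x) (ennreal (real M))) \<longlongrightarrow> ennreal (f M x)) (at x within In n)" if "x \<in> In n" for x
   using that unfolding ef continuous_on_def by blast
  thus ?thesis unfolding continuous_on_def f_def[abs_def]
   by (auto intro!: tendsto_enn2real simp: f_def)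
 qed
 have nn: "(\<integral>\<^sup>+ x. min (cn n w x) (ennreal (real M)) \<partial>\<kappa>) = ennreal (integral\<^sup>L \<kappa> (f M))"
  if "sets \<kappa> = sets (Mn n)" "prob_space \<kappa>" for M \<kappa>
  unfolding ef[symmetric] by (rule nn_integral_eq_integral[OF integrable_continuous_In[OF fc that]]) (simp add: f_def)
 have trunc: "(\<integral>\<^sup>+ x. min (cn n w x) (ennreal (real M)) \<partial>\<gamma>) <= C" for M
 proof (rule LIMSEQ_le[OF _ c])
  show "(%j. ennreal (integral\<^sup>L (\<mu> j) (f M))) \<longlonglongrightarrow> (\<integral>\<^sup>+ x. min (cn n w x) (ennreal (real M)) \<partial>\<gamma>)"
   unfolding nn[OF \<gamma>] using wc fc by (auto simp: weak_conv_In_def)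
  have "ennreal (integral\<^sup>L (\<mu> j) (f M)) <= c j" for j
   unfolding nn[OF \<mu>, symmetric] by (rule order_trans[OF nn_integral_mono le]) auto
  thus "\<exists>N. \<forall>j\<ge>N. ennreal (integral\<^sup>L (\<mu> j) (f M)) <= c j" by auto
 qed
 have sup: "cn n w x = (SUP M::nat. min (cn n w x) (ennreal (real M)))" for x
 proof -
  have "(SUP M::nat. inf (cn n w x) (of_nat M)) = inf (cn n w x) (SUP M::nat. of_nat M)"
   by (rule inf_SUP[symmetric])
  thus ?thesis unfolding ennreal_SUP_of_nat_eq_top by (simp add: ennreal_of_nat_eq_real_of_nat inf_min)
 qed
 have cm: "cn n w \<in> borel_measurable \<gamma>"
  using measurable_cn[OF w] measurable_cong_sets[OF \<gamma>(1) refl] by blast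
 have "(\<integral>\<^sup>+ x. cn n w x \<partial>\<gamma>) = (\<integral>\<^sup>+ x. (SUP M::nat. min (cn n w x) (ennreal (real M))) \<partial>\<gamma>)"
  using sup by simp
 also have "\<dots> = (SUP M::nat. \<integral>\<^sup>+ x. min (cn n w x) (ennreal (real M)) \<partial>\<gamma>)"
 proof (rule nn_integral_monotone_convergence_SUP)
  show "incseq (%M x. min (cn n w x) (ennreal (real M)))"
   unfolding incseq_def le_fun_def by (intro allI impI min.mono ennreal_leI order_refl) simp
 qed (intro borel_measurable_min cm borel_measurable_const)
 also have "\<dots> <= C" by (rule SUP_least) (rule trunc)
 finally show ?thesis .
qed

section \<open>Smooth periodic partitions of the circle\<close>

text \<open>\<open>Ck 0\<close> asks for nothing: in \<open>smooth\<close> the continuity of each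
  derivative follows from the existence of the next one, and the closure properties become plain
  inductions.\<close>

fun Ck :: "nat => (real => real) => bool" where
 "Ck 0 f = True"
| "Ck (Suc k) f = (\<exists>f'. (\<forall>x. (f has_real_derivative f' x) (at x)) \<and> Ck k f')"

definition smooth :: "(real => real) => bool" where "smooth f \<longleftrightarrow> (\<forall>k. Ck k f)"

lemma Ck_SucI: "(!!x. (f has_real_derivative f' x) (at x)) ==> Ck k f' ==> Ck (Suc k) f"
 by auto

lemma Ck_Suc_imp: "Ck (Suc k) f ==> Ck k f"
proof (induction k arbitrary: f)
 case (Suc k)
 then obtain f' where "!!x. (f has_real_derivative f' x) (at x)" "Ck (Suc k) f'" by auto
 thus ?case using Suc.IH[of f'] by (intro Ck_SucI[of f f']) auto
qed simp

lemma Ck_const: "Ck k (%x. c)"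
proof (induction k arbitrary: c)
 case (Suc k) thus ?case by (intro Ck_SucI[of _ "%_. 0"]) auto
qed simp

lemma Ck_id: "Ck k (%x. x)"
 by (cases k) (auto intro!: exI[of _ "%_. 1"] Ck_const derivative_eq_intros)

lemma Ck_add: "Ck k f ==> Ck k g ==> Ck k (%x. f x + g x)"
proof (induction k arbitrary: f g)
 case (Suc k)
 then obtain f' g' where "!!x. (f has_real_derivative f' x) (at x)" "Ck k f'"
  "!!x. (g has_real_derivative g' x) (at x)" "Ck k g'" by auto
 thus ?case by (intro Ck_SucI[of _ "%x. f' x + g' x"] derivative_intros Suc.IH)
qed simp

lemma Ck_mult: "Ck k f ==> Ck k g ==> Ck k (%x. f x * g x)"
proof (induction k arbitrary: f g)
 case (Suc k)
 then obtain f' g' where *: "!!x. (f has_real_derivative f' x) (at x)" "Ck k f'"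
  "!!x. (g has_real_derivative g' x) (at x)" "Ck k g'" by auto
 have "Ck k f" "Ck k g" using Suc.prems Ck_Suc_imp by blast+
 hence "Ck k (%x. f' x * g x + f x * g' x)" using * by (intro Ck_add Suc.IH)
 thus ?case using * by (intro Ck_SucI[of _ "%x. f' x * g x + f x * g' x"]) (auto intro!: derivative_eq_intros)
qed simp

lemma Ck_compose: "Ck k f ==> Ck k g ==> Ck k (%x. f (g x))"
proof (induction k arbitrary: f g)
 case (Suc k)
 then obtain f' g' where *: "!!x. (f has_real_derivative f' x) (at x)" "Ck k f'"
  "!!x. (g has_real_derivative g' x) (at x)" "Ck k g'" by auto
 have "Ck k g" using Suc.prems Ck_Suc_imp by blast
 hence "Ck k (%x. f' (g x) * g' x)" by (intro Ck_mult[OF Suc.IH[OF *(2)] *(4)])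
 moreover have "((%x. f (g x)) has_real_derivative f' (g x) * g' x) (at x)" for x
  by (rule DERIV_chain2[OF *(1) *(3)])
 ultimately show ?case by (intro Ck_SucI[of _ "%x. f' (g x) * g' x"])
qed simp

lemma Ck_inverse: "Ck k f ==> (!!x. f x \<noteq> 0) ==> Ck k (%x. inverse (f x))"
proof (induction k arbitrary: f)
 case (Suc k)
 then obtain f' where *: "!!x. (f has_real_derivative f' x) (at x)" "Ck k f'" by auto
 have "Ck k f" using Suc.prems Ck_Suc_imp by blast
 hence "Ck k (%x. (-1) * f' x * (inverse (f x) * inverse (f x)))"
  using * Suc.prems by (intro Ck_mult Ck_const Suc.IH)
 thus ?case using * Suc.prems
  by (intro Ck_SucI[of _ "%x. (-1) * f' x * (inverse (f x) * inverse (f x))"])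
    (auto intro!: derivative_eq_intros simp: power2_eq_square field_simps)
qed simp

lemma Ck_sin_cos: "Ck k sin \<and> Ck k cos"
proof (induction k)
 case (Suc k)
 have "Ck k (%x. (-1) * sin x)" using Suc by (intro Ck_mult Ck_const) auto
 hence "Ck (Suc k) cos" by (intro Ck_SucI[of _ "%x. (-1) * sin x"]) (auto intro!: derivative_eq_intros)
 moreover have "Ck (Suc k) sin" using Suc by (intro Ck_SucI[of _ cos]) (auto intro!: derivative_eq_intros)
 ultimately show ?case by blast
qed simp

lemma smooth_const: "smooth (%x. c)" by (simp add: smooth_def Ck_const)
lemma smooth_id: "smooth (%x. x)" by (simp add: smooth_def Ck_id)
lemma smooth_add: "smooth f ==> smooth g ==> smooth (%x. f x + g x)" by (simp add: smooth_def Ck_add)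
lemma smooth_mult: "smooth f ==> smooth g ==> smooth (%x. f x * g x)" by (simp add: smooth_def Ck_mult)
lemma smooth_compose: "smooth f ==> smooth g ==> smooth (%x. f (g x))" by (simp add: smooth_def Ck_compose)
lemma smooth_inverse: "smooth f ==> (!!x. f x \<noteq> 0) ==> smooth (%x. inverse (f x))" by (simp add: smooth_def Ck_inverse)
lemma smooth_sin: "smooth sin" and smooth_cos: "smooth cos" by (simp_all add: smooth_def Ck_sin_cos)
lemma smooth_diff: "smooth f ==> smooth g ==> smooth (%x. f x - g x)"
 using smooth_add[of f "%x. (-1) * g x"] smooth_mult[OF smooth_const[of "-1"], of g] by simp

lemmas smooth_intros = smooth_const smooth_id smooth_add smooth_mult smooth_diff
 smooth_compose[OF smooth_sin] smooth_compose[OF smooth_cos]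

lemma smooth_DERIV: assumes "smooth f" shows "(f has_real_derivative deriv f x) (at x)"
proof -
 have "Ck (Suc 0) f" using assms by (simp only: smooth_def)
 thus ?thesis by (auto simp: DERIV_deriv_iff_has_field_derivative)
qed

lemma smooth_deriv: assumes "smooth f" shows "smooth (deriv f)"
 unfolding smooth_def
proof
 fix k
 have "Ck (Suc k) f" using assms by (simp only: smooth_def)
 then obtain f' where f': "!!x. (f has_real_derivative f' x) (at x)" "Ck k f'" by auto
 have "deriv f = f'" using f' by (auto intro!: ext DERIV_imp_deriv)
 thus "Ck k (deriv f)" using f' by simp
qed

lemma smooth_continuous: "smooth f ==> continuous_on A f"
 by (meson DERIV_continuous_on has_field_derivative_at_within smooth_DERIV)

lemma smooth_measurable: "smooth f ==> f \<in> borel_measurable borel"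
 by (intro borel_measurable_continuous_onI smooth_continuous)

section \<open>Smooth steps and bumps from exp(-1/x) divided by powers\<close>

definition flat :: "nat => real => real" where
 "flat m x = (if x > 0 then exp (- 1 / x) / x ^ m else 0)"

lemma flat_tendsto: "((%x. exp (- 1 / x) / x ^ m) \<longlongrightarrow> 0) (at_right (0::real))"
proof -
 have "((%y::real. y ^ m / exp y) \<longlongrightarrow> 0) at_top" by (rule tendsto_power_div_exp_0)
 hence "((%x. inverse x ^ m / exp (inverse x)) \<longlongrightarrow> 0) (at_right (0::real))"
  by (rule filterlim_compose) (rule filterlim_inverse_at_top_right)
 thus ?thesis by (simp add: field_simps exp_minus)
qed

text \<open>The power \<open>x^m\<close> is carried along so that derivatives stay in the span of
  the family; smoothness of all members then follows by one induction.\<close>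

lemma flat_DERIV: "(flat m has_real_derivative (- real m) * flat (Suc m) x + flat (m + 2) x) (at x)"
proof -
 consider "x < 0" | "x = 0" | "x > 0" by linarith
 thus ?thesis
 proof cases
  case 1
  have "((%_. 0) has_real_derivative 0) (at x)" by simp
  hence "(flat m has_real_derivative 0) (at x)"
   by (rule has_field_derivative_transform_within_open[of _ _ _ "{..<0}"]) (use 1 in \<open>auto simp: flat_def\<close>)
  thus ?thesis using 1 by (simp add: flat_def)
 next
  case 3
  have "((%x. exp (- 1 / x) / x ^ m) has_real_derivative (- real m) * flat (Suc m) x + flat (m + 2) x) (at x)"
  proof (induction m)
   case 0 show ?case using 3
    by (auto intro!: derivative_eq_intros simp: flat_def field_simps power2_eq_square)
  next
   case (Suc m)
   have "((%x. exp (- 1 / x) / x ^ m * inverse x) has_real_derivative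
     ((- real m) * flat (Suc m) x + flat (m + 2) x) * inverse x + (- (inverse x ^ Suc (Suc 0))) * (exp (- 1 / x) / x ^ m)) (at x)"
    using 3 by (intro DERIV_mult Suc DERIV_inverse) simp
   also have "((- real m) * flat (Suc m) x + flat (m + 2) x) * inverse x + (- (inverse x ^ Suc (Suc 0))) * (exp (- 1 / x) / x ^ m)
     = (- real (Suc m)) * flat (Suc (Suc m)) x + flat (Suc m + 2) x"
    using 3 by (simp add: flat_def field_simps power2_eq_square)
   finally show ?case by (simp add: divide_inverse mult_ac)
  qed
  thus ?thesis
   by (rule has_field_derivative_transform_within_open[of _ _ _ "{0<..}"]) (use 3 in \<open>auto simp: flat_def\<close>)
 next
  case 2
  \<comment> \<open>At the origin the difference quotient is \<open>flat (Suc m)\<close> on the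
    right, where the exponential beats every power, and 0 on the left.\<close>
  have "((%y. flat m y / y) \<longlongrightarrow> 0) (at 0)"
   unfolding filterlim_split_at_real[of "%y. flat m y / y"] filterlim_at_split
  proof
   show "((%y. flat m y / y) \<longlongrightarrow> 0) (at_left 0)"
    by (rule tendsto_eventually) (auto simp: flat_def eventually_at_filter)
   show "((%y. flat m y / y) \<longlongrightarrow> 0) (at_right 0)"
    by (rule Lim_transform_eventually[OF flat_tendsto[of "Suc m"]])
      (auto simp: flat_def eventually_at_filter intro!: always_eventually)
  qed
  thus ?thesis using 2 by (simp add: has_field_derivative_iff flat_def)
 qed
qed

lemma smooth_flat: "smooth (flat m)"
proof -
 have "Ck k (flat m)" for k
 proof (induction k arbitrary: m)
  case (Suc k)
  show ?case by (rule Ck_SucI[OF flat_DERIV]) (intro Ck_add Ck_mult Ck_const Suc)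
 qed simp
 thus ?thesis by (simp add: smooth_def)
qed

abbreviation "h0 \<equiv> flat 0"

lemma h0_pos: "x > 0 ==> 0 < h0 x" and h0_zero: "x <= 0 ==> h0 x = 0" and h0_nonneg: "0 <= h0 x"
 and h0_le1: "h0 x <= 1"
 by (auto simp: flat_def)

definition step :: "real => real" where "step x = h0 x * inverse (h0 x + h0 (1 - x))"

lemma step_den: "h0 x + h0 (1 - x) \<noteq> 0"
 using h0_pos[of x] h0_pos[of "1 - x"] h0_nonneg[of x] h0_nonneg[of "1 - x"] by (cases "x > 0") auto

lemma smooth_step: "smooth step"
 unfolding step_def[abs_def]
 by (intro smooth_intros smooth_flat smooth_inverse smooth_compose[OF smooth_flat] step_den)

lemma step_0: "x <= 0 ==> step x = 0" by (simp add: step_def h0_zero)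
lemma step_1: "x \<ge> 1 ==> step x = 1" using h0_pos[of x] by (simp add: step_def h0_zero)
lemma step_bounds: "0 <= step x" "step x <= 1"
proof -
 have "0 < h0 x + h0 (1 - x)" using step_den[of x] h0_nonneg[of x] h0_nonneg[of "1 - x"] by linarith
 thus "0 <= step x" "step x <= 1"
  using h0_nonneg[of x] h0_nonneg[of "1 - x"] by (auto simp: step_def field_simps)
qed

definition bump :: "real => real => real => real" where "bump a b x = h0 (x - a) * h0 (b - x)"

lemma smooth_bump: "smooth (bump a b)"
 unfolding bump_def[abs_def]
 by (intro smooth_mult smooth_compose[OF smooth_flat] smooth_diff smooth_id smooth_const)

lemma bump_pos: "a < x ==> x < b ==> 0 < bump a b x" by (simp add: bump_def h0_pos)
lemma bump_zero: "x <= a \<or> b <= x ==> bump a b x = 0" by (auto simp: bump_def h0_zero)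
lemma bump_bounds: "0 <= bump a b x" "bump a b x <= 1"
 using h0_nonneg[of "x-a"] h0_nonneg[of "b-x"] h0_le1[of "x-a"] h0_le1[of "b-x"]
 by (auto simp: bump_def intro!: mult_le_one)

text \<open>An angle rising from 0 to \<open>\<pi>/2\<close> for which the mass-weighted overlap of cosine and sine vanishes:
 the preliminary negative excursion of size \<open>s\<close> is tuned by the intermediate value theorem.\<close>

lemma orthogonal_angle:
 fixes m :: "real => real"
 assumes ab: "a < b" and int: "integrable lborel (%x. indicator {a..b} x * m x)" and nn: "!!x. x \<in> {a..b} ==> 0 <= m x"
 shows "\<exists>\<phi>. smooth \<phi> \<and> (\<forall>x\<le>a. \<phi> x = 0) \<and> (\<forall>x\<ge>b. \<phi> x = pi / 2) \<and>
   (\<integral>x. indicator {a..b} x * m x * sin (2 * \<phi> x) \<partial>lborel) = 0"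
proof -
 define \<mu> where "\<mu> x = indicator {a..b} x * m x" for x
 have \<mu>i: "integrable lborel \<mu>" using int by (simp add: \<mu>_def[abs_def])
 have \<mu>0: "0 <= \<mu> x" for x using nn by (auto simp: \<mu>_def split: split_indicator)
 have [measurable]: "\<mu> \<in> borel_measurable borel" using borel_measurable_integrable[OF \<mu>i] by simp
 \<comment> \<open>The angle rises only on [c,b], while \<open>s\<close> scales a downward excursion
   spread over all of (a,b).\<close>
 define \<phi> where "\<phi> c s x = (pi/2) * step ((x - c) * inverse (b - c)) - s * bump a b x" for c s x
 have sm: "smooth (\<phi> c s)" for c s
  unfolding \<phi>_def[abs_def] by (intro smooth_intros smooth_compose[OF smooth_step] smooth_bump)
 have [measurable]: "\<phi> c s \<in> borel_measurable borel" for c s using smooth_measurable[OF sm] .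
 have left: "\<phi> c s x = 0" if "a <= c" "c < b" "x <= a" for c s x
  using that by (simp add: \<phi>_def bump_zero step_0 mult_nonpos_nonneg)
 have right: "\<phi> c s x = pi/2" if "a <= c" "c < b" "x \<ge> b" for c s x
 proof -
  have "(x - c) * inverse (b - c) \<ge> 1" using that by (simp add: field_simps)
  thus ?thesis using that by (simp add: \<phi>_def bump_zero step_1)
 qed
 have ints: "integrable lborel (%x. \<mu> x * sin (g x))" if "g \<in> borel_measurable borel" for g
 proof (rule Bochner_Integration.integrable_bound[OF \<mu>i])
  show "(%x. \<mu> x * sin (g x)) \<in> borel_measurable lborel" using that by simp
  show "AE x in lborel. norm (\<mu> x * sin (g x)) <= norm (\<mu> x)"
   by (auto simp: abs_mult intro!: AE_I2 mult_left_le)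
 qed
 define I where "I c s = (\<integral>x. \<mu> x * sin (2 * \<phi> c s x) \<partial>lborel)" for c s
 have b2: "0 <= 2 * bump a b x \<and> 2 * bump a b x < pi" for x
  using bump_bounds[of a b x] pi_gt3 by auto
 have sb: "0 <= sin (2 * bump a b x)" for x
  using b2[of x] by (intro sin_ge_zero) auto
 have [measurable]: "bump a b \<in> borel_measurable borel" by (rule smooth_measurable[OF smooth_bump])
 \<comment> \<open>The overlap of a full excursion alone. Its doubled angle stays below \<pi>, so
   the sine is positive inside the interval and \<open>J = 0\<close> forces the mass to vanish
   almost everywhere; then every angle works.\<close>
 define J where "J = (\<integral>x. \<mu> x * sin (2 * bump a b x) \<partial>lborel)"
 have J0: "0 <= J" unfolding J_def by (intro Bochner_Integration.integral_nonneg) (auto simp: sb \<mu>0)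
 have "\<exists>c s. a <= c \<and> c < b \<and> I c s = 0"
 proof (cases "J = 0")
  case True
  have "AE x in lborel. \<mu> x * sin (2 * bump a b x) = 0"
   using integral_nonneg_eq_0_iff_AE[OF ints[of "%x. 2 * bump a b x"]] True sb \<mu>0 by (auto simp: J_def)
  hence "AE x in lborel. \<mu> x = 0"
   using AE_lborel_singleton[of a] AE_lborel_singleton[of b]
  proof (elim AE_mp, intro AE_I2 impI)
   fix x assume x: "\<mu> x * sin (2 * bump a b x) = 0" "x \<noteq> a" "x \<noteq> b"
   show "\<mu> x = 0"
   proof (cases "a < x \<and> x < b")
    case True
    hence "0 < sin (2 * bump a b x)" using bump_pos[of a x b] b2[of x] by (intro sin_gt_zero) auto
    thus ?thesis using x by simp
   qed (use x in \<open>auto simp: \<mu>_def split: split_indicator\<close>)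
  qed
  hence "I a 0 = (\<integral>x. 0 \<partial>(lborel :: real measure))"
   unfolding I_def by (intro integral_cong_AE) (auto elim!: eventually_mono)
  thus ?thesis using ab by (intro exI[of _ a] exI[of _ 0]) auto
 next
  case False
  \<comment> \<open>The rise is squeezed towards \<open>b\<close>. Before \<open>c\<close> only the
    excursion acts, and after \<open>c\<close> both sines are at most 1. Hence for
    \<open>s = 1\<close> the overlap is at most twice the mass of [c,b] minus \<open>J\<close>,
    which is negative once that mass is below \<open>J/2\<close>; for \<open>s = 0\<close> it is
    nonnegative. Continuity in \<open>s\<close> gives a zero.\<close>
  define c where "c k = b - (b - a) / real (Suc k)" for k
  have c: "a <= c k" "c k < b" for k
  proof -
   have "(b - a) / real (Suc k) <= (b - a) / 1" using ab by (intro divide_left_mono) auto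
   moreover define d where "d = (b - a) / real (Suc k)"
   ultimately show "a <= c k" unfolding c_def d_def[symmetric] by simp
   have "0 < d" unfolding d_def using ab by (intro divide_pos_pos) auto
   thus "c k < b" unfolding c_def d_def[symmetric] by simp
  qed
  have "(%k. \<integral>x. \<mu> x * indicator {c k..} x \<partial>lborel) \<longlonglongrightarrow> (\<integral>x. \<mu> x * indicator {b} x \<partial>lborel)"
  proof (rule integral_dominated_convergence[OF _ _ \<mu>i])
   show "AE x in lborel. (%k. \<mu> x * indicator {c k..} x) \<longlonglongrightarrow> \<mu> x * indicator {b} x"
   proof (intro AE_I2)
    fix x
    have cl: "c \<longlonglongrightarrow> b"
     unfolding c_def using tendsto_diff[OF tendsto_const[of b] tendsto_mult[OF tendsto_const[of "b-a"] LIMSEQ_inverse_real_of_nat]]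
     by (simp add: divide_inverse)
    consider "x < b" | "x = b" | "x > b" by linarith
    thus "(%k. \<mu> x * indicator {c k..} x) \<longlonglongrightarrow> \<mu> x * indicator {b} x"
    proof cases
     case 1
     have "\<forall>\<^sub>F k in sequentially. x < c k" using cl 1 by (rule order_tendstoD)
     hence "\<forall>\<^sub>F k in sequentially. \<mu> x * indicator {c k..} x = \<mu> x * indicator {b} x"
      by (rule eventually_mono) (use 1 in auto)
     thus ?thesis by (rule tendsto_eventually)
    next
     case 2 thus ?thesis using c(2) by (auto simp: less_imp_le)
    next
     case 3 thus ?thesis by (simp add: \<mu>_def)
    qed
   qed
   show "AE x in lborel. norm (\<mu> x * indicator {c k..} x) <= \<mu> x" for k
    using \<mu>0 by (auto split: split_indicator)
  qed (auto simp: measurable_lborel1)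
  moreover have "(\<integral>x. \<mu> x * indicator {b} x \<partial>lborel) = (\<integral>x. 0 \<partial>(lborel :: real measure))"
   by (intro integral_cong_AE, measurable) (use AE_lborel_singleton[of b] in \<open>elim AE_mp, auto intro!: AE_I2\<close>)
  ultimately have "\<forall>\<^sub>F k in sequentially. (\<integral>x. \<mu> x * indicator {c k..} x \<partial>lborel) < J / 2"
   using False J0 by (intro order_tendstoD(2)[where a="J/2"]) auto
  then obtain k where k: "(\<integral>x. \<mu> x * indicator {c k..} x \<partial>lborel) < J / 2" by (auto simp: eventually_sequentially)
  have i2: "integrable lborel (%x. \<mu> x * indicator {c k..} x)"
   by (rule Bochner_Integration.integrable_bound[OF \<mu>i]) (auto split: split_indicator)
  have "I (c k) 1 <= (\<integral>x. 2 * (\<mu> x * indicator {c k..} x) - \<mu> x * sin (2 * bump a b x) \<partial>lborel)"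
   unfolding I_def
  proof (rule integral_mono)
   fix x
   show "\<mu> x * sin (2 * \<phi> (c k) 1 x) <= 2 * (\<mu> x * indicator {c k..} x) - \<mu> x * sin (2 * bump a b x)"
   proof (cases "x < c k")
    case True
    hence "step ((x - c k) * inverse (b - c k)) = 0" using c(2)[of k] by (intro step_0 mult_nonpos_nonneg) auto
    thus ?thesis using True by (simp add: \<phi>_def)
   next
    case False
    have "sin (2 * \<phi> (c k) 1 x) + sin (2 * bump a b x) <= 2"
     using sin_le_one[of "2 * \<phi> (c k) 1 x"] sin_le_one[of "2 * bump a b x"] by linarith
    hence "\<mu> x * (sin (2 * \<phi> (c k) 1 x) + sin (2 * bump a b x)) <= \<mu> x * 2"
     using \<mu>0[of x] by (rule mult_left_mono)
    thus ?thesis using False by (simp add: algebra_simps)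
   qed
  qed (use i2 ints in \<open>auto intro!: Bochner_Integration.integrable_diff integrable_mult_right\<close>)
  also have "\<dots> = 2 * (\<integral>x. \<mu> x * indicator {c k..} x \<partial>lborel) - J"
   unfolding J_def by (subst Bochner_Integration.integral_diff) (use i2 ints in auto)
  finally have I1: "I (c k) 1 <= 0" using k by linarith
  have I0: "0 <= I (c k) 0"
   unfolding I_def
  proof (rule Bochner_Integration.integral_nonneg, rule mult_nonneg_nonneg[OF \<mu>0])
   fix x
   show "0 <= sin (2 * \<phi> (c k) 0 x)"
    using step_bounds[of "(x - c k) * inverse (b - c k)"] by (intro sin_ge_zero) (auto simp: \<phi>_def)
  qed
  have "continuous_on {0..1} (I (c k))"
  proof (rule continuous_on_sequentiallyI)
   fix u :: "nat => real" and s assume u: "u \<longlonglongrightarrow> s"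
   show "(%j. I (c k) (u j)) \<longlonglongrightarrow> I (c k) s"
    unfolding I_def
   proof (rule integral_dominated_convergence[OF _ _ \<mu>i])
    show "AE x in lborel. (%j. \<mu> x * sin (2 * \<phi> (c k) (u j) x)) \<longlonglongrightarrow> \<mu> x * sin (2 * \<phi> (c k) s x)"
     unfolding \<phi>_def using u by (intro AE_I2 tendsto_intros)
    show "AE x in lborel. norm (\<mu> x * sin (2 * \<phi> (c k) (u j) x)) <= \<mu> x" for j
     using \<mu>0 by (auto simp: abs_mult intro!: AE_I2 mult_left_le)
   qed auto
  qed
  then obtain s where "I (c k) s = 0" using IVT2'[of "I (c k)" 1 0 0] I0 I1 by auto
  thus ?thesis using c[of k] by (intro exI[of _ "c k"] exI[of _ s]) auto
 qed
 then obtain c s where cs: "a <= c" "c < b" "I c s = 0" by blast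
 have "(\<integral>x. indicator {a..b} x * m x * sin (2 * \<phi> c s x) \<partial>lborel) = 0" using cs(3) by (simp add: I_def \<mu>_def)
 thus ?thesis using sm[of c s] left right cs by (intro exI[of _ "\<phi> c s"]) auto
qed

section \<open>Periodization and the partition itself\<close>

definition per :: "(real => real) => real => real" where
 "per g x = g (x - 2 * pi * of_int \<lfloor>x / (2*pi)\<rfloor>)"

lemma per_periodic: "per g (x + 2*pi) = per g x"
proof -
 have "\<lfloor>(x + 2*pi) / (2*pi)\<rfloor> = \<lfloor>x / (2*pi)\<rfloor> + 1" by (simp add: add_divide_distrib)
 thus ?thesis by (simp add: per_def algebra_simps)
qed

lemma per_eq: "0 <= x ==> x < 2*pi ==> per g x = g x"
proof -
 assume "0 <= x" "x < 2*pi"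
 hence "\<lfloor>x / (2*pi)\<rfloor> = 0" by (simp add: floor_eq_iff)
 thus ?thesis by (simp add: per_def)
qed

lemma per_2pi: "per g (2*pi) = g 0" by (simp add: per_def)

text \<open>On both sides of the seam the function is the same constant, so its periodization is
  locally constant there. The derivative has the same property with constant 0, which keeps the
  induction going.\<close>

lemma Ck_per:
 assumes "Ck k g" "0 < r" "!!x. \<bar>x\<bar> < r \<or> \<bar>x - 2*pi\<bar> < r ==> g x = c"
 shows "Ck k (per g)"
 using assms
proof (induction k arbitrary: g c)
 case (Suc k)
 then obtain g' where g': "!!x. (g has_real_derivative g' x) (at x)" "Ck k g'" by auto
 have g0: "g' x = 0" if "\<bar>x\<bar> < r \<or> \<bar>x - 2*pi\<bar> < r" for x
 proof -
  have "((%_. c) has_real_derivative 0) (at x)" by simp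
  hence "(g has_real_derivative 0) (at x)"
  proof (rule has_field_derivative_transform_within_open)
   show "open (ball 0 r \<union> ball (2*pi) r)" by auto
   show "x \<in> ball 0 r \<union> ball (2*pi) r" using that by (auto simp: dist_real_def)
   show "!!y. y \<in> ball 0 r \<union> ball (2*pi) r ==> c = g y" using Suc.prems(3) by (auto simp: dist_real_def abs_minus_commute)
  qed
  thus ?thesis using g'(1) DERIV_unique by blast
 qed
 have "(per g has_real_derivative per g' x) (at x)" for x
 proof -
  define q where "q = \<lfloor>x / (2*pi)\<rfloor>"
  have q: "2 * pi * of_int q <= x" "x < 2 * pi * (of_int q + 1)"
  proof -
   have "of_int q <= x / (2*pi)" "x / (2*pi) < of_int q + 1" unfolding q_def by linarith+
   thus "2 * pi * of_int q <= x" "x < 2 * pi * (of_int q + 1)" by (simp_all add: field_simps)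
  qed
  show ?thesis
  proof (cases "x = 2 * pi * of_int q")
   case False
   have "((%y. g (y - 2 * pi * of_int q)) has_real_derivative g' (x - 2 * pi * of_int q) * 1) (at x)"
    by (rule DERIV_chain2[OF g'(1)]) (auto intro!: derivative_eq_intros)
   hence "(per g has_real_derivative g' (x - 2 * pi * of_int q) * 1) (at x)"
   proof (rule has_field_derivative_transform_within_open)
    show "open {2 * pi * of_int q <..< 2 * pi * (of_int q + 1)}" by simp
    show "x \<in> {2 * pi * of_int q <..< 2 * pi * (of_int q + 1)}" using q False by auto
    fix y assume y: "y \<in> {2 * pi * of_int q <..< 2 * pi * (of_int q + 1)}"
    hence "of_int q < y / (2*pi)" "y / (2*pi) < of_int q + 1" by (auto simp: field_simps)
    hence "\<lfloor>y / (2*pi)\<rfloor> = q" by (simp add: floor_eq_iff)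
    thus "g (y - 2 * pi * of_int q) = per g y" by (simp add: per_def)
   qed
   thus ?thesis by (simp add: per_def q_def)
  next
   case True
   have "((%_. c) has_real_derivative 0) (at x)" by simp
   hence "(per g has_real_derivative 0) (at x)"
   proof (rule has_field_derivative_transform_within_open)
    show "open (ball x (min r pi))" by simp
    show "x \<in> ball x (min r pi)" using \<open>0 < r\<close> by auto
    fix y assume y: "y \<in> ball x (min r pi)"
    show "c = per g y"
    proof (cases "x <= y")
     case le: True
     have "of_int q <= y / (2*pi)" "y / (2*pi) < of_int q + 1"
      using y le True by (auto simp: field_simps dist_real_def)
     hence fl: "\<lfloor>y / (2*pi)\<rfloor> = q" unfolding floor_eq_iff by blast
     have "g (y - x) = c" using y le by (intro Suc.prems(3)) (auto simp: dist_real_def)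
     thus ?thesis using True by (simp only: per_def fl)
    next
     case False
     have "of_int (q - 1) <= y / (2*pi)" "y / (2*pi) < of_int (q - 1) + 1"
      using y False True by (auto simp: field_simps dist_real_def)
     hence fl: "\<lfloor>y / (2*pi)\<rfloor> = q - 1" unfolding floor_eq_iff by blast
     have "y - 2 * pi * of_int (q - 1) = y - x + 2*pi" using True by (simp add: algebra_simps)
     moreover have "g (y - x + 2*pi) = c" using y False by (intro Suc.prems(3)) (auto simp: dist_real_def)
     ultimately show ?thesis by (simp only: per_def fl)
    qed
   qed
   moreover have "per g' x = 0" using g0[of 0] \<open>0 < r\<close> True by (simp add: per_def q_def)
   ultimately show ?thesis by simp
  qed
 qed
 moreover have "Ck k (per g')" by (rule Suc.IH[OF g'(2) \<open>0 < r\<close> g0])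
 ultimately show ?case by (rule Ck_SucI)
qed simp

lemma smooth_per:
 assumes "smooth g" "0 < r" "!!x. \<bar>x\<bar> < r \<or> \<bar>x - 2*pi\<bar> < r ==> g x = c"
 shows "smooth (per g)"
 using assms Ck_per unfolding smooth_def by metis

definition arc :: "nat => nat => real" where "arc N j = real j * (2 * pi / real N)"

text \<open>The last cell wraps around the identification of 0 with \<open>2\<pi>\<close>.\<close>
definition cell :: "nat => nat => real set" where
 "cell N j = {x \<in> Iper. if Suc j < N then arc N j <= x \<and> x <= arc N (j + 2) else arc N j <= x \<or> x <= arc N 1}"

lemma partition_exists:
 fixes m :: "real => real"
 assumes N: "3 <= N" and int: "integrable lborel (%x. indicator Iper x * m x)"
  and nn: "!!x. x \<in> Iper ==> 0 <= m x"
 obtains \<eta> :: "nat => real => real" where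
  "!!j. j < N ==> smooth (\<eta> j)" "!!j x. j < N ==> \<eta> j (x + 2*pi) = \<eta> j x"
  "!!x. x \<in> Iper ==> (\<Sum>j<N. (\<eta> j x)\<^sup>2) = 1"
  "!!i j. i < N ==> j < N ==> i \<noteq> j ==> (\<integral>x. indicator Iper x * m x * (\<eta> i x * \<eta> j x) \<partial>lborel) = 0"
  "!!j x. j < N ==> x \<in> Iper ==> \<eta> j x \<noteq> 0 ==> x \<in> cell N j"
proof -
 define h where "h = 2 * pi / real N"
 have h: "0 < h" using N by (simp add: h_def)
 have Nh: "real N * h = 2 * pi" using N by (simp add: h_def)
 have arc: "arc N j = real j * h" for j by (simp add: arc_def h_def)
 have mono: "real i * h + h <= real j * h" if "i < j" for i j :: nat
 proof -
  have "(real i + 1) * h <= real j * h" using that h by (intro mult_right_mono) auto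
  thus ?thesis by (simp add: algebra_simps)
 qed
 \<comment> \<open>The angle turns in the middle half of arc \<open>j\<close>. The quarters left at
   both ends keep everything constant near the seam, as \<open>smooth_per\<close> requires.\<close>
 define a where "a j = real j * h + h / 4" for j
 define b where "b j = real j * h + 3 * h / 4" for j
 have ab: "a j < b j" for j using h by (simp add: a_def b_def)
 have abI: "{a j..b j} \<subseteq> Iper" "b j < 2 * pi" if "j < N" for j
 proof -
  have "0 <= real j * h" using h by simp
  thus "{a j..b j} \<subseteq> Iper" "b j < 2 * pi" using mono[OF that] Nh h by (auto simp: a_def b_def Iper_def)
 qed
 have "\<exists>\<phi>. smooth \<phi> \<and> (\<forall>x\<le>a j. \<phi> x = 0) \<and> (\<forall>x\<ge>b j. \<phi> x = pi / 2) \<and>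
   (\<integral>x. indicator {a j..b j} x * m x * sin (2 * \<phi> x) \<partial>lborel) = 0" if j: "j < N" for j
 proof (rule orthogonal_angle[OF ab])
  have "integrable lborel (%x. indicator {a j..b j} x *\<^sub>R (indicator Iper x * m x))"
   by (rule integrable_mult_indicator[OF _ int]) simp
  moreover have "(%x. indicator {a j..b j} x *\<^sub>R (indicator Iper x * m x)) = (%x. indicator {a j..b j} x * m x)"
   using abI(1)[OF j] by (auto simp: fun_eq_iff split: split_indicator)
  ultimately show "integrable lborel (%x. indicator {a j..b j} x * m x)" by simp
 qed (use nn abI[OF j] in auto)
 hence "\<forall>j\<in>{..<N}. \<exists>\<phi>. smooth \<phi> \<and> (\<forall>x\<le>a j. \<phi> x = 0) \<and> (\<forall>x\<ge>b j. \<phi> x = pi / 2) \<and>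
   (\<integral>x. indicator {a j..b j} x * m x * sin (2 * \<phi> x) \<partial>lborel) = 0" by blast
 from bchoice[OF this] obtain \<Phi> where \<Phi>: "\<forall>j\<in>{..<N}. smooth (\<Phi> j) \<and> (\<forall>x\<le>a j. \<Phi> j x = 0) \<and> (\<forall>x\<ge>b j. \<Phi> j x = pi / 2) \<and>
   (\<integral>x. indicator {a j..b j} x * m x * sin (2 * \<Phi> j x) \<partial>lborel) = 0" by blast
 hence sm: "!!j. j < N ==> smooth (\<Phi> j)"
  and lo: "!!j x. j < N ==> x <= a j ==> \<Phi> j x = 0" and hi: "!!j x. j < N ==> b j <= x ==> \<Phi> j x = pi / 2"
  and orth: "!!j. j < N ==> (\<integral>x. indicator {a j..b j} x * m x * sin (2 * \<Phi> j x) \<partial>lborel) = 0"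
  by auto
 \<comment> \<open>\<open>g j\<close> rises on arc \<open>j\<close> and falls on the next arc. For
   the last index the next arc is arc 0, at the other end of \<open>I\<close>; rise and fall then
   have disjoint supports and are added instead of multiplied.\<close>
 define g where "g j y = (if Suc j < N then sin (\<Phi> j y) * cos (\<Phi> (Suc j) y) else sin (\<Phi> j y) + cos (\<Phi> 0 y))" for j y
 define \<eta> where "\<eta> j = per (g j)" for j
 define prd where "prd k = (if k = 0 then N - 1 else k - 1)" for k :: nat
 have prd: "prd k < N" "prd k \<noteq> k" if "k < N" for k using that N by (auto simp: prd_def)
 \<comment> \<open>With at least three arcs, two cyclically neighbouring indices share exactly one
   arc, so each overlap is governed by a single angle; with two arcs they would share both.\<close>
 have prd2: "\<not> (j = prd k \<and> k = prd j)" if "k < N" "j < N" for j k using that N by (auto simp: prd_def split: if_splits)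
 have prd_inj: "prd j = prd k ==> j = k" if "k < N" "j < N" for j k using that N by (auto simp: prd_def split: if_splits)
 have below: "sin (\<Phi> i y) = 1" "cos (\<Phi> i y) = 0" if "i < k" "k < N" "arc N k <= y" for i k y
 proof -
  have "\<Phi> i y = pi/2" using that mono[of i k] h by (intro hi) (auto simp: b_def arc)
  thus "sin (\<Phi> i y) = 1" "cos (\<Phi> i y) = 0" by (simp_all only: sin_pi_half cos_pi_half)
 qed
 have above: "sin (\<Phi> i y) = 0" "cos (\<Phi> i y) = 1" if "k < i" "i < N" "y <= arc N (Suc k)" for i k y
 proof -
  have "\<Phi> i y = 0" using that mono[of k i] h by (intro lo) (auto simp: a_def arc algebra_simps)
  thus "sin (\<Phi> i y) = 0" "cos (\<Phi> i y) = 1" by simp_all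
 qed
 have g_arc: "g j y = (if j = k then sin (\<Phi> k y) else if j = prd k then cos (\<Phi> k y) else 0)"
  if k: "k < N" "arc N k <= y" "y <= arc N (Suc k)" and j: "j < N" for j k y
 proof (cases "Suc j < N")
  case True
  consider "j = k" | "Suc j = k" | "Suc j < k" | "k < j" by linarith
  thus ?thesis
  proof cases
   case 1 thus ?thesis using above[of k "Suc j" y] True k by (simp add: g_def)
  next
   case 2 thus ?thesis using below[of j k y] True k by (auto simp: g_def prd_def)
  next
   case 3 thus ?thesis using below[of j k y] below[of "Suc j" k y] True k by (auto simp: g_def prd_def)
  next
   case 4 thus ?thesis using above[of k j y] True k by (auto simp: g_def prd_def)
  qed
 next
  case False
  hence jN: "j = N - 1" using j by auto
  consider "k = 0" | "0 < k" "k < j" | "k = j" using k jN by linarith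
  thus ?thesis
  proof cases
   case 1 thus ?thesis using above[of 0 j y] False k jN N by (auto simp: g_def prd_def)
  next
   case 2 thus ?thesis using above[of k j y] below[of 0 k y] False k jN by (auto simp: g_def prd_def)
  next
   case 3 thus ?thesis using below[of 0 k y] False k jN N by (auto simp: g_def)
  qed
 qed
 have find: "\<exists>k<N. arc N k <= x \<and> x <= arc N (Suc k)" if "0 <= x" "x < 2*pi" for x
 proof -
  define k where "k = nat \<lfloor>x / h\<rfloor>"
  have "0 <= x / h" using that h by simp
  hence k: "real k <= x / h" "x / h < real k + 1" unfolding k_def by linarith+
  hence *: "real k * h <= x" "x < real k * h + h" using h by (simp_all add: field_simps)
  have "k < N"
  proof (rule ccontr)
   assume "\<not> k < N"
   hence "real N * h <= real k * h" using h by (intro mult_right_mono) auto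
   thus False using * that Nh by linarith
  qed
  thus ?thesis using * by (intro exI[of _ k]) (auto simp: arc algebra_simps)
 qed
 have near0: "g j x = (if Suc j < N then 0 else 1)" if "j < N" "\<bar>x\<bar> < h/4 \<or> \<bar>x - 2*pi\<bar> < h/4" for j x
  using that(2)
 proof
  assume x: "\<bar>x\<bar> < h/4"
  have "\<Phi> i x = 0" if "i < N" for i
  proof -
   have "0 <= real i * h" using h by simp
   moreover have "x < h / 4" using x by linarith
   ultimately have "x <= a i" unfolding a_def by linarith
   thus ?thesis by (rule lo[OF that])
  qed
  thus ?thesis using that(1) N by (auto simp: g_def)
 next
  assume x: "\<bar>x - 2*pi\<bar> < h/4"
  have "sin (\<Phi> i x) = 1" "cos (\<Phi> i x) = 0" if "i < N" for i
  proof -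
   have "2 * pi - h / 4 < x" using x by linarith
   hence "b i <= x" using mono[OF that] Nh unfolding b_def by linarith
   hence "\<Phi> i x = pi/2" by (rule hi[OF that])
   thus "sin (\<Phi> i x) = 1" "cos (\<Phi> i x) = 0" by (simp_all only: sin_pi_half cos_pi_half)
  qed
  thus ?thesis using that(1) N by (auto simp: g_def)
 qed
 have \<eta>_lt: "\<eta> j x = g j x" if "0 <= x" "x < 2*pi" for j x using that by (simp add: \<eta>_def per_eq)
 have \<eta>_2pi: "\<eta> j (2*pi) = (if Suc j < N then 0 else 1)" if "j < N" for j
  using near0[OF that, of 0] h by (simp add: \<eta>_def per_2pi)
 have case_I: "x \<in> Iper ==> (0 <= x \<and> x < 2*pi) \<or> x = 2*pi" for x by (auto simp: Iper_def)
 show thesis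
 proof (rule that[of \<eta>])
  fix j assume j: "j < N"
  show "smooth (\<eta> j)"
   unfolding \<eta>_def
  proof (rule smooth_per[where r="h/4"])
   show "smooth (g j)" unfolding g_def[abs_def]
    by (cases "Suc j < N") (use j N sm in \<open>auto intro!: smooth_intros\<close>)
  qed (use h near0[OF j] in auto)
  show "\<eta> j (x + 2*pi) = \<eta> j x" for x by (simp add: \<eta>_def per_periodic)
  show "x \<in> cell N j" if x: "x \<in> Iper" "\<eta> j x \<noteq> 0" for x
   using case_I[OF x(1)]
  proof
   assume x2: "0 <= x \<and> x < 2*pi"
   then obtain k where k: "k < N" "arc N k <= x" "x <= arc N (Suc k)" using find by blast
   have "j = k \<or> j = prd k" using x(2) x2 g_arc[OF k j] by (auto simp: \<eta>_lt split: if_splits)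
   moreover have "arc N (Suc k) <= arc N (k + 2)" "arc N k <= arc N (Suc k)" "arc N (k - 1) <= arc N k" using h by (auto simp: arc algebra_simps)
   ultimately show ?thesis using x k j N by (auto simp: cell_def prd_def split: if_splits)
  next
   assume "x = 2*pi"
   thus ?thesis using x \<eta>_2pi[OF j] mono[OF j] Nh h by (auto simp: cell_def arc split: if_splits)
  qed
 next
  fix x assume x: "x \<in> Iper"
  show "(\<Sum>j<N. (\<eta> j x)\<^sup>2) = 1"
   using case_I[OF x]
  proof
   assume x2: "0 <= x \<and> x < 2*pi"
   then obtain k where k: "k < N" "arc N k <= x" "x <= arc N (Suc k)" using find by blast
   have "(\<Sum>j<N. (\<eta> j x)\<^sup>2) = (\<Sum>j\<in>{k, prd k}. (\<eta> j x)\<^sup>2)"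
    using k prd x2 by (intro sum.mono_neutral_right) (auto simp: \<eta>_lt g_arc[OF k])
   also have "\<dots> = 1" using k prd[OF k(1)] x2 by (simp add: \<eta>_lt g_arc[OF k])
   finally show ?thesis .
  next
   assume x2: "x = 2*pi"
   have "(\<Sum>j<N. (\<eta> j x)\<^sup>2) = (\<Sum>j\<in>{N-1}. (\<eta> j x)\<^sup>2)"
    using N x2 by (intro sum.mono_neutral_right) (auto simp: \<eta>_2pi)
   thus ?thesis using N x2 by (simp add: \<eta>_2pi)
  qed
 next
  \<comment> \<open>On the shared arc the product is cosine times sine of the same angle, half the
    sine of the doubled angle, and \<open>orthogonal_angle\<close> made its integral against the
    mass vanish.\<close>
  have adj: "(\<integral>x. indicator Iper x * m x * (\<eta> (prd j) x * \<eta> j x) \<partial>lborel) = 0" if j: "j < N" for j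
  proof -
   have pr: "\<eta> (prd j) x * \<eta> j x = indicator {a j..b j} x * sin (2 * \<Phi> j x) / 2" if x: "x \<in> Iper" for x
    using case_I[OF x]
   proof
    assume x2: "0 <= x \<and> x < 2*pi"
    then obtain k where k: "k < N" "arc N k <= x" "x <= arc N (Suc k)" using find by blast
    show ?thesis
    proof (cases "j = k")
     case True
     have "sin (\<Phi> j x) = 0 \<or> cos (\<Phi> j x) = 0" if "x \<notin> {a j..b j}"
     proof (cases "x <= a j")
      case True thus ?thesis using lo[OF j] by simp
     next
      case False
      hence "\<Phi> j x = pi/2" using hi[OF j, of x] that by simp
      thus ?thesis by (simp only: cos_pi_half) simp
     qed
     thus ?thesis using True x2 prd[OF j] k
      by (auto simp: \<eta>_lt g_arc[OF k] sin_double split: split_indicator)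
    next
     case False
     have "x \<notin> {a j..b j}"
      using False k mono[of j k] mono[of k j] h by (cases "j < k") (auto simp: a_def b_def arc algebra_simps)
     moreover have "\<eta> (prd j) x * \<eta> j x = 0"
      using False x2 k prd[OF j] prd[OF k(1)] prd2[OF k(1) j] j prd_inj[OF k(1) j] by (auto simp: \<eta>_lt g_arc[OF k])
     ultimately show ?thesis by simp
    qed
   next
    assume "x = 2*pi"
    thus ?thesis using abI[OF j] \<eta>_2pi[OF j] \<eta>_2pi[of "prd j"] prd[OF j] j by auto
   qed
   hence "indicator Iper x * m x * (\<eta> (prd j) x * \<eta> j x) = (1/2) * (indicator {a j..b j} x * m x * sin (2 * \<Phi> j x))" for x
   proof (cases "x \<in> Iper")
    case True thus ?thesis unfolding pr[OF True] by simp
   next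
    case False thus ?thesis using abI(1)[OF j] by (auto split: split_indicator)
   qed
   thus ?thesis using orth[OF j] by (simp only: integral_mult_right_zero mult_zero_right)
  qed
  fix i j assume ij: "i < N" "j < N" "i \<noteq> j"
  consider "i = prd j" | "j = prd i" | "i \<noteq> prd j" "j \<noteq> prd i" by blast
  thus "(\<integral>x. indicator Iper x * m x * (\<eta> i x * \<eta> j x) \<partial>lborel) = 0"
  proof cases
   case 1 thus ?thesis using adj[OF ij(2)] by simp
  next
   case 2 thus ?thesis using adj[OF ij(1)] by (simp add: mult.commute)
  next
   case 3
   have "\<eta> i x * \<eta> j x = 0" if x: "x \<in> Iper" for x
    using case_I[OF x]
   proof
    assume x2: "0 <= x \<and> x < 2*pi"
    then obtain k where k: "k < N" "arc N k <= x" "x <= arc N (Suc k)" using find by blast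
    show ?thesis using 3 ij x2 by (auto simp: \<eta>_lt g_arc[OF k])
   qed (use ij \<eta>_2pi in auto)
   hence "indicator Iper x * m x * (\<eta> i x * \<eta> j x) = 0" for x by (auto split: split_indicator)
   thus ?thesis by (simp only: Bochner_Integration.integral_zero)
  qed
 qed
qed

text \<open>Raw material for the states of weight zero that complete a finite mixture to an infinite
  orthonormal family. The normalizing \<open>J\<close> is positive because the bump is positive on a
  nonempty open interval.\<close>

lemma bump_orbital:
 assumes "0 < a" "a < b" "b < 2*pi"
 obtains v where "smooth v" "!!x. v (x + 2*pi) = v x" "!!x. x \<in> Iper ==> v x \<noteq> 0 ==> a < x \<and> x < b"
  "(\<integral>x. indicator Iper x * (v x)\<^sup>2 \<partial>lborel) = 1"
proof -
 define J where "J = (\<integral>x. (bump a b x)\<^sup>2 \<partial>lborel)"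
 have [measurable]: "bump a b \<in> borel_measurable borel" by (rule smooth_measurable[OF smooth_bump])
 have int: "integrable lborel (%x. (bump a b x)\<^sup>2)"
 proof (rule Bochner_Integration.integrable_bound)
  show "integrable lborel (indicator {a..b} :: real => real)" using assms by simp
  show "AE x in lborel. norm ((bump a b x)\<^sup>2) <= norm (indicator {a..b} x :: real)"
   using bump_bounds by (intro AE_I2) (auto simp: bump_zero power_le_one split: split_indicator)
 qed auto
 have "J \<noteq> 0"
 proof
  assume "J = 0"
  hence "AE x in lborel. (bump a b x)\<^sup>2 = 0"
   using integral_nonneg_eq_0_iff_AE[OF int] by (auto simp: J_def)
  hence "AE x in lborel. x \<notin> {a<..<b}"
  proof (rule AE_mp, intro AE_I2 impI)
   fix x assume "(bump a b x)\<^sup>2 = 0" thus "x \<notin> {a<..<b}" using bump_pos[of a x b] by auto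
  qed
  hence "{a<..<b} \<in> null_sets lborel" by (subst AE_iff_null_sets) auto
  hence "emeasure lborel {a<..<b} = 0" by (rule null_setsD1)
  thus False using assms by simp
 qed
 moreover have "0 <= J" unfolding J_def by (intro Bochner_Integration.integral_nonneg) auto
 ultimately have J: "0 < J" by simp
 define g where "g x = (1 / sqrt J) * bump a b x" for x
 define v where "v = per g"
 have z: "g x = 0" if "\<bar>x\<bar> < min a (2*pi - b) \<or> \<bar>x - 2*pi\<bar> < min a (2*pi - b)" for x
  unfolding g_def using that by (subst bump_zero) auto
 have v: "v x = g x" if "x \<in> Iper" for x
 proof (cases "x = 2*pi")
  case True
  thus ?thesis using assms by (simp add: v_def per_2pi g_def bump_zero)
 next
  case False
  thus ?thesis using that by (auto simp: v_def Iper_def intro!: per_eq)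
 qed
 show thesis
 proof (rule that[of v])
  show "smooth v" unfolding v_def
  proof (rule smooth_per[where r="min a (2*pi - b)" and c=0])
   show "smooth g" unfolding g_def[abs_def] by (intro smooth_intros smooth_bump)
  qed (use assms z in auto)
  show "v (x + 2*pi) = v x" for x by (simp add: v_def per_periodic)
  show "a < x \<and> x < b" if "x \<in> Iper" "v x \<noteq> 0" for x
   using that bump_zero[of x a b] by (force simp: v g_def)
  have "indicator Iper x * (v x)\<^sup>2 = (1 / J) * (bump a b x)\<^sup>2" for x
  proof (cases "x \<in> Iper")
   case True thus ?thesis using J by (simp add: v g_def power_divide power_mult_distrib)
  next
   case False thus ?thesis using assms by (auto simp: Iper_def bump_zero)
  qed
  thus "(\<integral>x. indicator Iper x * (v x)\<^sup>2 \<partial>lborel) = 1"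
   using J by (simp flip: J_def)
 qed
qed

section \<open>Periodic orbitals and Slater determinants\<close>

definition cpt_supp :: "(real => real) => bool" where
 "cpt_supp \<phi> \<longleftrightarrow> (\<exists>R. \<forall>x. R < \<bar>x\<bar> --> \<phi> x = 0)"

definition wd1 :: "(real => complex) => (real => complex) => bool" where
 "wd1 u v \<longleftrightarrow> (\<forall>\<phi>. smooth \<phi> \<and> cpt_supp \<phi> -->
   (\<integral>x. u x * complex_of_real (deriv \<phi> x) \<partial>lborel) = - (\<integral>x. v x * complex_of_real (\<phi> x) \<partial>lborel))"

definition L2l :: "(real => complex) => bool" where
 "L2l u \<longleftrightarrow> u \<in> borel_measurable borel \<and> (\<forall>R. (\<integral>\<^sup>+ x. indicator {-R..R} x * ennreal ((cmod (u x))\<^sup>2) \<partial>lborel) < \<infinity>)"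

text \<open>One-dimensional counterpart of the pairs behind \<open>H1per_grad\<close>, given on the
  whole line so that products of orbitals are their own periodic extensions.\<close>

definition orb :: "(real => complex) => (real => complex) => bool" where
 "orb u v \<longleftrightarrow> (\<forall>x. u (x + 2*pi) = u x) \<and> L2l u \<and> L2l v \<and> wd1 u v"

lemma norm_add_sq_le: "(cmod (a + b))\<^sup>2 <= 2 * (cmod a)\<^sup>2 + 2 * (cmod b)\<^sup>2"
proof -
 have "(cmod (a + b))\<^sup>2 <= (cmod a + cmod b)\<^sup>2" by (intro power_mono norm_triangle_ineq) auto
 also have "\<dots> <= 2 * (cmod a)\<^sup>2 + 2 * (cmod b)\<^sup>2"
  using sum_squares_bound[of "cmod a" "cmod b"] by (simp add: power2_sum)
 finally show ?thesis .
qed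

lemma deriv_outside:
 assumes "smooth \<phi>" "!!x. R < \<bar>x\<bar> ==> \<phi> x = 0" "R < \<bar>x\<bar>"
 shows "deriv \<phi> x = 0"
proof -
 have "((%_. 0) has_real_derivative 0) (at x)" by simp
 hence "(\<phi> has_real_derivative 0) (at x)"
 proof (rule has_field_derivative_transform_within_open)
  show "open {x. R < \<bar>x\<bar>}" by (intro open_Collect_less continuous_intros)
 qed (use assms in auto)
 thus ?thesis by (rule DERIV_imp_deriv)
qed

lemma cpt_supp_deriv: "smooth \<phi> ==> cpt_supp \<phi> ==> cpt_supp (deriv \<phi>)"
 unfolding cpt_supp_def using deriv_outside by blast

lemma cpt_supp_mult: "cpt_supp \<phi> ==> cpt_supp (%x. f x * \<phi> x)"
 by (auto simp: cpt_supp_def)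

lemma L2l_integrable:
 assumes u: "L2l u" and c: "continuous_on UNIV \<phi>" and s: "cpt_supp \<phi>"
 shows "integrable lborel (%x. u x * complex_of_real (\<phi> x))"
proof (rule integrableI_bounded)
 have [measurable]: "u \<in> borel_measurable borel" "\<phi> \<in> borel_measurable borel"
  using u borel_measurable_continuous_onI[OF c] by (auto simp: L2l_def)
 show "(%x. u x * complex_of_real (\<phi> x)) \<in> borel_measurable lborel" by measurable
 from s obtain R where R: "!!x. R < \<bar>x\<bar> ==> \<phi> x = 0" by (auto simp: cpt_supp_def)
 have "compact (\<phi> ` {-R..R})" by (rule compact_continuous_image[OF continuous_on_subset[OF c]]) auto
 then obtain B where "\<forall>x\<in>\<phi> ` {-R..R}. norm x <= B" using compact_imp_bounded bounded_iff by blast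
 hence B: "!!x. x \<in> {-R..R} ==> \<bar>\<phi> x\<bar> <= B" by auto
 have "(\<integral>\<^sup>+ x. ennreal (norm (u x * complex_of_real (\<phi> x))) \<partial>lborel)
   <= (\<integral>\<^sup>+ x. ennreal \<bar>B\<bar> * (indicator {-R..R} x + indicator {-R..R} x * ennreal ((cmod (u x))\<^sup>2)) \<partial>lborel)"
 proof (rule nn_integral_mono)
  fix x
  show "ennreal (norm (u x * complex_of_real (\<phi> x))) <= ennreal \<bar>B\<bar> * (indicator {-R..R} x + indicator {-R..R} x * ennreal ((cmod (u x))\<^sup>2))"
  proof (cases "\<bar>x\<bar> <= R")
   case True
   hence x: "x \<in> {-R..R}" by auto
   have "cmod (u x) <= 1 + (cmod (u x))\<^sup>2"
    using sum_squares_bound[of 1 "cmod (u x)"] zero_le_power2[of "cmod (u x)"] norm_ge_zero[of "u x"]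
    unfolding power2_eq_square by linarith
   hence "cmod (u x) * \<bar>\<phi> x\<bar> <= (1 + (cmod (u x))\<^sup>2) * \<bar>B\<bar>" using B[OF x] by (intro mult_mono) auto
   hence "ennreal (norm (u x * complex_of_real (\<phi> x))) <= ennreal (\<bar>B\<bar> * (1 + (cmod (u x))\<^sup>2))"
    by (simp add: norm_mult mult.commute)
   also have "\<dots> = ennreal \<bar>B\<bar> * (1 + ennreal ((cmod (u x))\<^sup>2))"
    by (subst ennreal_mult) (auto simp: ennreal_plus)
   finally show ?thesis using x by simp
  next
   case False thus ?thesis using R[of x] by simp
  qed
 qed
 also have "\<dots> = ennreal \<bar>B\<bar> * (emeasure lborel {-R..R} + (\<integral>\<^sup>+ x. indicator {-R..R} x * ennreal ((cmod (u x))\<^sup>2) \<partial>lborel))"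
  by (subst nn_integral_cmult, measurable) (subst nn_integral_add, auto)
 also have "\<dots> < \<infinity>"
 proof -
  have "(\<integral>\<^sup>+ x. indicator {-R..R} x * ennreal ((cmod (u x))\<^sup>2) \<partial>lborel) < \<infinity>" using u by (simp add: L2l_def)
  moreover have "emeasure lborel {-R..R} < \<infinity>" by (simp add: emeasure_lborel_Icc_eq)
  ultimately show ?thesis by (simp add: ennreal_mult_less_top)
 qed
 finally show "(\<integral>\<^sup>+ x. ennreal (norm (u x * complex_of_real (\<phi> x))) \<partial>lborel) < \<infinity>" .
qed

lemma L2l_add:
 assumes "L2l u" "L2l v" shows "L2l (%x. u x + v x)"
 unfolding L2l_def
proof (intro conjI allI)
 have [measurable]: "u \<in> borel_measurable borel" "v \<in> borel_measurable borel" using assms by (auto simp: L2l_def)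
 show "(%x. u x + v x) \<in> borel_measurable borel" by measurable
 fix R
 have "(\<integral>\<^sup>+ x. indicator {-R..R} x * ennreal ((cmod (u x + v x))\<^sup>2) \<partial>lborel)
   <= (\<integral>\<^sup>+ x. 2 * (indicator {-R..R} x * ennreal ((cmod (u x))\<^sup>2)) + 2 * (indicator {-R..R} x * ennreal ((cmod (v x))\<^sup>2)) \<partial>lborel)"
 proof (rule nn_integral_mono)
  fix x
  have "ennreal ((cmod (u x + v x))\<^sup>2) <= ennreal (2 * (cmod (u x))\<^sup>2 + 2 * (cmod (v x))\<^sup>2)"
   by (rule ennreal_leI[OF norm_add_sq_le])
  also have "\<dots> = 2 * ennreal ((cmod (u x))\<^sup>2) + 2 * ennreal ((cmod (v x))\<^sup>2)"
   by (simp add: ennreal_plus ennreal_mult)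
  finally show "indicator {-R..R} x * ennreal ((cmod (u x + v x))\<^sup>2) <= 2 * (indicator {-R..R} x * ennreal ((cmod (u x))\<^sup>2)) + 2 * (indicator {-R..R} x * ennreal ((cmod (v x))\<^sup>2))"
   by (auto split: split_indicator)
 qed
 also have "\<dots> = 2 * (\<integral>\<^sup>+ x. indicator {-R..R} x * ennreal ((cmod (u x))\<^sup>2) \<partial>lborel) + 2 * (\<integral>\<^sup>+ x. indicator {-R..R} x * ennreal ((cmod (v x))\<^sup>2) \<partial>lborel)"
  by (subst nn_integral_add, auto simp: nn_integral_cmult)
 also have "\<dots> < \<infinity>" using assms by (auto simp: L2l_def ennreal_mult_less_top)
 finally show "(\<integral>\<^sup>+ x. indicator {-R..R} x * ennreal ((cmod (u x + v x))\<^sup>2) \<partial>lborel) < \<infinity>" .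
qed

lemma L2l_mult:
 assumes u: "L2l u" and c: "continuous_on UNIV (\<phi>::real=>real)" shows "L2l (%x. u x * complex_of_real (\<phi> x))"
 unfolding L2l_def
proof (intro conjI allI)
 have [measurable]: "u \<in> borel_measurable borel" "\<phi> \<in> borel_measurable borel"
  using u borel_measurable_continuous_onI[OF c] by (auto simp: L2l_def)
 show "(%x. u x * complex_of_real (\<phi> x)) \<in> borel_measurable borel" by measurable
 fix R
 have "compact (\<phi> ` {-R..R})" by (rule compact_continuous_image[OF continuous_on_subset[OF c]]) auto
 then obtain B where "\<forall>x\<in>\<phi> ` {-R..R}. norm x <= B" using compact_imp_bounded bounded_iff by blast
 hence B: "!!x. x \<in> {-R..R} ==> \<bar>\<phi> x\<bar> <= B" by auto
 have "(\<integral>\<^sup>+ x. indicator {-R..R} x * ennreal ((cmod (u x * complex_of_real (\<phi> x)))\<^sup>2) \<partial>lborel)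
   <= (\<integral>\<^sup>+ x. ennreal (B\<^sup>2) * (indicator {-R..R} x * ennreal ((cmod (u x))\<^sup>2)) \<partial>lborel)"
 proof (rule nn_integral_mono)
  fix x
  have "(cmod (u x * complex_of_real (\<phi> x)))\<^sup>2 <= B\<^sup>2 * (cmod (u x))\<^sup>2" if "x \<in> {-R..R}"
   using power_mono[OF B[OF that], of 2] by (simp add: norm_mult power_mult_distrib mult.commute[of "(cmod (u x))\<^sup>2"] mult_right_mono)
  thus "indicator {-R..R} x * ennreal ((cmod (u x * complex_of_real (\<phi> x)))\<^sup>2) <= ennreal (B\<^sup>2) * (indicator {-R..R} x * ennreal ((cmod (u x))\<^sup>2))"
   by (auto simp: ennreal_leI split: split_indicator simp flip: ennreal_mult)
 qed
 also have "\<dots> = ennreal (B\<^sup>2) * (\<integral>\<^sup>+ x. indicator {-R..R} x * ennreal ((cmod (u x))\<^sup>2) \<partial>lborel)"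
  by (rule nn_integral_cmult) measurable
 also have "\<dots> < \<infinity>" using u by (auto simp: L2l_def ennreal_mult_less_top)
 finally show "(\<integral>\<^sup>+ x. indicator {-R..R} x * ennreal ((cmod (u x * complex_of_real (\<phi> x)))\<^sup>2) \<partial>lborel) < \<infinity>" .
qed

lemma deriv_mult_smooth:
 assumes "smooth f" "smooth g"
 shows "deriv (%x. f x * g x) x = deriv f x * g x + f x * deriv g x"
 by (rule DERIV_imp_deriv) (auto intro!: derivative_eq_intros smooth_DERIV assms)

text \<open>Testing \<open>f\<close> against \<open>\<eta> * \<phi>\<close> and subtracting the term
  with the derivative of \<eta> is the weak product rule. It turns the extension of the square root
  of \<rho> into orbitals.\<close>

lemma orb_mult:
 assumes o: "orb f g" and \<eta>: "smooth \<eta>" "!!x. \<eta> (x + 2*pi) = \<eta> x"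
 shows "orb (%x. f x * complex_of_real (\<eta> x)) (%x. g x * complex_of_real (\<eta> x) + f x * complex_of_real (deriv \<eta> x))"
 unfolding orb_def
proof (intro conjI allI)
 have f: "L2l f" and g: "L2l g" and wd: "wd1 f g" and p: "!!x. f (x + 2*pi) = f x" using o by (auto simp: orb_def)
 have c: "continuous_on UNIV \<eta>" "continuous_on UNIV (deriv \<eta>)" using \<eta>(1) smooth_deriv smooth_continuous by auto
 show "f (x + 2*pi) * complex_of_real (\<eta> (x + 2*pi)) = f x * complex_of_real (\<eta> x)" for x using p \<eta>(2) by simp
 show "L2l (%x. f x * complex_of_real (\<eta> x))" by (rule L2l_mult[OF f c(1)])
 show "L2l (%x. g x * complex_of_real (\<eta> x) + f x * complex_of_real (deriv \<eta> x))"
  by (intro L2l_add L2l_mult f g c)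
 show "wd1 (%x. f x * complex_of_real (\<eta> x)) (%x. g x * complex_of_real (\<eta> x) + f x * complex_of_real (deriv \<eta> x))"
  unfolding wd1_def
 proof (intro allI impI, elim conjE)
  fix \<phi> assume \<phi>: "smooth \<phi>" "cpt_supp \<phi>"
  have s: "smooth (%x. \<eta> x * \<phi> x)" "cpt_supp (%x. \<eta> x * \<phi> x)" using \<eta> \<phi> by (auto intro: smooth_mult cpt_supp_mult)
  have i1: "integrable lborel (%x. f x * complex_of_real (deriv (%x. \<eta> x * \<phi> x) x))"
   by (intro L2l_integrable f smooth_continuous smooth_deriv cpt_supp_deriv s)
  have i2: "integrable lborel (%x. f x * complex_of_real (deriv \<eta> x * \<phi> x))"
   by (intro L2l_integrable f smooth_continuous smooth_mult smooth_deriv cpt_supp_mult \<eta> \<phi>)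
  have i3: "integrable lborel (%x. g x * complex_of_real (\<eta> x * \<phi> x))"
   by (intro L2l_integrable g smooth_continuous s)
  have "(\<integral>x. f x * complex_of_real (\<eta> x) * complex_of_real (deriv \<phi> x) \<partial>lborel)
   = (\<integral>x. f x * complex_of_real (deriv (%x. \<eta> x * \<phi> x) x) - f x * complex_of_real (deriv \<eta> x * \<phi> x) \<partial>lborel)"
   by (intro Bochner_Integration.integral_cong) (auto simp: deriv_mult_smooth[OF \<eta>(1) \<phi>(1)] algebra_simps)
  also have "\<dots> = - (\<integral>x. g x * complex_of_real (\<eta> x * \<phi> x) \<partial>lborel) - (\<integral>x. f x * complex_of_real (deriv \<eta> x * \<phi> x) \<partial>lborel)"
   using wd s by (subst Bochner_Integration.integral_diff[OF i1 i2]) (auto simp: wd1_def)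
  also have "\<dots> = - (\<integral>x. g x * complex_of_real (\<eta> x * \<phi> x) + f x * complex_of_real (deriv \<eta> x * \<phi> x) \<partial>lborel)"
   by (subst Bochner_Integration.integral_add[OF i3 i2]) simp
  finally show "(\<integral>x. f x * complex_of_real (\<eta> x) * complex_of_real (deriv \<phi> x) \<partial>lborel)
   = - (\<integral>x. (g x * complex_of_real (\<eta> x) + f x * complex_of_real (deriv \<eta> x)) * complex_of_real (\<phi> x) \<partial>lborel)"
   by (simp add: algebra_simps)
 qed
qed

text \<open>The derivative of a compactly supported function has integral zero. Together with
  \<open>orb_mult\<close> this makes every smooth periodic function an orbital.\<close>

lemma orb_one: "orb (%_. 1) (%_. 0)"
 unfolding orb_def
proof (intro conjI allI)
 show "L2l (%_. 1)" by (auto simp: L2l_def emeasure_lborel_Icc_eq)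
 show "L2l (%_. 0)" by (auto simp: L2l_def)
 show "wd1 (%_. 1) (%_. 0)"
  unfolding wd1_def
 proof (intro allI impI, elim conjE)
  fix \<phi> assume \<phi>: "smooth \<phi>" "cpt_supp \<phi>"
  from \<phi>(2) obtain R where R: "!!x. R < \<bar>x\<bar> ==> \<phi> x = 0" by (auto simp: cpt_supp_def)
  define S where "S = \<bar>R\<bar> + 1"
  have "(\<integral>x. deriv \<phi> x * indicator {-S..S} x \<partial>lborel) = \<phi> S - \<phi> (-S)"
  proof (rule integral_FTC_Icc_real)
   show "- S <= S" by (simp add: S_def)
   show "DERIV \<phi> x :> deriv \<phi> x" for x by (rule smooth_DERIV[OF \<phi>(1)])
   show "isCont (deriv \<phi>) x" for x
    using smooth_continuous[OF smooth_deriv[OF \<phi>(1)], of UNIV] by (simp add: continuous_on_eq_continuous_at)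
  qed
  also have "(%x. deriv \<phi> x * indicator {-S..S} x) = deriv \<phi>"
  proof (rule ext)
   fix x show "deriv \<phi> x * indicator {-S..S} x = deriv \<phi> x"
   proof (cases "x \<in> {-S..S}")
    case False
    hence "deriv \<phi> x = 0" by (intro deriv_outside[OF \<phi>(1) R]) (auto simp: S_def)
    thus ?thesis by simp
   qed simp
  qed
  finally have "(\<integral>x. deriv \<phi> x \<partial>lborel) = 0" using R by (simp add: S_def)
  thus "(\<integral>x. 1 * complex_of_real (deriv \<phi> x) \<partial>lborel) = - (\<integral>x. 0 * complex_of_real (\<phi> x) \<partial>lborel)"
   by simp
 qed
qed auto

lemma smooth_deriv_funpow: "smooth \<phi> ==> smooth ((deriv ^^ k) \<phi>)"
 by (induction k) (auto intro: smooth_deriv)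

lemma deriv_shift: "deriv (%t. f (a + t)) 0 = deriv f (a::real)"
 unfolding deriv_def using DERIV_shift[of f _ 0 a] by (simp add: add.commute)

text \<open>The hypothesis on the square root of \<rho> is phrased with \<open>test_fun 1\<close> on
  extensional functions; this admits smooth functions of one real variable as test functions
  there.\<close>

lemma test_fun_1:
 assumes \<phi>: "smooth \<phi>" "cpt_supp \<phi>"
 shows "test_fun 1 (%x. \<phi> (x 0))" "pdir 0 (%x. \<phi> (x 0)) x = deriv \<phi> (x 0)"
proof -
 have pd: "pdir 0 (%x. f (x 0)) = (%x. deriv f (x 0))" for f
  by (rule ext) (simp add: pdir_def deriv_shift)
 show "pdir 0 (%x. \<phi> (x 0)) x = deriv \<phi> (x 0)" by (simp add: pd)
 have it: "iter_pd is (%x. \<phi> (x 0)) = (%x. (deriv ^^ length is) \<phi> (x 0))" if "set is \<subseteq> {..<1}" for "is"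
  using that by (induction "is") (auto simp: pd)
 show "test_fun 1 (%x. \<phi> (x 0))"
  unfolding test_fun_def
 proof (intro conjI allI impI ballI)
  fix "is" :: "nat list" assume s: "set is \<subseteq> {..<1}"
  note sm = smooth_deriv_funpow[OF \<phi>(1), of "length is"]
  show "continuous_on (Rspace 1) (iter_pd is (%x. \<phi> (x 0)))"
   unfolding it[OF s] by (rule continuous_on_compose2[OF smooth_continuous[OF sm, of UNIV]])
    (auto intro!: continuous_on_subset[OF continuous_on_product_coordinates])
  fix x :: "nat => real" and i :: nat assume "i < 1"
  hence "i = 0" by simp
  have "((%t. (deriv ^^ length is) \<phi> (x 0 + t)) has_real_derivative deriv ((deriv ^^ length is) \<phi>) (x 0 + 0) * 1) (at 0)"
   by (rule DERIV_chain2[OF smooth_DERIV[OF sm]]) (auto intro!: derivative_eq_intros)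
  thus "(%t. iter_pd is (%x. \<phi> (x 0)) (x(i := x i + t))) differentiable at 0"
   unfolding it[OF s] \<open>i = 0\<close> real_differentiable_def by auto
 next
  show "\<exists>R. \<forall>x\<in>Rspace 1. (\<exists>i<1. R < \<bar>x i\<bar>) --> \<phi> (x 0) = 0" using \<phi>(2) by (auto simp: cpt_supp_def)
 qed
qed

lemma orb_of_H1per:
 assumes "H1per 1 (%x. F (x 0))"
 obtains f g where "orb f g" "!!t. t \<in> Iper ==> f t = F t"
proof -
 from assms obtain f0 Gf where p: "periodic_fun 1 f0" and l: "L2loc 1 f0" "L2loc 1 (Gf 0)" and wd: "weak_pderiv 1 0 f0 (Gf 0)"
  and eq: "!!x. x \<in> In 1 ==> F (x 0) = f0 x"
  unfolding H1per_def H1per_grad_def by auto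
 \<comment> \<open>Identifies the line with \<open>Rspace 1\<close>; measurability, integrals and
   weak derivatives are all moved through it.\<close>
 define e :: "real => nat => real" where "e t = (\<lambda>i\<in>{0}. t)" for t
 have one: "{..<1::nat} = {0}" "{..<Suc 0} = {0}" by auto
 have eR: "e t \<in> Rspace 1" for t by (auto simp: e_def Rspace_def one(2) split: if_splits)
 have ex: "e (x 0) = x" if "x \<in> Rspace 1" for x using that by (auto simp: e_def Rspace_def one PiE_def extensional_def)
 have em: "e \<in> measurable lborel (Rn 1)"
  unfolding Rn_def one(1) e_def by (rule measurable_restrict) auto
 have R1: "Rn 1 = PiM {0} (%_. lborel)" by (simp only: Rn_def one(1))
 have meas: "(%t. h (e t)) \<in> borel_measurable borel" if "h \<in> borel_measurable (Rn 1)" for h :: "_ => complex"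
  using measurable_compose[OF em that] by simp
 have int: "integral\<^sup>L (Rn 1) h = (\<integral>t. h (e t) \<partial>lborel)" if "h \<in> borel_measurable (Rn 1)" for h :: "_ => complex"
 proof -
  have "integral\<^sup>L (Rn 1) h = integral\<^sup>L (Rn 1) (%x. h (e (x 0)))"
   by (intro Bochner_Integration.integral_cong) (auto simp: ex)
  also have "\<dots> = (\<integral>t. h (e t) \<partial>lborel)"
   unfolding R1 using meas[OF that] by (intro PR.product_integral_singleton) simp
  finally show ?thesis .
 qed
 have L2: "L2l (%t. h (e t))" if "L2loc 1 h" for h
  unfolding L2l_def
 proof (intro conjI allI meas)
  show "h \<in> borel_measurable (Rn 1)" using that by (simp add: L2loc_def)
  hence [measurable]: "(%t. h (e t)) \<in> borel_measurable borel" by (rule meas)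
  fix R
  have "(\<integral>\<^sup>+ t. indicator {-R..R} t * ennreal ((cmod (h (e t)))\<^sup>2) \<partial>lborel)
   = (\<integral>\<^sup>+ x. indicator {-R..R} (x 0) * ennreal ((cmod (h (e (x 0))))\<^sup>2) \<partial>Rn 1)"
   unfolding R1 by (rule PR.product_nn_integral_singleton[symmetric]) simp
  also have "\<dots> = (\<integral>\<^sup>+ x. indicator {x. \<forall>i<1. \<bar>x i\<bar> <= R} x * ennreal ((cmod (h x))\<^sup>2) \<partial>Rn 1)"
   by (intro nn_integral_cong) (auto simp: ex indicator_def abs_le_iff)
  also have "\<dots> < \<infinity>" using that by (simp add: L2loc_def)
  finally show "(\<integral>\<^sup>+ t. indicator {-R..R} t * ennreal ((cmod (h (e t)))\<^sup>2) \<partial>lborel) < \<infinity>" .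
 qed
 have fm: "f0 \<in> borel_measurable (Rn 1)" "Gf 0 \<in> borel_measurable (Rn 1)" using l by (auto simp: L2loc_def)
 have cm: "(%x. h (x 0)) \<in> borel_measurable (Rn 1)" if "smooth h" for h
 proof (rule measurable_compose[OF _ smooth_measurable[OF that]])
  have "(%x. x 0) \<in> measurable (PiM {0} (%_. lborel)) (lborel :: real measure)"
   by (rule measurable_component_singleton) simp
  thus "(%x. x 0) \<in> borel_measurable (Rn 1)" unfolding R1 by (simp add: measurable_lborel1 cong: measurable_cong_sets)
 qed
 have "orb (%t. f0 (e t)) (%t. Gf 0 (e t))"
  unfolding orb_def
 proof (intro conjI allI L2 l)
  fix t
  have "(e t)(0 := e t 0 + 2*pi) = e (t + 2*pi)" by (auto simp: e_def)
  thus "f0 (e (t + 2*pi)) = f0 (e t)" using p[unfolded periodic_fun_def, rule_format, OF eR[of t], of 0] by simp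
 next
  show "wd1 (%t. f0 (e t)) (%t. Gf 0 (e t))"
   unfolding wd1_def
  proof (intro allI impI, elim conjE)
   fix \<phi> assume \<phi>: "smooth \<phi>" "cpt_supp \<phi>"
   have e0: "e t 0 = t" for t by (simp add: e_def)
   have "integral\<^sup>L (Rn 1) (%x. f0 x * complex_of_real (deriv \<phi> (x 0))) = - integral\<^sup>L (Rn 1) (%x. Gf 0 x * complex_of_real (\<phi> (x 0)))"
    using wd[unfolded weak_pderiv_def, rule_format, OF test_fun_1(1)[OF \<phi>]] by (simp only: test_fun_1(2)[OF \<phi>])
   thus "(\<integral>t. f0 (e t) * complex_of_real (deriv \<phi> t) \<partial>lborel) = - (\<integral>t. Gf 0 (e t) * complex_of_real (\<phi> t) \<partial>lborel)"
    using fm cm[OF \<phi>(1)] cm[OF smooth_deriv[OF \<phi>(1)]] by (subst (asm) (1 2) int) (auto simp: e0)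
  qed
 qed
 moreover have "f0 (e t) = F t" if "t \<in> Iper" for t
  using eq[of "e t"] that by (auto simp: e_def In_def one(2))
 ultimately show thesis by (rule that)
qed

section \<open>Products of orbitals in n variables\<close>

definition prodf :: "nat => (nat => real => complex) => (nat => real) => complex" where
 "prodf n a x = (\<Prod>i<n. a i (x i))"

lemma measurable_coord_Rn: "i < n ==> (%x. x i) \<in> borel_measurable (Rn n)"
 unfolding Rn_def using measurable_component_singleton[of i "{..<n}" "%_. lborel"] by (simp add: measurable_lborel1 cong: measurable_cong_sets)

lemma measurable_Mn_Rn: "(%x. x) \<in> measurable (Mn n) (Rn n)"
 unfolding Rn_def by (rule measurable_PiM_single') (auto simp: measurable_coord In_def PiE_def)

lemma measurable_prodf:
 assumes "!!i. i < n ==> a i \<in> borel_measurable borel"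
 shows "prodf n a \<in> borel_measurable (Rn n)"
 unfolding prodf_def by (intro borel_measurable_prod measurable_compose[OF measurable_coord_Rn assms]) auto

lemma continuous_Rn_measurable:
 fixes f :: "(nat => real) => real"
 assumes "continuous_on (Rspace n) f"
 shows "f \<in> borel_measurable (Rn n)"
proof -
 have "(%x. x i) \<in> borel_measurable (Rn n)" for i
 proof (cases "i < n")
  case False
  have "(%x. x i) \<in> borel_measurable (Rn n) \<longleftrightarrow> (%x::nat=>real. undefined::real) \<in> borel_measurable (Rn n)"
   using False by (intro measurable_cong) (auto simp: Rspace_def PiE_def extensional_def)
  thus ?thesis by simp
 qed (rule measurable_coord_Rn)
 hence "(%x. x) \<in> measurable (Rn n) (PiM UNIV (%_. borel))"
  by (intro measurable_PiM_single') auto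
 hence "(%x. x) \<in> measurable (Rn n) (borel :: (nat => real) measure)"
  using measurable_cong_sets[OF refl sets_PiM_equal_borel] by blast
 hence "(%x. x) \<in> measurable (Rn n) (restrict_space borel (Rspace n))"
  by (rule measurable_restrict_space2[rotated]) auto
 from measurable_compose[OF this borel_measurable_continuous_on_restrict[OF assms]] show ?thesis .
qed

lemma cube_indicator:
 fixes x :: "nat => real"
 shows "indicator {x. \<forall>i<n. \<bar>x i\<bar> <= R} x = (\<Prod>i<n. indicator {-R..R} (x i) :: ennreal)"
proof (cases "\<forall>i<n. \<bar>x i\<bar> <= R")
 case True
 hence "(\<Prod>i<n. indicator {-R..R} (x i) :: ennreal) = 1" by (intro prod.neutral) (auto simp: abs_le_iff)
 thus ?thesis using True by simp
next
 case False
 then obtain i where i: "i < n" "\<not> \<bar>x i\<bar> <= R" by blast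
 hence "x i \<notin> {-R..R}" by (auto simp: abs_le_iff)
 hence "(\<Prod>i<n. indicator {-R..R} (x i) :: ennreal) = 0" using i by (intro prod_zero) (auto intro!: bexI[of _ i])
 thus ?thesis using False by auto
qed

lemma measurable_cube:
 "(%x. indicator {x. \<forall>i<n. \<bar>x i\<bar> <= (R::real)} x :: ennreal) \<in> borel_measurable (Rn n)"
proof -
 have "(%x. indicator {-R..R} (x i) :: ennreal) \<in> borel_measurable (Rn n)" if "i < n" for i
  by (rule measurable_compose[OF measurable_coord_Rn[OF that]]) measurable
 thus ?thesis unfolding cube_indicator by (intro borel_measurable_prod_ennreal) auto
qed

lemma L2loc_prodf:
 assumes "!!i. i < n ==> L2l (a i)"
 shows "L2loc n (prodf n a)"
 unfolding L2loc_def
proof (intro conjI allI)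
 have m: "a i \<in> borel_measurable borel" if "i < n" for i using assms[OF that] by (simp add: L2l_def)
 show "prodf n a \<in> borel_measurable (Rn n)" by (rule measurable_prodf[OF m])
 fix R
 have "(\<integral>\<^sup>+ x. indicator {x. \<forall>i<n. \<bar>x i\<bar> <= R} x * ennreal ((cmod (prodf n a x))\<^sup>2) \<partial>Rn n)
   = (\<integral>\<^sup>+ x. (\<Prod>i<n. indicator {-R..R} (x i) * ennreal ((cmod (a i (x i)))\<^sup>2)) \<partial>Rn n)"
  by (intro nn_integral_cong)
    (simp add: cube_indicator prodf_def prod.distrib prod_norm[symmetric] prod_power_distrib prod_ennreal)
 also have "\<dots> = (\<Prod>i<n. \<integral>\<^sup>+ y. indicator {-R..R} y * ennreal ((cmod (a i y))\<^sup>2) \<partial>lborel)"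
 proof -
  have "(%y. indicator {-R..R} y * ennreal ((cmod (a i y))\<^sup>2)) \<in> borel_measurable lborel" if "i \<in> {..<n}" for i
  proof -
   have [measurable]: "a i \<in> borel_measurable borel" using m that by auto
   show ?thesis by measurable
  qed
  thus ?thesis unfolding Rn_def by (subst PR.product_nn_integral_prod) auto
 qed
 also have "\<dots> < \<infinity>" using assms by (auto simp: L2l_def ennreal_prod_eq_top less_top[symmetric])
 finally show "(\<integral>\<^sup>+ x. indicator {x. \<forall>i<n. \<bar>x i\<bar> <= R} x * ennreal ((cmod (prodf n a x))\<^sup>2) \<partial>Rn n) < \<infinity>" .
qed

lemma cube_finite: "(\<integral>\<^sup>+ x. indicator {x. \<forall>i<n. \<bar>x i\<bar> <= R} x \<partial>Rn n) < \<infinity>"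
 using L2loc_prodf[of n "%_ _. 1"] orb_one by (simp add: L2loc_def prodf_def orb_def)

text \<open>On the cube \<open>|f| <= 1 + |f|^2\<close>, which reduces integrability to the local L2
  bound and the finite volume of the cube; outside it the factor \<psi> vanishes.\<close>

lemma L2loc_integrable:
 assumes f: "L2loc n f" and m: "\<psi> \<in> borel_measurable (Rn n)"
  and B: "!!x. x \<in> Rspace n ==> \<bar>\<psi> x\<bar> <= B" and z: "!!x. x \<in> Rspace n ==> \<exists>i<n. R < \<bar>x i\<bar> ==> \<psi> x = 0"
 shows "integrable (Rn n) (%x. f x * complex_of_real (\<psi> x))"
proof (rule integrableI_bounded)
 have [measurable]: "f \<in> borel_measurable (Rn n)" "\<psi> \<in> borel_measurable (Rn n)" using f m by (auto simp: L2loc_def)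
 show "(%x. f x * complex_of_real (\<psi> x)) \<in> borel_measurable (Rn n)" by measurable
 define C :: "(nat => real) => ennreal" where "C = indicator {x. \<forall>i<n. \<bar>x i\<bar> <= R}"
 have [measurable]: "C \<in> borel_measurable (Rn n)"
  unfolding C_def by (rule measurable_cube)
 have "(\<integral>\<^sup>+ x. ennreal (norm (f x * complex_of_real (\<psi> x))) \<partial>Rn n) <= (\<integral>\<^sup>+ x. ennreal \<bar>B\<bar> * (C x + C x * ennreal ((cmod (f x))\<^sup>2)) \<partial>Rn n)"
 proof (rule nn_integral_mono)
  fix x assume "x \<in> space (Rn n)"
  hence x: "x \<in> Rspace n" by simp
  show "ennreal (norm (f x * complex_of_real (\<psi> x))) <= ennreal \<bar>B\<bar> * (C x + C x * ennreal ((cmod (f x))\<^sup>2))"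
  proof (cases "\<forall>i<n. \<bar>x i\<bar> <= R")
   case True
   have "cmod (f x) <= 1 + (cmod (f x))\<^sup>2"
    using sum_squares_bound[of 1 "cmod (f x)"] zero_le_power2[of "cmod (f x)"] norm_ge_zero[of "f x"]
    unfolding power2_eq_square by linarith
   hence "cmod (f x) * \<bar>\<psi> x\<bar> <= (1 + (cmod (f x))\<^sup>2) * \<bar>B\<bar>" using B[OF x] by (intro mult_mono) auto
   hence "ennreal (norm (f x * complex_of_real (\<psi> x))) <= ennreal (\<bar>B\<bar> * (1 + (cmod (f x))\<^sup>2))"
    by (simp add: norm_mult mult.commute)
   also have "\<dots> = ennreal \<bar>B\<bar> * (1 + ennreal ((cmod (f x))\<^sup>2))"
    by (subst ennreal_mult) (auto simp: ennreal_plus)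
   finally show ?thesis using True by (simp add: C_def)
  next
   case False
   hence "\<exists>i<n. R < \<bar>x i\<bar>" by (simp add: not_le)
   hence "\<psi> x = 0" by (rule z[OF x])
   thus ?thesis by simp
  qed
 qed
 also have "\<dots> = ennreal \<bar>B\<bar> * ((\<integral>\<^sup>+ x. C x \<partial>Rn n) + (\<integral>\<^sup>+ x. C x * ennreal ((cmod (f x))\<^sup>2) \<partial>Rn n))"
  by (subst nn_integral_cmult, simp) (subst nn_integral_add, simp_all)
 also have "\<dots> < \<infinity>"
 proof -
  have "(\<integral>\<^sup>+ x. C x * ennreal ((cmod (f x))\<^sup>2) \<partial>Rn n) < \<infinity>" 
   unfolding C_def by (rule f[unfolded L2loc_def, THEN conjunct2, rule_format])
  moreover have "(\<integral>\<^sup>+ x. C x \<partial>Rn n) < \<infinity>" unfolding C_def by (rule cube_finite)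
  ultimately show ?thesis by (simp add: ennreal_mult_less_top)
 qed
 finally show "(\<integral>\<^sup>+ x. ennreal (norm (f x * complex_of_real (\<psi> x))) \<partial>Rn n) < \<infinity>" .
qed

text \<open>Among all functions on \<open>nat\<close> the cube is a full product in which the
  coordinates beyond \<open>n\<close> range over the singleton of \<open>undefined\<close>, so a
  product of compact sets.\<close>

lemma compact_cube: "compact {x \<in> Rspace n. \<forall>i<n. \<bar>x i\<bar> <= (R::real)}"
proof -
 have "{x \<in> Rspace n. \<forall>i<n. \<bar>x i\<bar> <= R} = PiE UNIV (%i. if i < n then {-R..R} else {undefined})"
  by (auto simp: Rspace_def PiE_def Pi_def extensional_def abs_le_iff split: if_splits)
 moreover have "compactin (product_topology (%_. euclidean) UNIV) (PiE UNIV (%i. if i < n then {-R..R} else {undefined::real}))"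
  unfolding compactin_PiE by auto
 ultimately show ?thesis by (simp add: euclidean_product_topology)
qed

lemma upd_Rspace: "x \<in> Rspace n ==> i < n ==> x(i := y) \<in> Rspace n"
 by (auto simp: Rspace_def PiE_def extensional_def)

text \<open>Iterated partial derivatives in one direction are the successive derivatives along a
  line parallel to it, so an abstract test function restricts to a smooth one of one
  variable.\<close>

lemma test_fun_slice:
 assumes t: "test_fun n \<Phi>" and i: "i < n" and x: "x \<in> Rspace n"
 shows "smooth (%y. \<Phi> (x(i := y)))" "cpt_supp (%y. \<Phi> (x(i := y)))"
  "deriv (%y. \<Phi> (x(i := y))) y = pdir i \<Phi> (x(i := y))"
proof -
 have d: "((%y. iter_pd is \<Phi> (x(i := y))) has_real_derivative iter_pd (i # is) \<Phi> (x(i := y))) (at y)"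
  if "set is \<subseteq> {..<n}" for "is" y
 proof -
  have "(%t. iter_pd is \<Phi> ((x(i := y))(i := (x(i := y)) i + t))) differentiable at 0"
   by (rule t[unfolded test_fun_def, THEN conjunct1, rule_format, OF that, THEN conjunct2, rule_format, OF upd_Rspace[OF x i] i])
  hence "((%t. iter_pd is \<Phi> ((x(i := y))(i := (x(i := y)) i + t))) has_real_derivative iter_pd (i # is) \<Phi> (x(i := y))) (at 0)"
   unfolding iter_pd.simps(2) pdir_def by (simp add: DERIV_deriv_iff_real_differentiable)
  thus ?thesis using DERIV_shift[of "%y. iter_pd is \<Phi> (x(i := y))" _ 0 y] by (simp add: add.commute)
 qed
 have "Ck k (%y. iter_pd is \<Phi> (x(i := y)))" if "set is \<subseteq> {..<n}" for k "is"
  using that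
 proof (induction k arbitrary: "is")
  case (Suc k)
  have "Ck k (%y. iter_pd (i # is) \<Phi> (x(i := y)))" by (rule Suc.IH) (use Suc.prems i in auto)
  thus ?case by (rule Ck_SucI[OF d[OF Suc.prems]])
 qed simp
 from this[of "[]"] show "smooth (%y. \<Phi> (x(i := y)))" by (simp add: smooth_def)
 show "deriv (%y. \<Phi> (x(i := y))) y = pdir i \<Phi> (x(i := y))"
  using DERIV_imp_deriv[OF d[of "[]" y]] by simp
 obtain R where R: "!!x. x \<in> Rspace n ==> \<exists>i<n. R < \<bar>x i\<bar> ==> \<Phi> x = 0" using t[unfolded test_fun_def, THEN conjunct2] by blast
 show "cpt_supp (%y. \<Phi> (x(i := y)))"
  unfolding cpt_supp_def
 proof (intro exI[of _ R] allI impI R upd_Rspace x i)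
  fix y assume "R < \<bar>y\<bar>" thus "\<exists>k<n. R < \<bar>(x(i := y)) k\<bar>" using i by (intro exI[of _ i]) auto
 qed
qed

lemma test_fun_bounds:
 assumes t: "test_fun n \<Phi>"
 obtains B R where "!!x. x \<in> Rspace n ==> \<bar>\<Phi> x\<bar> <= B" "!!x i. i < n ==> x \<in> Rspace n ==> \<bar>pdir i \<Phi> x\<bar> <= B"
  "!!x. x \<in> Rspace n ==> \<exists>i<n. R < \<bar>x i\<bar> ==> \<Phi> x = 0"
  "!!x i. i < n ==> x \<in> Rspace n ==> \<exists>i<n. R < \<bar>x i\<bar> ==> pdir i \<Phi> x = 0"
  "\<Phi> \<in> borel_measurable (Rn n)" "!!i. i < n ==> pdir i \<Phi> \<in> borel_measurable (Rn n)"
proof -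
 have c: "continuous_on (Rspace n) \<Phi>" "!!i. i < n ==> continuous_on (Rspace n) (pdir i \<Phi>)"
 proof -
  have it: "continuous_on (Rspace n) (iter_pd is \<Phi>)" if "set is \<subseteq> {..<n}" for "is"
   using t[unfolded test_fun_def, THEN conjunct1, rule_format, OF that] by simp
  show "continuous_on (Rspace n) \<Phi>" using it[of "[]"] by simp
  show "continuous_on (Rspace n) (pdir i \<Phi>)" if "i < n" for i using it[of "[i]"] that by simp
 qed
 obtain R where R: "!!x. x \<in> Rspace n ==> \<exists>i<n. R < \<bar>x i\<bar> ==> \<Phi> x = 0" using t[unfolded test_fun_def, THEN conjunct2] by blast
 have z: "pdir i \<Phi> x = 0" if "i < n" "x \<in> Rspace n" "\<exists>k<n. R < \<bar>x k\<bar>" for x i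
 proof -
  from that(3) obtain k where k: "k < n" "R < \<bar>x k\<bar>" by blast
  have d: "pdir i \<Phi> x = deriv (%y. \<Phi> (x(i := y))) (x i)"
   using test_fun_slice(3)[OF t that(1,2), of "x i"] by simp
  show ?thesis
  proof (cases "k = i")
   case True
   have "deriv (%y. \<Phi> (x(i := y))) (x i) = 0"
   proof (rule deriv_outside[OF test_fun_slice(1)[OF t that(1,2)]])
    fix y assume "R < \<bar>y\<bar>"
    thus "\<Phi> (x(i := y)) = 0" using that(1) by (intro R upd_Rspace that exI[of _ i]) auto
   qed (use k True in auto)
   thus ?thesis using d by simp
  next
   case False
   have "\<Phi> (x(i := y)) = 0" for y using False k by (intro R upd_Rspace that exI[of _ k]) auto
   thus ?thesis using d by simp
  qed
 qed
 have bd: "\<exists>B. \<forall>x\<in>Rspace n. \<bar>\<psi> x\<bar> <= B" if "continuous_on (Rspace n) \<psi>" "!!x. x \<in> Rspace n ==> \<exists>i<n. R < \<bar>x i\<bar> ==> \<psi> x = 0" for \<psi> :: "(nat => real) => real"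
 proof -
  have "compact (\<psi> ` {x \<in> Rspace n. \<forall>i<n. \<bar>x i\<bar> <= R})"
   by (rule compact_continuous_image[OF continuous_on_subset[OF that(1)] compact_cube]) auto
  then obtain B where "\<forall>y\<in>\<psi> ` {x \<in> Rspace n. \<forall>i<n. \<bar>x i\<bar> <= R}. norm y <= B" using compact_imp_bounded bounded_iff by blast
  hence B: "\<bar>\<psi> x\<bar> <= B" if "x \<in> Rspace n" "\<forall>i<n. \<bar>x i\<bar> <= R" for x using that by auto
  have "\<bar>\<psi> x\<bar> <= \<bar>B\<bar>" if x: "x \<in> Rspace n" for x
  proof (cases "\<forall>i<n. \<bar>x i\<bar> <= R")
   case True thus ?thesis using B[OF x True] by linarith
  next
   case False
   hence "\<psi> x = 0" by (intro \<open>!!x. x \<in> Rspace n ==> \<exists>i<n. R < \<bar>x i\<bar> ==> \<psi> x = 0\<close> x) (auto simp: not_le)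
   thus ?thesis by simp
  qed
  thus ?thesis by blast
 qed
 from bd[OF c(1) R] obtain B0 where B0: "\<forall>x\<in>Rspace n. \<bar>\<Phi> x\<bar> <= B0" by blast
 have "\<forall>i\<in>{..<n}. \<exists>B. \<forall>x\<in>Rspace n. \<bar>pdir i \<Phi> x\<bar> <= B" using bd[OF c(2) z] by blast
 from bchoice[OF this] obtain Bi where Bi: "\<forall>i\<in>{..<n}. \<forall>x\<in>Rspace n. \<bar>pdir i \<Phi> x\<bar> <= Bi i" by blast
 define B where "B = Max (insert B0 (Bi ` {..<n}))"
 have le: "B0 <= B" "!!i. i < n ==> Bi i <= B" unfolding B_def by (auto intro!: Max_ge)
 show thesis
 proof (rule that[of B R])
  show "\<bar>\<Phi> x\<bar> <= B" if "x \<in> Rspace n" for x using B0 le(1) that by force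
  show "\<bar>pdir i \<Phi> x\<bar> <= B" if "i < n" "x \<in> Rspace n" for x i
   using Bi le(2)[OF that(1)] that by force
 qed (use R z c in \<open>auto intro!: continuous_Rn_measurable\<close>)
qed

text \<open>Fubini in coordinate \<open>i\<close> isolates the factor \<open>a i\<close>: the other
  factors are constant on each line, and the slice of the test function is a legitimate
  one-dimensional test function.\<close>

lemma weak_pderiv_prodf:
 assumes o: "!!k. k < n ==> orb (a k) (b k)" and i: "i < n"
 shows "weak_pderiv n i (prodf n a) (prodf n (a(i := b i)))"
 unfolding weak_pderiv_def
proof (intro allI impI)
 fix \<Phi> assume t: "test_fun n \<Phi>"
 obtain B R where tb: "!!x. x \<in> Rspace n ==> \<bar>\<Phi> x\<bar> <= B" "!!x i. i < n ==> x \<in> Rspace n ==> \<bar>pdir i \<Phi> x\<bar> <= B"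
  "!!x. x \<in> Rspace n ==> \<exists>i<n. R < \<bar>x i\<bar> ==> \<Phi> x = 0"
  "!!x i. i < n ==> x \<in> Rspace n ==> \<exists>i<n. R < \<bar>x i\<bar> ==> pdir i \<Phi> x = 0"
  "\<Phi> \<in> borel_measurable (Rn n)" "!!i. i < n ==> pdir i \<Phi> \<in> borel_measurable (Rn n)"
  by (rule test_fun_bounds[OF t], rule that)
 have La: "L2loc n (prodf n a)" by (rule L2loc_prodf) (use o in \<open>auto simp: orb_def\<close>)
 have Lb: "L2loc n (prodf n (a(i := b i)))" by (rule L2loc_prodf) (use o in \<open>auto simp: orb_def\<close>)
 have ia: "integrable (Rn n) (%x. prodf n a x * complex_of_real (pdir i \<Phi> x))"
  by (rule L2loc_integrable[OF La tb(6)[OF i] tb(2)[OF i] tb(4)[OF i]])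
 have ib: "integrable (Rn n) (%x. prodf n (a(i := b i)) x * complex_of_real (\<Phi> x))"
  by (rule L2loc_integrable[OF Lb tb(5) tb(1) tb(3)])
 let ?I = "{..<n} - {i}"
 have ins: "{..<n} = insert i ?I" using i by auto
 have pf: "prodf n c (x(i := y)) = (\<Prod>k\<in>?I. c k (x k)) * c i y" for c x y
 proof -
  have "prodf n c (x(i := y)) = c i y * (\<Prod>k\<in>?I. c k ((x(i := y)) k))"
   unfolding prodf_def using i by (subst prod.remove[of _ i]) auto
  also have "(\<Prod>k\<in>?I. c k ((x(i := y)) k)) = (\<Prod>k\<in>?I. c k (x k))" by (rule prod.cong) auto
  finally show ?thesis by (simp only: mult.commute)
 qed
 have split: "integral\<^sup>L (Rn n) h = (\<integral>x. (\<integral>y. h (x(i := y)) \<partial>lborel) \<partial>PiM ?I (%_. lborel))"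
  if "integrable (Rn n) h" for h :: "_ => complex"
  using PR.product_integral_insert[of ?I i h] that ins unfolding Rn_def by simp
 have "integral\<^sup>L (Rn n) (%x. prodf n a x * complex_of_real (pdir i \<Phi> x))
   = (\<integral>x. - (\<integral>y. prodf n (a(i := b i)) (x(i := y)) * complex_of_real (\<Phi> (x(i := y))) \<partial>lborel) \<partial>PiM ?I (%_. lborel))"
  unfolding split[OF ia]
 proof (rule Bochner_Integration.integral_cong[OF refl])
  fix x assume "x \<in> space (PiM ?I (%_. lborel :: real measure))"
  hence x: "x(i := 0) \<in> Rspace n" using i by (auto simp: space_PiM Rspace_def PiE_def extensional_def)
  note sl = test_fun_slice[OF t i x]
  let ?C = "\<Prod>k\<in>?I. a k (x k)"
  have C': "(\<Prod>k\<in>?I. (a(i := b i)) k (x k)) = ?C" by (rule prod.cong) auto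
  have "(\<integral>y. prodf n a (x(i := y)) * complex_of_real (pdir i \<Phi> (x(i := y))) \<partial>lborel)
    = (\<integral>y. ?C * (a i y * complex_of_real (deriv (%y. \<Phi> (x(i := y))) y)) \<partial>lborel)"
   unfolding pf using sl(3) by (simp add: mult.assoc)
  also have "\<dots> = ?C * (\<integral>y. a i y * complex_of_real (deriv (%y. \<Phi> (x(i := y))) y) \<partial>lborel)" by simp
  also have "(\<integral>y. a i y * complex_of_real (deriv (%y. \<Phi> (x(i := y))) y) \<partial>lborel) = - (\<integral>y. b i y * complex_of_real (\<Phi> (x(i := y))) \<partial>lborel)"
   using o[OF i] sl(1,2) unfolding orb_def wd1_def by simp
  also have "?C * - (\<integral>y. b i y * complex_of_real (\<Phi> (x(i := y))) \<partial>lborel) = - (\<integral>y. ?C * (b i y * complex_of_real (\<Phi> (x(i := y)))) \<partial>lborel)"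
   by simp
  finally show "(\<integral>y. prodf n a (x(i := y)) * complex_of_real (pdir i \<Phi> (x(i := y))) \<partial>lborel)
    = - (\<integral>y. prodf n (a(i := b i)) (x(i := y)) * complex_of_real (\<Phi> (x(i := y))) \<partial>lborel)"
   unfolding pf C' by (simp only: mult.assoc fun_upd_same)
 qed
 also have "\<dots> = - integral\<^sup>L (Rn n) (%x. prodf n (a(i := b i)) x * complex_of_real (\<Phi> x))"
  unfolding split[OF ib] by simp
 finally show "integral\<^sup>L (Rn n) (%x. prodf n a x * complex_of_real (pdir i \<Phi> x)) = - integral\<^sup>L (Rn n) (%x. prodf n (a(i := b i)) x * complex_of_real (\<Phi> x))" .
qed

text \<open>\<open>H1per_grad\<close> with the function as its own extension, a form closed under
  linear combinations without choosing extensions anew.\<close>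

definition H1full :: "nat => ((nat => real) => complex) => (nat => (nat => real) => complex) => bool" where
 "H1full n f G \<longleftrightarrow> periodic_fun n f \<and> L2loc n f \<and> (\<forall>i<n. L2loc n (G i) \<and> weak_pderiv n i f (G i))"

lemma H1full_grad: "H1full n f G ==> H1per_grad n f G"
 unfolding H1full_def H1per_grad_def by (intro exI[of _ f] exI[of _ G]) auto

lemma H1full_prodf:
 assumes o: "!!k. k < n ==> orb (a k) (b k)"
 shows "H1full n (prodf n a) (%i. prodf n (a(i := b i)))"
 unfolding H1full_def
proof (intro conjI allI impI weak_pderiv_prodf L2loc_prodf o)
 show "periodic_fun n (prodf n a)"
  unfolding periodic_fun_def prodf_def
 proof (intro ballI allI impI prod.cong[OF refl])
  fix x :: "nat => real" and i k assume "k \<in> {..<n}"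
  thus "a k ((x(i := x i + 2*pi)) k) = a k (x k)" using o[of k] by (auto simp: orb_def)
 qed
qed (use o in \<open>auto simp: orb_def\<close>)

lemma L2loc_cmult:
 assumes f: "L2loc n f" shows "L2loc n (%x. c * f x)"
 unfolding L2loc_def
proof (intro conjI allI)
 have [measurable]: "f \<in> borel_measurable (Rn n)" using f by (simp add: L2loc_def)
 show "(%x. c * f x) \<in> borel_measurable (Rn n)" by measurable
 fix R
 define C :: "(nat => real) => ennreal" where "C = indicator {x. \<forall>i<n. \<bar>x i\<bar> <= R}"
 have [measurable]: "C \<in> borel_measurable (Rn n)"
  unfolding C_def by (rule measurable_cube)
 have "(\<integral>\<^sup>+ x. C x * ennreal ((cmod (c * f x))\<^sup>2) \<partial>Rn n)
  = (\<integral>\<^sup>+ x. ennreal ((cmod c)\<^sup>2) * (C x * ennreal ((cmod (f x))\<^sup>2)) \<partial>Rn n)"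
  by (intro nn_integral_cong) (simp add: norm_mult power_mult_distrib ennreal_mult mult.left_commute)
 also have "\<dots> = ennreal ((cmod c)\<^sup>2) * (\<integral>\<^sup>+ x. C x * ennreal ((cmod (f x))\<^sup>2) \<partial>Rn n)"
  by (rule nn_integral_cmult) measurable
 also have "\<dots> < \<infinity>" using f[unfolded L2loc_def, THEN conjunct2, rule_format, of R, folded C_def]
  by (simp add: ennreal_mult_less_top)
 finally show "(\<integral>\<^sup>+ x. indicator {x. \<forall>i<n. \<bar>x i\<bar> <= R} x * ennreal ((cmod (c * f x))\<^sup>2) \<partial>Rn n) < \<infinity>"
  by (simp add: C_def)
qed

lemma L2loc_add:
 assumes "L2loc n f" "L2loc n g" shows "L2loc n (%x. f x + g x)"
 unfolding L2loc_def
proof (intro conjI allI)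
 have [measurable]: "f \<in> borel_measurable (Rn n)" "g \<in> borel_measurable (Rn n)" using assms by (auto simp: L2loc_def)
 show "(%x. f x + g x) \<in> borel_measurable (Rn n)" by measurable
 fix R
 define C :: "(nat => real) => ennreal" where "C = indicator {x. \<forall>i<n. \<bar>x i\<bar> <= R}"
 have [measurable]: "C \<in> borel_measurable (Rn n)"
  unfolding C_def by (rule measurable_cube)
 have "(\<integral>\<^sup>+ x. C x * ennreal ((cmod (f x + g x))\<^sup>2) \<partial>Rn n)
   <= (\<integral>\<^sup>+ x. 2 * (C x * ennreal ((cmod (f x))\<^sup>2)) + 2 * (C x * ennreal ((cmod (g x))\<^sup>2)) \<partial>Rn n)"
 proof (rule nn_integral_mono)
  fix x
  have "ennreal ((cmod (f x + g x))\<^sup>2) <= ennreal (2 * (cmod (f x))\<^sup>2 + 2 * (cmod (g x))\<^sup>2)"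
   by (rule ennreal_leI[OF norm_add_sq_le])
  also have "\<dots> = 2 * ennreal ((cmod (f x))\<^sup>2) + 2 * ennreal ((cmod (g x))\<^sup>2)"
   by (simp add: ennreal_plus ennreal_mult)
  finally show "C x * ennreal ((cmod (f x + g x))\<^sup>2) <= 2 * (C x * ennreal ((cmod (f x))\<^sup>2)) + 2 * (C x * ennreal ((cmod (g x))\<^sup>2))"
   by (auto simp: C_def split: split_indicator)
 qed
 also have "\<dots> = 2 * (\<integral>\<^sup>+ x. C x * ennreal ((cmod (f x))\<^sup>2) \<partial>Rn n) + 2 * (\<integral>\<^sup>+ x. C x * ennreal ((cmod (g x))\<^sup>2) \<partial>Rn n)"
  by (subst nn_integral_add) (auto simp: nn_integral_cmult)
 also have "\<dots> < \<infinity>" 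
  using assms[unfolded L2loc_def, THEN conjunct2, rule_format, of R, folded C_def] by (simp add: ennreal_mult_less_top)
 finally show "(\<integral>\<^sup>+ x. indicator {x. \<forall>i<n. \<bar>x i\<bar> <= R} x * ennreal ((cmod (f x + g x))\<^sup>2) \<partial>Rn n) < \<infinity>"
  by (simp add: C_def)
qed

lemma H1full_add_cmult:
 assumes f: "H1full n f G" and g: "H1full n g H"
 shows "H1full n (%x. c * f x + g x) (%i x. c * G i x + H i x)"
 unfolding H1full_def
proof (intro conjI allI impI)
 show "periodic_fun n (%x. c * f x + g x)" using f g by (simp add: H1full_def periodic_fun_def)
 show "L2loc n (%x. c * f x + g x)" using f g by (auto simp: H1full_def intro!: L2loc_add L2loc_cmult)
 fix i assume i: "i < n"
 show "L2loc n (%x. c * G i x + H i x)" using f g i by (auto simp: H1full_def intro!: L2loc_add L2loc_cmult)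
 show "weak_pderiv n i (%x. c * f x + g x) (%x. c * G i x + H i x)"
  unfolding weak_pderiv_def
 proof (intro allI impI)
  fix \<Phi> assume t: "test_fun n \<Phi>"
  obtain B R where tb: "!!x. x \<in> Rspace n ==> \<bar>\<Phi> x\<bar> <= B" "!!x i. i < n ==> x \<in> Rspace n ==> \<bar>pdir i \<Phi> x\<bar> <= B"
   "!!x. x \<in> Rspace n ==> \<exists>i<n. R < \<bar>x i\<bar> ==> \<Phi> x = 0"
   "!!x i. i < n ==> x \<in> Rspace n ==> \<exists>i<n. R < \<bar>x i\<bar> ==> pdir i \<Phi> x = 0"
   "\<Phi> \<in> borel_measurable (Rn n)" "!!i. i < n ==> pdir i \<Phi> \<in> borel_measurable (Rn n)"
   by (rule test_fun_bounds[OF t], rule that)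
  have L: "L2loc n f" "L2loc n g" "L2loc n (G i)" "L2loc n (H i)" using f g i by (auto simp: H1full_def)
  note I1 = L2loc_integrable[OF L(1) tb(6)[OF i] tb(2)[OF i] tb(4)[OF i]]
  note I2 = L2loc_integrable[OF L(2) tb(6)[OF i] tb(2)[OF i] tb(4)[OF i]]
  note I3 = L2loc_integrable[OF L(3) tb(5) tb(1) tb(3)]
  note I4 = L2loc_integrable[OF L(4) tb(5) tb(1) tb(3)]
  have w: "integral\<^sup>L (Rn n) (%x. f x * complex_of_real (pdir i \<Phi> x)) = - integral\<^sup>L (Rn n) (%x. G i x * complex_of_real (\<Phi> x))"
   "integral\<^sup>L (Rn n) (%x. g x * complex_of_real (pdir i \<Phi> x)) = - integral\<^sup>L (Rn n) (%x. H i x * complex_of_real (\<Phi> x))"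
   using f g i t by (auto simp: H1full_def weak_pderiv_def)
  have "integral\<^sup>L (Rn n) (%x. (c * f x + g x) * complex_of_real (pdir i \<Phi> x))
   = integral\<^sup>L (Rn n) (%x. c * (f x * complex_of_real (pdir i \<Phi> x)) + g x * complex_of_real (pdir i \<Phi> x))"
   by (simp add: algebra_simps)
  also have "\<dots> = c * integral\<^sup>L (Rn n) (%x. f x * complex_of_real (pdir i \<Phi> x)) + integral\<^sup>L (Rn n) (%x. g x * complex_of_real (pdir i \<Phi> x))"
   by (subst Bochner_Integration.integral_add) (use I1 I2 in auto)
  also have "\<dots> = - (c * integral\<^sup>L (Rn n) (%x. G i x * complex_of_real (\<Phi> x)) + integral\<^sup>L (Rn n) (%x. H i x * complex_of_real (\<Phi> x)))"
   unfolding w by simp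
  also have "c * integral\<^sup>L (Rn n) (%x. G i x * complex_of_real (\<Phi> x)) + integral\<^sup>L (Rn n) (%x. H i x * complex_of_real (\<Phi> x))
    = integral\<^sup>L (Rn n) (%x. c * (G i x * complex_of_real (\<Phi> x)) + H i x * complex_of_real (\<Phi> x))"
   by (subst Bochner_Integration.integral_add) (use I3 I4 in auto)
  finally show "integral\<^sup>L (Rn n) (%x. (c * f x + g x) * complex_of_real (pdir i \<Phi> x)) = - integral\<^sup>L (Rn n) (%x. (c * G i x + H i x) * complex_of_real (\<Phi> x))"
   by (simp add: algebra_simps)
 qed
qed

lemma H1full_zero: "H1full n (%_. 0) (%_ _. 0)"
 by (auto simp: H1full_def periodic_fun_def L2loc_def weak_pderiv_def)

lemma H1full_sum:
 assumes "finite S" "!!s. s \<in> S ==> H1full n (f s) (G s)"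
 shows "H1full n (%x. \<Sum>s\<in>S. c s * f s x) (%i x. \<Sum>s\<in>S. c s * G s i x)"
 using assms
proof (induction S)
 case empty thus ?case by (simp add: H1full_zero)
next
 case (insert s S)
 have "H1full n (%x. c s * f s x + (\<Sum>s\<in>S. c s * f s x)) (%i x. c s * G s i x + (\<Sum>s\<in>S. c s * G s i x))"
  using insert by (intro H1full_add_cmult) auto
 thus ?case using insert by simp
qed

section \<open>Slater determinants: regularity, norm, density, orthogonality\<close>

abbreviation perms :: "nat => (nat => nat) set" where "perms n \<equiv> {\<sigma>. \<sigma> permutes {..<n}}"

definition slater :: "nat => (nat => real => complex) => (nat => real) => complex" where
 "slater n u x = (\<Sum>\<sigma>\<in>perms n. (of_int (sign \<sigma>) / complex_of_real (sqrt (fact n))) * (\<Prod>k<n. u k (x (\<sigma> k))))"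

lemma finite_perms: "finite (perms n)" by (simp add: finite_permutations)

lemma card_perms: "card (perms n) = fact n" by (rule card_permutations) auto

lemma perm_lt: "\<sigma> permutes {..<n} ==> \<sigma> i < n \<longleftrightarrow> i < n"
 using permutes_in_image[of \<sigma> "{..<n}" i] by simp

lemma prod_perm_eq:
 assumes "\<sigma> permutes {..<n}"
 shows "(\<Prod>k<n. g k (x (\<sigma> k))) = (\<Prod>i<n. g (inv \<sigma> i) (x i))"
 using prod.permute[OF permutes_inv[OF assms], of "%k. g k (x (\<sigma> k))"]
 by (simp add: o_def permutes_inverses(1)[OF assms])

text \<open>Reordering each product by the inverse permutation displays it as a
  \<open>prodf\<close>, so that the Sobolev and product integral lemmas apply term by term.\<close>

lemma slater_eq_sum_prodf:
 "slater n u = (%x. \<Sum>\<sigma>\<in>perms n. (of_int (sign \<sigma>) / complex_of_real (sqrt (fact n))) * prodf n (%i. u (inv \<sigma> i)) x)"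
 unfolding slater_def prodf_def by (intro ext sum.cong refl) (auto simp: prod_perm_eq)

lemma slater_H1full:
 assumes "!!k. k < n ==> orb (u k) (v k)"
 shows "\<exists>G. H1full n (slater n u) G"
proof -
 have H: "H1full n (prodf n (%i. u (inv \<sigma> i))) (%i. prodf n ((%i. u (inv \<sigma> i))(i := v (inv \<sigma> i))))" if "\<sigma> \<in> perms n" for \<sigma>
  using that assms perm_lt[OF permutes_inv] by (intro H1full_prodf) auto
 show ?thesis unfolding slater_eq_sum_prodf by (rule exI, rule H1full_sum[OF finite_perms], rule H)
qed

lemma slater_antisym:
 assumes t: "\<tau> permutes {..<n}"
 shows "slater n u (x \<circ> \<tau>) = of_int (sign \<tau>) * slater n u x"
proof -
 let ?c = "complex_of_real (sqrt (fact n))"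
 have s: "sign \<tau> * sign \<tau> = 1" "of_int (sign \<tau>) * of_int (sign \<tau>) = (1::complex)" by (auto simp: sign_def)
 have "slater n u x = (\<Sum>\<sigma>\<in>perms n. (of_int (sign (\<tau> \<circ> \<sigma>)) / ?c) * (\<Prod>k<n. u k (x ((\<tau> \<circ> \<sigma>) k))))"
  unfolding slater_def by (rule setum_permutations_compose_left[OF t])
 hence "of_int (sign \<tau>) * slater n u x
   = of_int (sign \<tau>) * (\<Sum>\<sigma>\<in>perms n. (of_int (sign (\<tau> \<circ> \<sigma>)) / ?c) * (\<Prod>k<n. u k (x ((\<tau> \<circ> \<sigma>) k))))"
  by (rule arg_cong)
 also have "\<dots> = (\<Sum>\<sigma>\<in>perms n. (of_int (sign \<tau> * sign \<tau> * sign \<sigma>) / ?c) * (\<Prod>k<n. u k (x ((\<tau> \<circ> \<sigma>) k))))"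
  unfolding sum_distrib_left
 proof (rule sum.cong[OF refl])
  fix \<sigma> assume "\<sigma> \<in> perms n"
  hence "sign (\<tau> \<circ> \<sigma>) = sign \<tau> * sign \<sigma>"
   using t by (intro sign_compose) (auto simp: permutation_permutes)
  thus "of_int (sign \<tau>) * ((of_int (sign (\<tau> \<circ> \<sigma>)) / ?c) * (\<Prod>k<n. u k (x ((\<tau> \<circ> \<sigma>) k))))
   = (of_int (sign \<tau> * sign \<tau> * sign \<sigma>) / ?c) * (\<Prod>k<n. u k (x ((\<tau> \<circ> \<sigma>) k)))" by (simp add: s)
 qed
 finally show ?thesis unfolding s(1) by (simp add: slater_def)
qed

lemma slater_nonzero:
 assumes "slater n u x \<noteq> 0"
 obtains \<sigma> where "\<sigma> permutes {..<n}" "!!k. k < n ==> u k (x (\<sigma> k)) \<noteq> 0"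
proof -
 have "\<exists>\<sigma>\<in>perms n. (\<Prod>k<n. u k (x (\<sigma> k))) \<noteq> 0"
 proof (rule ccontr)
  assume "\<not> ?thesis"
  hence "slater n u x = 0" unfolding slater_def by (intro sum.neutral) auto
  thus False using assms by simp
 qed
 then obtain \<sigma> where "\<sigma> \<in> perms n" "(\<Prod>k<n. u k (x (\<sigma> k))) \<noteq> 0" by blast
 thus thesis by (intro that[of \<sigma>]) auto
qed

lemma norm_sum_sq_disjoint:
 fixes z :: "'a => complex"
 assumes "finite S" "!!a b. a \<in> S ==> b \<in> S ==> a \<noteq> b ==> z a = 0 \<or> z b = 0"
 shows "(cmod (\<Sum>a\<in>S. z a))\<^sup>2 = (\<Sum>a\<in>S. (cmod (z a))\<^sup>2)"
 using assms
proof (induction S)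
 case (insert a S)
 show ?case
 proof (cases "z a = 0")
  case True thus ?thesis using insert by simp
 next
  case False
  hence "z b = 0" if "b \<in> S" for b using insert.prems[of a b] insert.hyps that by auto
  thus ?thesis using insert.hyps by simp
 qed
qed simp

text \<open>Normalized orbitals with pairwise disjoint supports: the \<open>n!\<close> terms of the determinant are then disjointly supported too.\<close>
definition slater_ok :: "nat => (nat => real => complex) => bool" where
 "slater_ok n u \<longleftrightarrow> (\<forall>k<n. \<exists>v. orb (u k) v) \<and>
   (\<forall>k<n. (\<integral>\<^sup>+ t. ennreal ((cmod (u k t))\<^sup>2) \<partial>mI) = 1) \<and>
   (\<forall>k<n. \<forall>l<n. k \<noteq> l --> (\<forall>t\<in>Iper. u k t = 0 \<or> u l t = 0))"

lemma slater_ok_meas: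
 assumes "slater_ok n u" "k < n" shows "u k \<in> borel_measurable borel" "u k \<in> borel_measurable mI"
proof -
 show "u k \<in> borel_measurable borel" using assms by (auto simp: slater_ok_def orb_def L2l_def)
 from measurable_compose[OF measurable_mI_borel this] show "u k \<in> borel_measurable mI" .
qed

text \<open>Each index is the value at 0 of (n-1)! permutations; multiplication by \<open>n\<close>
  keeps the identity free of that factorial. The proof averages over the position \<open>m\<close>
  instead of counting.\<close>

lemma sum_perms_eval:
 fixes h :: "nat => 'a::comm_semiring_1"
 assumes "1 <= n"
 shows "of_nat n * (\<Sum>\<sigma>\<in>perms n. h (inv \<sigma> 0)) = of_nat (fact n) * (\<Sum>k<n. h k)"
proof -
 have 0: "(\<Sum>\<sigma>\<in>perms n. h (\<sigma> m)) = (\<Sum>\<sigma>\<in>perms n. h (\<sigma> 0))" if "m < n" for m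
 proof -
  have "Transposition.transpose 0 m permutes {..<n}" using that assms by (intro permutes_swap_id) auto
  from sum_permutations_compose_right[OF this, of "%\<sigma>. h (\<sigma> m)"] show ?thesis by simp
 qed
 have "of_nat n * (\<Sum>\<sigma>\<in>perms n. h (inv \<sigma> 0)) = of_nat n * (\<Sum>\<sigma>\<in>perms n. h (\<sigma> 0))"
  by (simp only: sum_permutations_inverse[of "%\<sigma>. h (\<sigma> 0)", symmetric])
 also have "\<dots> = (\<Sum>m<n. \<Sum>\<sigma>\<in>perms n. h (\<sigma> 0))" by simp
 also have "\<dots> = (\<Sum>m<n. \<Sum>\<sigma>\<in>perms n. h (\<sigma> m))" by (intro sum.cong[OF refl] 0[symmetric]) auto
 also have "\<dots> = (\<Sum>\<sigma>\<in>perms n. \<Sum>m<n. h (\<sigma> m))" by (rule sum.swap)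
 also have "\<dots> = (\<Sum>\<sigma>\<in>perms n. \<Sum>m<n. h m)"
 proof (rule sum.cong[OF refl])
  fix \<sigma> assume "\<sigma> \<in> perms n"
  thus "(\<Sum>m<n. h (\<sigma> m)) = (\<Sum>m<n. h m)" using sum.permute[of \<sigma> "{..<n}" h] by (simp add: o_def)
 qed
 also have "\<dots> = of_nat (fact n) * (\<Sum>k<n. h k)" by (simp add: card_perms)
 finally show ?thesis .
qed

context
 fixes n :: nat and u :: "nat => real => complex"
 assumes ok: "slater_ok n u"
begin

lemma slater_meas: "slater n u \<in> borel_measurable (Mn n)"
proof -
 have "slater n u \<in> borel_measurable (Rn n)"
  unfolding slater_eq_sum_prodf
  by (intro borel_measurable_sum borel_measurable_times borel_measurable_const measurable_prodf slater_ok_meas[OF ok])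
    (auto simp: perm_lt permutes_inv)
 from measurable_compose[OF measurable_Mn_Rn this] show ?thesis .
qed

text \<open>No cross terms survive, so the squared determinant is an average of products of
  one-particle densities, and its integrals factor.\<close>

lemma slater_norm_sq:
 assumes x: "x \<in> In n"
 shows "ennreal ((cmod (slater n u x))\<^sup>2) = ennreal (1 / fact n) * (\<Sum>\<sigma>\<in>perms n. \<Prod>i<n. ennreal ((cmod (u (inv \<sigma> i) (x i)))\<^sup>2))"
proof -
 define z where "z \<sigma> = (of_int (sign \<sigma>) / complex_of_real (sqrt (fact n))) * (\<Prod>k<n. u k (x (\<sigma> k)))" for \<sigma>
 have "(cmod (\<Sum>\<sigma>\<in>perms n. z \<sigma>))\<^sup>2 = (\<Sum>\<sigma>\<in>perms n. (cmod (z \<sigma>))\<^sup>2)"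
 proof (rule norm_sum_sq_disjoint[OF finite_perms])
  fix \<sigma> \<tau> assume st: "\<sigma> \<in> perms n" "\<tau> \<in> perms n" "\<sigma> \<noteq> \<tau>"
  show "z \<sigma> = 0 \<or> z \<tau> = 0"
  proof (rule ccontr)
   assume "\<not> (z \<sigma> = 0 \<or> z \<tau> = 0)"
   hence nz: "!!k. k < n ==> u k (x (\<sigma> k)) \<noteq> 0" "!!k. k < n ==> u k (x (\<tau> k)) \<noteq> 0"
    by (auto simp: z_def)
   obtain k where k: "\<sigma> k \<noteq> \<tau> k" using st(3) by blast
   have kn: "k < n"
   proof (rule ccontr)
    assume "\<not> k < n"
    thus False using k st by (simp add: permutes_not_in)
   qed
   \<comment> \<open>\<open>l\<close> is the orbital that \<tau> gives to the particle carrying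
     orbital \<open>k\<close> under \<sigma>. Two different orbitals would then be nonzero at one
     position.\<close>
   define l where "l = inv \<tau> (\<sigma> k)"
   have tl: "\<tau> l = \<sigma> k" unfolding l_def using st by (simp add: permutes_inverses)
   have ln: "l < n" using perm_lt[of \<tau> n l] perm_lt[of \<sigma> n k] st kn tl by simp
   have "l \<noteq> k" using tl k by auto
   moreover have "x (\<sigma> k) \<in> Iper" using perm_lt[of \<sigma> n k] st kn In_coord[OF x] by simp
   ultimately have "u k (x (\<sigma> k)) = 0 \<or> u l (x (\<sigma> k)) = 0" using ok[unfolded slater_ok_def, THEN conjunct2, THEN conjunct2, rule_format, OF kn ln] by auto
   thus False using nz(1)[OF kn] nz(2)[OF ln] tl by simp
  qed
 qed
 also have "\<dots> = (\<Sum>\<sigma>\<in>perms n. (1 / fact n) * (\<Prod>i<n. (cmod (u (inv \<sigma> i) (x i)))\<^sup>2))"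
 proof (rule sum.cong[OF refl])
  fix \<sigma> assume s: "\<sigma> \<in> perms n"
  have "(cmod (z \<sigma>))\<^sup>2 = (1 / fact n) * (\<Prod>k<n. (cmod (u k (x (\<sigma> k))))\<^sup>2)"
   unfolding z_def by (simp add: norm_mult norm_divide power_mult_distrib power_divide sign_def prod_norm[symmetric] prod_power_distrib)
  thus "(cmod (z \<sigma>))\<^sup>2 = (1 / fact n) * (\<Prod>i<n. (cmod (u (inv \<sigma> i) (x i)))\<^sup>2)"
   using prod_perm_eq[of \<sigma> n "%k y. (cmod (u k y))\<^sup>2" x] s by simp
 qed
 finally have "(cmod (slater n u x))\<^sup>2 = (1 / fact n) * (\<Sum>\<sigma>\<in>perms n. \<Prod>i<n. (cmod (u (inv \<sigma> i) (x i)))\<^sup>2)"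
  unfolding slater_def z_def sum_distrib_left .
 hence "ennreal ((cmod (slater n u x))\<^sup>2) = ennreal ((1 / fact n) * (\<Sum>\<sigma>\<in>perms n. \<Prod>i<n. (cmod (u (inv \<sigma> i) (x i)))\<^sup>2))"
  by (simp only:)
 also have "\<dots> = ennreal (1 / fact n) * ennreal (\<Sum>\<sigma>\<in>perms n. \<Prod>i<n. (cmod (u (inv \<sigma> i) (x i)))\<^sup>2)"
  by (intro ennreal_mult sum_nonneg prod_nonneg) auto
 also have "ennreal (\<Sum>\<sigma>\<in>perms n. \<Prod>i<n. (cmod (u (inv \<sigma> i) (x i)))\<^sup>2) = (\<Sum>\<sigma>\<in>perms n. ennreal (\<Prod>i<n. (cmod (u (inv \<sigma> i) (x i)))\<^sup>2))"
  by (rule sum_ennreal[symmetric]) (auto intro: prod_nonneg)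
 also have "\<dots> = (\<Sum>\<sigma>\<in>perms n. \<Prod>i<n. ennreal ((cmod (u (inv \<sigma> i) (x i)))\<^sup>2))"
  by (intro sum.cong refl prod_ennreal[symmetric]) auto
 finally show ?thesis .
qed

lemma slater_norm: "(\<integral>\<^sup>+ x. ennreal ((cmod (slater n u x))\<^sup>2) \<partial>Mn n) = 1"
proof -
 note m = slater_ok_meas(2)[OF ok]
 have meas: "(%t. ennreal ((cmod (u k t))\<^sup>2)) \<in> borel_measurable mI" if "k < n" for k
 proof -
  have [measurable]: "u k \<in> borel_measurable mI" by (rule m[OF that])
  show ?thesis by measurable
 qed
 have one: "(\<integral>\<^sup>+ x. (\<Prod>i<n. ennreal ((cmod (u (inv \<sigma> i) (x i)))\<^sup>2)) \<partial>Mn n) = 1" if "\<sigma> \<in> perms n" for \<sigma>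
 proof -
  have "(\<integral>\<^sup>+ x. (\<Prod>i<n. ennreal ((cmod (u (inv \<sigma> i) (x i)))\<^sup>2)) \<partial>Mn n) = (\<Prod>i<n. \<integral>\<^sup>+ t. ennreal ((cmod (u (inv \<sigma> i) t))\<^sup>2) \<partial>mI)"
   unfolding Mn_def using that by (intro PM.product_nn_integral_prod meas) (auto simp: perm_lt permutes_inv)
  also have "\<dots> = 1" using that ok by (intro prod.neutral) (auto simp: slater_ok_def perm_lt permutes_inv)
  finally show ?thesis .
 qed
 have pm: "(%x. \<Prod>i<n. ennreal ((cmod (u (inv \<sigma> i) (x i)))\<^sup>2)) \<in> borel_measurable (Mn n)" if "\<sigma> \<in> perms n" for \<sigma>
  using that by (intro borel_measurable_prod_ennreal measurable_compose[OF measurable_coord_mI meas]) (auto simp: perm_lt permutes_inv)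
 have "(\<integral>\<^sup>+ x. ennreal ((cmod (slater n u x))\<^sup>2) \<partial>Mn n)
   = (\<integral>\<^sup>+ x. ennreal (1 / fact n) * (\<Sum>\<sigma>\<in>perms n. \<Prod>i<n. ennreal ((cmod (u (inv \<sigma> i) (x i)))\<^sup>2)) \<partial>Mn n)"
  by (intro nn_integral_cong slater_norm_sq) simp
 also have "\<dots> = ennreal (1 / fact n) * (\<Sum>\<sigma>\<in>perms n. \<integral>\<^sup>+ x. (\<Prod>i<n. ennreal ((cmod (u (inv \<sigma> i) (x i)))\<^sup>2)) \<partial>Mn n)"
  by (subst nn_integral_cmult[OF borel_measurable_sum[OF pm]], assumption) (subst nn_integral_sum[OF pm], auto)
 also have "\<dots> = ennreal (1 / fact n) * of_nat (fact n)" using one by (simp add: card_perms)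
 also have "\<dots> = ennreal (1 / fact n * fact n)"
  by (subst ennreal_mult) (auto simp: ennreal_of_nat_eq_real_of_nat)
 also have "\<dots> = 1" by simp
 finally show ?thesis .
qed

lemma slater_in_Hn: "in_Hn n (slater n u)"
 using slater_meas slater_norm by (auto simp: in_Hn_def antisym_fun_def slater_antisym)

lemma slater_H1per_grad: "\<exists>G. H1full n (slater n u) G"
proof -
 have "\<forall>k. \<exists>v. k < n --> orb (u k) v" using ok by (auto simp: slater_ok_def)
 from choice[OF this] obtain v where "!!k. k < n ==> orb (u k) (v k)" by blast
 thus ?thesis by (rule slater_H1full)
qed

text \<open>Integrating out all other coordinates leaves the density of the orbital sitting in
  position 0, and \<open>sum_perms_eval\<close> averages it over all orbitals.\<close>

lemma rhoPsi_slater: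
 assumes n: "1 <= n" and t: "t \<in> Iper"
 shows "rhoPsi n (slater n u) t = (\<Sum>k<n. ennreal ((cmod (u k t))\<^sup>2))"
proof -
 have meas: "(%t. ennreal ((cmod (u k t))\<^sup>2)) \<in> borel_measurable mI" if "k < n" for k
 proof -
  have [measurable]: "u k \<in> borel_measurable mI" by (rule slater_ok_meas(2)[OF ok that])
  show ?thesis by measurable
 qed
 let ?P = "PiM {1..<n} (%_. mI)"
 have ins: "{..<n} = insert 0 {1..<n}" using n by auto
 have inv_lt: "inv \<sigma> i < n" if "\<sigma> \<in> perms n" "i < n" for \<sigma> i using that perm_lt[OF permutes_inv, of \<sigma> n i] by simp
 define g :: "(nat => nat) => nat => real => ennreal" where "g \<sigma> i = (%s. ennreal ((cmod (u (inv \<sigma> i) s))\<^sup>2))" for \<sigma> i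
 have gm: "g \<sigma> i \<in> borel_measurable mI" if "\<sigma> \<in> perms n" "i < n" for \<sigma> i unfolding g_def by (rule meas[OF inv_lt[OF that]])
 have g1: "integral\<^sup>N mI (g \<sigma> i) = 1" if "\<sigma> \<in> perms n" "i < n" for \<sigma> i
  unfolding g_def using ok inv_lt[OF that] by (simp add: slater_ok_def)
 have pm: "(%y. \<Prod>i\<in>{1..<n}. g \<sigma> i (y i)) \<in> borel_measurable ?P" if "\<sigma> \<in> perms n" for \<sigma>
  using that by (intro borel_measurable_prod_ennreal measurable_compose[OF measurable_component_singleton[of _ "{1..<n}" "%_. mI"]] gm) auto
 have pi: "(\<integral>\<^sup>+ y. (\<Prod>i\<in>{1..<n}. g \<sigma> i (y i)) \<partial>?P) = 1" if "\<sigma> \<in> perms n" for \<sigma>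
 proof -
  have "(\<integral>\<^sup>+ y. (\<Prod>i\<in>{1..<n}. g \<sigma> i (y i)) \<partial>?P) = (\<Prod>i\<in>{1..<n}. integral\<^sup>N mI (g \<sigma> i))"
   using that by (intro PM.product_nn_integral_prod gm) auto
  also have "\<dots> = 1" using that by (intro prod.neutral) (auto simp: g1)
  finally show ?thesis .
 qed
 have "(\<integral>\<^sup>+ y. ennreal ((cmod (slater n u (y(0 := t))))\<^sup>2) \<partial>?P)
   = (\<integral>\<^sup>+ y. ennreal (1 / fact n) * (\<Sum>\<sigma>\<in>perms n. g \<sigma> 0 t * (\<Prod>i\<in>{1..<n}. g \<sigma> i (y i))) \<partial>?P)"
 proof (rule nn_integral_cong)
  fix y assume y: "y \<in> space ?P"
  have yI: "y(0 := t) \<in> In n" using y t n by (auto simp: space_PiM In_def PiE_def Pi_def extensional_def)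
  have "(\<Prod>i<n. ennreal ((cmod (u (inv \<sigma> i) ((y(0 := t)) i)))\<^sup>2)) = g \<sigma> 0 t * (\<Prod>i\<in>{1..<n}. g \<sigma> i (y i))" for \<sigma>
   unfolding ins g_def by (subst prod.insert) (auto intro!: arg_cong2[where f="(*)"] prod.cong)
  thus "ennreal ((cmod (slater n u (y(0 := t))))\<^sup>2) = ennreal (1 / fact n) * (\<Sum>\<sigma>\<in>perms n. g \<sigma> 0 t * (\<Prod>i\<in>{1..<n}. g \<sigma> i (y i)))"
   unfolding slater_norm_sq[OF yI] by simp
 qed
 also have "\<dots> = ennreal (1 / fact n) * (\<Sum>\<sigma>\<in>perms n. g \<sigma> 0 t * (\<integral>\<^sup>+ y. (\<Prod>i\<in>{1..<n}. g \<sigma> i (y i)) \<partial>?P))"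
 proof -
  have pm': "(%y. g \<sigma> 0 t * (\<Prod>i\<in>{1..<n}. g \<sigma> i (y i))) \<in> borel_measurable ?P" if "\<sigma> \<in> perms n" for \<sigma>
   by (intro borel_measurable_times_ennreal pm that borel_measurable_const)
  show ?thesis
   by (subst nn_integral_cmult[OF borel_measurable_sum[OF pm']], assumption)
     (subst nn_integral_sum[OF pm'], assumption,
      intro arg_cong2[where f="(*)"] refl sum.cong nn_integral_cmult pm)
 qed
 also have "\<dots> = ennreal (1 / fact n) * (\<Sum>\<sigma>\<in>perms n. g \<sigma> 0 t)" using pi by simp
 finally have "rhoPsi n (slater n u) t = ennreal (1 / fact n) * (of_nat n * (\<Sum>\<sigma>\<in>perms n. ennreal ((cmod (u (inv \<sigma> 0) t))\<^sup>2)))"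
  by (simp add: rhoPsi_def g_def mult.left_commute)
 also have "\<dots> = ennreal (1 / fact n) * (of_nat (fact n) * (\<Sum>k<n. ennreal ((cmod (u k t))\<^sup>2)))"
  using sum_perms_eval[OF n, of "%k. ennreal ((cmod (u k t))\<^sup>2)"] by (simp only:)
 also have "\<dots> = (ennreal (1 / fact n) * of_nat (fact n)) * (\<Sum>k<n. ennreal ((cmod (u k t))\<^sup>2))" by (simp only: mult.assoc)
 also have "ennreal (1 / fact n) * of_nat (fact n) = ennreal (1 / fact n * fact n)"
  by (subst ennreal_mult) (auto simp: ennreal_of_nat_eq_real_of_nat)
 finally show ?thesis by simp
qed

end

lemma integrable_L2_product:
 fixes f g :: "'a => complex"
 assumes [measurable]: "f \<in> borel_measurable M" "g \<in> borel_measurable M"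
  and "(\<integral>\<^sup>+ t. ennreal ((cmod (f t))\<^sup>2) \<partial>M) < \<infinity>" "(\<integral>\<^sup>+ t. ennreal ((cmod (g t))\<^sup>2) \<partial>M) < \<infinity>"
 shows "integrable M (%t. f t * cnj (g t))"
proof (rule integrableI_bounded)
 have [measurable]: "(%t. cnj (g t)) \<in> borel_measurable M"
  by (rule borel_measurable_continuous_on[OF _ assms(2)]) (intro continuous_intros)
 show "(%t. f t * cnj (g t)) \<in> borel_measurable M" by measurable
 have "(\<integral>\<^sup>+ t. ennreal (norm (f t * cnj (g t))) \<partial>M) <= (\<integral>\<^sup>+ t. ennreal ((cmod (f t))\<^sup>2) + ennreal ((cmod (g t))\<^sup>2) \<partial>M)"
 proof (rule nn_integral_mono)
  fix t
  have "cmod (f t) * cmod (g t) <= (cmod (f t))\<^sup>2 + (cmod (g t))\<^sup>2"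
   using sum_squares_bound[of "cmod (f t)" "cmod (g t)"] mult_nonneg_nonneg[OF norm_ge_zero[of "f t"] norm_ge_zero[of "g t"]] by linarith
  thus "ennreal (norm (f t * cnj (g t))) <= ennreal ((cmod (f t))\<^sup>2) + ennreal ((cmod (g t))\<^sup>2)"
   by (simp add: norm_mult flip: ennreal_plus)
 qed
 also have "\<dots> < \<infinity>" using assms by (subst nn_integral_add) auto
 finally show "(\<integral>\<^sup>+ t. ennreal (norm (f t * cnj (g t))) \<partial>M) < \<infinity>" .
qed

text \<open>After expanding both determinants each term is a product of one-particle overlaps, and
  in every one of them \<open>u k0\<close> is paired with some orbital of \<open>v\<close>, which
  gives a zero factor.\<close>

lemma slater_orthogonal:
 assumes u: "slater_ok n u" and v: "slater_ok n v" and k0: "k0 < n"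
  and orth: "!!l. l < n ==> (\<integral>t. u k0 t * cnj (v l t) \<partial>mI) = 0"
 shows "integral\<^sup>L (Mn n) (%x. slater n u x * cnj (slater n v x)) = 0"
proof -
 let ?c = "complex_of_real (sqrt (fact n))"
 define T where "T \<sigma> \<tau> x = (\<Prod>i<n. u (inv \<sigma> i) (x i) * cnj (v (inv \<tau> i) (x i)))" for \<sigma> \<tau> x
 have inv_lt: "inv \<sigma> i < n" if "\<sigma> \<in> perms n" "i < n" for \<sigma> i using that perm_lt[OF permutes_inv, of \<sigma> n i] by simp
 have int: "integrable mI (%t. u k t * cnj (v l t))" if "k < n" "l < n" for k l
  using that u v by (intro integrable_L2_product slater_ok_meas) (auto simp: slater_ok_def)
 have Ti: "integrable (Mn n) (T \<sigma> \<tau>)" if "\<sigma> \<in> perms n" "\<tau> \<in> perms n" for \<sigma> \<tau>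
  unfolding T_def[abs_def] Mn_def by (intro PM.product_integrable_prod int inv_lt that) auto
 have T0: "integral\<^sup>L (Mn n) (T \<sigma> \<tau>) = 0" if st: "\<sigma> \<in> perms n" "\<tau> \<in> perms n" for \<sigma> \<tau>
 proof -
  have "integral\<^sup>L (Mn n) (T \<sigma> \<tau>) = (\<Prod>i<n. \<integral>t. u (inv \<sigma> i) t * cnj (v (inv \<tau> i) t) \<partial>mI)"
   unfolding T_def[abs_def] Mn_def by (intro PM.product_integral_prod int inv_lt st) auto
  also have "\<dots> = 0"
  proof (rule prod_zero)
   have "\<sigma> k0 < n" "inv \<sigma> (\<sigma> k0) = k0" using st k0 by (auto simp: perm_lt permutes_inverses)
   thus "\<exists>i\<in>{..<n}. (\<integral>t. u (inv \<sigma> i) t * cnj (v (inv \<tau> i) t) \<partial>mI) = 0"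
    using orth[OF inv_lt[OF st(2)]] by (intro bexI[of _ "\<sigma> k0"]) auto
  qed simp
  finally show ?thesis .
 qed
 define c where "c \<sigma> \<tau> = of_int (sign \<sigma>) / ?c * cnj (of_int (sign \<tau>) / ?c)" for \<sigma> \<tau> :: "nat => nat"
 have "slater n u x * cnj (slater n v x) = (\<Sum>\<sigma>\<in>perms n. \<Sum>\<tau>\<in>perms n. c \<sigma> \<tau> * T \<sigma> \<tau> x)" for x
  unfolding slater_eq_sum_prodf prodf_def cnj_sum sum_product T_def prod.distrib c_def complex_cnj_mult cnj_prod
  by (intro sum.cong refl) (simp only: mult_ac)
 hence "integral\<^sup>L (Mn n) (%x. slater n u x * cnj (slater n v x))
   = integral\<^sup>L (Mn n) (%x. \<Sum>\<sigma>\<in>perms n. \<Sum>\<tau>\<in>perms n. c \<sigma> \<tau> * T \<sigma> \<tau> x)"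
  by simp
 also have "\<dots> = (\<Sum>\<sigma>\<in>perms n. integral\<^sup>L (Mn n) (%x. \<Sum>\<tau>\<in>perms n. c \<sigma> \<tau> * T \<sigma> \<tau> x))"
  by (intro Bochner_Integration.integral_sum Bochner_Integration.integrable_sum integrable_mult_right Ti)
 also have "\<dots> = (\<Sum>\<sigma>\<in>perms n. \<Sum>\<tau>\<in>perms n. integral\<^sup>L (Mn n) (%x. c \<sigma> \<tau> * T \<sigma> \<tau> x))"
  by (intro sum.cong refl Bochner_Integration.integral_sum integrable_mult_right Ti)
 also have "\<dots> = (\<Sum>\<sigma>\<in>perms n. \<Sum>\<tau>\<in>perms n. c \<sigma> \<tau> * integral\<^sup>L (Mn n) (T \<sigma> \<tau>))"
  by simp
 also have "\<dots> = 0" using T0 by (intro sum.neutral) auto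
 finally show ?thesis .
qed

section \<open>Discretizing a transport plan\<close>

lemma sum_PiE_prod:
 fixes f :: "nat => 'a => real"
 assumes "finite V"
 shows "(\<Sum>K\<in>PiE {..<n} (%_. V). \<Prod>i<n. f i (K i)) = (\<Prod>i<n. \<Sum>L\<in>V. f i L)"
 using prod_sum_PiE[of "{..<n}" "%_. V" f] assms by simp

text \<open>Each bad tuple \<open>J\<close> is traded together with \<open>n\<close> good partners
  \<open>K 0, ..., K (n-1)\<close>. They are replaced by the diagonal tuple with entries
  \<open>K i i\<close> and by the \<open>n\<close> tuples obtained from \<open>K i\<close> on
  writing \<open>J i\<close> in place \<open>i\<close>. In every position the multiset of entries is
  unchanged, so the marginals survive, and if the entries that meet are far apart all new tuples are
  separated. The partners are drawn independently from \<open>p\<close>, conditioned on this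
  event.\<close>

lemma discrete_swap:
 fixes n N :: nat and p :: "(nat => nat) => real" and R :: "nat => nat => bool" and m :: "nat => real"
 defines "V \<equiv> PiE {..<n} (%_. {..<N})"
 defines "sep \<equiv> %J. \<forall>k<n. \<forall>l<n. k \<noteq> l --> R (J k) (J l)"
 assumes p0: "!!J. J \<in> V ==> 0 <= p J" and p1: "sum p V = 1"
  and marg: "!!i j. i < n ==> j < N ==> (\<Sum>J\<in>V. p J * of_bool (J i = j)) = m j"
  and Rsym: "!!i j. R i j = R j i"
  and close: "!!j. j < N ==> (\<Sum>l<N. m l * of_bool (\<not> R j l)) <= \<kappa>"
  and psep: "(\<Sum>J\<in>V. p J * of_bool (\<not> sep J)) <= \<kappa>"
  and B: "B \<subseteq> V" "(\<Sum>J\<in>B. p J) = b" "b <= \<kappa>"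
  and small: "(2 * (real n)\<^sup>2 + 2 * real n) * \<kappa> <= 1/2"
 obtains q1 q2 where "!!J. J \<in> V ==> 0 <= q1 J \<and> q1 J <= p J" "!!J. J \<in> B ==> q1 J = 0"
  "!!J. J \<in> V ==> 0 <= q2 J" "!!J. J \<in> V ==> q2 J \<noteq> 0 ==> sep J"
  "sum q2 V = (real n + 1) * b"
  "!!i j. i < n ==> j < N ==> (\<Sum>J\<in>V. (q1 J + q2 J) * of_bool (J i = j)) = m j"
proof -
 have fV: "finite V" by (simp add: V_def finite_PiE)
 define W where "W = PiE {..<n} (%_. V)"
 have fW: "finite W" using fV by (simp add: W_def finite_PiE)
 have WV: "K i \<in> V" if "K \<in> W" "i < n" for K i using that by (auto simp: W_def)
 have VN: "J i < N" if "J \<in> V" "i < n" for J i using that by (auto simp: V_def)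
 \<comment> \<open>The law of \<open>n\<close> independent partners.\<close>
 define q where "q K = (\<Prod>i<n. p (K i))" for K
 have q0: "0 <= q K" if "K \<in> W" for K unfolding q_def using p0 WV[OF that] by (intro prod_nonneg) auto
 have fB: "finite B" using fV B finite_subset by blast
 have pB0: "0 <= p J" if "J \<in> B" for J using p0 B that by blast
 have b0: "0 <= b" using pB0 B(2) by (metis sum_nonneg)
 have one: "(\<Sum>K\<in>W. q K * g (K i)) = (\<Sum>L\<in>V. p L * g L)" if i: "i < n" for i g
 proof -
  have "(\<Sum>K\<in>W. q K * g (K i)) = (\<Sum>K\<in>W. \<Prod>k<n. p (K k) * (if k = i then g (K k) else 1))"
  proof (rule sum.cong[OF refl])
   fix K
   have "(\<Prod>k<n. if k = i then g (K k) else 1) = g (K i)" using i by (subst prod.delta) auto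
   thus "q K * g (K i) = (\<Prod>k<n. p (K k) * (if k = i then g (K k) else 1))" by (simp add: prod.distrib q_def)
  qed
  also have "\<dots> = (\<Prod>k<n. \<Sum>L\<in>V. p L * (if k = i then g L else 1))" unfolding W_def by (rule sum_PiE_prod[OF fV])
  also have "\<dots> = (\<Prod>k<n. if k = i then (\<Sum>L\<in>V. p L * g L) else 1)" using p1 by (intro prod.cong) auto
  also have "\<dots> = (\<Sum>L\<in>V. p L * g L)" using i by (subst prod.delta) auto
  finally show ?thesis .
 qed
 have two: "(\<Sum>K\<in>W. q K * g (K i) (K k)) = (\<Sum>L\<in>V. p L * (\<Sum>M\<in>V. p M * g L M))" if i: "i < n" "k < n" "i \<noteq> k" for i k g
 proof -
  have "(\<Sum>K\<in>W. q K * g (K i) (K k)) = (\<Sum>K\<in>W. \<Sum>L\<in>V. q K * (of_bool (K i = L) * g L (K k)))"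
  proof (rule sum.cong[OF refl])
   fix K assume "K \<in> W"
   thus "q K * g (K i) (K k) = (\<Sum>L\<in>V. q K * (of_bool (K i = L) * g L (K k)))"
    using WV[of K i] i fV by (simp add: sum_distrib_left[symmetric] of_bool_def if_distrib[of "%z. z * _"] cong: if_cong)
  qed
  also have "\<dots> = (\<Sum>L\<in>V. \<Sum>K\<in>W. q K * (of_bool (K i = L) * g L (K k)))" by (rule sum.swap)
  also have "\<dots> = (\<Sum>L\<in>V. p L * (\<Sum>M\<in>V. p M * g L M))"
  proof (rule sum.cong[OF refl])
   fix L assume L: "L \<in> V"
   have "(\<Sum>K\<in>W. q K * (of_bool (K i = L) * g L (K k)))
     = (\<Sum>K\<in>W. \<Prod>j<n. p (K j) * ((if j = i then of_bool (K j = L) else 1) * (if j = k then g L (K j) else 1)))"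
   proof (rule sum.cong[OF refl])
    fix K
    have "(\<Prod>j<n. if j = i then of_bool (K j = L) else 1) = (of_bool (K i = L) :: real)" "(\<Prod>j<n. if j = k then g L (K j) else 1) = g L (K k)"
     using i by (subst prod.delta; auto)+
    thus "q K * (of_bool (K i = L) * g L (K k)) = (\<Prod>j<n. p (K j) * ((if j = i then of_bool (K j = L) else 1) * (if j = k then g L (K j) else 1)))"
     by (simp add: prod.distrib q_def)
   qed
   also have "\<dots> = (\<Prod>j<n. \<Sum>M\<in>V. p M * ((if j = i then of_bool (M = L) else 1) * (if j = k then g L M else 1)))"
    unfolding W_def by (rule sum_PiE_prod[OF fV])
   also have "\<dots> = (\<Prod>j<n. (if j = i then p L else 1) * (if j = k then (\<Sum>M\<in>V. p M * g L M) else 1))"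
   proof (rule prod.cong[OF refl])
    fix j
    have "(\<Sum>M\<in>V. p M * of_bool (M = L)) = p L" using L fV by (simp add: of_bool_def if_distrib cong: if_cong)
    thus "(\<Sum>M\<in>V. p M * ((if j = i then of_bool (M = L) else 1) * (if j = k then g L M else 1)))
      = (if j = i then p L else 1) * (if j = k then (\<Sum>M\<in>V. p M * g L M) else 1)"
     using i p1 by auto
   qed
   also have "\<dots> = p L * (\<Sum>M\<in>V. p M * g L M)" using i by (simp add: prod.distrib)
   finally show "(\<Sum>K\<in>W. q K * (of_bool (K i = L) * g L (K k))) = p L * (\<Sum>M\<in>V. p M * g L M)" .
  qed
  finally show ?thesis .
 qed
 have coord: "(\<Sum>L\<in>V. p L * of_bool (\<not> R j (L k))) <= \<kappa>" if "k < n" "j < N" for j k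
 proof -
  have "(\<Sum>L\<in>V. p L * of_bool (\<not> R j (L k))) = (\<Sum>L\<in>V. \<Sum>l<N. p L * (of_bool (L k = l) * of_bool (\<not> R j l)))"
  proof (rule sum.cong[OF refl])
   fix L assume "L \<in> V"
   hence "L k < N" using VN that by blast
   thus "p L * of_bool (\<not> R j (L k)) = (\<Sum>l<N. p L * (of_bool (L k = l) * of_bool (\<not> R j l)))"
    by (simp add: sum_distrib_left[symmetric] of_bool_def if_distrib[of "%z. z * _"] cong: if_cong)
  qed
  also have "\<dots> = (\<Sum>l<N. \<Sum>L\<in>V. p L * (of_bool (L k = l) * of_bool (\<not> R j l)))" by (rule sum.swap)
  also have "\<dots> = (\<Sum>l<N. m l * of_bool (\<not> R j l))"
   using that by (intro sum.cong refl) (simp add: marg[symmetric] sum_distrib_right mult.assoc)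
  also have "\<dots> <= \<kappa>" by (rule close[OF that(2)])
  finally show ?thesis .
 qed
 \<comment> \<open>Partners that work for \<open>J\<close>: none is bad, each is separated,
   \<open>J i\<close> is far from every entry of \<open>K i\<close>, and the diagonal entries are
   far from one another.\<close>
 define E where "E J = {K \<in> W. (\<forall>i<n. K i \<notin> B \<and> sep (K i)) \<and> (\<forall>i<n. \<forall>k<n. R (J i) (K i k)) \<and> (\<forall>i<n. \<forall>k<n. i \<noteq> k --> R (K i i) (K k k))}" for J
 define Z where "Z J = (\<Sum>K\<in>E J. q K)" for J
 have EW: "E J \<subseteq> W" for J by (auto simp: E_def)
 have fE: "finite (E J)" for J using EW fW finite_subset by blast
 have qW: "(\<Sum>K\<in>W. q K) = 1"
  using sum_PiE_prod[OF fV, where n=n and f="%_. p"] p1 by (simp add: q_def W_def)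
 have \<kappa>0: "0 <= \<kappa>" using b0 B by linarith
 \<comment> \<open>Union bound over \<open>n + n + n^2 + n^2\<close> possible failures, each of
   probability at most \<kappa>; this is the origin of the constant in \<open>small\<close>.\<close>
 have Zge: "1/2 <= Z J" if J: "J \<in> V" for J
 proof -
  have "q K <= q K * of_bool (K \<in> E J) + ((\<Sum>i<n. q K * of_bool (K i \<in> B)) + (\<Sum>i<n. q K * of_bool (\<not> sep (K i)))
    + (\<Sum>i<n. \<Sum>k<n. q K * of_bool (\<not> R (J i) (K i k))) + (\<Sum>i<n. \<Sum>k<n. q K * of_bool (i \<noteq> k \<and> \<not> R (K i i) (K k k))))"
   (is "_ <= _ + (?a + ?b + ?c + ?d)") if K: "K \<in> W" for K
  proof -
   have nn: "0 <= ?a" "0 <= ?b" "0 <= ?c" "0 <= ?d" using q0[OF K] by (auto intro!: sum_nonneg)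
   show ?thesis
   proof (cases "K \<in> E J")
    case True thus ?thesis using nn by simp
   next
    case False
    have le1: "q K * of_bool (P i) <= (\<Sum>i<n. q K * of_bool (P i))" if "i < n" for P i
     using q0[OF K] that by (intro member_le_sum) auto
    have le2: "q K * of_bool (P i k) <= (\<Sum>i<n. \<Sum>k<n. q K * of_bool (P i k))" if "i < n" "k < n" for P i k
    proof -
     have "q K * of_bool (P i k) <= (\<Sum>k<n. q K * of_bool (P i k))" using q0[OF K] that by (intro member_le_sum) auto
     also have "\<dots> <= (\<Sum>i<n. \<Sum>k<n. q K * of_bool (P i k))"
      using q0[OF K] that by (intro member_le_sum[of i "{..<n}" "%i. \<Sum>k<n. q K * of_bool (P i k)"]) (auto intro!: sum_nonneg)
     finally show ?thesis .
    qed
    from False K consider (a) i where "i < n" "K i \<in> B" | (b) i where "i < n" "\<not> sep (K i)"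
     | (c) i k where "i < n" "k < n" "\<not> R (J i) (K i k)" | (d) i k where "i < n" "k < n" "i \<noteq> k" "\<not> R (K i i) (K k k)"
     unfolding E_def by blast
    hence "q K <= ?a + ?b + ?c + ?d"
    proof cases
     case a thus ?thesis using le1[of i "%i. K i \<in> B"] nn by simp
    next
     case b thus ?thesis using le1[of i "%i. \<not> sep (K i)"] nn by simp
    next
     case c thus ?thesis using le2[of i k "%i k. \<not> R (J i) (K i k)"] nn by simp
    next
     case d thus ?thesis using le2[of i k "%i k. i \<noteq> k \<and> \<not> R (K i i) (K k k)"] nn by simp
    qed
    thus ?thesis using False by simp
   qed
  qed
  hence "(\<Sum>K\<in>W. q K) <= (\<Sum>K\<in>W. q K * of_bool (K \<in> E J) + ((\<Sum>i<n. q K * of_bool (K i \<in> B)) + (\<Sum>i<n. q K * of_bool (\<not> sep (K i)))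
    + (\<Sum>i<n. \<Sum>k<n. q K * of_bool (\<not> R (J i) (K i k))) + (\<Sum>i<n. \<Sum>k<n. q K * of_bool (i \<noteq> k \<and> \<not> R (K i i) (K k k)))))"
   by (rule sum_mono)
  also have "\<dots> = (\<Sum>K\<in>W. q K * of_bool (K \<in> E J)) + ((\<Sum>i<n. \<Sum>K\<in>W. q K * of_bool (K i \<in> B)) + (\<Sum>i<n. \<Sum>K\<in>W. q K * of_bool (\<not> sep (K i)))
    + (\<Sum>i<n. \<Sum>k<n. \<Sum>K\<in>W. q K * of_bool (\<not> R (J i) (K i k))) + (\<Sum>i<n. \<Sum>k<n. \<Sum>K\<in>W. q K * of_bool (i \<noteq> k \<and> \<not> R (K i i) (K k k))))"
   by (simp only: sum.distrib sum.swap[of _ "{..<n}" W])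
  also have "\<dots> <= Z J + (real n * \<kappa> + real n * \<kappa> + real n * (real n * \<kappa>) + real n * (real n * \<kappa>))"
  proof -
   have "(\<Sum>K\<in>W. q K * of_bool (K \<in> E J)) = Z J"
    unfolding Z_def using fW EW[of J] by (simp add: of_bool_def if_distrib sum.If_cases Int_absorb1 Collect_mem_eq cong: if_cong)
   moreover have "(\<Sum>K\<in>W. q K * of_bool (K i \<in> B)) <= \<kappa>" if "i < n" for i
   proof -
    have "(\<Sum>L\<in>V. p L * of_bool (L \<in> B)) = b"
     using fV B(1) unfolding B(2)[symmetric] by (simp add: of_bool_def if_distrib sum.If_cases Int_absorb1 Collect_mem_eq cong: if_cong)
    thus ?thesis using one[OF that, of "%L. of_bool (L \<in> B)"] B(3) by simp
   qed
   moreover have "(\<Sum>K\<in>W. q K * of_bool (\<not> sep (K i))) <= \<kappa>" if "i < n" for i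
    using one[OF that, of "%L. of_bool (\<not> sep L)"] psep by simp
   moreover have "(\<Sum>K\<in>W. q K * of_bool (\<not> R (J i) (K i k))) <= \<kappa>" if "i < n" "k < n" for i k
    using one[OF that(1), of "%L. of_bool (\<not> R (J i) (L k))"] coord[OF that(2) VN[OF J that(1)]] by simp
   moreover have "(\<Sum>K\<in>W. q K * of_bool (i \<noteq> k \<and> \<not> R (K i i) (K k k))) <= \<kappa>" if ik: "i < n" "k < n" for i k
   proof (cases "i = k")
    case False
    have "(\<Sum>K\<in>W. q K * of_bool (\<not> R (K i i) (K k k))) = (\<Sum>L\<in>V. p L * (\<Sum>M\<in>V. p M * of_bool (\<not> R (L i) (M k))))"
     by (rule two[OF ik False])
    also have "\<dots> <= (\<Sum>L\<in>V. p L * \<kappa>)" using ik by (intro sum_mono mult_left_mono coord VN p0) auto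
    also have "\<dots> = \<kappa>" using p1 by (simp add: sum_distrib_right[symmetric])
    finally show ?thesis using False by simp
   qed (simp add: \<kappa>0)
   ultimately show ?thesis
    by (intro add_mono order_refl sum_bounded_above[where A="{..<n}", simplified] order_trans[OF sum_mono sum_bounded_above[where A="{..<n}", simplified]]) (auto intro!: sum_bounded_above[where A="{..<n}", simplified])
  qed
  finally show ?thesis using small qW by (simp add: power2_eq_square algebra_simps)
 qed
 define \<theta> where "\<theta> J K = p J * q K / Z J" for J K
 have Zp: "0 < Z J" if "J \<in> B" for J using Zge[of J] B that by force
 have \<theta>0: "0 <= \<theta> J K" if "J \<in> B" "K \<in> E J" for J K
  unfolding \<theta>_def using pB0[OF that(1)] q0[of K] EW[of J] that(2) Zp[OF that(1)] by (intro divide_nonneg_nonneg mult_nonneg_nonneg) auto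
 have \<theta>1: "(\<Sum>K\<in>E J. \<theta> J K) = p J" if "J \<in> B" for J
  unfolding \<theta>_def using Zp[OF that] by (simp add: sum_divide_distrib[symmetric] sum_distrib_left[symmetric] Z_def[symmetric])
 \<comment> \<open>The mass withdrawn from tuples that serve as partners. Since \<open>Z J\<close>
   is at least 1/2 it is at most \<open>2 * n * b\<close> times \<open>p\<close>, hence at most
   \<open>p\<close>, and the remainder \<open>q1\<close> stays nonnegative.\<close>
 define us where "us L = (\<Sum>J\<in>B. \<Sum>K\<in>E J. \<theta> J K * (\<Sum>i<n. of_bool (K i = L)))" for L
 have usB: "us L = 0" if "L \<in> B" for L unfolding us_def using that by (intro sum.neutral ballI) (auto simp: E_def)
 have us0: "0 <= us L" for L unfolding us_def using \<theta>0 by (auto intro!: sum_nonneg mult_nonneg_nonneg)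
 have usp: "us L <= p L" if L: "L \<in> V" for L
 proof -
  have "(\<Sum>K\<in>E J. \<theta> J K * (\<Sum>i<n. of_bool (K i = L))) <= p J * (2 * real n * p L)" if J: "J \<in> B" for J
  proof -
   have "(\<Sum>K\<in>E J. \<theta> J K * (\<Sum>i<n. of_bool (K i = L))) = (p J / Z J) * (\<Sum>K\<in>E J. \<Sum>i<n. q K * of_bool (K i = L))"
    unfolding \<theta>_def sum_distrib_left by (intro sum.cong refl) simp
   also have "\<dots> <= (p J * 2) * (\<Sum>K\<in>W. \<Sum>i<n. q K * of_bool (K i = L))"
   proof (rule mult_mono)
    have "1 / Z J <= 2" using Zge[of J] J B Zp[OF J] by (auto simp: field_simps)
    hence "p J * (1 / Z J) <= p J * 2" using pB0[OF J] by (rule mult_left_mono)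
    thus "p J / Z J <= p J * 2" by simp
    show "(\<Sum>K\<in>E J. \<Sum>i<n. q K * of_bool (K i = L)) <= (\<Sum>K\<in>W. \<Sum>i<n. q K * of_bool (K i = L))"
     using fW EW q0 by (intro sum_mono2) (auto intro!: sum_nonneg)
    show "0 <= (\<Sum>K\<in>E J. \<Sum>i<n. q K * of_bool (K i = L))" using EW[of J] q0 by (auto intro!: sum_nonneg)
   qed (use pB0[OF J] in auto)
   also have "(\<Sum>K\<in>W. \<Sum>i<n. q K * of_bool (K i = L)) = (\<Sum>i<n. \<Sum>K\<in>W. q K * of_bool (K i = L))" by (rule sum.swap)
   also have "\<dots> = (\<Sum>i<n. p L)"
   proof (rule sum.cong[OF refl])
    fix i assume "i \<in> {..<n}"
    hence "(\<Sum>K\<in>W. q K * of_bool (K i = L)) = (\<Sum>M\<in>V. p M * of_bool (M = L))" using one[of i "%M. of_bool (M = L)"] by simp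
    also have "\<dots> = p L" using L fV by (simp add: of_bool_def if_distrib cong: if_cong)
    finally show "(\<Sum>K\<in>W. q K * of_bool (K i = L)) = p L" .
   qed
   finally show ?thesis by (simp add: algebra_simps)
  qed
  hence "us L <= (\<Sum>J\<in>B. p J * (2 * real n * p L))" unfolding us_def by (rule sum_mono)
  also have "\<dots> = b * (2 * real n * p L)" using B(2) by (simp add: sum_distrib_right[symmetric])
  also have "\<dots> <= 1 * p L"
  proof -
   have "2 * real n * b <= 2 * real n * \<kappa>" using B(3) by (intro mult_left_mono) auto
   moreover have "0 <= 2 * (real n)\<^sup>2 * \<kappa>" using \<kappa>0 by simp
   moreover have "2 * (real n)\<^sup>2 * \<kappa> + 2 * real n * \<kappa> <= 1/2" using small by (simp add: algebra_simps)
   ultimately have "2 * real n * b <= 1" by linarith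
   hence "(2 * real n * b) * p L <= 1 * p L" using p0[OF L] by (rule mult_right_mono)
   thus ?thesis by (simp add: algebra_simps)
  qed
  finally show ?thesis by simp
 qed
 define q1 where "q1 L = p L - of_bool (L \<in> B) * p L - us L" for L
 define dg where "dg K = (\<lambda>i\<in>{..<n}. K i i)" for K :: "nat => nat => nat"
 define q2 where "q2 L = (\<Sum>J\<in>B. \<Sum>K\<in>E J. \<theta> J K * (of_bool (dg K = L) + (\<Sum>i<n. of_bool ((K i)(i := J i) = L))))" for L
 have dgV: "dg K \<in> V" if "K \<in> W" for K using VN WV[OF that] by (auto simp: dg_def V_def)
 have upV: "(K i)(i := J i) \<in> V" if "K \<in> W" "J \<in> V" "i < n" for K J i
  using WV[OF that(1,3)] VN[OF that(2,3)] that(3) by (auto simp: V_def PiE_def Pi_def extensional_def)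
 have collapse: "(\<Sum>L\<in>V. (\<Sum>J\<in>B. \<Sum>K\<in>E J. \<theta> J K * f J K L) * G L) = (\<Sum>J\<in>B. \<Sum>K\<in>E J. \<theta> J K * (\<Sum>L\<in>V. f J K L * G L))" for f G
 proof -
  have "(\<Sum>L\<in>V. (\<Sum>J\<in>B. \<Sum>K\<in>E J. \<theta> J K * f J K L) * G L) = (\<Sum>L\<in>V. \<Sum>J\<in>B. \<Sum>K\<in>E J. \<theta> J K * (f J K L * G L))"
   by (simp add: sum_distrib_right mult.assoc)
  also have "\<dots> = (\<Sum>J\<in>B. \<Sum>L\<in>V. \<Sum>K\<in>E J. \<theta> J K * (f J K L * G L))" by (rule sum.swap)
  also have "\<dots> = (\<Sum>J\<in>B. \<Sum>K\<in>E J. \<Sum>L\<in>V. \<theta> J K * (f J K L * G L))" by (intro sum.cong refl sum.swap)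
  finally show ?thesis by (simp add: sum_distrib_left)
 qed
 have pick: "(\<Sum>L\<in>V. of_bool (M = L) * G L) = G M" if "M \<in> V" for M and G :: "(nat => nat) => real"
  using that fV by (simp add: of_bool_def if_distrib[of "%z. z * _"] cong: if_cong)
 have usG: "(\<Sum>L\<in>V. us L * G L) = (\<Sum>J\<in>B. \<Sum>K\<in>E J. \<theta> J K * (\<Sum>i<n. G (K i)))" for G
  unfolding us_def collapse
 proof (intro sum.cong refl arg_cong2[where f="(*)"])
  fix J K assume "J \<in> B" "K \<in> E J"
  hence K: "K \<in> W" using EW by blast
  have "(\<Sum>L\<in>V. (\<Sum>i<n. of_bool (K i = L)) * G L) = (\<Sum>i<n. \<Sum>L\<in>V. of_bool (K i = L) * G L)"
   unfolding sum_distrib_right by (rule sum.swap)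
  also have "\<dots> = (\<Sum>i<n. G (K i))" by (intro sum.cong refl pick WV[OF K]) auto
  finally show "(\<Sum>L\<in>V. (\<Sum>i<n. of_bool (K i = L)) * G L) = (\<Sum>i<n. G (K i))" .
 qed
 have q2G: "(\<Sum>L\<in>V. q2 L * G L) = (\<Sum>J\<in>B. \<Sum>K\<in>E J. \<theta> J K * (G (dg K) + (\<Sum>i<n. G ((K i)(i := J i)))))" for G
  unfolding q2_def collapse
 proof (intro sum.cong refl arg_cong2[where f="(*)"])
  fix J K assume JK: "J \<in> B" "K \<in> E J"
  hence K: "K \<in> W" and J: "J \<in> V" using EW B by blast+
  have "(\<Sum>L\<in>V. (of_bool (dg K = L) + (\<Sum>i<n. of_bool ((K i)(i := J i) = L))) * G L)
    = (\<Sum>L\<in>V. of_bool (dg K = L) * G L) + (\<Sum>L\<in>V. \<Sum>i<n. of_bool ((K i)(i := J i) = L) * G L)"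
   by (simp add: distrib_right sum.distrib sum_distrib_right)
  also have "(\<Sum>L\<in>V. \<Sum>i<n. of_bool ((K i)(i := J i) = L) * G L) = (\<Sum>i<n. \<Sum>L\<in>V. of_bool ((K i)(i := J i) = L) * G L)" by (rule sum.swap)
  also have "\<dots> = (\<Sum>i<n. G ((K i)(i := J i)))" by (intro sum.cong refl pick upV[OF K J]) auto
  finally show "(\<Sum>L\<in>V. (of_bool (dg K = L) + (\<Sum>i<n. of_bool ((K i)(i := J i) = L))) * G L) = G (dg K) + (\<Sum>i<n. G ((K i)(i := J i)))"
   by (simp only: pick[OF dgV[OF K]])
 qed
 show thesis
 proof (rule that[of q1 q2])
  show "0 <= q1 J \<and> q1 J <= p J" if "J \<in> V" for J
   using usp[OF that] us0[of J] usB[of J] p0[OF that] by (cases "J \<in> B") (auto simp: q1_def)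
  show "q1 J = 0" if "J \<in> B" for J using usB[OF that] that by (simp add: q1_def)
  show "0 <= q2 J" for J unfolding q2_def using \<theta>0 by (auto intro!: sum_nonneg mult_nonneg_nonneg add_nonneg_nonneg)
  show "sep L" if L: "L \<in> V" "q2 L \<noteq> 0" for L
  proof -
   from L(2) obtain J where J: "J \<in> B" "(\<Sum>K\<in>E J. \<theta> J K * (of_bool (dg K = L) + (\<Sum>i<n. of_bool ((K i)(i := J i) = L)))) \<noteq> 0"
    unfolding q2_def by (meson sum.neutral)
   then obtain K where K: "K \<in> E J" "\<theta> J K * (of_bool (dg K = L) + (\<Sum>i<n. of_bool ((K i)(i := J i) = L))) \<noteq> 0"
    by (meson sum.neutral)
   hence "dg K = L \<or> (\<Sum>i<n. of_bool ((K i)(i := J i) = L)) \<noteq> (0::real)" by auto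
   moreover have "(\<Sum>i<n. of_bool ((K i)(i := J i) = L)) = (0::real)" if "\<not> (\<exists>i<n. (K i)(i := J i) = L)"
    using that by (intro sum.neutral) auto
   ultimately have "dg K = L \<or> (\<exists>i<n. (K i)(i := J i) = L)" by blast
   thus ?thesis
   proof
    assume "dg K = L" thus ?thesis using K(1) by (auto simp: sep_def dg_def E_def)
   next
    assume "\<exists>i<n. (K i)(i := J i) = L"
    then obtain i where i: "i < n" "L = (K i)(i := J i)" by blast
    have "sep (K i)" "!!k. k < n ==> R (J i) (K i k)" using K(1) i(1) by (auto simp: E_def)
    thus ?thesis unfolding i(2) sep_def using Rsym i(1) by auto
   qed
  qed
  have "sum q2 V = (\<Sum>J\<in>B. \<Sum>K\<in>E J. \<theta> J K * (real n + 1))" using q2G[of "%_. 1"] by (simp add: add.commute)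
  also have "\<dots> = (\<Sum>J\<in>B. p J * (real n + 1))" by (intro sum.cong refl) (simp add: sum_distrib_right[symmetric] \<theta>1)
  finally show "sum q2 V = (real n + 1) * b" using B(2) by (simp add: sum_distrib_right[symmetric])
  fix i0 j assume i0: "i0 < n" and j: "j < N"
  define G where "G L = (of_bool (L i0 = j) :: real)" for L :: "nat => nat"
  \<comment> \<open>In position \<open>i0\<close> only partner \<open>i0\<close> changes: it
    receives the entry of \<open>J\<close> and passes its own to the diagonal tuple.\<close>
  have key: "G (dg K) + (\<Sum>i<n. G ((K i)(i := J i))) = G J + (\<Sum>i<n. G (K i))" for J and K :: "nat => nat => nat"
  proof -
   have "(\<Sum>i<n. G ((K i)(i := J i))) = G J + (\<Sum>i\<in>{..<n} - {i0}. G (K i))"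
    using i0 by (subst sum.remove[of _ i0]) (auto simp: G_def intro!: sum.cong)
   moreover have "(\<Sum>i<n. G (K i)) = G (K i0) + (\<Sum>i\<in>{..<n} - {i0}. G (K i))" using i0 by (subst sum.remove[of _ i0]) auto
   moreover have "G (dg K) = G (K i0)" using i0 by (simp add: G_def dg_def)
   ultimately show ?thesis by simp
  qed
  have "(\<Sum>L\<in>V. of_bool (L \<in> B) * p L * G L) = (\<Sum>J\<in>B. p J * G J)"
   using fV B(1) by (simp add: of_bool_def if_distrib[of "%z. z * _"] sum.If_cases Int_absorb1 Collect_mem_eq cong: if_cong)
  also have "\<dots> = (\<Sum>J\<in>B. \<Sum>K\<in>E J. \<theta> J K * G J)" by (intro sum.cong refl) (simp add: sum_distrib_right[symmetric] \<theta>1)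
  finally have bG: "(\<Sum>L\<in>V. of_bool (L \<in> B) * p L * G L) = (\<Sum>J\<in>B. \<Sum>K\<in>E J. \<theta> J K * G J)" .
  have "(\<Sum>L\<in>V. (q1 L + q2 L) * G L) = (\<Sum>L\<in>V. p L * G L) - (\<Sum>L\<in>V. of_bool (L \<in> B) * p L * G L) - (\<Sum>L\<in>V. us L * G L) + (\<Sum>L\<in>V. q2 L * G L)"
   unfolding q1_def by (simp add: algebra_simps sum.distrib sum_subtractf)
  also have "\<dots> = (\<Sum>L\<in>V. p L * G L) + ((\<Sum>J\<in>B. \<Sum>K\<in>E J. \<theta> J K * (G (dg K) + (\<Sum>i<n. G ((K i)(i := J i))))) - (\<Sum>J\<in>B. \<Sum>K\<in>E J. \<theta> J K * (G J + (\<Sum>i<n. G (K i)))))"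
   unfolding bG usG q2G by (simp add: distrib_left sum.distrib)
  also have "\<dots> = m j" unfolding key using marg[OF i0 j] by (simp add: G_def)
  finally show "(\<Sum>J\<in>V. (q1 J + q2 J) * of_bool (J i0 = j)) = m j" by (simp add: G_def)
 qed
qed

text \<open>Closed form, on \<open>I\<close>, of the distance on the circle; unlike the infimum in
  \<open>tnorm\<close> it is visibly continuous and open to case analysis.\<close>

definition dT :: "real => real => real" where "dT s t = min \<bar>s - t\<bar> (2*pi - \<bar>s - t\<bar>)"

lemma dT_sym: "dT s t = dT t s" by (simp add: dT_def abs_minus_commute)

lemma dT_self [simp]: "dT s s = 0" by (simp add: dT_def)

lemma dT_nonneg: "s \<in> Iper ==> t \<in> Iper ==> 0 <= dT s t" by (auto simp: dT_def Iper_def)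

lemma dT_le: "dT s t <= \<bar>s - t\<bar>" by (simp add: dT_def)

lemma dT_triangle:
 assumes "s \<in> Iper" "t \<in> Iper" "r \<in> Iper"
 shows "dT s r <= dT s t + dT t r"
 using assms by (auto simp: dT_def Iper_def min_def abs_if split: if_splits)

lemma continuous_dT: "continuous_on A (%z. dT (fst z) (snd z))"
 unfolding dT_def by (intro continuous_intros)

lemma tnorm_zero_iff:
 assumes s: "s \<in> Iper" and t: "t \<in> Iper"
 shows "tnorm (s - t) = 0 \<longleftrightarrow> dT s t = 0"
proof
 have bdd: "bdd_below (range (%k::int. \<bar>s - t - 2 * pi * of_int k\<bar>))" by (rule bdd_belowI[of _ 0]) auto
 have "dT s t <= \<bar>s - t - 2 * pi * of_int k\<bar>" for k :: int
 proof -
  have d2: "dT s t <= 2*pi - \<bar>s - t\<bar>" by (simp add: dT_def)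
  consider "k = 0" | "1 <= k" | "k <= -1" by linarith
  thus ?thesis
  proof cases
   case 1 thus ?thesis by (simp add: dT_def)
  next
   case 2
   hence "2 * pi * 1 <= 2 * pi * of_int k" by (intro mult_left_mono) auto
   thus ?thesis using d2 by linarith
  next
   case 3
   hence "2 * pi * of_int k <= 2 * pi * (-1)" by (intro mult_left_mono) auto
   thus ?thesis using d2 by linarith
  qed
 qed
 hence ge: "dT s t <= tnorm (s - t)" unfolding tnorm_def by (intro cINF_greatest) auto
 show "dT s t = 0" if "tnorm (s - t) = 0" using ge that dT_nonneg[OF s t] by linarith
 have nn: "0 <= tnorm (s - t)" using ge dT_nonneg[OF s t] by linarith
 assume "dT s t = 0"
 hence "s - t = 0 \<or> s - t = 2*pi \<or> s - t = -2*pi" using s t by (auto simp: dT_def min_def split: if_splits)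
 then obtain k :: int where "\<bar>s - t - 2 * pi * of_int k\<bar> = 0"
 proof (elim disjE)
  assume "s - t = 0" thus ?thesis by (intro that[of 0]) simp
 next
  assume "s - t = 2*pi" thus ?thesis by (intro that[of 1]) simp
 next
  assume "s - t = -2*pi" thus ?thesis by (intro that[of "-1"]) simp
 qed
 hence "tnorm (s - t) <= 0" unfolding tnorm_def using cINF_lower[OF bdd, of k] by simp
 thus "tnorm (s - t) = 0" using nn by simp
qed

lemma w_inf_iff:
 assumes "assumptionA w" "s \<in> Iper" "t \<in> Iper"
 shows "w s t = \<infinity> \<longleftrightarrow> dT s t = 0"
proof -
 have "{(x,y) \<in> Iper \<times> Iper. w x y = \<infinity>} = {(x,y) \<in> Iper \<times> Iper. tnorm (x - y) = 0}"
  using assms(1) by (simp add: assumptionA_def)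
 hence "(s, t) \<in> {(x,y) \<in> Iper \<times> Iper. w x y = \<infinity>} \<longleftrightarrow> (s, t) \<in> {(x,y) \<in> Iper \<times> Iper. tnorm (x - y) = 0}" by simp
 thus ?thesis using assms tnorm_zero_iff by auto
qed

definition tsep :: "nat => real => (nat => real) => bool" where
 "tsep n a x \<longleftrightarrow> (\<forall>i<n. \<forall>j<n. i \<noteq> j --> a <= dT (x i) (x j))"

lemma tsepD: "tsep n a x ==> i < n ==> j < n ==> i \<noteq> j ==> a <= dT (x i) (x j)"
 by (simp add: tsep_def)

text \<open>Away from the diagonal of the circle \<open>w\<close> is finite and continuous on a
  compact set. The modulus is in Euclidean distance, because nothing relates the values of
  \<open>w\<close> on the two sides of the seam.\<close>

lemma pair_cost_unif:
 assumes w: "assumptionA w" and a: "0 < a"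
 shows "\<exists>C\<ge>0. \<forall>s\<in>Iper. \<forall>t\<in>Iper. a <= dT s t --> w s t <= ennreal C"
  and "0 < e ==> \<exists>d>0. \<forall>s\<in>Iper. \<forall>t\<in>Iper. \<forall>s'\<in>Iper. \<forall>t'\<in>Iper. a <= dT s t --> a <= dT s' t' -->
    \<bar>s - s'\<bar> <= d --> \<bar>t - t'\<bar> <= d --> w s t <= w s' t' + ennreal e"
proof -
 define S where "S = {z \<in> Iper \<times> Iper. a <= dT (fst z) (snd z)}"
 define g where "g z = enn2real (w (fst z) (snd z))" for z
 have "S = (Iper \<times> Iper) \<inter> {z. a <= dT (fst z) (snd z)}" by (auto simp: S_def)
 moreover have "closed {z. a <= dT (fst z) (snd z)}"
  by (intro closed_Collect_le continuous_on_const continuous_dT)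
 ultimately have cS: "compact S" by (simp add: compact_Int_closed compact_Times Iper_def)
 have fin: "ennreal (g z) = w (fst z) (snd z)" if "z \<in> S" for z
  using that w_inf_iff[OF w, of "fst z" "snd z"] a by (auto simp: S_def g_def ennreal_enn2real_if less_top)
 have cw: "continuous_on (Iper \<times> Iper) (%z. w (fst z) (snd z))"
  using w by (simp add: assumptionA_def case_prod_beta')
 have gc: "continuous_on S g"
  unfolding continuous_on_def
 proof
  fix z assume z: "z \<in> S"
  have "continuous_on S (%z. w (fst z) (snd z))" by (rule continuous_on_subset[OF cw]) (auto simp: S_def)
  hence "((%z. w (fst z) (snd z)) \<longlongrightarrow> ennreal (g z)) (at z within S)"
   using z fin[OF z] by (simp add: continuous_on_def)
  hence "((%z. enn2real (w (fst z) (snd z))) \<longlongrightarrow> g z) (at z within S)" by (rule tendsto_enn2real) (simp add: g_def)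
  thus "(g \<longlongrightarrow> g z) (at z within S)" by (simp add: g_def[abs_def])
 qed
 have "compact (g ` S)" by (rule compact_continuous_image[OF gc cS])
 then obtain C where C: "\<forall>y\<in>g ` S. norm y <= C" using compact_imp_bounded bounded_iff by blast
 show "\<exists>C\<ge>0. \<forall>s\<in>Iper. \<forall>t\<in>Iper. a <= dT s t --> w s t <= ennreal C"
 proof (intro exI[of _ "\<bar>C\<bar>"] conjI ballI impI)
  fix s t assume st: "s \<in> Iper" "t \<in> Iper" "a <= dT s t"
  hence z: "(s, t) \<in> S" by (auto simp: S_def)
  hence "g (s, t) <= \<bar>C\<bar>" using C by force
  thus "w s t <= ennreal \<bar>C\<bar>" using fin[OF z] ennreal_leI by fastforce
 qed simp
 assume e: "0 < e"
 have "uniformly_continuous_on S g" by (rule compact_uniformly_continuous[OF gc cS])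
 then obtain d where d: "0 < d" "!!z z'. z \<in> S ==> z' \<in> S ==> dist z' z < d ==> dist (g z') (g z) < e"
  unfolding uniformly_continuous_on_def using e by blast
 show "\<exists>d>0. \<forall>s\<in>Iper. \<forall>t\<in>Iper. \<forall>s'\<in>Iper. \<forall>t'\<in>Iper. a <= dT s t --> a <= dT s' t' -->
    \<bar>s - s'\<bar> <= d --> \<bar>t - t'\<bar> <= d --> w s t <= w s' t' + ennreal e"
 proof (intro exI[of _ "d/3"] conjI ballI impI)
  fix s t s' t' assume st: "s \<in> Iper" "t \<in> Iper" "s' \<in> Iper" "t' \<in> Iper" "a <= dT s t" "a <= dT s' t'" "\<bar>s - s'\<bar> <= d/3" "\<bar>t - t'\<bar> <= d/3"
  hence z: "(s, t) \<in> S" "(s', t') \<in> S" by (auto simp: S_def)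
  have "dist (s, t) (s', t') <= \<bar>s - s'\<bar> + \<bar>t - t'\<bar>"
   unfolding dist_prod_def using sqrt_sum_squares_le_sum_abs[of "dist s s'" "dist t t'"] by (simp add: dist_real_def)
  hence "dist (s, t) (s', t') < d" using st d(1) by linarith
  hence "dist (g (s, t)) (g (s', t')) < e" using d(2)[OF z(2,1)] by simp
  hence "g (s, t) <= g (s', t') + e" by (simp add: dist_real_def)
  hence "ennreal (g (s, t)) <= ennreal (g (s', t') + e)" by (rule ennreal_leI)
  also have "\<dots> = ennreal (g (s', t')) + ennreal e" using e by (intro ennreal_plus) (auto simp: g_def)
  finally show "w s t <= w s' t' + ennreal e" using fin[OF z(1)] fin[OF z(2)] by simp
 qed (use d in auto)
qed

lemma cn_card_bound:
 assumes "!!i j. i < n ==> j < n ==> i \<noteq> j ==> w (x i) (x j) <= w (y i) (y j) + ennreal e" "0 <= e"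
 shows "cn n w x <= cn n w y + ennreal (real n * real n * e)"
proof -
 have "cn n w x <= (\<Sum>i<n. \<Sum>j\<in>{..<n} - {i}. w (y i) (y j) + ennreal e)"
  unfolding cn_def using assms by (intro sum_mono) auto
 also have "\<dots> = cn n w y + (\<Sum>i<n. \<Sum>j\<in>{..<n} - {i}. ennreal e)" by (simp add: cn_def sum.distrib)
 also have "(\<Sum>i<n. \<Sum>j\<in>{..<n} - {i}. ennreal e) <= (\<Sum>i<n. \<Sum>j<n. ennreal e)"
  by (intro sum_mono sum_mono2) auto
 also have "\<dots> = ennreal (real n * real n * e)"
  using assms(2) by (simp add: ennreal_of_nat_eq_real_of_nat mult.assoc flip: ennreal_mult)
 finally show ?thesis by (simp add: add_left_mono)
qed

lemma cost_unif:
 assumes w: "assumptionA w" and a: "0 < a" and e: "0 < e"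
 obtains d where "0 < d" "!!x y. x \<in> In n ==> y \<in> In n ==> tsep n a x ==> tsep n a y ==> (!!i. i < n ==> \<bar>x i - y i\<bar> <= d) ==>
   cn n w x <= cn n w y + ennreal e"
proof -
 define e' where "e' = e / (real n * real n + 1)"
 have e': "0 < e'" using e by (simp add: e'_def add_nonneg_pos)
 have le: "real n * real n * e' <= e"
 proof -
  have "real n * real n * e' <= (real n * real n + 1) * e'" using e' by (intro mult_right_mono) auto
  also have "\<dots> = e" unfolding e'_def by (simp add: add_nonneg_eq_0_iff)
  finally show ?thesis .
 qed
 from pair_cost_unif(2)[OF w a e'] obtain d where d: "0 < d" and u: "!!s t s' t'. s \<in> Iper ==> t \<in> Iper ==> s' \<in> Iper ==> t' \<in> Iper ==>
   a <= dT s t ==> a <= dT s' t' ==> \<bar>s - s'\<bar> <= d ==> \<bar>t - t'\<bar> <= d ==> w s t <= w s' t' + ennreal e'" by blast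
 show thesis
 proof (rule that[OF d])
  fix x y assume xy: "x \<in> In n" "y \<in> In n" "tsep n a x" "tsep n a y" and dd: "!!i. i < n ==> \<bar>x i - y i\<bar> <= d"
  have "cn n w x <= cn n w y + ennreal (real n * real n * e')"
   by (rule cn_card_bound) (use xy dd e' in \<open>auto intro!: u In_coord tsepD\<close>)
  also have "\<dots> <= cn n w y + ennreal e" by (intro add_left_mono ennreal_leI le)
  finally show "cn n w x <= cn n w y + ennreal e" .
 qed
qed

lemma cost_bounded:
 assumes w: "assumptionA w" and a: "0 < a"
 obtains C where "0 <= C" "!!x. x \<in> In n ==> tsep n a x ==> cn n w x <= ennreal C"
proof -
 from pair_cost_unif(1)[OF w a] obtain C where C: "0 <= C" and u: "!!s t. s \<in> Iper ==> t \<in> Iper ==> a <= dT s t ==> w s t <= ennreal C" by blast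
 show thesis
 proof (rule that[of "real n * real n * C"])
  fix x assume x: "x \<in> In n" "tsep n a x"
  have "cn n w x <= (\<Sum>i<n. \<Sum>j\<in>{..<n} - {i}. ennreal C)"
   unfolding cn_def by (intro sum_mono u) (use x in \<open>auto intro!: In_coord tsepD\<close>)
  also have "\<dots> <= (\<Sum>i<n. \<Sum>j<n. ennreal C)" by (intro sum_mono sum_mono2) auto
  also have "\<dots> = ennreal (real n * real n * C)"
   using C by (simp add: ennreal_of_nat_eq_real_of_nat mult.assoc flip: ennreal_mult)
  finally show "cn n w x <= ennreal (real n * real n * C)" .
 qed (use C in auto)
qed

lemma measurable_dT [measurable]:
 assumes "f \<in> borel_measurable M" "g \<in> borel_measurable M"
 shows "(%x. dT (f x) (g x)) \<in> borel_measurable M"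
 unfolding dT_def using assms by measurable

text \<open>As \<rho> has no atoms its distribution function is uniformly continuous on a compact
  interval. An arc is covered by intervals around its centre, 0 and \<open>2*pi\<close>, hence the
  division of \<kappa> by 3.\<close>

lemma rho_small_arcs:
 assumes \<rho>: "prob_density_on_I \<rho>" and \<kappa>: "0 < \<kappa>"
 obtains r where "0 < r" "!!s. s \<in> Iper ==> measure (rho_measure \<rho>) {t \<in> Iper. dT t s < r} <= \<kappa>"
proof -
 interpret R: real_distribution "rho_measure \<rho>" by (rule real_distribution_rho[OF \<rho>])
 let ?F = "cdf (rho_measure \<rho>)"
 have "uniformly_continuous_on {-1..2*pi+1} ?F"
  by (rule compact_uniformly_continuous) (auto intro!: continuous_at_imp_continuous_on isCont_cdf_rho[OF \<rho>])
 then obtain d where d: "0 < d" "!!x y. x \<in> {-1..2*pi+1} ==> y \<in> {-1..2*pi+1} ==> dist y x < d ==> dist (?F y) (?F x) < \<kappa>/3"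
  unfolding uniformly_continuous_on_def using \<kappa> by (metis divide_pos_pos zero_less_numeral)
 define r where "r = min (d/3) (1/2)"
 have r: "0 < r" "r <= 1" "2 * r < d" using d by (auto simp: r_def)
 have iv: "measure (rho_measure \<rho>) {c - r<..c + r} <= \<kappa>/3" if "c \<in> Iper" for c
 proof -
  have "measure (rho_measure \<rho>) {c - r<..c + r} = ?F (c + r) - ?F (c - r)"
   using r by (intro R.cdf_diff_eq[symmetric]) auto
  also have "\<dots> <= \<kappa>/3"
  proof -
   have "dist (?F (c + r)) (?F (c - r)) < \<kappa>/3"
    using that r by (intro d(2)) (auto simp: Iper_def dist_real_def)
   thus ?thesis unfolding dist_real_def by linarith
  qed
  finally show ?thesis .
 qed
 show thesis
 proof (rule that[OF r(1)])
  fix s assume s: "s \<in> Iper"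
  have "measure (rho_measure \<rho>) {t \<in> Iper. dT t s < r} <= measure (rho_measure \<rho>) (({s - r<..s + r} \<union> {0 - r<..0 + r}) \<union> {2*pi - r<..2*pi + r})"
   using s r by (intro R.finite_measure_mono) (auto simp: Iper_def dT_def min_def split: if_splits)
  also have "\<dots> <= measure (rho_measure \<rho>) ({s - r<..s + r} \<union> {0 - r<..0 + r}) + measure (rho_measure \<rho>) {2*pi - r<..2*pi + r}"
   by (rule measure_Un_le) auto
  also have "\<dots> <= (measure (rho_measure \<rho>) {s - r<..s + r} + measure (rho_measure \<rho>) {0 - r<..0 + r}) + measure (rho_measure \<rho>) {2*pi - r<..2*pi + r}"
   by (intro add_right_mono measure_Un_le) auto
  also have "\<dots> <= \<kappa>" using iv[OF s] iv[of 0] iv[of "2*pi"] by (simp add: Iper_def)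
  finally show "measure (rho_measure \<rho>) {t \<in> Iper. dT t s < r} <= \<kappa>" .
 qed
qed

text \<open>The cost is infinite on the diagonals, so a plan of finite cost gives them no mass; the
  events that a pair is closer than \<open>1/(k+1)\<close> decrease to them.\<close>

lemma near_diagonal_small:
 assumes w: "assumptionA w" and \<gamma>: "sets \<gamma> = sets (Mn n)" "prob_space \<gamma>" and c: "(\<integral>\<^sup>+ x. cn n w x \<partial>\<gamma>) < \<infinity>" and \<kappa>: "0 < \<kappa>"
 obtains a where "0 < a" "measure \<gamma> {x \<in> In n. \<not> tsep n a x} <= \<kappa>"
proof -
 interpret prob_space \<gamma> by fact
 have sp: "space \<gamma> = In n" using sets_eq_imp_space_eq[OF \<gamma>(1)] by simp
 have [measurable]: "(%x. x i) \<in> borel_measurable \<gamma>" for i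
  using measurable_coord measurable_cong_sets[OF \<gamma>(1) refl] by blast
 define D where "D i j k = {x \<in> space \<gamma>. dT (x i) (x j) < inverse (real (Suc k))}" for i j k
 have Dm[measurable]: "D i j k \<in> sets \<gamma>" for i j k unfolding D_def by measurable
 have cm: "cn n w \<in> borel_measurable \<gamma>" using measurable_cn[OF w] measurable_cong_sets[OF \<gamma>(1) refl] by blast
 have fin: "AE x in \<gamma>. cn n w x \<noteq> \<infinity>" using nn_integral_PInf_AE[OF cm] c by auto
 have lim: "(%k. measure \<gamma> (D i j k)) \<longlonglongrightarrow> 0" if ij: "i < n" "j < n" "i \<noteq> j" for i j
 proof -
  have "(%k. measure \<gamma> (D i j k)) \<longlonglongrightarrow> measure \<gamma> (\<Inter>k. D i j k)"
  proof (rule finite_Lim_measure_decseq)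
   show "decseq (D i j)" unfolding decseq_def D_def
    by (auto elim!: less_le_trans simp: frac_le intro!: le_imp_inverse_le)
  qed auto
  moreover have "measure \<gamma> (\<Inter>k. D i j k) = 0"
  proof -
   have "AE x in \<gamma>. x \<notin> (\<Inter>k. D i j k)"
    using fin
   proof (rule AE_mp, intro AE_I2 impI notI)
    fix x assume x: "x \<in> space \<gamma>" "cn n w x \<noteq> \<infinity>" "x \<in> (\<Inter>k. D i j k)"
    have xI: "x i \<in> Iper" "x j \<in> Iper" using x sp ij In_coord by auto
    have "dT (x i) (x j) <= 0"
    proof (rule ccontr)
     assume "\<not> dT (x i) (x j) <= 0"
     then obtain k where "inverse (real (Suc k)) < dT (x i) (x j)" using reals_Archimedean[of "dT (x i) (x j)"] by auto
     moreover have "dT (x i) (x j) < inverse (real (Suc k))" using x(3) by (auto simp: D_def)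
     ultimately show False by simp
    qed
    hence "w (x i) (x j) = \<infinity>" using w_inf_iff[OF w xI] dT_nonneg[OF xI] by simp
    hence "(\<Sum>j\<in>{..<n} - {i}. w (x i) (x j)) = \<infinity>" using ij by (simp add: sum.remove[of "{..<n} - {i}" j])
    hence "cn n w x = \<infinity>" unfolding cn_def using ij by (simp add: sum.remove[of "{..<n}" i])
    thus False using x(2) by simp
   qed
   hence "emeasure \<gamma> (\<Inter>k. D i j k) = 0" by (subst (asm) AE_iff_null_sets[symmetric]) auto
   thus ?thesis by (simp add: measure_def)
  qed
  ultimately show ?thesis by simp
 qed
 have "(%k. \<Sum>i<n. \<Sum>j<n. if i = j then 0 else measure \<gamma> (D i j k)) \<longlonglongrightarrow> (\<Sum>i<n. \<Sum>j<n. 0)"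
 proof (intro tendsto_sum)
  fix i j assume "i \<in> {..<n}" "j \<in> {..<n}"
  thus "(%k. if i = j then 0 else measure \<gamma> (D i j k)) \<longlonglongrightarrow> 0" using lim[of i j] by (cases "i = j") auto
 qed
 hence "\<forall>\<^sub>F k in sequentially. (\<Sum>i<n. \<Sum>j<n. if i = j then 0 else measure \<gamma> (D i j k)) < \<kappa>"
  using \<kappa> by (intro order_tendstoD(2)) auto
 then obtain k where k: "(\<Sum>i<n. \<Sum>j<n. if i = j then 0 else measure \<gamma> (D i j k)) < \<kappa>" by (auto simp: eventually_sequentially)
 show thesis
 proof (rule that[of "inverse (real (Suc k))"])
  have "measure \<gamma> {x \<in> In n. \<not> tsep n (inverse (real (Suc k))) x} <= measure \<gamma> (\<Union>i<n. \<Union>j<n. if i = j then {} else D i j k)"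
  proof (rule finite_measure_mono)
   show "{x \<in> In n. \<not> tsep n (inverse (real (Suc k))) x} \<subseteq> (\<Union>i<n. \<Union>j<n. if i = j then {} else D i j k)"
    by (auto simp: tsep_def D_def sp not_le)
   show "(\<Union>i<n. \<Union>j<n. if i = j then {} else D i j k) \<in> events"
    by (intro sets.finite_UN) (auto simp: Dm)
  qed
  also have "\<dots> <= (\<Sum>i<n. measure \<gamma> (\<Union>j<n. if i = j then {} else D i j k))"
   by (intro finite_measure_subadditive_finite) auto
  also have "\<dots> <= (\<Sum>i<n. \<Sum>j<n. measure \<gamma> (if i = j then {} else D i j k))"
   by (intro sum_mono finite_measure_subadditive_finite) auto
  also have "\<dots> = (\<Sum>i<n. \<Sum>j<n. if i = j then 0 else measure \<gamma> (D i j k))"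
   by (intro sum.cong refl) auto
  also have "\<dots> <= \<kappa>" using k by simp
  finally show "measure \<gamma> {x \<in> In n. \<not> tsep n (inverse (real (Suc k))) x} <= \<kappa>" .
 qed simp
qed

text \<open>The cell across the seam is short only on the circle, so the Euclidean bound is claimed
  for the other cells alone.\<close>

lemma cell_dT:
 assumes "3 <= N" "j < N" "x \<in> cell N j" "y \<in> cell N j"
 shows "dT x y <= 2 * (2*pi / real N)" "Suc j < N ==> \<bar>x - y\<bar> <= 2 * (2*pi / real N)"
  "\<not> Suc j < N ==> dT x 0 <= 2*pi / real N"
proof -
 define h where "h = 2*pi / real N"
 have arc: "arc N j = real j * h" "arc N (j + 2) = real j * h + 2 * h" "arc N 1 = h" by (simp_all add: arc_def h_def algebra_simps add_divide_distrib)
 have h: "0 < h" using assms by (simp add: h_def)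
 have last: "real j * h = 2*pi - h" if "\<not> Suc j < N"
 proof -
  have "real j = real N - 1" using that assms by (simp add: of_nat_diff)
  hence "real j * h = real N * h - h" by (simp add: left_diff_distrib)
  moreover have "real N * h = 2*pi" using assms(1) by (simp add: h_def)
  ultimately show ?thesis by simp
 qed
 show *: "\<bar>x - y\<bar> <= 2 * (2*pi / real N)" if "Suc j < N"
  using assms that unfolding cell_def h_def[symmetric] by (auto simp: arc[unfolded add_2_eq_Suc'] abs_le_iff)
 show "dT x 0 <= 2*pi / real N" if "\<not> Suc j < N"
  using assms that last[OF that] unfolding cell_def h_def[symmetric] arc(1,3) by (auto simp: dT_def Iper_def min_def)
 show "dT x y <= 2 * (2*pi / real N)"
 proof (cases "Suc j < N")
  case True thus ?thesis using * dT_le[of x y] by linarith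
 next
  case False
  thus ?thesis using assms last[OF False] h unfolding cell_def h_def[symmetric] arc(1,3)
   by (auto simp: dT_def Iper_def min_def abs_if split: if_splits)
 qed
qed

section \<open>Cells, boxes and the choice of the mesh\<close>

definition tuples :: "nat => nat => (nat => nat) set" where "tuples n N = PiE {..<n} (%_. {..<N})"

definition cbox :: "nat => nat => (nat => nat) => (nat => real) set" where
 "cbox n N J = {x \<in> In n. \<forall>i<n. x i \<in> cell N (J i)}"

text \<open>A supremum over the box, because a determinant built on \<open>J\<close> may put its
  particles anywhere in the cells of \<open>J\<close>.\<close>

definition cbound :: "nat => (real => real => ennreal) => nat => (nat => nat) => ennreal" where
 "cbound n w N J = (SUP x\<in>cbox n N J. cn n w x)"

definition cell_partition :: "nat => (real => real) => (nat => real => real) => bool" where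
 "cell_partition N \<rho> ch \<longleftrightarrow> 3 <= N \<and> (\<forall>j<N. smooth (ch j)) \<and> (\<forall>j<N. \<forall>x. ch j (x + 2*pi) = ch j x) \<and>
  (\<forall>x\<in>Iper. (\<Sum>j<N. (ch j x)\<^sup>2) = 1) \<and>
  (\<forall>i<N. \<forall>j<N. i \<noteq> j --> (\<integral>x. indicator Iper x * \<rho> x * (ch i x * ch j x) \<partial>lborel) = 0) \<and>
  (\<forall>j<N. \<forall>x\<in>Iper. ch j x \<noteq> 0 --> x \<in> cell N j)"

definition cmass :: "(real => real) => (nat => real => real) => nat => real" where
 "cmass \<rho> ch j = (\<integral>x. indicator Iper x * \<rho> x * (ch j x)\<^sup>2 \<partial>lborel)"

lemma integrable_rho:
 assumes "prob_density_on_I \<rho>" shows "integrable lborel (%x. indicator Iper x * \<rho> x)"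
proof (rule integrableI_bounded)
 have [measurable]: "\<rho> \<in> borel_measurable borel" using assms by (simp add: prob_density_on_I_def)
 show "(%x. indicator Iper x * \<rho> x) \<in> borel_measurable lborel" by measurable
 have "(\<integral>\<^sup>+ x. ennreal (norm (indicator Iper x * \<rho> x)) \<partial>lborel) = (\<integral>\<^sup>+ t\<in>Iper. ennreal (\<rho> t) \<partial>lborel)"
  using assms by (intro nn_integral_cong) (auto simp: prob_density_on_I_def split: split_indicator)
 also have "\<dots> < \<infinity>" using assms by (simp add: prob_density_on_I_def)
 finally show "(\<integral>\<^sup>+ x. ennreal (norm (indicator Iper x * \<rho> x)) \<partial>lborel) < \<infinity>" .
qed

lemma integral_rho_measure:
 fixes g :: "real => real"
 assumes \<rho>: "prob_density_on_I \<rho>" and [measurable]: "g \<in> borel_measurable borel"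
 shows "integral\<^sup>L (rho_measure \<rho>) g = (\<integral>x. indicator Iper x * \<rho> x * g x \<partial>lborel)"
proof -
 have [measurable]: "\<rho> \<in> borel_measurable borel" using \<rho> by (simp add: prob_density_on_I_def)
 have "rho_measure \<rho> = density lborel (%t. ennreal (indicator Iper t * \<rho> t))"
  unfolding rho_measure_def by (rule arg_cong[where f="density lborel"]) (auto simp: fun_eq_iff split: split_indicator)
 thus ?thesis
  using \<rho> by (simp add: integral_density prob_density_on_I_def AE_I2 split: split_indicator)
qed

text \<open>Order of the constants: the probability \<kappa> asked for by
  \<open>discrete_swap\<close> fixes the separation \<open>a0\<close> of the exchanged tuples and so
  their cost bound \<open>C\<close>; \<open>C\<close> fixes the mass \<beta> that may be exchanged;
  \<beta> fixes the finer separation \<open>a\<close> of the kept tuples; only then is the mesh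
  chosen. As \<open>a0\<close> does not depend on \<beta>, there is no circularity.\<close>

lemma discretization:
 assumes n1: "1 <= n" and w: "assumptionA w" and \<rho>: "prob_density_on_I \<rho>" and \<gamma>: "\<gamma> \<in> Pi_rho n \<rho>"
  and c: "(\<integral>\<^sup>+ x. cn n w x \<partial>\<gamma>) < \<infinity>" and \<delta>: "0 < \<delta>"
 obtains N ch q where "cell_partition N \<rho> ch" "!!J. J \<in> tuples n N ==> 0 <= q J"
  "!!i j. i < n ==> j < N ==> (\<Sum>J\<in>tuples n N. q J * of_bool (J i = j)) = cmass \<rho> ch j"
  "!!J k l s t. J \<in> tuples n N ==> q J \<noteq> 0 ==> k < n ==> l < n ==> k \<noteq> l ==> s \<in> cell N (J k) ==> t \<in> cell N (J l)
    ==> 4 * (2*pi / real N) <= dT s t"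
  "(\<Sum>J\<in>tuples n N. ennreal (q J) * cbound n w N J) <= (\<integral>\<^sup>+ x. cn n w x \<partial>\<gamma>) + ennreal \<delta>"
proof -
 have s\<gamma>: "sets \<gamma> = sets (Mn n)" and p\<gamma>: "prob_space \<gamma>" and mg: "!!i. i < n ==> distr \<gamma> borel (%x. x i) = rho_measure \<rho>"
  using \<gamma> by (auto simp: Pi_rho_def)
 interpret g: prob_space \<gamma> by fact
 interpret R: real_distribution "rho_measure \<rho>" by (rule real_distribution_rho[OF \<rho>])
 have sp: "space \<gamma> = In n" using sets_eq_imp_space_eq[OF s\<gamma>] by simp
 have cm[measurable]: "(%x. x i) \<in> borel_measurable \<gamma>" for i
  using measurable_coord measurable_cong_sets[OF s\<gamma> refl] by blast
 have cnm: "cn n w \<in> borel_measurable \<gamma>" using measurable_cn[OF w] measurable_cong_sets[OF s\<gamma> refl] by blast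
 \<comment> \<open>Equality in the smallness condition of \<open>discrete_swap\<close>.\<close>
 define \<kappa> where "\<kappa> = 1 / (2 * (2 * (real n)\<^sup>2 + 2 * real n))"
 have \<kappa>: "0 < \<kappa>" using n1 by (simp add: \<kappa>_def add_pos_pos)
 obtain r1 where r1: "0 < r1" "!!s. s \<in> Iper ==> measure (rho_measure \<rho>) {t \<in> Iper. dT t s < r1} <= \<kappa>"
  using rho_small_arcs[OF \<rho> \<kappa>] by blast
 obtain a1 where a1: "0 < a1" "measure \<gamma> {x \<in> In n. \<not> tsep n a1 x} <= \<kappa>"
  using near_diagonal_small[OF w s\<gamma> p\<gamma> c \<kappa>] by blast
 define a0 where "a0 = min r1 a1 / 2"
 have a0: "0 < a0" "2 * a0 <= r1" "2 * a0 <= a1" using r1 a1 by (auto simp: a0_def)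
 obtain C where C: "0 <= C" "!!x. x \<in> In n ==> tsep n a0 x ==> cn n w x <= ennreal C"
  using cost_bounded[OF w a0(1)] by blast
 \<comment> \<open>Exchanging mass \<open>b <= \<beta>\<close> creates mass \<open>(n+1) * b\<close>
   of cost at most \<open>C\<close>; this choice keeps that contribution below
   \<open>\<delta>/2\<close>.\<close>
 define \<beta> where "\<beta> = min \<kappa> (\<delta> / (2 * (real n + 1) * (C + 1)))"
 have \<beta>: "0 < \<beta>" "\<beta> <= \<kappa>" using \<kappa> \<delta> C by (auto simp: \<beta>_def intro!: divide_pos_pos mult_pos_pos)
 have \<beta>C: "(real n + 1) * \<beta> * C <= \<delta> / 2"
 proof -
  have "(real n + 1) * \<beta> * C <= (real n + 1) * \<beta> * (C + 1)" using \<beta> by (intro mult_left_mono) auto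
  also have "\<dots> <= (real n + 1) * (\<delta> / (2 * (real n + 1) * (C + 1))) * (C + 1)"
   using C by (intro mult_right_mono mult_left_mono) (auto simp: \<beta>_def)
  also have "\<dots> = \<delta> / 2"
  proof -
   have gen: "A * (\<delta> / (2 * A * D)) * D = \<delta> / 2" if "A \<noteq> 0" "D \<noteq> 0" for A D :: real using that by simp
   show ?thesis by (rule gen) (use C(1) in linarith)+
  qed
  finally show ?thesis .
 qed
 obtain a2 where a2: "0 < a2" "measure \<gamma> {x \<in> In n. \<not> tsep n a2 x} <= \<beta> / 2"
  using near_diagonal_small[OF w s\<gamma> p\<gamma> c, of "\<beta>/2"] \<beta> by auto
 \<comment> \<open>Half of \<open>a2\<close> leaves room for cell diameters: two cells of a tuple
   closer than \<open>a\<close> force points of its box closer than \<open>a + 4*h\<close>, which is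
   at most \<open>a2\<close>.\<close>
 define a where "a = min a0 (a2 / 2)"
 have a: "0 < a" "a <= a0" "2 * a <= a2" using a0 a2 by (auto simp: a_def)
 obtain r0 where r0: "0 < r0" "!!s. s \<in> Iper ==> measure (rho_measure \<rho>) {t \<in> Iper. dT t s < r0} <= \<beta> / (2 * real n)"
  using rho_small_arcs[OF \<rho>, of "\<beta> / (2 * real n)"] \<beta> n1 by auto
 obtain d where d: "0 < d" "!!x y. x \<in> In n ==> y \<in> In n ==> tsep n a x ==> tsep n a y ==> (!!i. i < n ==> \<bar>x i - y i\<bar> <= d) ==>
   cn n w x <= cn n w y + ennreal (\<delta>/2)"
  using cost_unif[OF w a(1), of "\<delta>/2" n] \<delta> by auto
 define \<mu> where "\<mu> = min (min (a/4) (d/2)) (r0/2)"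
 have \<mu>: "0 < \<mu>" using a d r0 by (simp add: \<mu>_def)
 obtain N0 :: nat where N0: "2*pi / \<mu> < real N0" using reals_Archimedean2 by blast
 define N where "N = N0 + 3"
 define h where "h = 2*pi / real N"
 have N3: "3 <= N" by (simp add: N_def)
 have h: "0 < h" "4 * h <= a" "2 * h <= d" "h < r0"
 proof -
  have "2*pi / \<mu> < real N" using N0 by (simp add: N_def)
  hence "h < \<mu>" using \<mu> by (simp add: h_def N_def field_simps)
  thus "4 * h <= a" "2 * h <= d" "h < r0" using r0(1) by (auto simp: \<mu>_def)
  show "0 < h" by (simp add: h_def N_def)
 qed
 have \<rho>0: "!!x. x \<in> Iper ==> 0 <= \<rho> x" using \<rho> by (simp add: prob_density_on_I_def)
 obtain ch :: "nat => real => real" where ch: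
  "!!j. j < N ==> smooth (ch j)" "!!j x. j < N ==> ch j (x + 2*pi) = ch j x"
  "!!x. x \<in> Iper ==> (\<Sum>j<N. (ch j x)\<^sup>2) = 1"
  "!!i j. i < N ==> j < N ==> i \<noteq> j ==> (\<integral>x. indicator Iper x * \<rho> x * (ch i x * ch j x) \<partial>lborel) = 0"
  "!!j x. j < N ==> x \<in> Iper ==> ch j x \<noteq> 0 ==> x \<in> cell N j"
  by (rule partition_exists[OF N3 integrable_rho[OF \<rho>] \<rho>0], assumption, rule that)
 have part: "cell_partition N \<rho> ch" unfolding cell_partition_def using N3 ch by auto
 define V where "V = tuples n N"
 have fV: "finite V" by (simp add: V_def tuples_def finite_PiE)
 have VN: "J i < N" if "J \<in> V" "i < n" for J i using that by (auto simp: V_def tuples_def)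
 \<comment> \<open>A product partition of unity on the cube. Integrated against \<gamma> it gives a
   probability on tuples; summing out all indices but one leaves the square of \<open>ch j\<close>,
   so its marginals are the cell masses.\<close>
 define P where "P J x = (\<Prod>i<n. (ch (J i) (x i))\<^sup>2)" for J and x :: "nat => real"
 have P0: "0 <= P J x" for J x unfolding P_def by (intro prod_nonneg) auto
 have Psum: "(\<Sum>J\<in>V. P J x) = 1" if "x \<in> In n" for x
 proof -
  have "(\<Sum>J\<in>V. P J x) = (\<Prod>i<n. \<Sum>j<N. (ch j (x i))\<^sup>2)"
   unfolding P_def V_def tuples_def by (rule sum_PiE_prod) simp
  also have "\<dots> = 1" using that by (intro prod.neutral) (auto simp: ch(3) In_coord)
  finally show ?thesis .
 qed
 have P1: "P J x <= 1" if "x \<in> In n" "J \<in> V" for J x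
  unfolding Psum[OF that(1), symmetric] using fV P0 that by (intro member_le_sum) auto
 have Pbox: "x \<in> cbox n N J" if "x \<in> In n" "J \<in> V" "P J x \<noteq> 0" for J x
  using that VN[OF that(2)] ch(5) In_coord[OF that(1)] by (auto simp: cbox_def P_def)
 have chm: "ch j \<in> borel_measurable borel" if "j < N" for j by (rule smooth_measurable[OF ch(1)[OF that]])
 have Pm: "P J \<in> borel_measurable \<gamma>" if "J \<in> V" for J
  unfolding P_def using VN[OF that] by (intro borel_measurable_prod borel_measurable_power measurable_compose[OF cm chm]) auto
 have Pi: "integrable \<gamma> (P J)" if "J \<in> V" for J
  using P0 P1[OF _ that] by (intro g.integrable_const_bound[of _ 1] Pm that) (auto simp: sp intro!: AE_I2)
 define p where "p J = integral\<^sup>L \<gamma> (P J)" for J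
 have p0: "0 <= p J" for J unfolding p_def by (intro Bochner_Integration.integral_nonneg P0)
 have psum: "(\<Sum>J\<in>V. p J * f J) = (\<integral>x. (\<Sum>J\<in>V. P J x * f J) \<partial>\<gamma>)" for f
  unfolding p_def using Pi by (subst Bochner_Integration.integral_sum) (auto intro!: sum.cong)
 have p1: "sum p V = 1"
 proof -
  have "sum p V = (\<integral>x. (\<Sum>J\<in>V. P J x) \<partial>\<gamma>)" using psum[of "%_. 1"] by simp
  also have "\<dots> = (\<integral>x. 1 \<partial>\<gamma>)" by (intro Bochner_Integration.integral_cong refl) (simp add: sp Psum)
  finally show ?thesis by (simp add: g.prob_space)
 qed
 have mi: "(\<integral>x. g (x i) \<partial>\<gamma>) = (\<integral>x. indicator Iper x * \<rho> x * g x \<partial>lborel)" if "i < n" "g \<in> borel_measurable borel" for i and g :: "real => real"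
  using integral_distr[OF cm that(2), of i] mg[OF that(1)] integral_rho_measure[OF \<rho> that(2)] by simp
 have marg: "(\<Sum>J\<in>V. p J * of_bool (J i = j)) = cmass \<rho> ch j" if ij: "i < n" "j < N" for i j
 proof -
  have "(\<Sum>J\<in>V. P J x * of_bool (J i = j)) = (ch j (x i))\<^sup>2" if x: "x \<in> In n" for x
  proof -
   have "(\<Sum>J\<in>V. P J x * of_bool (J i = j)) = (\<Sum>J\<in>V. \<Prod>k<n. (ch (J k) (x k))\<^sup>2 * (if k = i then of_bool (J k = j) else 1))"
   proof (rule sum.cong[OF refl])
    fix J
    have "(\<Prod>k<n. if k = i then of_bool (J k = j) else 1) = (of_bool (J i = j) :: real)" using ij by (subst prod.delta) auto
    thus "P J x * of_bool (J i = j) = (\<Prod>k<n. (ch (J k) (x k))\<^sup>2 * (if k = i then of_bool (J k = j) else 1))"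
     by (simp add: P_def prod.distrib)
   qed
   also have "\<dots> = (\<Prod>k<n. \<Sum>l<N. (ch l (x k))\<^sup>2 * (if k = i then of_bool (l = j) else 1))"
    unfolding V_def tuples_def by (rule sum_PiE_prod) simp
   also have "\<dots> = (\<Prod>k<n. if k = i then (ch j (x k))\<^sup>2 else 1)"
   proof (rule prod.cong[OF refl])
    fix k assume k: "k \<in> {..<n}"
    have "(\<Sum>l<N. (ch l (x k))\<^sup>2 * of_bool (l = j)) = (ch j (x k))\<^sup>2"
     using ij by (simp add: of_bool_def if_distrib cong: if_cong)
    thus "(\<Sum>l<N. (ch l (x k))\<^sup>2 * (if k = i then of_bool (l = j) else 1)) = (if k = i then (ch j (x k))\<^sup>2 else 1)"
     using k x by (cases "k = i") (simp_all add: ch(3) In_coord)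
   qed
   also have "\<dots> = (ch j (x i))\<^sup>2" using ij by (subst prod.delta) auto
   finally show ?thesis .
  qed
  hence "(\<Sum>J\<in>V. p J * of_bool (J i = j)) = (\<integral>x. (ch j (x i))\<^sup>2 \<partial>\<gamma>)"
   unfolding psum by (intro Bochner_Integration.integral_cong refl) (simp add: sp)
  also have "\<dots> = cmass \<rho> ch j"
   unfolding cmass_def using chm[OF ij(2)] by (intro mi[OF ij(1)]) auto
  finally show ?thesis .
 qed
 \<comment> \<open>\<open>P J\<close> vanishes on the cube outside the box of \<open>J\<close>.
   Hence the total weight of the tuples with property \<open>Q\<close> is at most the mass of any
   event that contains all their boxes.\<close>
 have event: "(\<Sum>J\<in>V. p J * of_bool (Q J)) <= measure \<gamma> Ev"
  if Ev: "Ev \<in> sets \<gamma>" and imp: "!!J x. J \<in> V ==> Q J ==> x \<in> cbox n N J ==> x \<in> Ev" for Q Ev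
 proof -
  have "(\<Sum>J\<in>V. p J * of_bool (Q J)) <= (\<integral>x. indicator Ev x \<partial>\<gamma>)"
   unfolding psum
  proof (rule integral_mono)
   show "integrable \<gamma> (%x. \<Sum>J\<in>V. P J x * of_bool (Q J))" using Pi by (intro Bochner_Integration.integrable_sum integrable_mult_left)
   show "integrable \<gamma> (indicator Ev :: _ => real)" using Ev by (intro g.integrable_const_bound[of _ 1]) auto
   fix x assume "x \<in> space \<gamma>"
   hence x: "x \<in> In n" by (simp add: sp)
   show "(\<Sum>J\<in>V. P J x * of_bool (Q J)) <= indicator Ev x"
   proof (cases "x \<in> Ev")
    case True
    have "(\<Sum>J\<in>V. P J x * of_bool (Q J)) <= (\<Sum>J\<in>V. P J x)" using P0 by (intro sum_mono) auto
    thus ?thesis using True Psum[OF x] by simp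
   next
    case False
    hence "P J x * of_bool (Q J) = 0" if "J \<in> V" for J using imp[OF that] Pbox[OF x that] by auto
    hence "(\<Sum>J\<in>V. P J x * of_bool (Q J)) = 0" by (intro sum.neutral ballI)
    thus ?thesis using False by simp
   qed
  qed
  thus ?thesis using Ev by simp
 qed
 have sepm: "{x \<in> In n. \<not> tsep n b x} \<in> sets \<gamma>" for b
 proof -
  have "{x \<in> In n. \<not> tsep n b x} = {x \<in> space \<gamma>. \<not> (\<forall>i\<in>{..<n}. \<forall>j\<in>{..<n}. i \<noteq> j --> b <= dT (x i) (x j))}"
   by (auto simp: tsep_def sp)
  also have "\<dots> \<in> sets \<gamma>" by measurable
  finally show ?thesis .
 qed
 have cI: "x \<in> Iper" if "x \<in> cell N j" for x j using that by (simp add: cell_def)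
 have cellh: "dT x y <= 2 * h" if "j < N" "x \<in> cell N j" "y \<in> cell N j" for x y j
  unfolding h_def by (rule cell_dT(1)[OF N3 that])
 have far: "\<not> tsep n (b + 4 * h) x" if J: "J \<in> V" "x \<in> cbox n N J" and kl: "k < n" "l < n" "k \<noteq> l"
  and st: "s \<in> cell N (J k)" "t \<in> cell N (J l)" "dT s t < b" for J x k l s t b
 proof -
  have xk: "x k \<in> cell N (J k)" "x l \<in> cell N (J l)" using J kl by (auto simp: cbox_def)
  have "dT (x k) s <= 2 * h" "dT t (x l) <= 2 * h"
   using cellh[OF VN[OF J(1) kl(1)] xk(1) st(1)] cellh[OF VN[OF J(1) kl(2)] st(2) xk(2)] by auto
  moreover have "dT (x k) (x l) <= dT (x k) s + (dT s t + dT t (x l))"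
   using dT_triangle[OF cI[OF xk(1)] cI[OF st(1)] cI[OF xk(2)]] dT_triangle[OF cI[OF st(1)] cI[OF st(2)] cI[OF xk(2)]] by linarith
  ultimately have "dT (x k) (x l) < b + 4 * h" using st by linarith
  thus ?thesis using tsepD[of n "b + 4 * h" x k l] kl by linarith
 qed
 have tsep_mono: "tsep n b x ==> b' <= b ==> tsep n b' x" for b b' x by (force simp: tsep_def)
 define RR where "RR b i j \<longleftrightarrow> (\<forall>s\<in>cell N i. \<forall>t\<in>cell N j. b <= dT s t)" for b i j
 have RRsym: "RR b i j = RR b j i" for b i j unfolding RR_def by (subst dT_sym) blast
 have boxsep: "tsep n b x" if "x \<in> cbox n N J" "\<forall>k<n. \<forall>l<n. k \<noteq> l --> RR b (J k) (J l)" for b x J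
  using that by (auto simp: tsep_def cbox_def RR_def)
 have nsep: "(\<Sum>J\<in>V. p J * of_bool (\<not> (\<forall>k<n. \<forall>l<n. k \<noteq> l --> RR b (J k) (J l)))) <= measure \<gamma> {x \<in> In n. \<not> tsep n b' x}"
  if "b + 4 * h <= b'" for b b'
 proof (rule event[OF sepm])
  fix J x assume J: "J \<in> V" "\<not> (\<forall>k<n. \<forall>l<n. k \<noteq> l --> RR b (J k) (J l))" "x \<in> cbox n N J"
  then obtain k l s t where "k < n" "l < n" "k \<noteq> l" "s \<in> cell N (J k)" "t \<in> cell N (J l)" "dT s t < b"
   unfolding RR_def by (auto simp: not_le)
  hence "\<not> tsep n (b + 4 * h) x" using far[OF J(1,3)] by blast
  thus "x \<in> {x \<in> In n. \<not> tsep n b' x}" using J tsep_mono[OF _ that] by (auto simp: cbox_def)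
 qed
 have cell_mass: "(\<Sum>l<N. cmass \<rho> ch l * of_bool (Q l)) <= measure (rho_measure \<rho>) Ev"
  if Ev: "Ev \<in> sets borel" and imp: "!!l x. l < N ==> Q l ==> x \<in> cell N l ==> x \<in> Ev" for Q Ev
 proof -
  have "(\<Sum>l<N. cmass \<rho> ch l * of_bool (Q l)) = (\<Sum>J\<in>V. p J * of_bool (Q (J 0)))"
  proof -
   have "(\<Sum>l<N. cmass \<rho> ch l * of_bool (Q l)) = (\<Sum>l<N. \<Sum>J\<in>V. p J * (of_bool (J 0 = l) * of_bool (Q l)))"
    using n1 by (intro sum.cong refl) (simp add: marg[symmetric] sum_distrib_right mult.assoc)
   also have "\<dots> = (\<Sum>J\<in>V. \<Sum>l<N. p J * (of_bool (J 0 = l) * of_bool (Q l)))" by (rule sum.swap)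
   also have "\<dots> = (\<Sum>J\<in>V. p J * of_bool (Q (J 0)))"
    using VN n1 by (intro sum.cong refl) (simp add: sum_distrib_left[symmetric] of_bool_def if_distrib[of "%z. z * _"] cong: if_cong)
   finally show ?thesis .
  qed
  also have "\<dots> <= measure \<gamma> ((%x. x 0) -` Ev \<inter> space \<gamma>)"
  proof (rule event)
   fix J x assume "J \<in> V" "Q (J 0)" "x \<in> cbox n N J"
   thus "x \<in> (%x. x 0) -` Ev \<inter> space \<gamma>" using imp[of "J 0" "x 0"] n1 VN[of J 0] by (auto simp: cbox_def sp)
  qed (use Ev in \<open>auto intro: measurable_sets[OF cm]\<close>)
  also have "\<dots> = measure (rho_measure \<rho>) Ev"
   using measure_distr[OF cm Ev, of 0] mg[of 0] n1 by simp
  finally show ?thesis .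
 qed
 have arcm: "{t \<in> Iper. dT t s < r} \<in> sets borel" for s r
 proof -
  have "{t \<in> Iper. dT t s < r} = {t \<in> space borel. t \<in> Iper \<and> dT t s < r}" by simp
  also have "\<dots> \<in> sets borel" by measurable
  finally show ?thesis .
 qed
 \<comment> \<open>Tuples through the last cell count as bad even if separated, since points on
   either side of the seam need not have similar cost. The choice of \<open>r0\<close> makes their
   mass small.\<close>
 define B where "B = {J \<in> V. \<not> (\<forall>k<n. \<forall>l<n. k \<noteq> l --> RR a (J k) (J l)) \<or> (\<exists>i<n. J i = N - 1)}"
 define b where "b = (\<Sum>J\<in>B. p J)"
 have b\<beta>: "b <= \<beta>"
 proof -
  have "b = (\<Sum>J\<in>V. p J * of_bool (J \<in> B))"
   unfolding b_def using fV by (simp add: of_bool_def if_distrib sum.If_cases B_def Int_def cong: if_cong conj_cong)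
  also have "\<dots> <= (\<Sum>J\<in>V. p J * of_bool (\<not> (\<forall>k<n. \<forall>l<n. k \<noteq> l --> RR a (J k) (J l))) + (\<Sum>i<n. p J * of_bool (J i = N - 1)))"
  proof (rule sum_mono)
   fix J assume "J \<in> V"
   have nn: "0 <= (\<Sum>i<n. p J * of_bool (J i = N - 1))" using p0 by (auto intro!: sum_nonneg)
   have "p J <= (\<Sum>i<n. p J * of_bool (J i = N - 1))" if "\<exists>i<n. J i = N - 1"
   proof -
    from that obtain i where "i < n" "J i = N - 1" by blast
    thus ?thesis using member_le_sum[of i "{..<n}" "%i. p J * of_bool (J i = N - 1)"] p0 by auto
   qed
   note wrap = this
   show "p J * of_bool (J \<in> B) <= p J * of_bool (\<not> (\<forall>k<n. \<forall>l<n. k \<noteq> l --> RR a (J k) (J l))) + (\<Sum>i<n. p J * of_bool (J i = N - 1))"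
   proof (cases "J \<in> B \<and> (\<exists>i<n. J i = N - 1)")
    case True
    hence "p J <= (\<Sum>i<n. p J * of_bool (J i = N - 1))" using wrap by blast
    moreover have "0 <= p J * of_bool Q" "p J * of_bool Q <= p J" for Q using p0[of J] by auto
    ultimately show ?thesis by (meson add_increasing order_trans)
   next
    case False
    hence "of_bool (J \<in> B) <= (of_bool (\<not> (\<forall>k<n. \<forall>l<n. k \<noteq> l --> RR a (J k) (J l))) :: real)" by (auto simp: B_def)
    hence "p J * of_bool (J \<in> B) <= p J * of_bool (\<not> (\<forall>k<n. \<forall>l<n. k \<noteq> l --> RR a (J k) (J l)))"
     using p0[of J] by (rule mult_left_mono)
    thus ?thesis using nn by linarith
   qed
  qed
  also have "\<dots> = (\<Sum>J\<in>V. p J * of_bool (\<not> (\<forall>k<n. \<forall>l<n. k \<noteq> l --> RR a (J k) (J l)))) + (\<Sum>i<n. \<Sum>J\<in>V. p J * of_bool (J i = N - 1))"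
   unfolding sum.distrib by (rule arg_cong2[where f="(+)", OF refl sum.swap])
  also have "\<dots> <= \<beta> / 2 + (\<Sum>i<n. \<beta> / (2 * real n))"
  proof (intro add_mono sum_mono)
   have "a + 4 * h <= a2" using a h by linarith
   from nsep[OF this] show "(\<Sum>J\<in>V. p J * of_bool (\<not> (\<forall>k<n. \<forall>l<n. k \<noteq> l --> RR a (J k) (J l)))) <= \<beta> / 2" using a2(2) by linarith
   fix i assume "i \<in> {..<n}"
   hence "(\<Sum>J\<in>V. p J * of_bool (J i = N - 1)) = cmass \<rho> ch (N - 1)" using marg[of i "N - 1"] N3 by simp
   also have "\<dots> = (\<Sum>l<N. cmass \<rho> ch l * of_bool (l = N - 1))" using N3 by (simp add: of_bool_def if_distrib cong: if_cong)
   also have "\<dots> <= measure (rho_measure \<rho>) {t \<in> Iper. dT t 0 < r0}"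
   proof (rule cell_mass[OF arcm])
    fix l x assume "l < N" "l = N - 1" "x \<in> cell N l"
    thus "x \<in> {t \<in> Iper. dT t 0 < r0}" using cell_dT(3)[OF N3, of l x x] h N3 cI[of x l] by (auto simp: h_def)
   qed
   also have "\<dots> <= \<beta> / (2 * real n)" by (rule r0(2)) (simp add: Iper_def)
   finally show "(\<Sum>J\<in>V. p J * of_bool (J i = N - 1)) <= \<beta> / (2 * real n)" .
  qed
  also have "\<dots> = \<beta>" using n1 by simp
  finally show ?thesis .
 qed
 have b0: "0 <= b" unfolding b_def using p0 by (intro sum_nonneg)
 obtain q1 q2 where q1: "!!J. J \<in> V ==> 0 <= q1 J \<and> q1 J <= p J" "!!J. J \<in> B ==> q1 J = 0"
  and q2: "!!J. J \<in> V ==> 0 <= q2 J" "!!J. J \<in> V ==> q2 J \<noteq> 0 ==> \<forall>k<n. \<forall>l<n. k \<noteq> l --> RR a0 (J k) (J l)"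
   "sum q2 V = (real n + 1) * b"
  and qm: "!!i j. i < n ==> j < N ==> (\<Sum>J\<in>V. (q1 J + q2 J) * of_bool (J i = j)) = cmass \<rho> ch j"
 proof (rule discrete_swap[where n=n and N=N and p=p and R="RR a0" and m="cmass \<rho> ch" and \<kappa>=\<kappa> and B=B and b=b, folded tuples_def V_def])
  show "(\<Sum>J\<in>V. p J * of_bool (\<not> (\<forall>k<n. \<forall>l<n. k \<noteq> l --> RR a0 (J k) (J l)))) <= \<kappa>"
   using nsep[of a0 a1] a0 a h a1(2) by linarith
  show "(2 * (real n)\<^sup>2 + 2 * real n) * \<kappa> <= 1 / 2" using n1 by (simp add: \<kappa>_def)
  show "(\<Sum>l<N. cmass \<rho> ch l * of_bool (\<not> RR a0 j l)) <= \<kappa>" if j: "j < N" for j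
  proof (cases "cell N j = {}")
   case True thus ?thesis using \<kappa> by (simp add: RR_def)
  next
   case False
   then obtain s0 where s0: "s0 \<in> cell N j" by blast
   have "(\<Sum>l<N. cmass \<rho> ch l * of_bool (\<not> RR a0 j l)) <= measure (rho_measure \<rho>) {t \<in> Iper. dT t s0 < r1}"
   proof (rule cell_mass[OF arcm])
    fix l y assume l: "l < N" "\<not> RR a0 j l" "y \<in> cell N l"
    then obtain s t where st: "s \<in> cell N j" "t \<in> cell N l" "dT s t < a0" unfolding RR_def by (auto simp: not_le)
    have "dT y t <= 2 * h" "dT s s0 <= 2 * h" using cellh[OF l(1,3) st(2)] cellh[OF j st(1) s0] by auto
    moreover have "dT y s0 <= dT y t + dT t s0" "dT t s0 <= dT t s + dT s s0"
     using l st s0 cI by (auto intro!: dT_triangle)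
    ultimately have "dT y s0 < r1" using st(3) dT_sym[of s t] a0 a h by linarith
    thus "y \<in> {t \<in> Iper. dT t s0 < r1}" using cI[OF l(3)] by simp
   qed
   also have "\<dots> <= \<kappa>" by (rule r1(2)[OF cI[OF s0]])
   finally show ?thesis .
  qed
 qed (use p0 p1 marg RRsym b\<beta> \<beta> in \<open>auto simp: b_def B_def\<close>)
 have RRmono: "RR b' i j ==> b'' <= b' ==> RR b'' i j" for b' b'' i j unfolding RR_def by force
 define q where "q J = q1 J + q2 J" for J
 have qsep: "RR a (J k) (J l)" if "J \<in> V" "q J \<noteq> 0" "k < n" "l < n" "k \<noteq> l" for J k l
 proof (cases "q1 J = 0")
  case True
  hence "q2 J \<noteq> 0" using that by (simp add: q_def)
  thus ?thesis using q2(2)[OF that(1)] that a RRmono by blast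
 next
  case False
  hence "J \<notin> B" using q1 by blast
  thus ?thesis using that by (auto simp: B_def)
 qed
 \<comment> \<open>Exchanged tuples may contain the last cell; for them only the uniform bound
   \<open>C\<close> is used.\<close>
 have bd2: "cbound n w N J <= ennreal C" if "\<forall>k<n. \<forall>l<n. k \<noteq> l --> RR a0 (J k) (J l)" for J
  unfolding cbound_def using boxsep[OF _ that] by (intro SUP_least C(2)) (auto simp: cbox_def)
 \<comment> \<open>Here the last cell is absent, so points of one box are within \<open>d\<close> in
   every coordinate and the modulus of continuity at separation \<open>a\<close> applies.\<close>
 have bd1: "cbound n w N J <= cn n w y + ennreal (\<delta>/2)" if J: "J \<in> V" "J \<notin> B" and y: "y \<in> cbox n N J" for J y
  unfolding cbound_def
 proof (rule SUP_least)
  fix x assume x: "x \<in> cbox n N J"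
  have Js: "\<forall>k<n. \<forall>l<n. k \<noteq> l --> RR a (J k) (J l)" "!!i. i < n ==> Suc (J i) < N"
  proof -
   show "\<forall>k<n. \<forall>l<n. k \<noteq> l --> RR a (J k) (J l)" using J unfolding B_def by blast
   fix i assume i: "i < n"
   hence "J i \<noteq> N - 1" using J by (simp add: B_def)
   thus "Suc (J i) < N" using VN[OF J(1) i] by linarith
  qed
  show "cn n w x <= cn n w y + ennreal (\<delta>/2)"
  proof (rule d(2))
   show "tsep n a x" "tsep n a y" using boxsep[OF x Js(1)] boxsep[OF y Js(1)] by auto
   show "\<bar>x i - y i\<bar> <= d" if "i < n" for i
    using cell_dT(2)[OF N3 VN[OF J(1) that], of "x i" "y i"] Js(2)[OF that] x y that h by (auto simp: cbox_def h_def)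
  qed (use x y in \<open>auto simp: cbox_def\<close>)
 qed
 have "(\<Sum>J\<in>V. ennreal (q1 J) * cbound n w N J) <= (\<Sum>J\<in>V. \<integral>\<^sup>+ x. ennreal (P J x) * (cn n w x + ennreal (\<delta>/2)) \<partial>\<gamma>)"
 proof (rule sum_mono)
  fix J assume J: "J \<in> V"
  show "ennreal (q1 J) * cbound n w N J <= (\<integral>\<^sup>+ x. ennreal (P J x) * (cn n w x + ennreal (\<delta>/2)) \<partial>\<gamma>)"
  proof (cases "J \<in> B")
   case True thus ?thesis using q1(2) by simp
  next
   case False
   have "ennreal (q1 J) * cbound n w N J <= ennreal (p J) * cbound n w N J" using q1(1)[OF J] by (intro mult_right_mono ennreal_leI) auto
   also have "\<dots> = (\<integral>\<^sup>+ x. ennreal (P J x) \<partial>\<gamma>) * cbound n w N J"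
    unfolding p_def using P0 Pi[OF J] by (subst nn_integral_eq_integral) auto
   also have "\<dots> = (\<integral>\<^sup>+ x. ennreal (P J x) * cbound n w N J \<partial>\<gamma>)" using Pm[OF J] by (subst nn_integral_multc) auto
   also have "\<dots> <= (\<integral>\<^sup>+ x. ennreal (P J x) * (cn n w x + ennreal (\<delta>/2)) \<partial>\<gamma>)"
   proof (rule nn_integral_mono)
    fix x assume x: "x \<in> space \<gamma>"
    show "ennreal (P J x) * cbound n w N J <= ennreal (P J x) * (cn n w x + ennreal (\<delta>/2))"
    proof (cases "P J x = 0")
     case False': False
     thus ?thesis using bd1[OF J False Pbox[OF _ J False']] x sp by (intro mult_left_mono) auto
    qed simp
   qed
   finally show ?thesis .
  qed
 qed
 also have "\<dots> = (\<integral>\<^sup>+ x. (\<Sum>J\<in>V. ennreal (P J x) * (cn n w x + ennreal (\<delta>/2))) \<partial>\<gamma>)"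
  using Pm cnm by (subst nn_integral_sum) auto
 also have "\<dots> = (\<integral>\<^sup>+ x. cn n w x + ennreal (\<delta>/2) \<partial>\<gamma>)"
 proof (rule nn_integral_cong)
  fix x assume x: "x \<in> space \<gamma>"
  have "(\<Sum>J\<in>V. ennreal (P J x)) = 1" using Psum[of x] x sp P0 by (simp add: sum_ennreal)
  thus "(\<Sum>J\<in>V. ennreal (P J x) * (cn n w x + ennreal (\<delta>/2))) = cn n w x + ennreal (\<delta>/2)"
   by (simp add: sum_distrib_right[symmetric])
 qed
 also have "\<dots> = (\<integral>\<^sup>+ x. cn n w x \<partial>\<gamma>) + ennreal (\<delta>/2)"
  using cnm by (subst nn_integral_add) (auto simp: g.emeasure_space_1)
 finally have S1: "(\<Sum>J\<in>V. ennreal (q1 J) * cbound n w N J) <= (\<integral>\<^sup>+ x. cn n w x \<partial>\<gamma>) + ennreal (\<delta>/2)" .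
 have "(\<Sum>J\<in>V. ennreal (q2 J) * cbound n w N J) <= (\<Sum>J\<in>V. ennreal (q2 J) * ennreal C)"
 proof (rule sum_mono)
  fix J assume J: "J \<in> V"
  show "ennreal (q2 J) * cbound n w N J <= ennreal (q2 J) * ennreal C"
   using bd2[OF q2(2)[OF J]] by (cases "q2 J = 0") (auto intro!: mult_left_mono)
 qed
 also have "\<dots> = ennreal ((real n + 1) * b * C)"
  using q2 C by (simp add: sum_distrib_right[symmetric] sum_ennreal ennreal_mult[symmetric] sum_nonneg)
 also have "\<dots> <= ennreal (\<delta>/2)"
 proof (rule ennreal_leI)
  have "(real n + 1) * b * C <= (real n + 1) * \<beta> * C" using b\<beta> C by (intro mult_right_mono mult_left_mono) auto
  thus "(real n + 1) * b * C <= \<delta>/2" using \<beta>C by linarith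
 qed
 finally have S2: "(\<Sum>J\<in>V. ennreal (q2 J) * cbound n w N J) <= ennreal (\<delta>/2)" .
 show thesis
 proof (rule that[of N ch q, folded V_def, OF part])
  show "0 <= q J" if "J \<in> V" for J using q1(1)[OF that] q2(1)[OF that] by (simp add: q_def)
  show "(\<Sum>J\<in>V. q J * of_bool (J i = j)) = cmass \<rho> ch j" if "i < n" "j < N" for i j using qm[OF that] by (simp add: q_def)
  show "4 * (2*pi / real N) <= dT s t" if "J \<in> V" "q J \<noteq> 0" "k < n" "l < n" "k \<noteq> l" "s \<in> cell N (J k)" "t \<in> cell N (J l)" for J k l s t
  proof -
   have "a <= dT s t" using qsep[OF that(1-5)] that(6,7) by (auto simp: RR_def)
   thus ?thesis using h(2) by (simp add: h_def)
  qed
  have "(\<Sum>J\<in>V. ennreal (q J) * cbound n w N J) = (\<Sum>J\<in>V. ennreal (q1 J) * cbound n w N J) + (\<Sum>J\<in>V. ennreal (q2 J) * cbound n w N J)"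
   unfolding sum.distrib[symmetric] q_def using q1(1) q2(1) by (intro sum.cong refl) (simp add: ennreal_plus distrib_right)
  also have "\<dots> <= ((\<integral>\<^sup>+ x. cn n w x \<partial>\<gamma>) + ennreal (\<delta>/2)) + ennreal (\<delta>/2)" using S1 S2 by (rule add_mono)
  also have "\<dots> = (\<integral>\<^sup>+ x. cn n w x \<partial>\<gamma>) + ennreal \<delta>"
   using \<delta> by (simp add: add.assoc ennreal_plus[symmetric] del: ennreal_plus)
  finally show "(\<Sum>J\<in>V. ennreal (q J) * cbound n w N J) <= (\<integral>\<^sup>+ x. cn n w x \<partial>\<gamma>) + ennreal \<delta>" .
 qed
qed

section \<open>The upper bound\<close>

lemma cn_permute:
 assumes s: "\<sigma> permutes {..<n}"
 shows "cn n w (x \<circ> \<sigma>) = cn n w x"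
proof -
 have c: "cn n w y = (\<Sum>i<n. \<Sum>j<n. if j = i then 0 else w (y i) (y j))" for y
  unfolding cn_def by (intro sum.cong[OF refl] sum.mono_neutral_cong_left) auto
 have inj: "\<sigma> j = \<sigma> i \<longleftrightarrow> j = i" for i j using permutes_inj[OF s] by (auto dest: injD)
 have "cn n w (x \<circ> \<sigma>) = (\<Sum>i<n. \<Sum>j<n. if \<sigma> j = \<sigma> i then 0 else w (x (\<sigma> i)) (x (\<sigma> j)))"
  unfolding c comp_apply inj ..
 also have "\<dots> = (\<Sum>i<n. \<Sum>j<n. if j = \<sigma> i then 0 else w (x (\<sigma> i)) (x j))"
 proof (rule sum.cong[OF refl])
  fix i
  show "(\<Sum>j<n. if \<sigma> j = \<sigma> i then 0 else w (x (\<sigma> i)) (x (\<sigma> j))) = (\<Sum>j<n. if j = \<sigma> i then 0 else w (x (\<sigma> i)) (x j))"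
   using sum.permute[OF s, of "%j. if j = \<sigma> i then 0 else w (x (\<sigma> i)) (x j)"] by (simp add: o_def)
 qed
 also have "\<dots> = cn n w x"
  unfolding c using sum.permute[OF s, of "%i. \<Sum>j<n. if j = i then 0 else w (x i) (x j)"] by (simp add: o_def)
 finally show ?thesis .
qed

lemma In_sets_Rn: "In n \<in> sets (Rn n)"
 unfolding In_def Rn_def by (intro sets_PiM_I_finite) auto

text \<open>Moves integrals over the cube to the full space, where local square integrability is
  available.\<close>

lemma nn_integral_Mn_Rn:
 assumes h: "h \<in> borel_measurable (Mn n)"
 shows "(\<integral>\<^sup>+ x. h x \<partial>Mn n) = (\<integral>\<^sup>+ x. h x * indicator (In n) x \<partial>Rn n)"
proof -
 let ?R = "restrict_space (Rn n) (In n)"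
 have sp: "space ?R = In n" using In_subset_Rspace by (auto simp: space_restrict_space)
 have id: "(%x. x) \<in> measurable ?R (Mn n)"
 proof (rule measurable_into_Mn)
  fix i assume "i < n"
  thus "(%x. x i) \<in> borel_measurable ?R" by (intro measurable_restrict_space1 measurable_coord_Rn)
 qed (simp add: sp)
 have "distr ?R (Mn n) (%x. x) = PiM {..<n} (%_. mI)"
 proof (rule PM.PiM_eqI)
  fix A :: "nat => real set" assume A: "!!i. i \<in> {..<n} ==> A i \<in> sets mI"
  have A': "A i \<in> sets borel" "A i \<subseteq> Iper" if "i < n" for i
   using A[of i] that by (auto simp: sets_mI sets_restrict_space)
  have sub: "PiE {..<n} A \<subseteq> In n" using A' by (auto simp: In_def PiE_def Pi_def)
  have "emeasure (distr ?R (Mn n) (%x. x)) (PiE {..<n} A) = emeasure ?R (PiE {..<n} A \<inter> In n)"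
   using A by (subst emeasure_distr[OF id]) (auto simp: sp Mn_def intro!: sets_PiM_I_finite)
  also have "\<dots> = emeasure (Rn n) (PiE {..<n} A)"
   using sub In_sets_Rn by (subst emeasure_restrict_space) (auto simp: Int_absorb2 In_subset_Rspace)
  also have "\<dots> = (\<Prod>i<n. emeasure lborel (A i))" unfolding Rn_def using A' by (intro PR.emeasure_PiM) auto
  also have "\<dots> = (\<Prod>i<n. emeasure mI (A i))"
   using A' by (intro prod.cong refl) (auto simp: mI_def emeasure_restrict_space)
  finally show "emeasure (distr ?R (Mn n) (%x. x)) (PiE {..<n} A) = (\<Prod>i\<in>{..<n}. emeasure mI (A i))" .
 qed (auto simp: Mn_def)
 hence eq: "distr ?R (Mn n) (%x. x) = Mn n" by (simp add: Mn_def)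
 have "(\<integral>\<^sup>+ x. h x \<partial>distr ?R (Mn n) (%x. x)) = (\<integral>\<^sup>+ x. h x \<partial>?R)" by (rule nn_integral_distr[OF id]) (simp add: h)
 hence "(\<integral>\<^sup>+ x. h x \<partial>Mn n) = (\<integral>\<^sup>+ x. h x \<partial>?R)" unfolding eq .
 also have "\<dots> = (\<integral>\<^sup>+ x. h x * indicator (In n) x \<partial>Rn n)"
  using In_sets_Rn by (intro nn_integral_restrict_space) (auto simp: Int_absorb2 In_subset_Rspace)
 finally show ?thesis .
qed

lemma L2loc_Mn:
 assumes f: "L2loc n f"
 shows "f \<in> borel_measurable (Mn n)" "(\<integral>\<^sup>+ x. ennreal ((cmod (f x))\<^sup>2) \<partial>Mn n) < \<infinity>"
proof -
 have "f \<in> borel_measurable (Rn n)" using f by (simp add: L2loc_def)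
 from measurable_compose[OF measurable_Mn_Rn this] show m[measurable]: "f \<in> borel_measurable (Mn n)" .
 have "(\<integral>\<^sup>+ x. ennreal ((cmod (f x))\<^sup>2) \<partial>Mn n) = (\<integral>\<^sup>+ x. ennreal ((cmod (f x))\<^sup>2) * indicator (In n) x \<partial>Rn n)"
  by (rule nn_integral_Mn_Rn) measurable
 also have "\<dots> <= (\<integral>\<^sup>+ x. indicator {x. \<forall>i<n. \<bar>x i\<bar> <= 2*pi} x * ennreal ((cmod (f x))\<^sup>2) \<partial>Rn n)"
  by (intro nn_integral_mono) (auto simp: In_def Iper_def PiE_def Pi_def split: split_indicator)
 also have "\<dots> < \<infinity>" using f[unfolded L2loc_def, THEN conjunct2, rule_format, of "2*pi"] .
 finally show "(\<integral>\<^sup>+ x. ennreal ((cmod (f x))\<^sup>2) \<partial>Mn n) < \<infinity>" .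
qed

lemma kinetic_finite:
 assumes "H1full n f G"
 shows "(\<integral>\<^sup>+ x. ennreal (\<Sum>i<n. (cmod (G i x))\<^sup>2) \<partial>Mn n) < \<infinity>"
proof -
 have L: "L2loc n (G i)" if "i < n" for i using assms that by (simp add: H1full_def)
 have "(\<integral>\<^sup>+ x. ennreal (\<Sum>i<n. (cmod (G i x))\<^sup>2) \<partial>Mn n) = (\<integral>\<^sup>+ x. (\<Sum>i<n. ennreal ((cmod (G i x))\<^sup>2)) \<partial>Mn n)"
  by (simp add: sum_ennreal)
 also have "\<dots> = (\<Sum>i<n. \<integral>\<^sup>+ x. ennreal ((cmod (G i x))\<^sup>2) \<partial>Mn n)"
 proof (rule nn_integral_sum)
  fix i assume "i \<in> {..<n}"
  hence [measurable]: "G i \<in> borel_measurable (Mn n)" using L2loc_Mn(1)[OF L] by simp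
  show "(%x. ennreal ((cmod (G i x))\<^sup>2)) \<in> borel_measurable (Mn n)" by measurable
 qed
 also have "\<dots> < \<infinity>" using L2loc_Mn(2)[OF L] by (simp add: less_top[symmetric])
 finally show ?thesis .
qed

lemma lieb_energy_term:
 assumes w: "assumptionA w" and H: "H1full n \<Psi> G" and m: "\<Psi> \<in> borel_measurable (Mn n)"
 shows "(\<integral>\<^sup>+ x. ennreal \<epsilon> * ennreal (\<Sum>i<n. (cmod (G i x))\<^sup>2) + cn n w x * ennreal ((cmod (\<Psi> x))\<^sup>2) \<partial>Mn n)
  = ennreal \<epsilon> * (\<integral>\<^sup>+ x. ennreal (\<Sum>i<n. (cmod (G i x))\<^sup>2) \<partial>Mn n) + (\<integral>\<^sup>+ x. cn n w x * ennreal ((cmod (\<Psi> x))\<^sup>2) \<partial>Mn n)"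
proof -
 have Gm: "(%x. \<Sum>i<n. (cmod (G i x))\<^sup>2) \<in> borel_measurable (Mn n)"
 proof (rule borel_measurable_sum)
  fix i assume "i \<in> {..<n}"
  hence [measurable]: "G i \<in> borel_measurable (Mn n)" using H by (auto simp: H1full_def intro: L2loc_Mn)
  show "(%x. (cmod (G i x))\<^sup>2) \<in> borel_measurable (Mn n)" by measurable
 qed
 note [measurable] = Gm m measurable_cn[OF w]
 show ?thesis by (subst nn_integral_add) (auto simp: nn_integral_cmult)
qed

lemma same_image_permutes:
 fixes n :: nat and J J' :: "nat => nat"
 assumes "inj_on J {..<n}" "inj_on J' {..<n}" "J ` {..<n} = J' ` {..<n}"
 obtains \<pi> where "\<pi> permutes {..<n}" "!!i. i < n ==> J' i = J (\<pi> i)"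
proof -
 define \<pi> where "\<pi> i = (if i < n then inv_into {..<n} J (J' i) else i)" for i
 have im: "J' i \<in> J ` {..<n}" if "i < n" for i using assms(3) that by auto
 have J\<pi>: "J (\<pi> i) = J' i" "\<pi> i < n" if "i < n" for i
  using f_inv_into_f[OF im[OF that]] inv_into_into[OF im[OF that]] that by (auto simp: \<pi>_def)
 have "inj_on \<pi> {..<n}"
 proof (rule inj_onI)
  fix i j assume "i \<in> {..<n}" "j \<in> {..<n}" "\<pi> i = \<pi> j"
  thus "i = j" using J\<pi>[of i] J\<pi>[of j] assms(2) by (auto dest: inj_onD)
 qed
 moreover have "\<pi> ` {..<n} \<subseteq> {..<n}" using J\<pi>(2) by auto
 ultimately have "bij_betw \<pi> {..<n} {..<n}" using endo_inj_surj[of "{..<n}" \<pi>] by (simp add: bij_betw_def)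
 hence "\<pi> permutes {..<n}" by (rule bij_imp_permutes) (simp add: \<pi>_def)
 thus thesis by (rule that) (simp add: J\<pi>)
qed

lemma slater_unit:
 assumes "slater_ok n u"
 shows "integral\<^sup>L (Mn n) (%x. slater n u x * cnj (slater n u x)) = 1"
proof -
 have [measurable]: "slater n u \<in> borel_measurable (Mn n)" by (rule slater_meas[OF assms])
 have int: "integrable (Mn n) (%x. (cmod (slater n u x))\<^sup>2)"
  using slater_norm[OF assms] by (intro integrableI_bounded) auto
 have "integral\<^sup>L (Mn n) (%x. slater n u x * cnj (slater n u x)) = integral\<^sup>L (Mn n) (%x. complex_of_real ((cmod (slater n u x))\<^sup>2))"
  by (simp add: complex_norm_square flip: of_real_power)
 also have "\<dots> = complex_of_real (integral\<^sup>L (Mn n) (%x. (cmod (slater n u x))\<^sup>2))" by (rule integral_complex_of_real)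
 also have "integral\<^sup>L (Mn n) (%x. (cmod (slater n u x))\<^sup>2) = 1"
  using nn_integral_eq_integral[OF int] slater_norm[OF assms]
  by (simp add: ennreal_eq_1)
 finally show ?thesis by simp
qed

lemma integral_mI:
 fixes f :: "real => complex"
 shows "integral\<^sup>L mI f = (\<integral>x. indicator Iper x *\<^sub>R f x \<partial>lborel)"
 unfolding mI_def by (rule integral_restrict_space) simp

lemma nn_integral_mI: "integral\<^sup>N mI f = (\<integral>\<^sup>+ x. f x * indicator Iper x \<partial>lborel)"
 unfolding mI_def by (rule nn_integral_restrict_space) simp

text \<open>The supports lie in the disjoint intervals from \<open>h/(m+2)\<close> to
  \<open>h/(m+1)\<close>. An infinite family is required because admissible states form an infinite
  orthonormal sequence.\<close>

lemma smooth_bump_family: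
 assumes "0 < h" "h < 2*pi"
 obtains v :: "nat => real => real" where "!!m. smooth (v m)" "!!m x. v m (x + 2*pi) = v m x"
  "!!m x. x \<in> Iper ==> v m x \<noteq> 0 ==> 0 < x \<and> x < h"
  "!!m l x. m \<noteq> l ==> x \<in> Iper ==> v m x = 0 \<or> v l x = 0"
  "!!m. (\<integral>x. indicator Iper x * (v m x)\<^sup>2 \<partial>lborel) = 1"
proof -
 have "\<exists>v. smooth v \<and> (\<forall>x. v (x + 2*pi) = v x) \<and> (\<forall>x\<in>Iper. v x \<noteq> 0 --> h / real (m + 2) < x \<and> x < h / real (m + 1)) \<and>
  (\<integral>x. indicator Iper x * (v x)\<^sup>2 \<partial>lborel) = 1" for m :: nat
 proof -
  have "h / real (m + 1) <= h / 1" using assms by (intro divide_left_mono) auto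
  hence 3: "h / real (m + 1) < 2*pi" using assms(2) unfolding div_by_1 by (rule order.strict_trans1)
  have 1: "0 < h / real (m + 2)" and 2: "h / real (m + 2) < h / real (m + 1)" using assms by (auto intro!: divide_strict_left_mono)
  show ?thesis by (rule bump_orbital[OF 1 2 3]) blast
 qed
 then obtain v where v: "!!m. smooth (v m) \<and> (\<forall>x. v m (x + 2*pi) = v m x) \<and> (\<forall>x\<in>Iper. v m x \<noteq> 0 --> h / real (m + 2) < x \<and> x < h / real (m + 1)) \<and>
  (\<integral>x. indicator Iper x * (v m x)\<^sup>2 \<partial>lborel) = 1" using choice[of "%m v. smooth v \<and> (\<forall>x. v (x + 2*pi) = v x) \<and> (\<forall>x\<in>Iper. v x \<noteq> 0 --> h / real (m + 2) < x \<and> x < h / real (m + 1)) \<and>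
  (\<integral>x. indicator Iper x * (v x)\<^sup>2 \<partial>lborel) = 1"] by blast
 have dis: "v m x = 0 \<or> v l x = 0" if "m < l" "x \<in> Iper" for m l x
 proof (rule ccontr)
  assume "\<not> ?thesis"
  hence "h / real (m + 2) < x" "x < h / real (l + 1)" using v[of m] v[of l] that by auto
  moreover have "h / real (l + 1) <= h / real (m + 2)" using that assms by (intro divide_left_mono) auto
  ultimately show False by linarith
 qed
 show thesis
 proof (rule that[of v])
  show "0 < x \<and> x < h" if x: "x \<in> Iper" "v m x \<noteq> 0" for m x
  proof -
   have "h / real (m + 2) < x" "x < h / real (m + 1)" using v[of m] x by auto
   moreover have "h / real (m + 1) <= h / 1" using assms by (intro divide_left_mono) auto
   moreover have "0 < h / real (m + 2)" using assms by simp
   ultimately show ?thesis by auto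
  qed
  show "v m x = 0 \<or> v l x = 0" if "m \<noteq> l" "x \<in> Iper" for m l x
   using dis[of m l x] dis[of l m x] that by (cases "m < l") auto
 qed (use v in auto)
qed

text \<open>For a finite mixture the kinetic energy is a finite number \<open>K\<close>, and on the
  support of each determinant the interaction is at most \<open>bd\<close>. That \<epsilon> is
  quantified after \<open>K\<close> is what the limit will exploit.\<close>

lemma F_per_le_slaters:
 fixes U :: "nat => nat => real => complex"
 assumes n1: "1 <= n" and w: "assumptionA w"
  and ok: "!!k. slater_ok n (U k)"
  and orth: "!!k l. k \<noteq> l ==> integral\<^sup>L (Mn n) (%x. slater n (U k) x * cnj (slater n (U l) x)) = 0"
  and lam: "!!k. 0 <= lam k" "!!k. M <= k ==> lam k = 0" "(\<Sum>k<M. lam k) = 1"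
  and dens: "AE t in lborel. t \<in> Iper --> (\<Sum>k<M. ennreal (lam k) * (\<Sum>i<n. ennreal ((cmod (U k i t))\<^sup>2))) = of_nat n * ennreal (\<rho> t)"
  and cost: "!!k x. k < M ==> x \<in> In n ==> slater n (U k) x \<noteq> 0 ==> cn n w x <= bd k"
 shows "\<exists>K<\<infinity>. \<forall>\<epsilon>. F_per n w \<epsilon> \<rho> <= ennreal \<epsilon> * K + (\<Sum>k<M. ennreal (lam k) * bd k)"
proof -
 define Psi where "Psi k = slater n (U k)" for k
 have "\<forall>k. \<exists>G. H1full n (Psi k) G" using slater_H1per_grad[OF ok] by (simp add: Psi_def)
 from choice[OF this] obtain G where G: "!!k. H1full n (Psi k) (G k)" by blast
 have fin: "(\<Sum>k. ennreal (lam k) * f k) = (\<Sum>k<M. ennreal (lam k) * f k)" for f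
  by (rule suminf_finite) (auto simp: lam(2) not_less)
 have adm: "lieb_admissible n \<rho> lam Psi G"
  unfolding lieb_admissible_def
 proof (intro conjI allI)
  fix k show "in_Hn n (Psi k)" unfolding Psi_def by (rule slater_in_Hn[OF ok])
  show "H1per_grad n (Psi k) (G k)" by (rule H1full_grad[OF G])
  show "0 <= lam k" by (rule lam)
  fix l show "integral\<^sup>L (Mn n) (%x. Psi k x * cnj (Psi l x)) = (if k = l then 1 else 0)"
   using orth[of k l] slater_unit[OF ok, of k] by (auto simp: Psi_def)
 next
  have "lam sums (\<Sum>k\<in>{..<M}. lam k)" by (rule sums_finite) (auto simp: lam(2) not_less)
  thus "lam sums 1" by (simp add: lam(3))
  show "AE t in lborel. t \<in> Iper --> (\<Sum>k. ennreal (lam k) * rhoPsi n (Psi k) t) = of_nat n * ennreal (\<rho> t)"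
   using dens
  proof (rule AE_mp, intro AE_I2 impI)
   fix t assume t: "t \<in> Iper --> (\<Sum>k<M. ennreal (lam k) * (\<Sum>i<n. ennreal ((cmod (U k i t))\<^sup>2))) = of_nat n * ennreal (\<rho> t)" "t \<in> Iper"
   thus "(\<Sum>k. ennreal (lam k) * rhoPsi n (Psi k) t) = of_nat n * ennreal (\<rho> t)"
    unfolding fin by (simp add: Psi_def rhoPsi_slater[OF ok n1])
  qed
 qed
 define Kk where "Kk k = (\<integral>\<^sup>+ x. ennreal (\<Sum>i<n. (cmod (G k i x))\<^sup>2) \<partial>Mn n)" for k
 define K where "K = (\<Sum>k<M. ennreal (lam k) * Kk k)"
 have "K < \<infinity>" unfolding K_def Kk_def using kinetic_finite[OF G] by (auto simp: less_top[symmetric] ennreal_mult_eq_top_iff)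
 moreover have "F_per n w \<epsilon> \<rho> <= ennreal \<epsilon> * K + (\<Sum>k<M. ennreal (lam k) * bd k)" for \<epsilon>
 proof -
  have "F_per n w \<epsilon> \<rho> <= lieb_energy n w \<epsilon> lam Psi G"
   unfolding F_per_def using adm by (intro INF_lower2[of "(lam, Psi, G)"]) auto
  also have "\<dots> = (\<Sum>k<M. ennreal (lam k) * (ennreal \<epsilon> * Kk k + (\<integral>\<^sup>+ x. cn n w x * ennreal ((cmod (Psi k x))\<^sup>2) \<partial>Mn n)))"
   unfolding lieb_energy_def fin Kk_def
   by (intro sum.cong refl arg_cong2[where f="(*)"] lieb_energy_term[OF w G]) (simp add: slater_meas[OF ok] Psi_def)
  also have "\<dots> <= (\<Sum>k<M. ennreal (lam k) * (ennreal \<epsilon> * Kk k + bd k))"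
  proof (intro sum_mono mult_left_mono add_left_mono)
   fix k assume k: "k \<in> {..<M}"
   have "(\<integral>\<^sup>+ x. cn n w x * ennreal ((cmod (Psi k x))\<^sup>2) \<partial>Mn n) <= (\<integral>\<^sup>+ x. bd k * ennreal ((cmod (Psi k x))\<^sup>2) \<partial>Mn n)"
   proof (rule nn_integral_mono)
    fix x assume "x \<in> space (Mn n)"
    thus "cn n w x * ennreal ((cmod (Psi k x))\<^sup>2) <= bd k * ennreal ((cmod (Psi k x))\<^sup>2)"
     using cost[of k x] k by (cases "Psi k x = 0") (auto simp: Psi_def intro!: mult_right_mono)
   qed
   also have "\<dots> = bd k * (\<integral>\<^sup>+ x. ennreal ((cmod (Psi k x))\<^sup>2) \<partial>Mn n)"
   proof (rule nn_integral_cmult)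
    have [measurable]: "Psi k \<in> borel_measurable (Mn n)" unfolding Psi_def by (rule slater_meas[OF ok])
    show "(%x. ennreal ((cmod (Psi k x))\<^sup>2)) \<in> borel_measurable (Mn n)" by measurable
   qed
   also have "\<dots> = bd k" unfolding Psi_def using slater_norm[OF ok] by simp
   finally show "(\<integral>\<^sup>+ x. cn n w x * ennreal ((cmod (Psi k x))\<^sup>2) \<partial>Mn n) <= bd k" .
  qed auto
  also have "\<dots> = ennreal \<epsilon> * K + (\<Sum>k<M. ennreal (lam k) * bd k)"
   unfolding K_def by (simp add: distrib_left sum.distrib sum_distrib_left mult.left_commute)
  finally show ?thesis .
 qed
 ultimately show ?thesis by blast
qed

lemma orb_smooth:
 assumes "smooth v" "!!x. v (x + 2*pi) = v x"
 shows "\<exists>g. orb (%t. complex_of_real (v t)) g"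
 using orb_mult[OF orb_one assms] by auto

lemma nn_norm_smooth:
 assumes "smooth v" "(\<integral>x. indicator Iper x * (v x)\<^sup>2 \<partial>lborel) = 1"
 shows "(\<integral>\<^sup>+ t. ennreal ((cmod (complex_of_real (v t)))\<^sup>2) \<partial>mI) = 1"
proof -
 have "integrable lborel (%x. indicator Iper x * (v x)\<^sup>2)"
  using assms(2) not_integrable_integral_eq by fastforce
 hence "(\<integral>\<^sup>+ x. ennreal (indicator Iper x * (v x)\<^sup>2) \<partial>lborel) = 1"
  using assms(2) by (subst nn_integral_eq_integral) auto
 moreover have "(\<integral>\<^sup>+ t. ennreal ((cmod (complex_of_real (v t)))\<^sup>2) \<partial>mI) = (\<integral>\<^sup>+ x. ennreal (indicator Iper x * (v x)\<^sup>2) \<partial>lborel)"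
  unfolding nn_integral_mI by (intro nn_integral_cong) (auto split: split_indicator)
 ultimately show ?thesis by simp
qed

text \<open>Two particles are what keeps the filling states of weight zero apart from the others:
  the former live in one short interval, whereas a determinant from a tuple always has two particles
  four mesh lengths apart.\<close>

lemma F_per_upper_ge2:
 assumes n2: "2 <= n" and w: "assumptionA w" and \<rho>: "prob_density_on_I \<rho>"
  and fo: "orb f gf" and fI: "!!t. t \<in> Iper ==> f t = complex_of_real (sqrt (\<rho> t))"
  and part: "cell_partition N \<rho> ch" and q0: "!!J. J \<in> tuples n N ==> 0 <= q J"
  and qm: "!!i j. i < n ==> j < N ==> (\<Sum>J\<in>tuples n N. q J * of_bool (J i = j)) = cmass \<rho> ch j"
  and qsep: "!!J k l s t. J \<in> tuples n N ==> q J \<noteq> 0 ==> k < n ==> l < n ==> k \<noteq> l ==> s \<in> cell N (J k) ==> t \<in> cell N (J l)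
    ==> 4 * (2*pi / real N) <= dT s t"
 shows "\<exists>K<\<infinity>. \<forall>\<epsilon>. F_per n w \<epsilon> \<rho> <= ennreal \<epsilon> * K + (\<Sum>J\<in>tuples n N. ennreal (q J) * cbound n w N J)"
proof -
 define V where "V = tuples n N"
 define m where "m = cmass \<rho> ch"
 define h where "h = 2*pi / real N"
 have N3: "3 <= N" and ch: "!!j. j < N ==> smooth (ch j)" "!!j x. j < N ==> ch j (x + 2*pi) = ch j x"
  "!!x. x \<in> Iper ==> (\<Sum>j<N. (ch j x)\<^sup>2) = 1"
  "!!i j. i < N ==> j < N ==> i \<noteq> j ==> (\<integral>x. indicator Iper x * \<rho> x * (ch i x * ch j x) \<partial>lborel) = 0"
  "!!j x. j < N ==> x \<in> Iper ==> ch j x \<noteq> 0 ==> x \<in> cell N j"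
  using part unfolding cell_partition_def by auto
 have h: "0 < h" "h < 2*pi" using N3 by (auto simp: h_def field_simps)
 have \<rho>0: "0 <= \<rho> t" if "t \<in> Iper" for t using \<rho> that by (simp add: prob_density_on_I_def)
 have [measurable]: "\<rho> \<in> borel_measurable borel" using \<rho> by (simp add: prob_density_on_I_def)
 have chm: "ch j \<in> borel_measurable borel" if "j < N" for j by (rule smooth_measurable[OF ch(1)[OF that]])
 have ch1: "(ch j x)\<^sup>2 <= 1" if "j < N" "x \<in> Iper" for j x
  unfolding ch(3)[OF that(2), symmetric] using that by (intro member_le_sum) auto
 have fV: "finite V" by (simp add: V_def tuples_def finite_PiE)
 have VN: "J i < N" if "J \<in> V" "i < n" for J i using that by (auto simp: V_def tuples_def)
 have mi: "integrable lborel (%x. indicator Iper x * \<rho> x * (ch j x)\<^sup>2)" if j: "j < N" for j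
 proof (rule Bochner_Integration.integrable_bound[OF integrable_rho[OF \<rho>]])
  have [measurable]: "ch j \<in> borel_measurable borel" by (rule chm[OF j])
  show "(%x. indicator Iper x * \<rho> x * (ch j x)\<^sup>2) \<in> borel_measurable lborel" by measurable
  show "AE x in lborel. norm (indicator Iper x * \<rho> x * (ch j x)\<^sup>2) <= norm (indicator Iper x * \<rho> x)"
   using ch1[OF j] by (intro AE_I2) (auto simp: abs_mult mult_left_le split: split_indicator)
 qed
 have m0: "0 <= m j" for j
  unfolding m_def cmass_def by (intro Bochner_Integration.integral_nonneg) (auto simp: \<rho>0 split: split_indicator)
 define Vq where "Vq = {J \<in> V. q J \<noteq> 0}"
 have VqV: "Vq \<subseteq> V" and fVq: "finite Vq" using fV by (auto simp: Vq_def)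
 have mpos: "0 < m (J k)" if J: "J \<in> Vq" "k < n" for J k
 proof -
  have JV: "J \<in> V" "q J \<noteq> 0" using J by (auto simp: Vq_def)
  have "q J * of_bool (J k = J k) <= (\<Sum>J'\<in>V. q J' * of_bool (J' k = J k))"
   using fV JV q0 by (intro member_le_sum) (auto simp: V_def)
  also have "\<dots> = m (J k)" using qm[OF J(2) VN[OF JV(1) J(2)]] by (simp add: V_def m_def)
  finally show ?thesis using JV q0[of J] by (simp add: V_def)
 qed
 have cellne: "\<exists>s. s \<in> cell N (J k)" if J: "J \<in> Vq" "k < n" for J k
 proof (rule ccontr)
  assume "\<not> ?thesis"
  hence "indicator Iper x * \<rho> x * (ch (J k) x)\<^sup>2 = 0" for x
   using ch(5)[OF VN[OF subsetD[OF VqV J(1)] J(2)], of x] by (auto split: split_indicator)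
  hence "m (J k) = 0" unfolding m_def cmass_def by (simp only: Bochner_Integration.integral_zero)
  thus False using mpos[OF J] by simp
 qed
 have sep: "4 * h <= dT s t" if "J \<in> Vq" "k < n" "l < n" "k \<noteq> l" "s \<in> cell N (J k)" "t \<in> cell N (J l)" for J k l s t
  unfolding h_def using that by (intro qsep[of J k l s t]) (auto simp: Vq_def V_def)
 have inj: "inj_on J {..<n}" if J: "J \<in> Vq" for J
 proof (rule inj_onI, rule ccontr)
  fix k l assume kl: "k \<in> {..<n}" "l \<in> {..<n}" "J k = J l" "k \<noteq> l"
  obtain s where "s \<in> cell N (J k)" using cellne[OF J, of k] kl by auto
  thus False using sep[OF J, of k l s s] kl h by auto
 qed
 \<comment> \<open>The root of the cell mass normalizes the orbital. If that mass is zero, the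
   orbital is zero by the convention on division.\<close>
 define u where "u j t = f t * complex_of_real (ch j t * (1 / sqrt (m j)))" for j t
 have uo: "\<exists>v. orb (u j) v" if j: "j < N" for j
 proof -
  have s: "smooth (%t. ch j t * (1 / sqrt (m j)))" by (intro smooth_mult smooth_const ch(1)[OF j])
  have p: "ch j (x + 2*pi) * (1 / sqrt (m j)) = ch j x * (1 / sqrt (m j))" for x by (simp only: ch(2)[OF j])
  show ?thesis unfolding u_def[abs_def] by (rule exI, rule orb_mult[OF fo s p])
 qed
 have usq: "(cmod (u j t))\<^sup>2 = \<rho> t * (ch j t)\<^sup>2 / m j" if "t \<in> Iper" for j t
  using that m0[of j] \<rho>0[OF that] by (simp add: u_def fI norm_mult power_mult_distrib power_divide norm_divide)
 have un: "(\<integral>\<^sup>+ t. ennreal ((cmod (u j t))\<^sup>2) \<partial>mI) = 1" if j: "j < N" "0 < m j" for j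
 proof -
  have "(\<integral>\<^sup>+ t. ennreal ((cmod (u j t))\<^sup>2) \<partial>mI) = (\<integral>\<^sup>+ t. ennreal (indicator Iper t * \<rho> t * (ch j t)\<^sup>2 / m j) \<partial>lborel)"
   unfolding nn_integral_mI by (intro nn_integral_cong) (auto simp: usq split: split_indicator)
  also have "\<dots> = ennreal (\<integral>t. indicator Iper t * \<rho> t * (ch j t)\<^sup>2 / m j \<partial>lborel)"
   using mi[OF j(1)] m0 \<rho>0 by (intro nn_integral_eq_integral) (auto intro!: AE_I2 split: split_indicator)
  also have "\<dots> = 1" using j by (simp add: m_def cmass_def)
  finally show ?thesis .
 qed
 have uorth: "(\<integral>t. u i t * cnj (u j t) \<partial>mI) = 0" if ij: "i < N" "j < N" "i \<noteq> j" for i j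
 proof -
  have "(\<integral>t. u i t * cnj (u j t) \<partial>mI) = (\<integral>t. complex_of_real ((1 / (sqrt (m i) * sqrt (m j))) * (indicator Iper t * \<rho> t * (ch i t * ch j t))) \<partial>lborel)"
   unfolding integral_mI
  proof (intro Bochner_Integration.integral_cong refl)
   fix t
   show "indicator Iper t *\<^sub>R (u i t * cnj (u j t)) = complex_of_real ((1 / (sqrt (m i) * sqrt (m j))) * (indicator Iper t * \<rho> t * (ch i t * ch j t)))"
   proof (cases "t \<in> Iper")
    case True
    have "complex_of_real (sqrt (\<rho> t)) * complex_of_real (sqrt (\<rho> t)) = complex_of_real (\<rho> t)"
     using \<rho>0[OF True] by (simp flip: of_real_mult)
    thus ?thesis using True by (simp add: u_def fI field_simps)
   qed simp
  qed
  also have "\<dots> = complex_of_real ((1 / (sqrt (m i) * sqrt (m j))) * (\<integral>t. indicator Iper t * \<rho> t * (ch i t * ch j t) \<partial>lborel))"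
   unfolding integral_complex_of_real by (simp only: integral_mult_right_zero)
  also have "\<dots> = 0" using ch(4)[OF ij] by simp
  finally show ?thesis .
 qed
 have unz: "t \<in> cell N j" if "j < N" "t \<in> Iper" "u j t \<noteq> 0" for j t
  using that ch(5)[of j t] by (auto simp: u_def)
 have ok1: "slater_ok n (%i. u (J i))" if J: "J \<in> Vq" for J
  unfolding slater_ok_def
 proof (intro conjI allI impI ballI)
  fix k assume k: "k < n"
  hence JN: "J k < N" using VN VqV J by blast
  show "\<exists>v. orb (u (J k)) v" by (rule uo[OF JN])
  show "(\<integral>\<^sup>+ t. ennreal ((cmod (u (J k) t))\<^sup>2) \<partial>mI) = 1" by (rule un[OF JN mpos[OF J k]])
  fix l t assume l: "l < n" "k \<noteq> l" "t \<in> Iper"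
  have JN': "J l < N" using VN VqV J l by blast
  show "u (J k) t = 0 \<or> u (J l) t = 0"
  proof (rule ccontr)
   assume "\<not> ?thesis"
   hence "t \<in> cell N (J k)" "t \<in> cell N (J l)" using unz JN JN' l by auto
   thus False using sep[OF J k l(1,2), of t t] h by simp
  qed
 qed
 \<comment> \<open>Tuples with the same set of cells give the same determinant up to sign and cannot
   both occur in an orthonormal family. One representative per set inherits the total weight;
   density and \<open>cbound\<close> depend only on the set.\<close>
 define rep where "rep J = (SOME J'. J' \<in> Vq \<and> J' ` {..<n} = J ` {..<n})" for J
 have rep: "rep J \<in> Vq" "rep J ` {..<n} = J ` {..<n}" if "J \<in> Vq" for J
  unfolding rep_def using someI[of "%J'. J' \<in> Vq \<and> J' ` {..<n} = J ` {..<n}" J] that by auto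
 have repeq: "rep J = rep J'" if "J ` {..<n} = J' ` {..<n}" for J J' by (simp add: rep_def that)
 define RJ where "RJ = rep ` Vq"
 have fRJ: "finite RJ" and RJV: "RJ \<subseteq> Vq" using fVq rep by (auto simp: RJ_def)
 have RJdist: "J ` {..<n} \<noteq> J' ` {..<n}" if a: "J \<in> RJ" "J' \<in> RJ" "J \<noteq> J'" for J J'
 proof
  assume eq: "J ` {..<n} = J' ` {..<n}"
  obtain K K' where K: "K \<in> Vq" "J = rep K" "K' \<in> Vq" "J' = rep K'" using a unfolding RJ_def by blast
  hence "K ` {..<n} = K' ` {..<n}" using rep eq by simp
  thus False using repeq K a by blast
 qed
 define M where "M = card RJ"
 obtain e where e: "bij_betw e {..<M} RJ" using ex_bij_betw_nat_finite[OF fRJ] by (auto simp: M_def atLeast0LessThan)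
 have eRJ: "e k \<in> RJ" if "k < M" for k using e that by (auto simp: bij_betw_def)
 have eVq: "e k \<in> Vq" if "k < M" for k using eRJ[OF that] RJV by blast
 have einj: "e k \<noteq> e l" if "k < M" "l < M" "k \<noteq> l" for k l using e that by (auto simp: bij_betw_def inj_on_def)
 define wt where "wt J = (\<Sum>J'\<in>{J'\<in>Vq. rep J' = J}. q J')" for J
 have wt0: "0 <= wt J" for J unfolding wt_def using q0 VqV by (intro sum_nonneg) (auto simp: V_def)
 have wt_enn: "ennreal (wt J) = (\<Sum>J'\<in>{J'\<in>Vq. rep J' = J}. ennreal (q J'))" for J
  unfolding wt_def using q0 VqV by (intro sum_ennreal[symmetric]) (auto simp: V_def)
 have regroup: "(\<Sum>k<M. ennreal (wt (e k)) * F (e k)) = (\<Sum>J\<in>V. ennreal (q J) * F (rep J))" for F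
 proof -
  have "(\<Sum>k<M. ennreal (wt (e k)) * F (e k)) = (\<Sum>J\<in>RJ. ennreal (wt J) * F J)" by (rule sum.reindex_bij_betw[OF e])
  also have "\<dots> = (\<Sum>J\<in>rep ` Vq. \<Sum>J'\<in>{J'\<in>Vq. rep J' = J}. ennreal (q J') * F (rep J'))"
   unfolding RJ_def wt_enn sum_distrib_right by (intro sum.cong refl) auto
  also have "\<dots> = (\<Sum>J\<in>Vq. ennreal (q J) * F (rep J))" by (rule sum.image_gen[OF fVq, symmetric])
  also have "\<dots> = (\<Sum>J\<in>V. ennreal (q J) * F (rep J))"
   using fV by (intro sum.mono_neutral_left) (auto simp: Vq_def)
  finally show ?thesis .
 qed
 obtain v :: "nat => real => real" where v: "!!m. smooth (v m)" "!!m x. v m (x + 2*pi) = v m x"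
  "!!m x. x \<in> Iper ==> v m x \<noteq> 0 ==> 0 < x \<and> x < h"
  "!!m l x. m \<noteq> l ==> x \<in> Iper ==> v m x = 0 \<or> v l x = 0"
  "!!m. (\<integral>x. indicator Iper x * (v m x)\<^sup>2 \<partial>lborel) = 1"
  by (rule smooth_bump_family[OF h], rule that)
 define vo where "vo m t = complex_of_real (v m t)" for m t
 \<comment> \<open>From index \<open>M\<close> on the family is filled with consecutive blocks of
   \<open>n\<close> bumps, at weight zero.\<close>
 define U where "U k = (if k < M then (%i. u (e k i)) else (%i. vo (n * (k - M) + i)))" for k
 have ok: "slater_ok n (U k)" for k
 proof (cases "k < M")
  case True thus ?thesis using ok1[OF eVq] by (simp add: U_def)
 next
  case False
  have "slater_ok n (%i. vo (n * (k - M) + i))"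
   unfolding slater_ok_def vo_def using orb_smooth[OF v(1,2)] nn_norm_smooth[OF v(1,5)] v(4) by auto
  thus ?thesis using False by (simp add: U_def)
 qed
 have lam: "(\<Sum>k<M. wt (e k)) = 1"
 proof -
  have "(\<Sum>k<M. ennreal (wt (e k))) = (\<Sum>J\<in>V. ennreal (q J))" using regroup[of "%_. 1"] by simp
  hence "ennreal (\<Sum>k<M. wt (e k)) = ennreal (\<Sum>J\<in>V. q J)" using wt0 q0 by (simp add: sum_ennreal V_def)
  hence "(\<Sum>k<M. wt (e k)) = (\<Sum>J\<in>V. q J)" using wt0 q0 by (simp add: V_def sum_nonneg)
  also have "\<dots> = (\<Sum>J\<in>V. \<Sum>j<N. q J * of_bool (J 0 = j))"
   using VN n2 by (intro sum.cong refl) (simp add: sum_distrib_left[symmetric])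
  also have "\<dots> = (\<Sum>j<N. \<Sum>J\<in>V. q J * of_bool (J 0 = j))" by (rule sum.swap)
  also have "\<dots> = (\<Sum>j<N. \<integral>x. indicator Iper x * \<rho> x * (ch j x)\<^sup>2 \<partial>lborel)"
   using qm n2 by (intro sum.cong refl) (simp add: V_def cmass_def)
  also have "\<dots> = (\<integral>x. (\<Sum>j<N. indicator Iper x * \<rho> x * (ch j x)\<^sup>2) \<partial>lborel)"
   using mi by (intro Bochner_Integration.integral_sum[symmetric]) auto
  also have "\<dots> = (\<integral>x. indicator Iper x * \<rho> x * 1 \<partial>lborel)"
   by (intro Bochner_Integration.integral_cong refl) (auto simp: ch(3) sum_distrib_left[symmetric] split: split_indicator)
  also have "\<dots> = integral\<^sup>L (rho_measure \<rho>) (%_. 1)" by (rule integral_rho_measure[OF \<rho>, symmetric]) simp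
  also have "\<dots> = 1"
  proof -
   interpret prob_space "rho_measure \<rho>" by (rule prob_rho_measure[OF \<rho>])
   show ?thesis using prob_space by simp
  qed
  finally show ?thesis .
 qed
 have main: "\<exists>K<\<infinity>. \<forall>\<epsilon>. F_per n w \<epsilon> \<rho> <= ennreal \<epsilon> * K + (\<Sum>k<M. ennreal (if k < M then wt (e k) else 0) * cbound n w N (e k))"
 proof (rule F_per_le_slaters[where U=U])
  show "1 <= n" using n2 by simp
  show "assumptionA w" by (rule w)
  show "slater_ok n (U k)" for k by (rule ok)
  show "integral\<^sup>L (Mn n) (%x. slater n (U k) x * cnj (slater n (U l) x)) = 0" if kl: "k \<noteq> l" for k l
  proof -
   have vorth: "(\<integral>t. vo a t * cnj (vo b t) \<partial>mI) = 0" if "a \<noteq> b" for a b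
   proof -
    have "(\<integral>t. vo a t * cnj (vo b t) \<partial>mI) = (\<integral>t. 0 \<partial>mI)"
     using v(4)[OF that] by (intro Bochner_Integration.integral_cong refl) (auto simp: vo_def)
    thus ?thesis by simp
   qed
   \<comment> \<open>A filling state forces all particles into (0,h), the other determinant puts two
     of them at distance at least \<open>4*h\<close>, so the supports are disjoint.\<close>
   have zero: "slater n (U a) x = 0 \<or> slater n (U b) x = 0" if ab: "a < M" "\<not> b < M" and x: "x \<in> In n" for a b x
   proof (rule ccontr)
    assume "\<not> ?thesis"
    hence nz: "slater n (%i. u (e a i)) x \<noteq> 0" "slater n (%i. vo (n * (b - M) + i)) x \<noteq> 0" using ab by (auto simp: U_def)
    from slater_nonzero[OF nz(1)] obtain \<sigma> where s: "\<sigma> permutes {..<n}" "!!k. k < n ==> u (e a k) (x (\<sigma> k)) \<noteq> 0" by blast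
    from slater_nonzero[OF nz(2)] obtain \<tau> where t: "\<tau> permutes {..<n}" "!!k. k < n ==> vo (n * (b - M) + k) (x (\<tau> k)) \<noteq> 0" by blast
    have small: "0 < x i \<and> x i < h" if i: "i < n" for i
    proof -
     have "inv \<tau> i < n" "\<tau> (inv \<tau> i) = i" using i t(1) by (auto simp: perm_lt permutes_inv permutes_inverses)
     hence "v (n * (b - M) + inv \<tau> i) (x i) \<noteq> 0" using t(2)[of "inv \<tau> i"] by (simp add: vo_def)
     thus ?thesis using v(3) In_coord[OF x i] by blast
    qed
    have sn: "\<sigma> 0 < n" "\<sigma> 1 < n" using n2 s(1) by (auto simp: perm_lt)
    have "x (\<sigma> 0) \<in> cell N (e a 0)" "x (\<sigma> 1) \<in> cell N (e a 1)"
     using s(2)[of 0] s(2)[of 1] n2 sn In_coord[OF x] VN[OF subsetD[OF VqV eVq[OF ab(1)]]] by (auto intro!: unz)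
    hence "4 * h <= dT (x (\<sigma> 0)) (x (\<sigma> 1))" using sep[OF eVq[OF ab(1)], of 0 1] n2 by simp
    moreover have "dT (x (\<sigma> 0)) (x (\<sigma> 1)) <= h" using dT_le[of "x (\<sigma> 0)" "x (\<sigma> 1)"] small[OF sn(1)] small[OF sn(2)] by linarith
    ultimately show False using h by linarith
   qed
   consider (both) "k < M" "l < M" | (mix1) "k < M" "\<not> l < M" | (mix2) "\<not> k < M" "l < M" | (none) "\<not> k < M" "\<not> l < M" by blast
   thus ?thesis
   proof cases
    case both
    have ne: "e k ` {..<n} \<noteq> e l ` {..<n}" using RJdist[OF eRJ[OF both(1)] eRJ[OF both(2)] einj[OF both kl]] .
    \<comment> \<open>Both sets of cells have \<open>n\<close> elements, so distinct ones are not
      nested and some cell of the first is missing from the second.\<close>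
    have "\<not> e k ` {..<n} \<subseteq> e l ` {..<n}"
    proof
     assume sub: "e k ` {..<n} \<subseteq> e l ` {..<n}"
     have "card (e k ` {..<n}) = card (e l ` {..<n})" using inj[OF eVq] both by (simp add: card_image)
     thus False using card_subset_eq[OF _ sub] ne by simp
    qed
    then obtain k0 where k0: "k0 < n" "e k k0 \<notin> e l ` {..<n}" by auto
    show ?thesis
    proof (rule slater_orthogonal[OF ok ok k0(1)])
     fix l' assume l': "l' < n"
     hence "e k k0 \<noteq> e l l'" using k0 by auto
     thus "(\<integral>t. U k k0 t * cnj (U l l' t) \<partial>mI) = 0"
      using both uorth VN[OF subsetD[OF VqV eVq[OF both(1)]] k0(1)] VN[OF subsetD[OF VqV eVq[OF both(2)]] l'] by (simp add: U_def)
    qed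
   next
    case mix1
    have "integral\<^sup>L (Mn n) (%x. slater n (U k) x * cnj (slater n (U l) x)) = integral\<^sup>L (Mn n) (%x. 0)"
     using zero[OF mix1] by (intro Bochner_Integration.integral_cong refl) auto
    thus ?thesis by simp
   next
    case mix2
    have "integral\<^sup>L (Mn n) (%x. slater n (U k) x * cnj (slater n (U l) x)) = integral\<^sup>L (Mn n) (%x. 0)"
     using zero[OF mix2(2,1)] by (intro Bochner_Integration.integral_cong refl) auto
    thus ?thesis by simp
   next
    case none
    show ?thesis
    proof (rule slater_orthogonal[OF ok ok, of 0])
     show "0 < n" using n2 by simp
     fix l' assume l': "l' < n"
     have "n * (k - M) + 0 \<noteq> n * (l - M) + l'"
     proof
      assume "n * (k - M) + 0 = n * (l - M) + l'"
      hence "(n * (k - M) + 0) div n = (n * (l - M) + l') div n" by simp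
      hence "k - M = l - M" using n2 l' by simp
      thus False using kl none by auto
     qed
     thus "(\<integral>t. U k 0 t * cnj (U l l' t) \<partial>mI) = 0" using none vorth by (simp add: U_def)
    qed
   qed
  qed
  show "0 <= (if k < M then wt (e k) else 0)" for k using wt0 by simp
  show "(\<Sum>k<M. if k < M then wt (e k) else 0) = 1" using lam by simp
  show "cn n w x <= cbound n w N (e k)" if k: "k < M" and x: "x \<in> In n" and nz: "slater n (U k) x \<noteq> 0" for k x
  proof -
   from slater_nonzero[OF nz] obtain \<sigma> where s: "\<sigma> permutes {..<n}" "!!i. i < n ==> u (e k i) (x (\<sigma> i)) \<noteq> 0"
    using k by (auto simp: U_def)
   have "x \<circ> \<sigma> \<in> cbox n N (e k)"
    unfolding cbox_def using permute_In[OF s(1) x] s(2) In_coord[OF x] VN[OF subsetD[OF VqV eVq[OF k]]] s(1)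
    by (auto intro!: unz simp: perm_lt)
   hence "cn n w (x \<circ> \<sigma>) <= cbound n w N (e k)" unfolding cbound_def by (rule SUP_upper)
   thus ?thesis by (simp add: cn_permute[OF s(1)])
  qed
  \<comment> \<open>For a cell of mass zero the left side vanishes identically, but
    \<open>\<rho> * ch j^2\<close> only almost everywhere.\<close>
  have mu: "AE t in lborel. \<forall>j\<in>{..<N}. t \<in> Iper --> m j * (cmod (u j t))\<^sup>2 = \<rho> t * (ch j t)\<^sup>2"
  proof (rule AE_finite_allI)
   fix j assume "j \<in> {..<N}"
   hence j: "j < N" by simp
   show "AE t in lborel. t \<in> Iper --> m j * (cmod (u j t))\<^sup>2 = \<rho> t * (ch j t)\<^sup>2"
   proof (cases "m j = 0")
    case False thus ?thesis by (simp add: usq)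
   next
    case True
    hence "AE t in lborel. indicator Iper t * \<rho> t * (ch j t)\<^sup>2 = 0"
     using integral_nonneg_eq_0_iff_AE[OF mi[OF j]] \<rho>0 by (auto simp: m_def cmass_def split: split_indicator)
    thus ?thesis by (rule AE_mp) (auto intro!: AE_I2 simp: True)
   qed
  qed simp
  show "AE t in lborel. t \<in> Iper --> (\<Sum>k<M. ennreal (if k < M then wt (e k) else 0) * (\<Sum>i<n. ennreal ((cmod (U k i t))\<^sup>2))) = of_nat n * ennreal (\<rho> t)"
   using mu
  proof (rule AE_mp, intro AE_I2 impI)
   fix t assume a: "\<forall>j\<in>{..<N}. t \<in> Iper --> m j * (cmod (u j t))\<^sup>2 = \<rho> t * (ch j t)\<^sup>2" and t: "t \<in> Iper"
   define D where "D J = (\<Sum>i<n. ennreal ((cmod (u (J i) t))\<^sup>2))" for J :: "nat => nat"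
   have Dim: "D J = (\<Sum>j\<in>J ` {..<n}. ennreal ((cmod (u j t))\<^sup>2))" if "J \<in> Vq" for J
    unfolding D_def by (simp add: sum.reindex[OF inj[OF that]])
   have "(\<Sum>k<M. ennreal (if k < M then wt (e k) else 0) * (\<Sum>i<n. ennreal ((cmod (U k i t))\<^sup>2))) = (\<Sum>k<M. ennreal (wt (e k)) * D (e k))"
    by (intro sum.cong refl) (simp add: U_def D_def)
   also have "\<dots> = (\<Sum>J\<in>V. ennreal (q J) * D (rep J))" by (rule regroup)
   also have "\<dots> = (\<Sum>J\<in>V. ennreal (q J) * D J)"
   proof (intro sum.cong refl)
    fix J assume J: "J \<in> V"
    show "ennreal (q J) * D (rep J) = ennreal (q J) * D J"
    proof (cases "q J = 0")
     case False
     hence "J \<in> Vq" using J by (simp add: Vq_def)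
     thus ?thesis using Dim rep by simp
    qed simp
   qed
   also have "\<dots> = (\<Sum>J\<in>V. ennreal (\<Sum>i<n. q J * (cmod (u (J i) t))\<^sup>2))"
    unfolding D_def sum_distrib_left using q0 by (intro sum.cong refl) (simp add: sum_ennreal[symmetric] ennreal_mult V_def)
   also have "\<dots> = ennreal (\<Sum>J\<in>V. \<Sum>i<n. q J * (cmod (u (J i) t))\<^sup>2)"
    using q0 by (intro sum_ennreal) (auto simp: V_def intro!: sum_nonneg)
   also have "(\<Sum>J\<in>V. \<Sum>i<n. q J * (cmod (u (J i) t))\<^sup>2) = (\<Sum>i<n. \<Sum>J\<in>V. q J * (cmod (u (J i) t))\<^sup>2)" by (rule sum.swap)
   also have "\<dots> = (\<Sum>i<n. \<rho> t)"
   proof (rule sum.cong[OF refl])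
    fix i assume "i \<in> {..<n}"
    hence i: "i < n" by simp
    have "(\<Sum>J\<in>V. q J * (cmod (u (J i) t))\<^sup>2) = (\<Sum>J\<in>V. \<Sum>j<N. q J * (of_bool (J i = j) * (cmod (u j t))\<^sup>2))"
     using VN i by (intro sum.cong refl) (simp add: sum_distrib_left[symmetric] of_bool_def if_distrib[of "%z. z * _"] cong: if_cong)
    also have "\<dots> = (\<Sum>j<N. \<Sum>J\<in>V. q J * (of_bool (J i = j) * (cmod (u j t))\<^sup>2))" by (rule sum.swap)
    also have "\<dots> = (\<Sum>j<N. m j * (cmod (u j t))\<^sup>2)"
     using qm[OF i] by (intro sum.cong refl) (simp add: V_def m_def mult.assoc[symmetric] sum_distrib_right[symmetric])
    also have "\<dots> = (\<Sum>j<N. \<rho> t * (ch j t)\<^sup>2)" using a t by (intro sum.cong refl) auto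
    also have "\<dots> = \<rho> t" using ch(3)[OF t] by (simp add: sum_distrib_left[symmetric])
    finally show "(\<Sum>J\<in>V. q J * (cmod (u (J i) t))\<^sup>2) = \<rho> t" .
   qed
   finally show "(\<Sum>k<M. ennreal (if k < M then wt (e k) else 0) * (\<Sum>i<n. ennreal ((cmod (U k i t))\<^sup>2))) = of_nat n * ennreal (\<rho> t)"
    using \<rho>0[OF t] by (simp add: ennreal_mult ennreal_of_nat_eq_real_of_nat)
  qed
 qed simp
 have cb: "cbound n w N (rep J) = cbound n w N J" if J: "J \<in> Vq" for J
 proof -
  have le: "cbound n w N J' <= cbound n w N J" if a: "J \<in> Vq" "J' \<in> Vq" "J ` {..<n} = J' ` {..<n}" for J J'
  proof -
   obtain \<pi> where p: "\<pi> permutes {..<n}" "!!i. i < n ==> J' i = J (\<pi> i)" by (rule same_image_permutes[OF inj[OF a(1)] inj[OF a(2)] a(3)], rule that)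
   show ?thesis unfolding cbound_def
   proof (rule SUP_least)
    fix x assume x: "x \<in> cbox n N J'"
    have "x \<circ> inv \<pi> \<in> cbox n N J"
     unfolding cbox_def
    proof (intro CollectI conjI allI impI)
     show "x \<circ> inv \<pi> \<in> In n" using x permute_In[OF permutes_inv[OF p(1)]] by (simp add: cbox_def)
     fix i assume i: "i < n"
     have i': "inv \<pi> i < n" "\<pi> (inv \<pi> i) = i" using i p(1) by (auto simp: perm_lt permutes_inv permutes_inverses)
     have "x (inv \<pi> i) \<in> cell N (J' (inv \<pi> i))" using x i' by (simp add: cbox_def)
     thus "(x \<circ> inv \<pi>) i \<in> cell N (J i)" using p(2)[OF i'(1)] i' by simp
    qed
    hence "cn n w (x \<circ> inv \<pi>) <= (SUP x\<in>cbox n N J. cn n w x)" by (rule SUP_upper)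
    thus "cn n w x <= (SUP x\<in>cbox n N J. cn n w x)" by (simp add: cn_permute[OF permutes_inv[OF p(1)]])
   qed
  qed
  show ?thesis using le[of J "rep J"] le[of "rep J" J] rep[OF J] J by (intro antisym) auto
 qed
 have "(\<Sum>k<M. ennreal (if k < M then wt (e k) else 0) * cbound n w N (e k)) = (\<Sum>k<M. ennreal (wt (e k)) * cbound n w N (e k))"
  by (intro sum.cong refl) simp
 also have "\<dots> = (\<Sum>J\<in>V. ennreal (q J) * cbound n w N (rep J))" by (rule regroup)
 also have "\<dots> = (\<Sum>J\<in>V. ennreal (q J) * cbound n w N J)"
 proof (intro sum.cong refl)
  fix J assume J: "J \<in> V"
  show "ennreal (q J) * cbound n w N (rep J) = ennreal (q J) * cbound n w N J"
   using cb[of J] J by (cases "q J = 0") (auto simp: Vq_def)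
 qed
 finally show ?thesis using main by (simp add: V_def)
qed

lemma cn_1: "cn 1 w x = 0"
 by (auto simp: cn_def intro!: sum.neutral)

text \<open>With one particle the cost is zero and the square root of \<rho> is itself the state.
  Its support may be all of \<open>I\<close>, so filling orbitals cannot simply avoid it; each is a
  combination of two bumps chosen orthogonal to it.\<close>

lemma F_per_upper_1:
 assumes w: "assumptionA w" and \<rho>: "prob_density_on_I \<rho>"
  and fo: "orb f gf" and fI: "!!t. t \<in> Iper ==> f t = complex_of_real (sqrt (\<rho> t))"
 shows "\<exists>K<\<infinity>. \<forall>\<epsilon>. F_per 1 w \<epsilon> \<rho> <= ennreal \<epsilon> * K"
proof -
 have \<rho>0: "0 <= \<rho> t" if "t \<in> Iper" for t using \<rho> that by (simp add: prob_density_on_I_def)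
 have [measurable]: "\<rho> \<in> borel_measurable borel" using \<rho> by (simp add: prob_density_on_I_def)
 obtain v :: "nat => real => real" where v: "!!m. smooth (v m)" "!!m x. v m (x + 2*pi) = v m x"
  "!!m x. x \<in> Iper ==> v m x \<noteq> 0 ==> 0 < x \<and> x < 1"
  "!!m l x. m \<noteq> l ==> x \<in> Iper ==> v m x = 0 \<or> v l x = 0"
  "!!m. (\<integral>x. indicator Iper x * (v m x)\<^sup>2 \<partial>lborel) = 1"
 proof (rule smooth_bump_family[of 1])
  show "1 < 2*pi" using pi_gt3 by linarith
 qed (auto intro: that)
 have vi: "integrable lborel (%x. indicator Iper x * (v m x)\<^sup>2)" for m
  using v(5)[of m] not_integrable_integral_eq by fastforce
 have fvi: "integrable lborel (%x. indicator Iper x * (sqrt (\<rho> x) * v m x))" for m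
 proof (rule Bochner_Integration.integrable_bound[OF Bochner_Integration.integrable_add[OF integrable_rho[OF \<rho>] vi[of m]]])
  have [measurable]: "v m \<in> borel_measurable borel" by (rule smooth_measurable[OF v(1)])
  show "(%x. indicator Iper x * (sqrt (\<rho> x) * v m x)) \<in> borel_measurable lborel" by measurable
  show "AE x in lborel. norm (indicator Iper x * (sqrt (\<rho> x) * v m x)) <= norm (indicator Iper x * \<rho> x + indicator Iper x * (v m x)\<^sup>2)"
  proof (intro AE_I2)
   fix x
   have "\<bar>sqrt (\<rho> x) * v m x\<bar> <= \<rho> x + (v m x)\<^sup>2" if "x \<in> Iper"
   proof -
    have "2 * (sqrt (\<rho> x) * \<bar>v m x\<bar>) <= (sqrt (\<rho> x))\<^sup>2 + \<bar>v m x\<bar>\<^sup>2" using sum_squares_bound[of "sqrt (\<rho> x)" "\<bar>v m x\<bar>"] by (simp add: mult.assoc)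
    moreover have "0 <= sqrt (\<rho> x) * \<bar>v m x\<bar>" using \<rho>0[OF that] by simp
    ultimately have "sqrt (\<rho> x) * \<bar>v m x\<bar> <= (sqrt (\<rho> x))\<^sup>2 + \<bar>v m x\<bar>\<^sup>2" by linarith
    thus ?thesis using \<rho>0[OF that] by (simp add: abs_mult)
   qed
   thus "norm (indicator Iper x * (sqrt (\<rho> x) * v m x)) <= norm (indicator Iper x * \<rho> x + indicator Iper x * (v m x)\<^sup>2)"
    using \<rho>0[of x] by (auto split: split_indicator)
  qed
 qed
 define A where "A m = (\<integral>x. indicator Iper x * (sqrt (\<rho> x) * v m x) \<partial>lborel)" for m
 \<comment> \<open>A unit vector orthogonal to the pair of overlaps with the square root of
   \<rho>.\<close>
 have "\<exists>\<alpha> \<beta>. \<alpha>\<^sup>2 + \<beta>\<^sup>2 = 1 \<and> \<alpha> * A (2*k) + \<beta> * A (2*k+1) = 0" for k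
 proof (cases "A (2*k) = 0")
  case True thus ?thesis by (intro exI[of _ 1] exI[of _ 0]) simp
 next
  case False
  let ?s = "sqrt ((A (2*k))\<^sup>2 + (A (2*k+1))\<^sup>2)"
  have s: "0 < (A (2*k))\<^sup>2 + (A (2*k+1))\<^sup>2" using False by (simp add: add_pos_nonneg)
  have "(A (2*k+1) / ?s)\<^sup>2 + (- A (2*k) / ?s)\<^sup>2 = ((A (2*k+1))\<^sup>2 + (A (2*k))\<^sup>2) / ((A (2*k))\<^sup>2 + (A (2*k+1))\<^sup>2)"
   using s by (simp add: power_divide add_divide_distrib)
  also have "\<dots> = 1" using s by (simp only: add.commute[of "(A (2*k+1))\<^sup>2"]) (rule divide_self, linarith)
  finally show ?thesis by (intro exI[of _ "A (2*k+1) / ?s"] exI[of _ "- A (2*k) / ?s"]) (simp add: field_simps)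
 qed
 then obtain \<alpha> \<beta> where ab: "!!k. (\<alpha> k)\<^sup>2 + (\<beta> k)\<^sup>2 = 1" "!!k. \<alpha> k * A (2*k) + \<beta> k * A (2*k+1) = 0" by metis
 define om where "om k t = \<alpha> k * v (2*k) t + \<beta> k * v (2*k+1) t" for k t
 have oms: "smooth (om k)" "om k (x + 2*pi) = om k x" for k x
  unfolding om_def[abs_def] using v(1,2) by (auto intro!: smooth_add smooth_mult smooth_const)
 have om1: "(\<integral>x. indicator Iper x * (om k x)\<^sup>2 \<partial>lborel) = 1" for k
 proof -
  have "indicator Iper x * (om k x)\<^sup>2 = (\<alpha> k)\<^sup>2 * (indicator Iper x * (v (2*k) x)\<^sup>2) + (\<beta> k)\<^sup>2 * (indicator Iper x * (v (2*k+1) x)\<^sup>2)" for x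
   using v(4)[of "2*k" "2*k+1" x] by (auto simp: om_def power_mult_distrib split: split_indicator)
  thus ?thesis using vi v(5) ab(1) by (simp add: Bochner_Integration.integral_add)
 qed
 have omf: "(\<integral>x. indicator Iper x * (sqrt (\<rho> x) * om k x) \<partial>lborel) = 0" for k
 proof -
  have "indicator Iper x * (sqrt (\<rho> x) * om k x) = \<alpha> k * (indicator Iper x * (sqrt (\<rho> x) * v (2*k) x)) + \<beta> k * (indicator Iper x * (sqrt (\<rho> x) * v (2*k+1) x))" for x
   by (simp add: om_def algebra_simps)
  thus ?thesis using fvi ab(2)[of k] by (simp add: Bochner_Integration.integral_add A_def)
 qed
 have omd: "om k x = 0 \<or> om l x = 0" if kl: "k \<noteq> l" and x: "x \<in> Iper" for k l x
 proof -
  have d: "2*k \<noteq> 2*l" "2*k \<noteq> 2*l+1" "2*k+1 \<noteq> 2*l" "2*k+1 \<noteq> 2*l+1" using kl by presburger+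
  show ?thesis using v(4)[OF d(1) x] v(4)[OF d(2) x] v(4)[OF d(3) x] v(4)[OF d(4) x] by (auto simp: om_def)
 qed
 define U where "U k = (case k of 0 => (%i::nat. f) | Suc k => (%i t. complex_of_real (om k t)))" for k
 have U0: "U 0 i t = f t" and US: "U (Suc k) i t = complex_of_real (om k t)" for i k t by (simp_all add: U_def)
 have fsq: "(cmod (f t))\<^sup>2 = \<rho> t" if "t \<in> Iper" for t using fI[OF that] \<rho>0[OF that] by simp
 have ok: "slater_ok 1 (U k)" for k
 proof (cases k)
  case 0
  have "(\<integral>\<^sup>+ t. ennreal ((cmod (f t))\<^sup>2) \<partial>mI) = (\<integral>\<^sup>+ t\<in>Iper. ennreal (\<rho> t) \<partial>lborel)"
   unfolding nn_integral_mI by (intro nn_integral_cong) (auto simp: fsq split: split_indicator)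
  also have "\<dots> = 1" using \<rho> by (simp add: prob_density_on_I_def)
  finally show ?thesis using fo 0 by (auto simp: slater_ok_def U_def)
 next
  case (Suc l)
  thus ?thesis using orb_smooth[OF oms] nn_norm_smooth[OF oms(1) om1] by (auto simp: slater_ok_def U_def)
 qed
 have fo0: "(\<integral>t. f t * cnj (complex_of_real (om l t)) \<partial>mI) = 0" "(\<integral>t. complex_of_real (om l t) * cnj (f t) \<partial>mI) = 0" for l
 proof -
  have "(\<integral>t. f t * cnj (complex_of_real (om l t)) \<partial>mI) = (\<integral>t. complex_of_real (indicator Iper t * (sqrt (\<rho> t) * om l t)) \<partial>lborel)"
   "(\<integral>t. complex_of_real (om l t) * cnj (f t) \<partial>mI) = (\<integral>t. complex_of_real (indicator Iper t * (sqrt (\<rho> t) * om l t)) \<partial>lborel)"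
   unfolding integral_mI by (intro Bochner_Integration.integral_cong refl; auto simp: fI split: split_indicator)+
  thus "(\<integral>t. f t * cnj (complex_of_real (om l t)) \<partial>mI) = 0" "(\<integral>t. complex_of_real (om l t) * cnj (f t) \<partial>mI) = 0"
   unfolding integral_complex_of_real by (simp_all add: omf)
 qed
 have oo: "(\<integral>t. complex_of_real (om k t) * cnj (complex_of_real (om l t)) \<partial>mI) = 0" if "k \<noteq> l" for k l
 proof -
  have "(\<integral>t. complex_of_real (om k t) * cnj (complex_of_real (om l t)) \<partial>mI) = (\<integral>t. 0 \<partial>mI)"
   using omd[OF that] by (intro Bochner_Integration.integral_cong refl) auto
  thus ?thesis by simp
 qed
 have "\<exists>K<\<infinity>. \<forall>\<epsilon>. F_per 1 w \<epsilon> \<rho> <= ennreal \<epsilon> * K + (\<Sum>k<1. ennreal (of_bool (k = (0::nat))) * 0)"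
 proof (rule F_per_le_slaters[where U=U and M=1 and lam="%k. of_bool (k = 0)" and bd="%_. 0"])
  show "integral\<^sup>L (Mn 1) (%x. slater 1 (U k) x * cnj (slater 1 (U l) x)) = 0" if "k \<noteq> l" for k l
  proof (rule slater_orthogonal[OF ok ok, of 0])
   fix l' :: nat
   show "(\<integral>t. U k 0 t * cnj (U l l' t) \<partial>mI) = 0"
    using that fo0 oo by (cases k; cases l) (auto simp: U0 US)
  qed simp
  show "AE t in lborel. t \<in> Iper --> (\<Sum>k<1. ennreal (of_bool (k = 0)) * (\<Sum>i<1. ennreal ((cmod (U k i t))\<^sup>2))) = of_nat 1 * ennreal (\<rho> t)"
   by (intro AE_I2) (simp add: U0 fsq)
 qed (use w ok in \<open>auto simp: cn_1[unfolded One_nat_def]\<close>)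
 thus ?thesis by simp
qed

lemma F_per_upper:
 assumes n1: "1 <= n" and w: "assumptionA w" and \<rho>: "prob_density_on_I \<rho>"
  and H: "H1per 1 (%x. complex_of_real (sqrt (\<rho> (x 0))))"
  and \<gamma>: "\<gamma> \<in> Pi_rho n \<rho>" and c: "(\<integral>\<^sup>+ x. cn n w x \<partial>\<gamma>) < \<infinity>" and \<delta>: "0 < \<delta>"
 shows "\<exists>K<\<infinity>. \<forall>\<epsilon>. F_per n w \<epsilon> \<rho> <= ennreal \<epsilon> * K + ((\<integral>\<^sup>+ x. cn n w x \<partial>\<gamma>) + ennreal \<delta>)"
proof -
 obtain f gf where fo: "orb f gf" and fI: "!!t. t \<in> Iper ==> f t = complex_of_real (sqrt (\<rho> t))"
  by (rule orb_of_H1per[of "%t. complex_of_real (sqrt (\<rho> t))"]) (use H in auto)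
 show ?thesis
 proof (cases "n = 1")
  case True
  obtain K where "K < \<infinity>" "!!\<epsilon>. F_per 1 w \<epsilon> \<rho> <= ennreal \<epsilon> * K" using F_per_upper_1[OF w \<rho> fo fI] by blast
  thus ?thesis using True by (intro exI[of _ K]) (auto intro: add_increasing2)
 next
  case False
  hence n2: "2 <= n" using n1 by simp
  obtain N ch q where d: "cell_partition N \<rho> ch" "!!J. J \<in> tuples n N ==> 0 <= q J"
   "!!i j. i < n ==> j < N ==> (\<Sum>J\<in>tuples n N. q J * of_bool (J i = j)) = cmass \<rho> ch j"
   "!!J k l s t. J \<in> tuples n N ==> q J \<noteq> 0 ==> k < n ==> l < n ==> k \<noteq> l ==> s \<in> cell N (J k) ==> t \<in> cell N (J l)
    ==> 4 * (2*pi / real N) <= dT s t"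
   "(\<Sum>J\<in>tuples n N. ennreal (q J) * cbound n w N J) <= (\<integral>\<^sup>+ x. cn n w x \<partial>\<gamma>) + ennreal \<delta>"
   by (rule discretization[OF n1 w \<rho> \<gamma> c \<delta>], rule that)
  obtain K where K: "K < \<infinity>" "!!\<epsilon>. F_per n w \<epsilon> \<rho> <= ennreal \<epsilon> * K + (\<Sum>J\<in>tuples n N. ennreal (q J) * cbound n w N J)"
  proof -
   have "\<exists>K<\<infinity>. \<forall>\<epsilon>. F_per n w \<epsilon> \<rho> <= ennreal \<epsilon> * K + (\<Sum>J\<in>tuples n N. ennreal (q J) * cbound n w N J)"
    by (rule F_per_upper_ge2[OF n2 w \<rho> fo _ d(1)]) (fact fI, fact d, fact d, fact d)
   thus thesis using that by blast
  qed
  thus ?thesis using d(5) by (intro exI[of _ K]) (auto intro: order_trans[OF K(2) add_left_mono])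
 qed
qed

text \<open>The lower bound holds for every \<epsilon>. In the upper bound the near-optimal plan,
  the discretization and the kinetic term each take a third of the room \<open>r\<close>, and
  \<open>K\<close> is fixed before \<epsilon>.\<close>

lemma F_per_tendsto:
 assumes n1: "1 <= n" and w: "assumptionA w" and \<rho>: "prob_density_on_I \<rho>"
  and H: "H1per 1 (%x. complex_of_real (sqrt (\<rho> (x 0))))"
 shows "((%\<epsilon>. F_per n w \<epsilon> \<rho>) \<longlongrightarrow> F_OT n w \<rho>) (at_right 0)"
proof (rule order_tendstoI)
 fix a assume "a < F_OT n w \<rho>"
 thus "\<forall>\<^sub>F \<epsilon> in at_right 0. a < F_per n w \<epsilon> \<rho>"
  using F_OT_le_F_per[OF n1 w \<rho>] by (intro always_eventually allI) (rule less_le_trans)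
next
 fix a assume a: "F_OT n w \<rho> < a"
 hence "F_OT n w \<rho> < top" using less_le_trans top_greatest by blast
 then obtain F where F: "F_OT n w \<rho> = ennreal F" "0 <= F" by (cases "F_OT n w \<rho>") auto
 have "\<exists>r>0. ennreal (F + r) <= a"
 proof (cases a)
  case (real a')
  hence "F < a'" using a F by (simp add: ennreal_less_iff)
  thus ?thesis using real by (intro exI[of _ "a' - F"]) auto
 next
  case top thus ?thesis by (intro exI[of _ 1]) auto
 qed
 then obtain r where r: "0 < r" "ennreal (F + r) <= a" by blast
 have "F_OT n w \<rho> < ennreal (F + r/3)" using F r by (simp add: ennreal_less_iff)
 then obtain \<gamma> where \<gamma>: "\<gamma> \<in> Pi_rho n \<rho>" "(\<integral>\<^sup>+ x. cn n w x \<partial>\<gamma>) < ennreal (F + r/3)"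
  unfolding F_OT_def INF_less_iff by blast
 have "(\<integral>\<^sup>+ x. cn n w x \<partial>\<gamma>) < \<infinity>" using \<gamma>(2) less_trans[OF _ ennreal_less_top] by simp
 then obtain K where K: "K < \<infinity>" "!!\<epsilon>. F_per n w \<epsilon> \<rho> <= ennreal \<epsilon> * K + ((\<integral>\<^sup>+ x. cn n w x \<partial>\<gamma>) + ennreal (r/3))"
  using F_per_upper[OF n1 w \<rho> H \<gamma>(1), of "r/3"] r by auto
 obtain k where k: "K = ennreal k" "0 <= k" using K(1) by (cases K) auto
 have "\<forall>\<^sub>F \<epsilon> in at_right 0. \<epsilon> < r / (3 * (k + 1))"
  using r k by (intro eventually_at_right_less[THEN eventually_mono] order_tendstoD(2)[OF tendsto_ident_at]) auto
 moreover have "\<forall>\<^sub>F \<epsilon> in at_right (0::real). 0 < \<epsilon>" by (rule eventually_at_right_less)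
 ultimately show "\<forall>\<^sub>F \<epsilon> in at_right 0. F_per n w \<epsilon> \<rho> < a"
 proof eventually_elim
  case (elim \<epsilon>)
  have "\<epsilon> * k <= r / 3"
  proof -
   have "\<epsilon> * k <= \<epsilon> * (k + 1)" using elim by simp
   also have "\<dots> <= r / (3 * (k + 1)) * (k + 1)" using elim k by (intro mult_right_mono) auto
   also have "\<dots> = r / 3" using k by (simp add: field_simps)
   finally show ?thesis .
  qed
  hence "ennreal \<epsilon> * K <= ennreal (r/3)" using elim k by (simp add: ennreal_leI flip: ennreal_mult)
  hence "F_per n w \<epsilon> \<rho> <= ennreal (r/3) + ((\<integral>\<^sup>+ x. cn n w x \<partial>\<gamma>) + ennreal (r/3))"
   using order_trans[OF K(2) add_right_mono] by blast
  also have "\<dots> < ennreal (r/3) + (ennreal (F + r/3) + ennreal (r/3))"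
   using \<gamma>(2) by (simp add: ennreal_add_left_cancel_less add.commute[of _ "ennreal (r/3)"])
  also have "\<dots> = ennreal (F + r)" using F r by (simp add: field_simps flip: ennreal_plus)
  finally show ?case using r(2) by simp
 qed
qed

section \<open>Balanced plans\<close>

definition cnt :: "nat => real => (nat => real) => nat" where
 "cnt n t x = card {i. i < n \<and> x i <= t}"

definition srt :: "nat => (nat => real) => nat => real" where
 "srt n x = (\<lambda>i\<in>{..<n}. sort (map x [0..<n]) ! i)"

lemma cnt_eq_sum: "real (cnt n t x) = (\<Sum>i<n. indicator {..t} (x i))"
proof -
 have "(\<Sum>i<n. indicator {..t} (x i) :: real) = (\<Sum>i\<in>{i. i < n \<and> x i <= t}. 1)"
  by (rule sum.mono_neutral_cong_right) auto
 thus ?thesis by (simp add: cnt_def)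
qed

lemma cnt_permute:
 assumes s: "\<sigma> permutes {..<n}" shows "cnt n t (x \<circ> \<sigma>) = cnt n t x"
proof -
 have "bij_betw \<sigma> {..<n} {..<n}" by (rule permutes_imp_bij[OF s])
 hence "(\<Sum>i<n. indicator {..t} (x (\<sigma> i))) = (\<Sum>i<n. indicator {..t} (x i) :: real)"
  by (rule sum.reindex_bij_betw)
 hence "real (cnt n t (x \<circ> \<sigma>)) = real (cnt n t x)" unfolding cnt_eq_sum by simp
 thus ?thesis by simp
qed

lemma srt_permute:
 assumes x: "x \<in> extensional {..<n}"
 obtains \<sigma> where "\<sigma> permutes {..<n}" "srt n x = x \<circ> \<sigma>"
proof -
 obtain p where p: "p permutes {..<length (map x [0..<n])}" "permute_list p (map x [0..<n]) = sort (map x [0..<n])"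
  by (rule mset_eq_permutation[of "sort (map x [0..<n])" "map x [0..<n]"]) (auto intro: that)
 have p1: "p permutes {..<n}" using p(1) by simp
 have "srt n x i = x (p i)" for i
 proof (cases "i < n")
  case True
  hence "p i < n" using permutes_in_image[OF p1] by auto
  thus ?thesis using True p1 unfolding srt_def p(2)[symmetric] permute_list_def by simp
 next
  case False
  thus ?thesis using permutes_not_in[OF p1, of i] x by (simp add: srt_def extensional_def)
 qed
 thus thesis using that[OF p1] by (simp add: fun_eq_iff)
qed

lemma srt_mono: "i <= j ==> j < n ==> srt n x i <= srt n x j"
 unfolding srt_def by (auto intro!: sorted_nth_mono)

text \<open>Positions are counted from 0, hence the strict inequality: the entry in position
  \<open>i\<close> is at most \<open>t\<close> when at least \<open>i + 1\<close> points are. This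
  trades order statistics for counting functions.\<close>

lemma srt_le_iff:
 assumes x: "x \<in> extensional {..<n}" and i: "i < n"
 shows "srt n x i <= t \<longleftrightarrow> i < cnt n t x"
proof -
 obtain \<sigma> where s: "\<sigma> permutes {..<n}" "srt n x = x \<circ> \<sigma>" by (rule srt_permute[OF x])
 have c: "cnt n t x = card {j. j < n \<and> srt n x j <= t}"
  using cnt_permute[OF s(1), of t x] s(2) by (simp add: cnt_def)
 show ?thesis
 proof
  assume "srt n x i <= t"
  hence "{..i} \<subseteq> {j. j < n \<and> srt n x j <= t}" using i srt_mono[OF _ i, of _ x] by (auto intro: order_trans)
  hence "card {..i} <= cnt n t x" unfolding c by (rule card_mono[rotated]) auto
  thus "i < cnt n t x" by simp
 next
  assume l: "i < cnt n t x"
  show "srt n x i <= t"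
  proof (rule ccontr)
   assume "\<not> srt n x i <= t"
   hence "{j. j < n \<and> srt n x j <= t} \<subseteq> {..<i}" using srt_mono[of i _ n x] by (force simp: not_less[symmetric])
   hence "cnt n t x <= card {..<i}" unfolding c by (rule card_mono[rotated]) auto
   thus False using l by simp
  qed
 qed
qed

lemma In_extensional: "x \<in> In n ==> x \<in> extensional {..<n}"
 by (auto simp: In_def PiE_def)

lemma srt_In: "x \<in> In n ==> srt n x \<in> In n"
 using srt_permute[OF In_extensional] permute_In by metis

lemma measurable_cnt: "(%x. real (cnt n t x)) \<in> borel_measurable (Mn n)"
 unfolding cnt_eq_sum
proof (rule borel_measurable_sum)
 fix i
 have [measurable]: "(%x. x i) \<in> borel_measurable (Mn n)" by (rule measurable_coord)
 show "(%x. indicator {..t} (x i) :: real) \<in> borel_measurable (Mn n)" by measurable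
qed

lemma cnt_sets: "{x \<in> In n. i < cnt n t x} \<in> sets (Mn n)"
proof -
 note measurable_cnt[measurable]
 have "{x \<in> space (Mn n). real i < real (cnt n t x)} \<in> sets (Mn n)" by measurable
 thus ?thesis by simp
qed

lemma measurable_srt: "srt n \<in> measurable (Mn n) (Mn n)"
proof (rule measurable_into_Mn)
 fix i assume i: "i < n"
 show "(%x. srt n x i) \<in> borel_measurable (Mn n)"
  unfolding borel_measurable_iff_le
 proof
  fix a
  have "{x \<in> space (Mn n). srt n x i <= a} = {x \<in> In n. i < cnt n a x}"
   using i by (auto simp: srt_le_iff In_extensional)
  thus "{x \<in> space (Mn n). srt n x i <= a} \<in> sets (Mn n)" using cnt_sets by simp
 qed
qed (simp add: srt_In)

text \<open>A sum over all rearrangements of a point depends only on its sorted version, so the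
  average of a plan is a function of its sorted law, while a symmetric plan is its own
  average.\<close>

lemma symmetrization_unique:
 assumes \<mu>: "sets \<mu> = sets (Mn n)" and \<nu>: "sets \<nu> = sets (Mn n)"
  and eq: "distr \<mu> (Mn n) (srt n) = distr \<nu> (Mn n) (srt n)" and sym: "sym_plan n \<nu>"
 shows "symmetrization n \<mu> = \<nu>"
proof -
 have avg: "(\<Sum>\<sigma>\<in>perms n. emeasure (distr \<kappa> (Mn n) (%x. x \<circ> \<sigma>)) A) = (\<integral>\<^sup>+ x. (\<Sum>\<sigma>\<in>perms n. indicator A (x \<circ> \<sigma>)) \<partial>distr \<kappa> (Mn n) (srt n))"
  if A: "A \<in> sets (Mn n)" and \<kappa>: "sets \<kappa> = sets (Mn n)" for A \<kappa>
 proof -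
  note A[measurable]
  have m: "(%x. x \<circ> \<sigma>) \<in> measurable \<kappa> (Mn n)" if "\<sigma> \<in> perms n" for \<sigma>
   using measurable_permute[of \<sigma> n] that measurable_cong_sets[OF \<kappa> refl] by blast
  have ms: "srt n \<in> measurable \<kappa> (Mn n)" using measurable_srt measurable_cong_sets[OF \<kappa> refl] by blast
  have mi: "(%x. indicator A (x \<circ> \<sigma>) :: ennreal) \<in> borel_measurable (Mn n)" if "\<sigma> \<in> perms n" for \<sigma>
   using that by (intro measurable_compose[OF measurable_permute borel_measurable_indicator]) (auto simp: A)
  have mk: "(%x. indicator A (x \<circ> \<sigma>) :: ennreal) \<in> borel_measurable \<kappa>" if "\<sigma> \<in> perms n" for \<sigma>
   using mi[OF that] measurable_cong_sets[OF \<kappa> refl] by blast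
  have "(\<Sum>\<sigma>\<in>perms n. emeasure (distr \<kappa> (Mn n) (%x. x \<circ> \<sigma>)) A) = (\<Sum>\<sigma>\<in>perms n. \<integral>\<^sup>+ x. indicator A (x \<circ> \<sigma>) \<partial>\<kappa>)"
  proof (rule sum.cong[OF refl])
   fix \<sigma> assume s: "\<sigma> \<in> perms n"
   have "emeasure (distr \<kappa> (Mn n) (%x. x \<circ> \<sigma>)) A = (\<integral>\<^sup>+ x. indicator A x \<partial>distr \<kappa> (Mn n) (%x. x \<circ> \<sigma>))" using A by simp
   also have "\<dots> = (\<integral>\<^sup>+ x. indicator A (x \<circ> \<sigma>) \<partial>\<kappa>)" by (rule nn_integral_distr[OF m[OF s]]) measurable
   finally show "emeasure (distr \<kappa> (Mn n) (%x. x \<circ> \<sigma>)) A = (\<integral>\<^sup>+ x. indicator A (x \<circ> \<sigma>) \<partial>\<kappa>)" .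
  qed
  also have "\<dots> = (\<integral>\<^sup>+ x. (\<Sum>\<sigma>\<in>perms n. indicator A (x \<circ> \<sigma>)) \<partial>\<kappa>)" using mk by (rule nn_integral_sum[symmetric])
  also have "\<dots> = (\<integral>\<^sup>+ x. (\<Sum>\<sigma>\<in>perms n. indicator A (srt n x \<circ> \<sigma>)) \<partial>\<kappa>)"
  proof (rule nn_integral_cong)
   fix x assume "x \<in> space \<kappa>"
   hence "x \<in> In n" using sets_eq_imp_space_eq[OF \<kappa>] by simp
   then obtain \<tau> where t: "\<tau> permutes {..<n}" "srt n x = x \<circ> \<tau>" using srt_permute[OF In_extensional] by metis
   show "(\<Sum>\<sigma>\<in>perms n. indicator A (x \<circ> \<sigma>) :: ennreal) = (\<Sum>\<sigma>\<in>perms n. indicator A (srt n x \<circ> \<sigma>))"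
    unfolding t(2) setum_permutations_compose_left[OF t(1), of "%\<sigma>. indicator A (x \<circ> \<sigma>) :: ennreal"] by (simp add: comp_assoc)
  qed
  also have "\<dots> = (\<integral>\<^sup>+ x. (\<Sum>\<sigma>\<in>perms n. indicator A (x \<circ> \<sigma>)) \<partial>distr \<kappa> (Mn n) (srt n))"
   using mi by (intro nn_integral_distr[symmetric, OF ms] borel_measurable_sum) auto
  finally show ?thesis .
 qed
 have "(\<Sum>\<sigma>\<in>perms n. emeasure (distr \<mu> (Mn n) (%x. x \<circ> \<sigma>)) A) / of_nat (fact n) = emeasure \<nu> A" if A: "A \<in> sets (Mn n)" for A
 proof -
  have "(\<Sum>\<sigma>\<in>perms n. emeasure (distr \<mu> (Mn n) (%x. x \<circ> \<sigma>)) A) = (\<Sum>\<sigma>\<in>perms n. emeasure (distr \<nu> (Mn n) (%x. x \<circ> \<sigma>)) A)"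
   unfolding avg[OF A \<mu>] avg[OF A \<nu>] eq ..
  also have "\<dots> = (\<Sum>\<sigma>\<in>perms n. emeasure \<nu> A)" using sym by (intro sum.cong[OF refl]) (auto simp: sym_plan_def)
  also have "\<dots> = of_nat (fact n) * emeasure \<nu> A" by (simp add: card_perms)
  finally have e: "(\<Sum>\<sigma>\<in>perms n. emeasure (distr \<mu> (Mn n) (%x. x \<circ> \<sigma>)) A) = of_nat (fact n) * emeasure \<nu> A" .
  have "of_nat (fact n) \<noteq> (0::ennreal)" "of_nat (fact n) \<noteq> (\<top>::ennreal)"
   unfolding ennreal_of_nat_eq_real_of_nat using fact_gt_zero[of n] by (auto simp: ennreal_eq_0_iff not_le simp del: fact_gt_zero)
  thus ?thesis unfolding e by (subst mult.commute) (rule ennreal_mult_divide_eq)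
 qed
 hence "symmetrization n \<mu> = measure_of (space (Mn n)) (sets (Mn n)) (emeasure \<nu>)"
  unfolding symmetrization_def by (intro measure_of_eq sets.space_closed) (metis sets.sigma_sets_eq)
 also have "\<dots> = \<nu>" using measure_of_of_measure[of \<nu>] \<nu> sets_eq_imp_space_eq[OF \<nu>] by simp
 finally show ?thesis .
qed

text \<open>Fluctuation as small as integrality permits when the mean number of points between two
  levels is prescribed. It mentions neither \<rho> nor a map, so it can be verified for an unknown
  optimizer.\<close>

definition balanced :: "nat => (nat => real) measure => bool" where
 "balanced n \<mu> \<longleftrightarrow> (\<forall>s t. \<exists>k::int. AE x in \<mu>. int (cnt n t x) - int (cnt n s x) \<in> {k, k + 1})"

lemma Pi_rhoD:
 assumes "\<mu> \<in> Pi_rho n \<rho>"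
 shows "sets \<mu> = sets (Mn n)" "space \<mu> = In n" "prob_space \<mu>" "!!i. i < n ==> distr \<mu> borel (%x. x i) = rho_measure \<rho>"
  "!!f N. f \<in> measurable (Mn n) N ==> f \<in> measurable \<mu> N"
 using assms sets_eq_imp_space_eq[of \<mu> "Mn n"] measurable_cong_sets[of \<mu> "Mn n"] by (auto simp: Pi_rho_def)

text \<open>A variable with values \<open>k\<close> and \<open>k + 1\<close> is determined in law by
  its mean, and the mean of the counting function is \<open>n\<close> times the distribution
  function of \<rho>.\<close>

lemma balanced_cnt_prob:
 assumes \<mu>: "\<mu> \<in> Pi_rho n \<rho>" and b: "balanced n \<mu>"
 shows "measure \<mu> {x \<in> In n. j < cnt n t x} = max 0 (min 1 (real n * cdf (rho_measure \<rho>) t - real j))"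
proof -
 note P = Pi_rhoD[OF \<mu>]
 interpret prob_space \<mu> by (rule P(3))
 have E: "{x \<in> In n. i < cnt n t x} \<in> events" for i using cnt_sets P(1) by simp
 \<comment> \<open>The level -1 lies below \<open>I\<close>, so the second count is zero.\<close>
 obtain k where "AE x in \<mu>. int (cnt n t x) - int (cnt n (-1) x) \<in> {k, k + 1}" using b unfolding balanced_def by blast
 moreover have "cnt n (-1) x = 0" if "x \<in> In n" for x
 proof -
  have "{i. i < n \<and> x i <= -1} = {}" using In_coord[OF that] by (force simp: Iper_def)
  thus ?thesis unfolding cnt_def by (metis card.empty)
 qed
 ultimately have k: "AE x in \<mu>. int (cnt n t x) \<in> {k, k + 1}"
  by (elim AE_mp) (auto intro!: AE_I2 simp: P(2))
 define K where "K = {x \<in> In n. k < int (cnt n t x)}"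
 have K: "K \<in> events"
 proof -
  note measurable_cnt[measurable]
  have "{x \<in> space (Mn n). real_of_int k < real (cnt n t x)} \<in> sets (Mn n)" by measurable
  moreover have "{x \<in> space (Mn n). real_of_int k < real (cnt n t x)} = K"
  proof -
   have "real_of_int k < real m \<longleftrightarrow> k < int m" for m by linarith
   thus ?thesis by (simp add: K_def)
  qed
  ultimately show ?thesis using P(1) by simp
 qed
 have cm: "(%x. real (cnt n t x)) \<in> borel_measurable \<mu>" by (rule P(5)[OF measurable_cnt])
 have "(\<integral>x. real (cnt n t x) \<partial>\<mu>) = (\<integral>x. real_of_int k + indicator K x \<partial>\<mu>)"
 proof (rule integral_cong_AE[OF cm])
  show "(%x. real_of_int k + indicator K x) \<in> borel_measurable \<mu>" using K by measurable
  show "AE x in \<mu>. real (cnt n t x) = real_of_int k + indicator K x"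
   using k
  proof (elim AE_mp, intro AE_I2 impI)
   fix x assume "x \<in> space \<mu>" "int (cnt n t x) \<in> {k, k + 1}"
   then consider "int (cnt n t x) = k" "x \<notin> K" | "int (cnt n t x) = k + 1" "x \<in> K" by (auto simp: K_def P(2))
   thus "real (cnt n t x) = real_of_int k + indicator K x" proof cases
    case 1
    hence "real (cnt n t x) = real_of_int k" by linarith
    thus ?thesis using 1 by simp
   next
    case 2
    hence "real (cnt n t x) = real_of_int k + 1" by linarith
    thus ?thesis using 2 by simp
   qed
  qed
 qed
 also have "\<dots> = k + prob K" proof -
  have "integrable \<mu> (indicator K :: _ => real)" using K by (intro integrable_real_indicator) (auto simp: less_top[symmetric])
  hence "(\<integral>x. real_of_int k + indicator K x \<partial>\<mu>) = (\<integral>x. real_of_int k \<partial>\<mu>) + (\<integral>x. indicator K x \<partial>\<mu>)"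
   by (intro Bochner_Integration.integral_add) auto
  thus ?thesis using K by (simp add: prob_space)
 qed
 finally have m1: "(\<integral>x. real (cnt n t x) \<partial>\<mu>) = k + prob K" .
 have "(\<integral>x. real (cnt n t x) \<partial>\<mu>) = (\<Sum>i<n. \<integral>x. indicator {..t} (x i) \<partial>\<mu>)"
  unfolding cnt_eq_sum
 proof (rule Bochner_Integration.integral_sum)
  fix i
  have [measurable]: "(%x. x i) \<in> borel_measurable \<mu>" by (rule P(5)[OF measurable_coord])
  show "integrable \<mu> (%x. indicator {..t} (x i) :: real)"
   by (rule integrable_const_bound[of _ 1]) (auto simp: indicator_def)
 qed
 also have "\<dots> = (\<Sum>i<n. cdf (rho_measure \<rho>) t)"
 proof (rule sum.cong[OF refl])
  fix i assume "i \<in> {..<n}"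
  hence d: "distr \<mu> borel (%x. x i) = rho_measure \<rho>" using P(4) by simp
  have m[measurable]: "(%x. x i) \<in> borel_measurable \<mu>" by (rule P(5)[OF measurable_coord])
  have "cdf (rho_measure \<rho>) t = (\<integral>y. indicator {..t} y \<partial>distr \<mu> borel (%x. x i))"
   unfolding d cdf_def by simp
  also have "\<dots> = (\<integral>x. indicator {..t} (x i) \<partial>\<mu>)" by (rule integral_distr[OF m]) measurable
  finally show "(\<integral>x. indicator {..t} (x i) \<partial>\<mu>) = cdf (rho_measure \<rho>) t" by simp
 qed
 finally have m: "real n * cdf (rho_measure \<rho>) t = k + prob K" using m1 by simp
 have p: "0 <= prob K" "prob K <= 1" by auto
 consider "int j < k" | "int j = k" | "k + 1 <= int j" by linarith
 thus ?thesis
 proof cases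
  case 1
  have "prob {x \<in> In n. j < cnt n t x} = 1"
   unfolding prob_eq_1[OF E] using k by (elim AE_mp) (use 1 in \<open>auto intro!: AE_I2 simp: P(2)\<close>)
  moreover have "1 <= real n * cdf (rho_measure \<rho>) t - real j"
  proof -
   have "real j + 1 <= real_of_int k" using 1 by linarith
   thus ?thesis using m p by linarith
  qed
  ultimately show ?thesis by simp
 next
  case 2
  hence "{x \<in> In n. j < cnt n t x} = K" by (auto simp: K_def)
  moreover have "real j = real_of_int k" using 2 by simp
  ultimately show ?thesis using m p by simp
 next
  case 3
  have "prob {x \<in> In n. j < cnt n t x} = 0"
   unfolding prob_eq_0[OF E] using k by (elim AE_mp) (use 3 in \<open>auto intro!: AE_I2\<close>)
  moreover have "real n * cdf (rho_measure \<rho>) t - real j <= 0"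
  proof -
   have "real_of_int k + 1 <= real j" using 3 by linarith
   thus ?thesis using m p by linarith
  qed
  ultimately show ?thesis by simp
 qed
qed

text \<open>Up to null sets the events are totally ordered, so the one of least probability is
  contained in all others.\<close>

lemma (in prob_space) prob_chain:
 assumes I: "finite I" "I \<noteq> {}" and E: "!!i. i \<in> I ==> E i \<in> events"
  and cmp: "!!i j. i \<in> I ==> j \<in> I ==> (AE x in M. x \<in> E i --> x \<in> E j) \<or> (AE x in M. x \<in> E j --> x \<in> E i)"
 shows "prob {x \<in> space M. \<forall>i\<in>I. x \<in> E i} = Min ((%i. prob (E i)) ` I)"
proof -
 obtain i where i: "i \<in> I" "Min ((%i. prob (E i)) ` I) = prob (E i)"
 proof -
  have "Min ((%i. prob (E i)) ` I) \<in> (%i. prob (E i)) ` I" using I by (intro Min_in) auto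
  thus thesis using that by auto
 qed
 have le: "prob (E i) <= prob (E j)" if "j \<in> I" for j
  unfolding i(2)[symmetric] using I that by (intro Min_le) auto
 have sub: "AE x in M. x \<in> E i --> x \<in> E j" if j: "j \<in> I" for j
  using cmp[OF i(1) j]
 proof
  assume a: "AE x in M. x \<in> E j --> x \<in> E i"
  have "prob (E j) <= prob (E i)" using a E[OF i(1)] by (rule finite_measure_mono_AE)
  hence e: "prob (E j) = prob (E i)" using le[OF j] by simp
  have "prob (E i - E j) = prob (E i) - prob (E i \<inter> E j)" using E i j by (intro finite_measure_Diff') auto
  also have "prob (E i \<inter> E j) = prob (E j)"
  proof (rule finite_measure_eq_AE)
   show "AE x in M. (x \<in> E i \<inter> E j) = (x \<in> E j)" using a by (elim AE_mp) (auto intro!: AE_I2)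
  qed (use E i j in auto)
  finally have "prob (E i - E j) = 0" using e by simp
  moreover have "E i - E j \<in> events" using E i j by auto
  ultimately have "AE x in M. x \<notin> E i - E j" using prob_eq_0 by blast
  thus ?thesis by (elim AE_mp) (auto intro!: AE_I2)
 qed
 have "AE x in M. \<forall>j\<in>I. x \<in> E i --> x \<in> E j" using I sub by (intro AE_finite_allI) auto
 hence "AE x in M. (x \<in> {x \<in> space M. \<forall>i\<in>I. x \<in> E i}) = (x \<in> E i)"
  by (elim AE_mp) (use i in \<open>auto intro!: AE_I2\<close>)
 moreover have "{x \<in> space M. \<forall>i\<in>I. x \<in> E i} \<in> events"
  proof -
  have "{x \<in> space M. \<forall>i\<in>I. x \<in> E i} = (\<Inter>i\<in>I. E i)" using E I sets.sets_into_space by blast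
  thus ?thesis using E I by (auto intro!: sets.finite_INT)
 qed
 ultimately show ?thesis unfolding i(2) using E i by (intro finite_measure_eq_AE) auto
qed

text \<open>Boxes for the sorted point are intersections of the events that
  \<open>i < cnt n (t i) x\<close>. Balance makes these pairwise nested: the difference of two
  counts is almost surely at least \<open>i - j\<close> or almost surely at most
  \<open>i - j\<close>, and each case gives one implication. Their single probabilities are known,
  so those of boxes are as well.\<close>

lemma balanced_sorted_unique:
 assumes n1: "1 <= n" and \<mu>: "\<mu> \<in> Pi_rho n \<rho>" "balanced n \<mu>" and \<nu>: "\<nu> \<in> Pi_rho n \<rho>" "balanced n \<nu>"
 shows "distr \<mu> (Mn n) (srt n) = distr \<nu> (Mn n) (srt n)"
proof -
 have box: "emeasure (distr \<kappa> (Mn n) (srt n)) (obox n t)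
   = ennreal (Min ((%i. max 0 (min 1 (real n * cdf (rho_measure \<rho>) (t i) - real i))) ` {..<n}))"
  if \<kappa>: "\<kappa> \<in> Pi_rho n \<rho>" "balanced n \<kappa>" for \<kappa> t
 proof -
  note P = Pi_rhoD[OF \<kappa>(1)]
  interpret prob_space \<kappa> by (rule P(3))
  define E where "E i = {x \<in> In n. i < cnt n (t i) x}" for i
  have Ee: "E i \<in> events" for i unfolding E_def using cnt_sets P(1) by simp
  have ms: "srt n \<in> measurable \<kappa> (Mn n)" by (rule P(5)[OF measurable_srt])
  have "srt n -` obox n t \<inter> space \<kappa> = {x \<in> space \<kappa>. \<forall>i\<in>{..<n}. x \<in> E i}"
   by (auto simp: obox_def E_def P(2) srt_In srt_le_iff In_extensional)
  hence "emeasure (distr \<kappa> (Mn n) (srt n)) (obox n t) = ennreal (prob {x \<in> space \<kappa>. \<forall>i\<in>{..<n}. x \<in> E i})"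
   by (simp add: emeasure_distr[OF ms obox_sets] emeasure_eq_measure)
  also have "prob {x \<in> space \<kappa>. \<forall>i\<in>{..<n}. x \<in> E i} = Min ((%i. prob (E i)) ` {..<n})"
  proof (rule prob_chain)
   fix i j
   obtain k where k: "AE x in \<kappa>. int (cnt n (t i) x) - int (cnt n (t j) x) \<in> {k, k + 1}" using \<kappa>(2) unfolding balanced_def by blast
   show "(AE x in \<kappa>. x \<in> E i --> x \<in> E j) \<or> (AE x in \<kappa>. x \<in> E j --> x \<in> E i)"
   proof (cases "k \<ge> int i - int j")
    case True
    have "AE x in \<kappa>. x \<in> E j --> x \<in> E i" using k by (elim AE_mp) (use True in \<open>auto intro!: AE_I2 simp: E_def\<close>)
    thus ?thesis ..
   next
    case False
    have "AE x in \<kappa>. x \<in> E i --> x \<in> E j" using k by (elim AE_mp) (use False in \<open>auto intro!: AE_I2 simp: E_def\<close>)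
    thus ?thesis ..
   qed
  qed (use n1 Ee in \<open>auto simp: lessThan_empty_iff\<close>)
  finally show ?thesis unfolding E_def balanced_cnt_prob[OF \<kappa>] .
 qed
 have ms: "srt n \<in> measurable \<mu> (Mn n)" by (rule Pi_rhoD(5)[OF \<mu>(1) measurable_srt])
 show ?thesis
  by (rule measure_eqI_boxes) (auto simp: box[OF \<mu>] box[OF \<nu>] intro!: prob_space.prob_space_distr[OF Pi_rhoD(3)[OF \<mu>(1)] ms])
qed

section \<open>The Seidl plan\<close>

lemma bij_betw_add_mod: "bij_betw (%k. (i + k) mod n) {..<n} {..<n::nat}"
proof -
 have inj: "inj_on (%k. (i + k) mod n) {..<n}"
 proof (rule linorder_inj_onI)
  fix k l assume kl: "k < l" "k \<in> {..<n}" "l \<in> {..<n}"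
  show "(i + k) mod n \<noteq> (i + l) mod n"
  proof
   assume "(i + k) mod n = (i + l) mod n"
   hence "n dvd (i + l) - (i + k)" using kl by (subst mod_eq_dvd_iff_nat[symmetric]) auto
   hence "n dvd l - k" by simp
   thus False using kl by (auto dest: dvd_imp_le)
  qed
 qed auto
 moreover have "(%k. (i + k) mod n) ` {..<n} \<subseteq> {..<n}" by auto
 ultimately show ?thesis using endo_inj_surj[of "{..<n}" "%k. (i + k) mod n"] by (simp add: bij_betw_def)
qed

lemma emeasure_lborel_shift:
 fixes a b s :: real
 assumes B: "B \<in> sets borel"
 shows "emeasure lborel {u \<in> {a<..<b}. u + s \<in> B} = emeasure lborel ({a+s<..<b+s} \<inter> B)"
proof -
 have "emeasure lborel ({a+s<..<b+s} \<inter> B) = emeasure (distr lborel borel ((+) s)) ({a+s<..<b+s} \<inter> B)"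
  by (simp add: lborel_distr_plus)
 also have "\<dots> = emeasure lborel ((+) s -` ({a+s<..<b+s} \<inter> B) \<inter> space lborel)" using B by (intro emeasure_distr) auto
 also have "(+) s -` ({a+s<..<b+s} \<inter> B) \<inter> space lborel = {u \<in> {a<..<b}. u + s \<in> B}" by (auto simp: add.commute)
 finally show ?thesis by simp
qed

locale seidl =
 fixes n :: nat and \<rho> :: "real => real"
 assumes n1: "1 <= n" and \<rho>: "prob_density_on_I \<rho>"
begin

sublocale D: cdf_distribution "rho_measure \<rho>"
 unfolding cdf_distribution_def by (rule real_distribution_rho[OF \<rho>])

abbreviation "F \<equiv> cdf (rho_measure \<rho>)"
abbreviation "\<Omega> \<equiv> restrict_space lborel {0<..<1::real}"

text \<open>The quantile function. Its values at 0 and 1 are set by hand so that the outer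
  breakpoints are the ends of \<open>I\<close> even when \<rho> vanishes near them.\<close>

definition Q :: "real => real" where
 "Q u = (if u <= 0 then 0 else if 1 <= u then 2*pi else Inf {x. u <= F x})"

text \<open>Rotation by \<open>1/n\<close> on the circle of levels; the Seidl map is this rotation
  in quantile coordinates.\<close>

definition R :: "real => real" where
 "R u = (if u + 1 / real n < 1 then u + 1 / real n else u + 1 / real n - 1)"

definition T :: "real => real" where "T x = Q (R (F x))"

lemma n_pos: "0 < real n" "1 / real n <= 1" using n1 by auto

lemma step_size: obtains h where "h = 1 / real n" "0 < h" "h <= 1" using n_pos by auto

lemma F_0: assumes "t <= 0" shows "F t = 0"
proof -
 have "AE s in lborel. indicator Iper s * ennreal (\<rho> s) * indicator {..t} s = 0"
  using AE_lborel_singleton[of "0::real"] by (elim AE_mp) (use assms in \<open>auto intro!: AE_I2 simp: Iper_def split: split_indicator\<close>)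
 hence "(\<integral>\<^sup>+ s. indicator Iper s * ennreal (\<rho> s) * indicator {..t} s \<partial>lborel) = (\<integral>\<^sup>+ s. 0 \<partial>(lborel :: real measure))"
  by (rule nn_integral_cong_AE)
 hence "emeasure (rho_measure \<rho>) {..t} = 0" by (simp add: emeasure_rho_measure[OF \<rho>])
 thus ?thesis by (simp add: cdf_def measure_def)
qed

lemma F_1: assumes "2*pi <= t" shows "F t = 1"
proof -
 have "emeasure (rho_measure \<rho>) {..t} = emeasure (rho_measure \<rho>) UNIV"
  unfolding emeasure_rho_measure[OF \<rho> borel_closed[OF closed_atMost]] emeasure_rho_measure[OF \<rho> borel_open[OF open_UNIV]]
  using assms by (intro nn_integral_cong) (auto simp: Iper_def split: split_indicator)
 thus ?thesis using D.emeasure_space_1 by (simp add: cdf_def measure_def)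
qed

lemma F_01: "0 <= F t" "F t <= 1" using D.cdf_nonneg D.cdf_bounded_prob by auto

lemma F_mono: "s <= t ==> F s <= F t" by (rule D.cdf_nondecreasing)

lemma Q_le_iff: assumes "0 < u" "u < 1" shows "Q u <= t \<longleftrightarrow> u <= F t"
 using D.pseudoinverse[OF assms, of t] assms by (simp add: Q_def)

text \<open>Continuity of \<open>F\<close> excludes a jump across the level \<open>u\<close>, since
  all values to the left of \<open>Q u\<close> are below \<open>u\<close>.\<close>

lemma F_Q: assumes u: "0 <= u" "u <= 1" shows "F (Q u) = u"
proof (cases "0 < u \<and> u < 1")
 case True
 have "u <= F (Q u)" using Q_le_iff[of u "Q u"] True by simp
 moreover have "F (Q u) <= u"
 proof (rule tendsto_upperbound[where F="at_left (Q u)"])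
  show "(F \<longlongrightarrow> F (Q u)) (at_left (Q u))"
   using isCont_cdf_rho[OF \<rho>, of "Q u"] by (simp add: isCont_def filterlim_at_split)
  show "\<forall>\<^sub>F t in at_left (Q u). F t <= u"
   unfolding eventually_at_filter
   by (intro always_eventually allI impI) (use Q_le_iff True in \<open>force simp: not_le[symmetric]\<close>)
 qed simp
 ultimately show ?thesis by simp
next
 case False
 thus ?thesis using u F_0[of 0] F_1[of "2*pi"] by (auto simp: Q_def)
qed

lemma Q_in: "Q u \<in> Iper"
proof (cases "0 < u \<and> u < 1")
 case True
 hence "Q u <= 2*pi" using Q_le_iff[of u "2*pi"] F_1[of "2*pi"] by simp
 moreover have "0 <= Q u" using F_Q[of u] F_0[of "Q u"] True by (cases "Q u <= 0") auto
 ultimately show ?thesis by (simp add: Iper_def)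
qed (auto simp: Q_def Iper_def)

lemma Q_mono: assumes "u <= v" shows "Q u <= Q v"
proof (cases "0 < u \<and> v < 1")
 case True
 thus ?thesis using assms Q_le_iff[of u "Q v"] F_Q[of v] by simp
next
 case False
 then consider "u <= 0" | "1 <= v" by linarith
 thus ?thesis using Q_in[of u] Q_in[of v] assms by cases (auto simp: Q_def[of u] Q_def[of v] Iper_def)
qed

lemma Q_measurable [measurable]: "Q \<in> borel_measurable borel"
 by (rule borel_measurable_mono) (simp add: monoI Q_mono)

lemma R_measurable [measurable]: "R \<in> borel_measurable borel"
 unfolding R_def[abs_def] by measurable

lemma T_measurable [measurable]: "T \<in> borel_measurable borel"
 unfolding T_def[abs_def] by measurable

lemma R_01: assumes "0 <= u" "u <= 1" shows "0 <= R u \<and> R u <= 1"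
proof -
 obtain h where h: "h = 1 / real n" "0 < h" "h <= 1" by (rule step_size)
 show ?thesis unfolding R_def h(1)[symmetric] using h(2,3) assms by auto
qed

lemma R_iter_01: "0 <= u ==> u <= 1 ==> 0 <= (R ^^ k) u \<and> (R ^^ k) u <= 1"
 by (induction k) (auto simp: R_01)

lemma T_iter_Q: "0 <= u ==> u <= 1 ==> (T ^^ k) (Q u) = Q ((R ^^ k) u)"
proof (induction k)
 case (Suc k)
 thus ?case using R_iter_01[of u k] by (simp add: T_def F_Q)
qed simp

lemma prob_\<Omega>: "prob_space \<Omega>"
 by (auto simp: emeasure_restrict_space space_restrict_space intro!: prob_spaceI)

lemma measurable_\<Omega>: "f \<in> borel_measurable borel ==> f \<in> borel_measurable \<Omega>"
 by (intro measurable_restrict_space1) simp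

lemma rho_Q: "distr \<Omega> borel Q = rho_measure \<rho>"
proof -
 have "distr \<Omega> borel Q = distr \<Omega> borel D.I"
  by (rule distr_cong) (auto simp: space_restrict_space Q_def)
 thus ?thesis using D.distr_I_eq_M by simp
qed

lemma emeasure_\<Omega>: "A \<in> sets borel ==> f \<in> borel_measurable borel ==> emeasure (distr \<Omega> borel f) A = emeasure lborel {u \<in> {0<..<1}. f u \<in> A}"
proof -
 assume A: "A \<in> sets borel" and f: "f \<in> borel_measurable borel"
 have "f -` A \<inter> space \<Omega> = {u \<in> {0<..<1}. f u \<in> A}" by (auto simp: space_restrict_space)
 thus ?thesis unfolding emeasure_distr[OF measurable_\<Omega>[OF f] A] by (subst emeasure_restrict_space) auto
qed

text \<open>A rotation cuts the unit interval in two and translates each piece; the end points are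
  null sets.\<close>

lemma R_preserves: "distr \<Omega> borel (R ^^ k) = distr \<Omega> borel (%u. u)"
proof (induction k)
 case 0
 thus ?case by (simp add: id_def)
next
 case (Suc k)
 have R1: "distr \<Omega> borel R = distr \<Omega> borel (%u. u)"
 proof (rule measure_eqI)
  fix B assume "B \<in> sets (distr \<Omega> borel R)"
  hence B[measurable]: "B \<in> sets borel" by simp
  obtain h where h: "h = 1 / real n" "0 < h" "h <= 1" by (rule step_size)
  let ?A1 = "{u \<in> {0<..<1 - h}. u + h \<in> B}" and ?A2 = "{u \<in> {1 - h<..<1}. u + (h - 1) \<in> B}"
  have m: "{u \<in> {0<..<1}. R u \<in> B} \<in> sets lborel" "?A1 \<in> sets lborel" "?A2 \<in> sets lborel"
   "{0<..<1} \<inter> B \<in> sets lborel" "{h<..<1} \<inter> B \<in> sets lborel" "{0<..<h} \<inter> B \<in> sets lborel"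
   by (measurable; simp)+
  have "emeasure lborel {u \<in> {0<..<1}. R u \<in> B} = emeasure lborel (?A1 \<union> ?A2)"
  proof (rule emeasure_eq_AE)
   show "AE u in lborel. (u \<in> {u \<in> {0<..<1}. R u \<in> B}) = (u \<in> ?A1 \<union> ?A2)"
    using AE_lborel_singleton[of "1 - h"]
    by (elim AE_mp) (use h(2,3) in \<open>auto intro!: AE_I2 simp: R_def h(1)[symmetric] algebra_simps\<close>)
  qed (use m in auto)
  also have "\<dots> = emeasure lborel ?A1 + emeasure lborel ?A2" using m by (intro plus_emeasure[symmetric]) auto
  also have "\<dots> = emeasure lborel ({h<..<1} \<inter> B) + emeasure lborel ({0<..<h} \<inter> B)"
   unfolding emeasure_lborel_shift[OF B] by simp
  also have "\<dots> = emeasure lborel (({h<..<1} \<inter> B) \<union> ({0<..<h} \<inter> B))" using m by (intro plus_emeasure) auto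
  also have "\<dots> = emeasure lborel ({0<..<1} \<inter> B)"
  proof (rule emeasure_eq_AE)
   show "AE u in lborel. (u \<in> ({h<..<1} \<inter> B) \<union> ({0<..<h} \<inter> B)) = (u \<in> {0<..<1} \<inter> B)"
    using AE_lborel_singleton[of "h"] by (elim AE_mp) (use h(2,3) in \<open>auto intro!: AE_I2\<close>)
  qed (use m in auto)
  finally show "emeasure (distr \<Omega> borel R) B = emeasure (distr \<Omega> borel (%u. u)) B"
   by (simp add: emeasure_\<Omega> Int_def)
 qed simp
 have mk: "(R ^^ k) \<in> borel_measurable \<Omega>" by (intro measurable_\<Omega> measurable_compose_n R_measurable)
 have "distr \<Omega> borel (R ^^ Suc k) = distr (distr \<Omega> borel (R ^^ k)) borel R"
  using mk by (subst distr_distr) (auto simp: comp_def)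
 also have "\<dots> = distr (distr \<Omega> borel (%u. u)) borel R" unfolding Suc ..
 also have "\<dots> = distr \<Omega> borel R" using measurable_\<Omega>[of "%u. u"] by (subst distr_distr) (auto simp: comp_def)
 finally show ?case unfolding R1 .
qed

definition dd :: "nat => real" where "dd i = Q (real i / real n)"

lemma F_dd: "i <= n ==> F (dd i) = real i / real n"
 unfolding dd_def using n_pos by (intro F_Q) auto

text \<open>In quantile coordinates the part of \<rho> between consecutive breakpoints is Lebesgue
  measure on a level interval of length \<open>1/n\<close>, which reduces the transport conditions
  to translations.\<close>

lemma piece:
 assumes i: "i < n" and A: "A \<in> sets borel"
 shows "emeasure (density lborel (%t. indicator {dd i..dd (Suc i)} t * ennreal (\<rho> t))) A
  = emeasure lborel {u \<in> {real i / real n<..<real (Suc i) / real n}. Q u \<in> A}"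
proof -
 note A[measurable]
 have [measurable]: "\<rho> \<in> borel_measurable borel" using \<rho> by (simp add: prob_density_on_I_def)
 have sub: "{dd i..dd (Suc i)} \<subseteq> Iper" using Q_in[of "real i / real n"] Q_in[of "real (Suc i) / real n"] by (auto simp: dd_def Iper_def)
 have "emeasure (density lborel (%t. indicator {dd i..dd (Suc i)} t * ennreal (\<rho> t))) A
   = (\<integral>\<^sup>+ t. indicator {dd i..dd (Suc i)} t * ennreal (\<rho> t) * indicator A t \<partial>lborel)"
  by (rule emeasure_density) (use A in auto)
 also have "\<dots> = emeasure (rho_measure \<rho>) ({dd i..dd (Suc i)} \<inter> A)"
  unfolding emeasure_rho_measure[OF \<rho> sets.Int[OF borel_closed[OF closed_atLeastAtMost] A]]
  using sub by (intro nn_integral_cong) (auto split: split_indicator)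
 also have "\<dots> = emeasure lborel {u \<in> {0<..<1}. Q u \<in> {dd i..dd (Suc i)} \<inter> A}"
  unfolding rho_Q[symmetric] using A by (intro emeasure_\<Omega>) auto
 also have "\<dots> = emeasure lborel {u \<in> {real i / real n<..<real (Suc i) / real n}. Q u \<in> A}"
 proof (rule emeasure_eq_AE)
  have le1: "real (Suc i) / real n <= 1" using i by simp
  have "(u \<in> {u \<in> {0<..<1}. Q u \<in> {dd i..dd (Suc i)} \<inter> A}) = (u \<in> {u \<in> {real i / real n<..<real (Suc i) / real n}. Q u \<in> A})"
   if ne: "u \<noteq> real i / real n" "u \<noteq> real (Suc i) / real n" for u
  proof -
   have "real i / real n <= u \<and> u <= real (Suc i) / real n" if "0 < u" "u < 1" "Q u \<in> {dd i..dd (Suc i)}"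
    using that F_mono[of "dd i" "Q u"] F_mono[of "Q u" "dd (Suc i)"] F_Q[of u] F_dd[of i] F_dd[of "Suc i"] i by auto
   moreover have "0 < u \<and> u < 1 \<and> Q u \<in> {dd i..dd (Suc i)}" if "real i / real n < u" "u < real (Suc i) / real n"
   proof -
    have "0 <= real i / real n" by simp
    hence "0 < u" "u < 1" using that le1 by linarith+
    thus ?thesis using that by (auto simp: dd_def intro!: Q_mono simp del: of_nat_Suc)
   qed
   ultimately show ?thesis using ne by auto
  qed
  thus "AE u in lborel. (u \<in> {u \<in> {0<..<1}. Q u \<in> {dd i..dd (Suc i)} \<inter> A}) = (u \<in> {u \<in> {real i / real n<..<real (Suc i) / real n}. Q u \<in> A})"
   by (intro AE_I2[THEN AE_mp[OF AE_conjI[OF AE_lborel_singleton[of "real i / real n"] AE_lborel_singleton[of "real (Suc i) / real n"]]]] impI) blast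
 qed (measurable; simp)+
 finally show ?thesis .
qed

lemma T_push:
 assumes i: "i < n"
 shows "distr (density lborel (%t. indicator {dd i..dd (Suc i)} t * ennreal (\<rho> t))) borel T
  = density lborel (%t. indicator {dd (Suc i mod n)..dd (Suc (Suc i mod n))} t * ennreal (\<rho> t))"
proof (rule measure_eqI)
 fix A assume "A \<in> sets (distr (density lborel (%t. indicator {dd i..dd (Suc i)} t * ennreal (\<rho> t))) borel T)"
 hence A[measurable]: "A \<in> sets borel" by simp
 define h where "h = 1 / real n"
 have B: "{u. Q u \<in> A} \<in> sets borel" by measurable
 have TA: "T -` A \<in> sets borel" using measurable_sets_borel[OF T_measurable A] by simp
 have hi: "real (Suc i) / real n = real i / real n + h" by (simp add: h_def add_divide_distrib)
 have i0: "0 <= real i / real n" "real i / real n + h <= 1" unfolding hi[symmetric] using i by auto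
 have "emeasure (distr (density lborel (%t. indicator {dd i..dd (Suc i)} t * ennreal (\<rho> t))) borel T) A
   = emeasure (density lborel (%t. indicator {dd i..dd (Suc i)} t * ennreal (\<rho> t))) (T -` A)"
  by (subst emeasure_distr) auto
 also have "\<dots> = emeasure lborel {u \<in> {real i / real n<..<real i / real n + h}. Q u \<in> T -` A}" unfolding piece[OF i TA] hi ..
 also have "{u \<in> {real i / real n<..<real i / real n + h}. Q u \<in> T -` A} = {u \<in> {real i / real n<..<real i / real n + h}. Q (R u) \<in> A}"
 proof -
  have "F (Q u) = u" if "u \<in> {real i / real n<..<real i / real n + h}" for u
   using that i0 by (intro F_Q) (simp_all only: greaterThanLessThan_iff, linarith+)
  thus ?thesis by (auto simp: T_def)
 qed
 also have "emeasure lborel \<dots> = emeasure lborel {u \<in> {real (Suc i mod n) / real n<..<real (Suc (Suc i mod n)) / real n}. Q u \<in> A}"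
 proof (cases "Suc i < n")
  case True
  have "real (Suc i) + 1 <= real n" using True by simp
  hence "real i / real n + h + h <= 1" using n_pos by (simp add: h_def field_simps)
  hence "{u \<in> {real i / real n<..<real i / real n + h}. Q (R u) \<in> A} = {u \<in> {real i / real n<..<real i / real n + h}. u + h \<in> {u. Q u \<in> A}}"
   by (auto simp: R_def h_def[symmetric])
  moreover have "Suc i mod n = Suc i" using True by simp
  moreover have "real (Suc i) / real n = real i / real n + h" "real (Suc (Suc i)) / real n = real i / real n + h + h"
   by (simp_all add: h_def add_divide_distrib)
  ultimately show ?thesis by (simp only: emeasure_lborel_shift[OF B]) (simp add: Int_def)
 next
  case False
  hence ni: "Suc i = n" using i by simp
  hence e: "real i / real n + h = 1" using n_pos unfolding hi[symmetric] by simp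
  have "{u \<in> {real i / real n<..<real i / real n + h}. Q (R u) \<in> A} = {u \<in> {real i / real n<..<real i / real n + h}. u + (h - 1) \<in> {u. Q u \<in> A}}"
   using e by (auto simp: R_def h_def[symmetric] add_diff_eq)
  moreover have "{real i / real n + (h - 1)<..<real i / real n + h + (h - 1)} = {0<..<h}" using e by (simp add: algebra_simps)
  moreover have "Suc i mod n = 0" using ni by simp
  ultimately show ?thesis by (simp only: emeasure_lborel_shift[OF B]) (simp add: h_def Int_def)
 qed
 also have "\<dots> = emeasure (density lborel (%t. indicator {dd (Suc i mod n)..dd (Suc (Suc i mod n))} t * ennreal (\<rho> t))) A"
  using i by (intro piece[symmetric, OF _ A]) auto
 finally show "emeasure (distr (density lborel (%t. indicator {dd i..dd (Suc i)} t * ennreal (\<rho> t))) borel T) A = \<dots>" .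
qed simp

text \<open>Over one piece the rotation of levels either never wraps or always does.\<close>

lemma T_mono: assumes i: "i < n" shows "mono_on {dd i<..<dd (Suc i)} T"
proof (rule mono_onI)
 fix x y assume xy: "x \<in> {dd i<..<dd (Suc i)}" "y \<in> {dd i<..<dd (Suc i)}" "x <= y"
 have lo: "real i / real n <= F z" if "z \<in> {dd i<..<dd (Suc i)}" for z
  using that F_mono[of "dd i" z] F_dd[of i] i by auto
 have "R (F x) <= R (F y)"
 proof (cases "Suc i < n")
  case True
  have hi: "F z + 1 / real n < 1" if z: "z \<in> {dd i<..<dd (Suc i)}" for z
  proof -
   have "\<not> Q (real (Suc i) / real n) <= z" using z by (simp add: dd_def)
   hence "F z < real (Suc i) / real n" using Q_le_iff[of "real (Suc i) / real n" z] True by (simp add: not_le)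
   moreover have "real (Suc i) / real n + 1 / real n <= 1" using True n_pos by (simp add: field_simps)
   ultimately show ?thesis by simp
  qed
  show ?thesis using hi[OF xy(1)] hi[OF xy(2)] F_mono[OF xy(3)] by (simp add: R_def)
 next
  case False
  hence "real i / real n + 1 / real n = 1" using i n_pos by (simp add: field_simps)
  hence "1 <= F z + 1 / real n" if "z \<in> {dd i<..<dd (Suc i)}" for z using lo[OF that] by linarith
  from this[OF xy(1)] this[OF xy(2)] show ?thesis using F_mono[OF xy(3)] by (simp add: R_def)
 qed
 thus "T x <= T y" unfolding T_def by (rule Q_mono)
qed

text \<open>Parametrizes the plan by a uniform level, so that iterates of \<open>T\<close> become
  iterates of a rotation.\<close>

definition Y :: "real => nat => real" where "Y u = (\<lambda>i\<in>{..<n}. Q ((R ^^ i) u))"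

definition plan :: "(nat => real) measure" where "plan = distr \<Omega> (Mn n) Y"

lemma Y_measurable: "Y \<in> measurable \<Omega> (Mn n)"
proof (rule measurable_into_Mn)
 fix i assume "i < n"
 hence "(%u. Y u i) = (%u. Q ((R ^^ i) u))" by (simp add: Y_def)
 moreover have "(%u. Q ((R ^^ i) u)) \<in> borel_measurable borel"
  by (rule measurable_compose[OF measurable_compose_n[OF R_measurable] Q_measurable])
 ultimately show "(%u. Y u i) \<in> borel_measurable \<Omega>" by (simp add: measurable_\<Omega>)
qed (auto simp: Y_def In_def Q_in)

lemma plan_eq: "plan = distr (density mI (%t. ennreal (\<rho> t))) (Mn n) (%x. \<lambda>i\<in>{..<n}. (T ^^ i) x)"
proof -
 have [measurable]: "\<rho> \<in> borel_measurable borel" using \<rho> by (simp add: prob_density_on_I_def)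
 have QM: "Q \<in> measurable \<Omega> mI"
  unfolding mI_def using measurable_\<Omega>[OF Q_measurable] Q_in by (intro measurable_restrict_space2) auto
 have "density mI (%t. ennreal (\<rho> t)) = distr \<Omega> mI Q"
 proof (rule measure_eqI)
  fix A assume "A \<in> sets (density mI (%t. ennreal (\<rho> t)))"
  hence A: "A \<in> sets mI" by simp
  hence Ab: "A \<in> sets borel" and AI: "A \<subseteq> Iper"
   by (auto simp: mI_def sets_restrict_space Iper_def)
  have "(%t. ennreal (\<rho> t)) \<in> borel_measurable mI" unfolding mI_def by (intro measurable_restrict_space1) measurable
  hence "emeasure (density mI (%t. ennreal (\<rho> t))) A = (\<integral>\<^sup>+ t. ennreal (\<rho> t) * indicator A t \<partial>mI)"
   by (intro emeasure_density A)
  also have "\<dots> = emeasure (rho_measure \<rho>) A"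
   unfolding nn_integral_mI emeasure_rho_measure[OF \<rho> Ab] by (intro nn_integral_cong) (auto split: split_indicator)
  also have "\<dots> = emeasure \<Omega> (Q -` A \<inter> space \<Omega>)"
   unfolding rho_Q[symmetric] by (rule emeasure_distr[OF measurable_\<Omega>[OF Q_measurable] Ab])
  also have "\<dots> = emeasure (distr \<Omega> mI Q) A" by (rule emeasure_distr[symmetric, OF QM A])
  finally show "emeasure (density mI (%t. ennreal (\<rho> t))) A = emeasure (distr \<Omega> mI Q) A" .
 qed simp
 moreover have "(%x. \<lambda>i\<in>{..<n}. (T ^^ i) x) \<in> measurable mI (Mn n)"
 proof (rule measurable_into_Mn)
  fix i assume "i < n"
  thus "(%x. (\<lambda>i\<in>{..<n}. (T ^^ i) x) i) \<in> borel_measurable mI"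
   using measurable_compose[OF measurable_mI_borel measurable_compose_n[OF T_measurable]] by simp
 next
  fix x assume "x \<in> space mI"
  hence "x \<in> Iper" by (simp add: mI_def space_restrict_space)
  hence "(T ^^ i) x \<in> Iper" for i by (cases i) (auto simp: T_def Q_in)
  thus "(\<lambda>i\<in>{..<n}. (T ^^ i) x) \<in> In n" by (simp add: In_def)
 qed
 ultimately have "distr (density mI (%t. ennreal (\<rho> t))) (Mn n) (%x. \<lambda>i\<in>{..<n}. (T ^^ i) x) = distr \<Omega> (Mn n) ((%x. \<lambda>i\<in>{..<n}. (T ^^ i) x) \<circ> Q)"
  using distr_distr[OF _ QM] by simp
 also have "\<dots> = plan"
  unfolding plan_def by (rule distr_cong) (auto simp: Y_def T_iter_Q space_restrict_space restrict_def)
 finally show ?thesis by simp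
qed

lemma seidl_plan_plan: "seidl_plan n \<rho> plan"
 unfolding seidl_plan_def
proof (intro exI conjI allI impI)
 show "dd 0 = 0" "dd n = 2*pi" using n_pos by (auto simp: dd_def Q_def)
 show "dd i < dd (Suc i)" if "i < n" for i
 proof (rule ccontr)
  assume "\<not> dd i < dd (Suc i)"
  hence "F (dd (Suc i)) <= F (dd i)" by (intro F_mono) simp
  thus False using F_dd[of i] F_dd[of "Suc i"] that n_pos by (simp add: divide_right_mono field_simps)
 qed
 show "(\<integral>\<^sup>+ t\<in>{dd i..dd (Suc i)}. ennreal (\<rho> t) \<partial>lborel) = ennreal (1 / real n)" if i: "i < n" for i
 proof -
  have [measurable]: "\<rho> \<in> borel_measurable borel" using \<rho> by (simp add: prob_density_on_I_def)
  have "(\<integral>\<^sup>+ t\<in>{dd i..dd (Suc i)}. ennreal (\<rho> t) \<partial>lborel) = emeasure (density lborel (%t. indicator {dd i..dd (Suc i)} t * ennreal (\<rho> t))) UNIV"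
   by (subst emeasure_density) (auto simp: mult.commute)
  also have "\<dots> = ennreal (1 / real n)" unfolding piece[OF i borel_open[OF open_UNIV]]
  proof -
   have "{u \<in> {real i / real n<..<real (Suc i) / real n}. Q u \<in> UNIV} = {real i / real n<..<real (Suc i) / real n}" by auto
   moreover have "real (Suc i) / real n - real i / real n = 1 / real n" by (simp add: diff_divide_distrib[symmetric])
   moreover have "real i / real n <= real (Suc i) / real n" by (simp add: divide_right_mono)
   ultimately show "emeasure lborel {u \<in> {real i / real n<..<real (Suc i) / real n}. Q u \<in> UNIV} = ennreal (1 / real n)"
    by (simp only: emeasure_lborel_Ioo)
  qed
  finally show ?thesis .
 qed
 show "T \<in> Iper \<rightarrow> Iper" by (auto simp: T_def Q_in)
qed (simp_all add: T_mono T_push plan_eq)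

lemma plan_Pi: "plan \<in> Pi_rho n \<rho>"
 unfolding Pi_rho_def plan_def
proof (intro CollectI conjI allI impI)
 show "prob_space (distr \<Omega> (Mn n) Y)" by (rule prob_space.prob_space_distr[OF prob_\<Omega> Y_measurable])
 fix i assume i: "i < n"
 have mk: "(R ^^ i) \<in> borel_measurable \<Omega>" by (intro measurable_\<Omega> measurable_compose_n R_measurable)
 have "distr (distr \<Omega> (Mn n) Y) borel (%x. x i) = distr \<Omega> borel (%u. Q ((R ^^ i) u))"
  by (subst distr_distr[OF measurable_coord Y_measurable]) (use i in \<open>simp add: comp_def Y_def\<close>)
 also have "\<dots> = distr (distr \<Omega> borel (R ^^ i)) borel Q"
  using mk by (subst distr_distr) (auto simp: comp_def)
 also have "\<dots> = distr \<Omega> borel Q"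
  unfolding R_preserves using measurable_\<Omega>[of "%u. u"] by (subst distr_distr) (auto simp: comp_def)
 finally show "distr (distr \<Omega> (Mn n) Y) borel (%x. x i) = rho_measure \<rho>" unfolding rho_Q .
qed simp

text \<open>An orbit of the rotation is a single arithmetic progression of step \<open>1/n\<close>,
  traversed cyclically from residue \<open>i\<close>. Multiples of \<open>1/n\<close> form a null
  set and are discarded to keep \<open>v\<close> positive.\<close>

lemma orbit:
 "AE u in \<Omega>. \<exists>v i. 0 < v \<and> v < 1 / real n \<and> (\<forall>k. (R ^^ k) u = v + real ((i + k) mod n) / real n)"
proof -
 have "AE u in lborel. \<forall>j\<in>{..<n}. u \<noteq> real j / real n"
  by (intro AE_finite_allI) (auto intro: AE_lborel_singleton)
 hence "AE u in \<Omega>. \<forall>j\<in>{..<n}. u \<noteq> real j / real n" by (simp add: AE_restrict_space_iff) (elim AE_mp, simp)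
 moreover have "\<exists>v i. 0 < v \<and> v < 1 / real n \<and> (\<forall>k. (R ^^ k) u = v + real ((i + k) mod n) / real n)"
  if u: "u \<in> space \<Omega>" "\<forall>j\<in>{..<n}. u \<noteq> real j / real n" for u
 proof -
  have u01: "0 < u" "u < 1" using u by (auto simp: space_restrict_space)
  define i where "i = nat \<lfloor>u * real n\<rfloor>"
  have un: "0 <= u * real n" "u * real n < real n" using u01 n_pos by auto
  have i: "real i <= u * real n" "u * real n < real i + 1" using un(1) by (auto simp: i_def)
  hence "real i < real n" using un by linarith
  hence iN: "i < n" by simp
  define v where "v = u - real i / real n"
  have ne: "u \<noteq> real i / real n" using u(2) iN by simp
  have "real i / real n <= u" "u < real i / real n + 1 / real n" using i n_pos by (simp_all add: field_simps)
  hence v: "0 < v" "v < 1 / real n" using ne by (auto simp: v_def)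
  have step: "R (v + real j / real n) = v + real (Suc j mod n) / real n" if j: "j < n" for j
  proof (cases "Suc j < n")
   case True
   hence "(real j + 2) / real n <= 1" by simp
   hence "v + real j / real n + 1 / real n < 1" using v by (simp add: add_divide_distrib)
   thus ?thesis using True by (simp add: R_def add_divide_distrib)
  next
   case False
   hence "Suc j = n" using j by simp
   moreover have "real j / real n + 1 / real n = 1" using calculation n_pos by (simp add: field_simps)
   ultimately show ?thesis using v by (simp add: R_def)
  qed
  have "(R ^^ k) u = v + real ((i + k) mod n) / real n" for k
  proof (induction k)
   case 0
   thus ?case using iN by (simp add: v_def)
  next
   case (Suc k)
   have "(R ^^ Suc k) u = v + real (Suc ((i + k) mod n) mod n) / real n"
    using Suc step[of "(i + k) mod n"] iN by simp
   thus ?case by (simp add: mod_Suc_eq)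
  qed
  thus ?thesis using v by blast
 qed
 ultimately show ?thesis by (elim AE_mp) (auto intro!: AE_I2)
qed

text \<open>The levels of an orbit are at least \<open>1/n\<close> apart, also around the circle.
  Uniform continuity of \<open>F\<close> turns this into a uniform distance between the points,
  where the cost is bounded.\<close>

lemma plan_cost_finite:
 assumes w: "assumptionA w"
 shows "(\<integral>\<^sup>+ x. cn n w x \<partial>plan) < \<infinity>"
proof -
 have "uniformly_continuous_on {0..2*pi} F"
  by (rule compact_uniformly_continuous) (auto intro!: continuous_at_imp_continuous_on isCont_cdf_rho[OF \<rho>])
 then obtain r where r: "0 < r" "!!x y. x \<in> Iper ==> y \<in> Iper ==> \<bar>y - x\<bar> < r ==> \<bar>F y - F x\<bar> < 1 / (2 * real n)"
 proof -
  assume u: "uniformly_continuous_on {0..2*pi} F"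
  have "0 < 1 / (2 * real n)" using n_pos by simp
  with u obtain r where "0 < r" "!!x y. x \<in> {0..2*pi} ==> y \<in> {0..2*pi} ==> dist y x < r ==> dist (F y) (F x) < 1 / (2 * real n)"
   unfolding uniformly_continuous_on_def by blast
  thus thesis by (intro that[of r]) (auto simp: Iper_def dist_real_def)
 qed
 obtain C where C: "!!x. x \<in> In n ==> tsep n r x ==> cn n w x <= ennreal C" by (rule cost_bounded[OF w r(1)]) (auto intro: that)
 have far: "r <= dT (Q a) (Q b)" if a: "0 < a" and ab: "a + 1 / real n <= b" "b <= a + 1 - 1 / real n" and b: "b < 1" for a b
 proof (rule ccontr)
  assume nr: "\<not> r <= dT (Q a) (Q b)"
  have n0: "0 < 1 / real n" using n_pos by simp
  have a01: "a <= b" "a <= 1" "0 <= b" using a b ab n0 by linarith+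
  have FF: "F (Q a) = a" "F (Q b) = b" using a a01 b by (auto intro!: F_Q)
  have le: "Q a <= Q b" using a01 by (intro Q_mono)
  have I: "0 <= Q a" "Q b <= 2*pi" "0 \<in> Iper" "2*pi \<in> Iper" using Q_in[of a] Q_in[of b] by (auto simp: Iper_def)
  have h: "1 / (2 * real n) < 1 / real n" "1 / (2 * real n) + 1 / (2 * real n) = 1 / real n" using n_pos by (simp_all add: field_simps)
  from nr consider "\<bar>Q b - Q a\<bar> < r" | "2*pi - (Q b - Q a) < r" using le by (auto simp: dT_def abs_if split: if_splits)
  thus False
  proof cases
   case 1
   from r(2)[OF Q_in Q_in 1] show False using FF ab h n_pos by linarith
  next
   case 2
   \<comment> \<open>Across the seam the levels would be within \<open>1/(2n)\<close> of 0 and of 1,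
     and the two errors add up to \<open>1/n\<close>; hence the factor 2 in the modulus.\<close>
   have "\<bar>Q a - 0\<bar> < r" "\<bar>2*pi - Q b\<bar> < r" using 2 I by auto
   from r(2)[OF I(3) Q_in this(1)] r(2)[OF Q_in I(4) this(2)] show False
    using FF F_0[of 0] F_1[of "2*pi"] ab h by linarith
  qed
 qed
 have "AE u in \<Omega>. cn n w (Y u) <= ennreal C"
  using orbit
 proof (elim AE_mp, intro AE_I2 impI)
  fix u assume u: "u \<in> space \<Omega>" and "\<exists>v i. 0 < v \<and> v < 1 / real n \<and> (\<forall>k. (R ^^ k) u = v + real ((i + k) mod n) / real n)"
  then obtain v i where v: "0 < v" "v < 1 / real n" and Rk: "!!k. (R ^^ k) u = v + real ((i + k) mod n) / real n" by blast
  have far': "r <= dT (Q (v + real j / real n)) (Q (v + real l / real n))" if jl: "j < l" "l < n" for j l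
  proof (rule far)
   have "real j + 1 <= real l" "real l + 1 <= real n" using jl by auto
   hence "(real j + 1) / real n <= real l / real n" "(real l + 1) / real n <= 1" "0 <= real j / real n"
    using n_pos by (auto simp: divide_right_mono)
   thus "v + real j / real n + 1 / real n <= v + real l / real n" "v + real l / real n <= v + real j / real n + 1 - 1 / real n" "v + real l / real n < 1" "0 < v + real j / real n"
    using v unfolding add_divide_distrib by linarith+
  qed
  have "tsep n r (Y u)"
   unfolding tsep_def
  proof (intro allI impI)
   fix k l assume kl: "k < n" "l < n" "k \<noteq> l"
   have "(i + k) mod n \<noteq> (i + l) mod n"
    using bij_betw_imp_inj_on[OF bij_betw_add_mod[of i n]] kl by (auto dest: inj_onD)
   thus "r <= dT (Y u k) (Y u l)"
    using far'[of "(i + k) mod n" "(i + l) mod n"] far'[of "(i + l) mod n" "(i + k) mod n"] kl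
     dT_sym[of "Q (v + real ((i + k) mod n) / real n)" "Q (v + real ((i + l) mod n) / real n)"]
    by (cases "(i + k) mod n" "(i + l) mod n" rule: linorder_cases) (simp_all add: Y_def Rk)
  qed
  moreover have "Y u \<in> In n" using measurable_space[OF Y_measurable u] by simp
  ultimately show "cn n w (Y u) <= ennreal C" using C by blast
 qed
 hence "(\<integral>\<^sup>+ u. cn n w (Y u) \<partial>\<Omega>) <= (\<integral>\<^sup>+ u. ennreal C \<partial>\<Omega>)" by (rule nn_integral_mono_AE)
 also have "\<dots> < \<infinity>" using prob_space.emeasure_space_1[OF prob_\<Omega>] by simp
 finally show ?thesis unfolding plan_def by (subst nn_integral_distr[OF Y_measurable]) (simp_all add: measurable_cn[OF w])
qed

lemma F_OT_finite: "assumptionA w ==> F_OT n w \<rho> < \<infinity>"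
 unfolding F_OT_def using INF_lower[OF plan_Pi] plan_cost_finite by (rule le_less_trans)

text \<open>The levels of the orbit are \<open>v + j/n\<close>; counting those up to
  \<open>F t\<close> is a floor, and the offset 1 accounts for \<open>j = 0\<close>.\<close>

lemma cnt_Y:
 assumes v: "0 < v" "v < 1 / real n" and Rk: "!!k. (R ^^ k) u = v + real ((i + k) mod n) / real n"
 shows "int (cnt n t (Y u)) = \<lfloor>real n * F t - real n * v\<rfloor> + 1"
proof -
 have vn: "0 < real n * v" "real n * v < 1" using v n_pos by (auto simp: field_simps)
 have "real (cnt n t (Y u)) = (\<Sum>k<n. of_bool (v + real ((i + k) mod n) / real n <= F t))"
  unfolding cnt_eq_sum
 proof (rule sum.cong[OF refl])
  fix k assume "k \<in> {..<n}"
  hence k: "k < n" by simp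
  define j where "j = (i + k) mod n"
  have "j < n" using k by (simp add: j_def)
  hence "(real j + 1) / real n <= 1" by simp
  hence "v + real j / real n < 1" "0 < v + real j / real n" using v by (auto simp: add_divide_distrib intro: add_pos_nonneg)
  thus "indicator {..t} (Y u k) = (of_bool (v + real ((i + k) mod n) / real n <= F t) :: real)"
   using k Q_le_iff by (simp add: Y_def Rk indicator_def flip: j_def)
 qed
 also have "\<dots> = (\<Sum>j<n. of_bool (v + real j / real n <= F t))"
  by (rule sum.reindex_bij_betw[OF bij_betw_add_mod[of i n]])
 also have "\<dots> = real (card {j. j < n \<and> v + real j / real n <= F t})"
 proof -
  have "(\<Sum>j<n. of_bool (v + real j / real n <= F t) :: real) = (\<Sum>j\<in>{j. j < n \<and> v + real j / real n <= F t}. 1)"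
   by (rule sum.mono_neutral_cong_right) auto
  thus ?thesis by simp
 qed
 also have "{j. j < n \<and> v + real j / real n <= F t} = {..<nat (\<lfloor>real n * F t - real n * v\<rfloor> + 1)}"
 proof -
  have "j < n \<and> v + real j / real n <= F t \<longleftrightarrow> j < nat (\<lfloor>real n * F t - real n * v\<rfloor> + 1)" for j
  proof -
   have "v + real j / real n <= F t \<longleftrightarrow> real j <= real n * F t - real n * v" using n_pos by (simp add: field_simps)
   also have "\<dots> \<longleftrightarrow> int j <= \<lfloor>real n * F t - real n * v\<rfloor>" by (simp add: le_floor_iff)
   finally have a: "v + real j / real n <= F t \<longleftrightarrow> j < nat (\<lfloor>real n * F t - real n * v\<rfloor> + 1)" by linarith
   have "real n * F t <= real n" using F_01[of t] n_pos by (simp add: mult_left_le)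
   hence "real j < real n" if "real j <= real n * F t - real n * v" using that vn by linarith
   hence "j < n" if "v + real j / real n <= F t" using that n_pos by (simp add: field_simps)
   thus ?thesis using a by blast
  qed
  thus ?thesis by auto
 qed
 finally have "cnt n t (Y u) = nat (\<lfloor>real n * F t - real n * v\<rfloor> + 1)" by simp
 moreover have "-1 <= \<lfloor>real n * F t - real n * v\<rfloor>"
 proof -
  have "0 <= real n * F t" using F_01 n_pos by simp
  thus ?thesis using vn by (simp add: le_floor_iff)
 qed
 ultimately show ?thesis by simp
qed

text \<open>The counts at two levels are floors with the same shift \<open>n * v\<close>, so their
  difference is the floor of the difference of the arguments or one more, whatever \<open>v\<close>
  is.\<close>

lemma plan_balanced: "balanced n plan"
 unfolding balanced_def
proof (intro allI exI)
 fix s t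
 let ?k = "\<lfloor>real n * F t - real n * F s\<rfloor>"
 have m: "{x \<in> space (Mn n). int (cnt n t x) - int (cnt n s x) \<in> {?k, ?k + 1}} \<in> sets (Mn n)"
 proof -
  note measurable_cnt[measurable]
  have "{x \<in> space (Mn n). real (cnt n t x) - real (cnt n s x) = real_of_int ?k \<or> real (cnt n t x) - real (cnt n s x) = real_of_int ?k + 1} \<in> sets (Mn n)"
   by measurable
  moreover have "int a - int b \<in> {k, k + 1} \<longleftrightarrow> real a - real b = real_of_int k \<or> real a - real b = real_of_int k + 1" for a b k
   by (simp, linarith)
  ultimately show ?thesis by simp
 qed
 have "AE u in \<Omega>. int (cnt n t (Y u)) - int (cnt n s (Y u)) \<in> {?k, ?k + 1}"
  using orbit
 proof (elim AE_mp, intro AE_I2 impI)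
  fix u assume u: "u \<in> space \<Omega>" and "\<exists>v i. 0 < v \<and> v < 1 / real n \<and> (\<forall>k. (R ^^ k) u = v + real ((i + k) mod n) / real n)"
  then obtain v i where v: "0 < v" "v < 1 / real n" and Rk: "!!k. (R ^^ k) u = v + real ((i + k) mod n) / real n" by blast
  show "int (cnt n t (Y u)) - int (cnt n s (Y u)) \<in> {?k, ?k + 1}"
   unfolding cnt_Y[OF v Rk] by (simp, linarith)
 qed
 thus "AE x in plan. int (cnt n t x) - int (cnt n s x) \<in> {?k, ?k + 1}"
  unfolding plan_def using AE_distr_iff[OF Y_measurable m] by simp
qed

end

section \<open>Balance of optimal plans\<close>

text \<open>Moving both differences from \<open>S\<close> to \<open>W\<close> leaves the double
  difference, with a minus sign, against \<open>S i * S j\<close>. Its rows and columns sum to zero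
  because \<pi> is a bijection, which allows the products to be completed to squares.\<close>

lemma sum_by_parts_quadratic:
 fixes W :: "'a => 'a => real" and S :: "'a => real"
 assumes b: "bij_betw \<pi> I I" and p: "!!i. i \<in> I ==> p (\<pi> i) = i"
 shows "(\<Sum>i\<in>I. \<Sum>j\<in>I. W i j * ((S (\<pi> i) - S i) * (S (\<pi> j) - S j)))
  = (\<Sum>i\<in>I. \<Sum>j\<in>I. (W (p i) j + W i (p j) - W (p i) (p j) - W i j) * (S i - S j)\<^sup>2) / 2"
proof -
 have e: "sum f I = (\<Sum>i\<in>I. f (\<pi> i))" for f :: "'a => real" by (rule sum.reindex_bij_betw[OF b, symmetric])
 define \<alpha> where "\<alpha> i j = W (p i) j + W i (p j) - W (p i) (p j) - W i j" for i j
 have sh: "(\<Sum>j\<in>I. f (p j) * g j) = (\<Sum>j\<in>I. f j * g (\<pi> j))" for f g :: "'a => real"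
  by (subst e) (auto intro!: sum.cong simp: p)
 have r: "(\<Sum>j\<in>I. \<alpha> i j) = 0" and c: "(\<Sum>j\<in>I. \<alpha> j i) = 0" for i
  using sh[of "W (p i)" "%_. 1"] sh[of "W i" "%_. 1"] sh[of "%j. W j (p i)" "%_. 1"] sh[of "%j. W j i" "%_. 1"]
  by (simp_all add: \<alpha>_def sum.distrib sum_subtractf)
 have "(\<Sum>i\<in>I. \<Sum>j\<in>I. \<alpha> i j * (S i - S j)\<^sup>2) = (\<Sum>i\<in>I. \<Sum>j\<in>I. \<alpha> i j * (S i)\<^sup>2) + (\<Sum>i\<in>I. \<Sum>j\<in>I. \<alpha> i j * (S j)\<^sup>2) - 2 * (\<Sum>i\<in>I. \<Sum>j\<in>I. \<alpha> i j * (S i * S j))"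
  by (simp add: sum_distrib_left power2_eq_square algebra_simps sum.distrib sum_subtractf)
 also have "(\<Sum>i\<in>I. \<Sum>j\<in>I. \<alpha> i j * (S i)\<^sup>2) = 0" by (simp add: r flip: sum_distrib_right)
 also have "(\<Sum>i\<in>I. \<Sum>j\<in>I. \<alpha> i j * (S j)\<^sup>2) = 0" by (subst sum.swap) (simp add: c flip: sum_distrib_right)
 finally have R: "(\<Sum>i\<in>I. \<Sum>j\<in>I. \<alpha> i j * (S i - S j)\<^sup>2) / 2 = - (\<Sum>i\<in>I. \<Sum>j\<in>I. \<alpha> i j * (S i * S j))" by simp
 have w1: "(\<Sum>i\<in>I. \<Sum>j\<in>I. W (p i) j * (S i * S j)) = (\<Sum>i\<in>I. \<Sum>j\<in>I. W i j * (S (\<pi> i) * S j))"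
  by (subst e) (auto intro!: sum.cong simp: p)
 have w2: "(\<Sum>i\<in>I. \<Sum>j\<in>I. W i (p j) * (S i * S j)) = (\<Sum>i\<in>I. \<Sum>j\<in>I. W i j * (S i * S (\<pi> j)))"
  by (rule sum.cong[OF refl]) (rule sh)
 have w3: "(\<Sum>i\<in>I. \<Sum>j\<in>I. W (p i) (p j) * (S i * S j)) = (\<Sum>i\<in>I. \<Sum>j\<in>I. W i j * (S (\<pi> i) * S (\<pi> j)))"
  by (subst e) (auto intro!: sum.cong sh simp: p)
 have "(\<Sum>i\<in>I. \<Sum>j\<in>I. \<alpha> i j * (S i * S j)) = (\<Sum>i\<in>I. \<Sum>j\<in>I. W (p i) j * (S i * S j)) + (\<Sum>i\<in>I. \<Sum>j\<in>I. W i (p j) * (S i * S j))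
   - (\<Sum>i\<in>I. \<Sum>j\<in>I. W (p i) (p j) * (S i * S j)) - (\<Sum>i\<in>I. \<Sum>j\<in>I. W i j * (S i * S j))"
  by (simp add: \<alpha>_def distrib_right left_diff_distrib sum.distrib sum_subtractf)
 thus ?thesis unfolding \<alpha>_def[symmetric] R w1 w2 w3
  by (simp add: algebra_simps sum.distrib sum_subtractf)
qed

text \<open>The double difference of \<open>W\<close> at non-adjacent indices is positive by the crossing condition, and it
 multiplies \<open>(S i - S j)\<^sup>2\<close>, which by parity is smallest for the alternating signs.\<close>
lemma alternating_signs_minimal:
 fixes W :: "nat => nat => real" and \<epsilon> :: "nat => int"
 assumes n1: "1 <= n" and sym: "!!i j. i < 2*n ==> j < 2*n ==> W i j = W j i"
  and cross: "!!i j k l. i < j ==> j < k ==> k < l ==> l < 2*n ==> W i k + W j l < W i j + W k l \<and> W i k + W j l < W i l + W j k"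
  and \<epsilon>: "!!i. i < 2*n ==> \<epsilon> i = 1 \<or> \<epsilon> i = -1" and \<epsilon>0: "(\<Sum>i<2*n. \<epsilon> i) = 0"
 defines "q \<equiv> %\<epsilon> :: nat => int. \<Sum>i<2*n. \<Sum>j<2*n. W i j * (real_of_int (\<epsilon> i) * real_of_int (\<epsilon> j))"
 shows "q (%i. (-1) ^ i) <= q \<epsilon>"
  and "q \<epsilon> = q (%i. (-1) ^ i) ==> k <= 2*n ==> l <= 2*n ==> \<bar>(\<Sum>i<k. \<epsilon> i) - (\<Sum>i<l. \<epsilon> i)\<bar> <= 1"
proof -
 define m where "m = 2*n"
 have m2: "2 <= m" "even m" using n1 by (auto simp: m_def)
 \<comment> \<open>Indices are cyclic, so summation by parts has no boundary term; the signs summing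
   to zero makes their partial sums periodic.\<close>
 define \<pi> where "\<pi> i = (1 + i) mod m" for i
 define p where "p i = (if i = 0 then m - 1 else i - 1)" for i
 define \<alpha> where "\<alpha> i j = W (p i) j + W i (p j) - W (p i) (p j) - W i j" for i j
 have b: "bij_betw \<pi> {..<m} {..<m}" unfolding \<pi>_def by (rule bij_betw_add_mod)
 have pp: "p (\<pi> i) = i" if "i \<in> {..<m}" for i
  using that m2 by (cases "Suc i = m") (auto simp: p_def \<pi>_def)
 define S where "S e k = (\<Sum>i<k. e i)" for e :: "nat => int" and k
 have form: "q e = (\<Sum>i<m. \<Sum>j<m. \<alpha> i j * (real_of_int (S e i) - real_of_int (S e j))\<^sup>2) / 2" if e0: "S e m = 0" for e
 proof -
  have "real_of_int (e i) = real_of_int (S e (\<pi> i)) - real_of_int (S e i)" if "i < m" for i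
  proof (cases "Suc i = m")
   case True
   hence "S e m = S e i + e i" by (auto simp: S_def)
   moreover have "\<pi> i = 0" "S e 0 = 0" using True by (auto simp: \<pi>_def S_def)
   ultimately show ?thesis using e0 by simp
  next
   case False
   hence "\<pi> i = Suc i" using that by (simp add: \<pi>_def)
   thus ?thesis by (simp add: S_def)
  qed
  note st = this
  have "q e = (\<Sum>i<m. \<Sum>j<m. W i j * ((real_of_int (S e (\<pi> i)) - real_of_int (S e i)) * (real_of_int (S e (\<pi> j)) - real_of_int (S e j))))"
   unfolding q_def m_def[symmetric] by (intro sum.cong refl arg_cong2[where f=times] st) simp_all
  thus ?thesis unfolding \<alpha>_def using sum_by_parts_quadratic[OF b pp, where W=W and S="%k. real_of_int (S e k)"] by simp
 qed
 define A where "A = S (%i. (-1) ^ i)"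
 have A: "A k = of_bool (odd k)" for k by (induction k) (auto simp: A_def S_def)
 have S0: "S \<epsilon> m = 0" "S \<epsilon> 0 = 0" using \<epsilon>0 by (auto simp: S_def m_def)
 have par: "even (S \<epsilon> k) \<longleftrightarrow> even k" if "k <= m" for k
  using that
 proof (induction k)
  case (Suc k)
  hence "odd (\<epsilon> k)" using \<epsilon>[of k] by (auto simp: m_def)
  thus ?case using Suc by (simp add: S_def)
 qed (simp add: S_def)
 \<comment> \<open>The crossing condition at \<open>i-1, i, j-1, j\<close>. For \<open>i = 0\<close>
   the cyclic predecessor is the largest index \<open>m-1\<close>, and the other inequality of the
   condition is the relevant one.\<close>
 have pos: "0 < \<alpha> i j" if ij: "i < j" "j < m" "Suc i \<noteq> j" "\<not> (i = 0 \<and> Suc j = m)" for i j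
 proof (cases "i = 0")
  case True
  hence "0 < j - 1 \<and> j - 1 < j \<and> j < m - 1 \<and> m - 1 < 2*n" using ij by (auto simp: m_def)
  from cross[of 0 "j-1" j "m-1"] this have "W 0 j + W (j-1) (m-1) < W 0 (j-1) + W j (m-1)" by simp
  moreover have "W (m-1) j = W j (m-1)" "W (m-1) (j-1) = W (j-1) (m-1)" using ij by (auto intro!: sym simp: m_def)
  ultimately show ?thesis using True ij by (simp add: \<alpha>_def p_def)
 next
  case False
  hence "i - 1 < i \<and> i < j - 1 \<and> j - 1 < j \<and> j < 2*n" using ij by (auto simp: m_def)
  from cross[of "i-1" i "j-1" j] this have "W (i-1) (j-1) + W i j < W (i-1) j + W i (j-1)" by simp
  thus ?thesis using False ij by (simp add: \<alpha>_def p_def)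
 qed
 have \<alpha>s: "\<alpha> i j = \<alpha> j i" if "i < m" "j < m" for i j
 proof -
  have "p i < m" "p j < m" using that by (auto simp: p_def)
  thus ?thesis using that sym[of "p i" j] sym[of i "p j"] sym[of "p i" "p j"] sym[of i j] by (simp add: \<alpha>_def m_def)
 qed
 have sq: "(A i - A j)\<^sup>2 <= (S \<epsilon> i - S \<epsilon> j)\<^sup>2" "\<bar>S \<epsilon> i - S \<epsilon> j\<bar> <= 1 \<or> (A i - A j)\<^sup>2 < (S \<epsilon> i - S \<epsilon> j)\<^sup>2" if "i <= m" "j <= m" for i j
 proof -
  have A1: "(A i - A j)\<^sup>2 = of_bool (odd i \<noteq> odd j)" by (auto simp: A)
  have "odd i \<noteq> odd j ==> S \<epsilon> i - S \<epsilon> j \<noteq> 0" using par[OF that(1)] par[OF that(2)] by auto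
  hence "odd i \<noteq> odd j ==> 0 < (S \<epsilon> i - S \<epsilon> j)\<^sup>2" by (simp only: zero_less_power2) blast
  thus "(A i - A j)\<^sup>2 <= (S \<epsilon> i - S \<epsilon> j)\<^sup>2"
   unfolding A1 by (cases "odd i = odd j") (simp_all only: of_bool_eq simp_thms zero_le_power2 int_one_le_iff_zero_less)
  have "4 <= (S \<epsilon> i - S \<epsilon> j)\<^sup>2" if "\<not> \<bar>S \<epsilon> i - S \<epsilon> j\<bar> <= 1"
  proof -
   have "2\<^sup>2 <= \<bar>S \<epsilon> i - S \<epsilon> j\<bar>\<^sup>2" using that by (intro power_mono) linarith+
   thus ?thesis unfolding power2_abs by simp
  qed
  moreover have "(of_bool (odd i \<noteq> odd j) :: int) < 4" by simp
  ultimately have "\<not> \<bar>S \<epsilon> i - S \<epsilon> j\<bar> <= 1 ==> (of_bool (odd i \<noteq> odd j) :: int) < (S \<epsilon> i - S \<epsilon> j)\<^sup>2" by (rule less_le_trans[rotated])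
  thus "\<bar>S \<epsilon> i - S \<epsilon> j\<bar> <= 1 \<or> (A i - A j)\<^sup>2 < (S \<epsilon> i - S \<epsilon> j)\<^sup>2" unfolding A1 by blast
 qed
 \<comment> \<open>For cyclic neighbours the sign of \<alpha> is unknown, but there the squares
   equal 1 for both sign patterns and the terms cancel.\<close>
 have adj: "\<bar>S \<epsilon> i - S \<epsilon> j\<bar> = 1 \<and> \<bar>A i - A j\<bar> = 1" if ij: "i < j" "j < m" "Suc i = j \<or> (i = 0 \<and> Suc j = m)" for i j
  using ij(3)
 proof
  assume "Suc i = j"
  hence "S \<epsilon> j = S \<epsilon> i + \<epsilon> i" "A j - A i = 1 \<or> A j - A i = -1" by (auto simp: S_def A)
  moreover have "\<epsilon> i = 1 \<or> \<epsilon> i = -1" using ij by (intro \<epsilon>) (simp add: m_def)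
  ultimately show ?thesis by linarith
 next
  assume *: "i = 0 \<and> Suc j = m"
  hence "S \<epsilon> j + \<epsilon> j = 0" using S0(1) by (auto simp: S_def)
  moreover have "odd j" using * m2(2) by auto
  moreover have "\<epsilon> j = 1 \<or> \<epsilon> j = -1" using ij by (intro \<epsilon>) (simp add: m_def)
  ultimately show ?thesis using * by (auto simp: S0(2) A)
 qed
 have gen: "0 <= a * (y - x) \<and> (a * (y - x) = 0 --> P)" if "x <= y" "x \<noteq> y \<or> P" "0 < a" for a x y :: real and P
  using that by auto
 define t where "t i j = \<alpha> i j * (real_of_int ((S \<epsilon> i - S \<epsilon> j)\<^sup>2) - real_of_int ((A i - A j)\<^sup>2))" for i j
 have t1: "0 <= t i j \<and> (t i j = 0 --> \<bar>S \<epsilon> i - S \<epsilon> j\<bar> <= 1)" if ij: "i < j" "j < m" for i j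
 proof (cases "Suc i = j \<or> (i = 0 \<and> Suc j = m)")
  case True
  from adj[OF ij this] have "(S \<epsilon> i - S \<epsilon> j)\<^sup>2 = (A i - A j)\<^sup>2" "\<bar>S \<epsilon> i - S \<epsilon> j\<bar> <= 1" using power2_abs[of "S \<epsilon> i - S \<epsilon> j"] power2_abs[of "A i - A j"] by (simp_all only: power_one order_refl)
  hence "t i j = 0 \<and> \<bar>S \<epsilon> i - S \<epsilon> j\<bar> <= 1" unfolding t_def by (metis diff_self mult_zero_right)
  thus ?thesis by simp
 next
  case False
  hence a: "0 < \<alpha> i j" using pos[OF ij] by blast
  have "i <= m" "j <= m" using ij by auto
  note s = sq[OF this]
  have "real_of_int ((A i - A j)\<^sup>2) <= real_of_int ((S \<epsilon> i - S \<epsilon> j)\<^sup>2)" using s(1) by (simp only: of_int_le_iff)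
  moreover have "real_of_int ((A i - A j)\<^sup>2) \<noteq> real_of_int ((S \<epsilon> i - S \<epsilon> j)\<^sup>2) \<or> \<bar>S \<epsilon> i - S \<epsilon> j\<bar> <= 1"
   unfolding of_int_eq_iff using s(2) by (blast dest: less_imp_neq)
  ultimately show ?thesis unfolding t_def using a by (intro gen)
 qed
 have t: "0 <= t i j \<and> (t i j = 0 --> \<bar>S \<epsilon> i - S \<epsilon> j\<bar> <= 1)" if "i < m" "j < m" for i j
 proof -
  have "t i j = t j i" unfolding t_def \<alpha>s[OF that] power2_commute[of "S \<epsilon> i" "S \<epsilon> j"] power2_commute[of "A i" "A j"] ..
  moreover have "t i i = 0" by (simp add: t_def)
  ultimately show ?thesis using t1[of i j] t1[of j i] that abs_minus_commute[of "S \<epsilon> i" "S \<epsilon> j"]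
   by (cases i j rule: linorder_cases) simp_all
 qed
 have "S (%i. (-1) ^ i) m = 0" using A[of m] m2(2) by (simp add: A_def)
 hence d: "q \<epsilon> - q (%i. (-1) ^ i) = (\<Sum>i<m. \<Sum>j<m. t i j) / 2"
  unfolding form[OF S0(1)] form[OF \<open>S (%i. (-1) ^ i) m = 0\<close>] A_def[symmetric] t_def
  by (simp only: right_diff_distrib sum_subtractf diff_divide_distrib of_int_power of_int_diff)
 have tn: "0 <= (\<Sum>i<m. \<Sum>j<m. t i j)" using t by (intro sum_nonneg) auto
 thus "q (%i. (-1) ^ i) <= q \<epsilon>" using d by simp
 assume eq: "q \<epsilon> = q (%i. (-1) ^ i)" and kl: "k <= 2*n" "l <= 2*n"
 have z: "(\<Sum>i<m. \<Sum>j<m. t i j) = 0" using d eq by simp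
 have tz: "t i j = 0" if ij: "i < m" "j < m" for i j
 proof -
  have "(\<Sum>j<m. t i j) = 0" using z t ij by (subst (asm) sum_nonneg_eq_0_iff) (auto intro!: sum_nonneg)
  thus ?thesis using t ij by (subst (asm) sum_nonneg_eq_0_iff) auto
 qed
 have "\<exists>k'<m. S \<epsilon> k = S \<epsilon> k'" if "k <= m" for k using that S0 m2 by (cases "k = m") (auto intro: exI[of _ 0] le_neq_implies_less)
 from this[of k] this[of l] kl obtain k' l' where "k' < m" "l' < m" "S \<epsilon> k = S \<epsilon> k'" "S \<epsilon> l = S \<epsilon> l'" unfolding m_def by auto
 thus "\<bar>(\<Sum>i<k. \<epsilon> i) - (\<Sum>i<l. \<epsilon> i)\<bar> <= 1" using t tz by (simp add: S_def)
qed

section \<open>Splitting a pair of samples alternately\<close>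

definition join :: "nat => (nat => real) => (nat => real) => nat => real" where
 "join n x y = (\<lambda>i\<in>{..<2*n}. if i < n then x i else y (i - n))"

text \<open>The rotation \<open>r\<close> relabels particles without changing the cost; averaging
  over it will give every particle the same law.\<close>

definition alt :: "nat => nat => nat => (nat => real) => nat => real" where
 "alt n r c z = (\<lambda>i\<in>{..<n}. z (2 * ((r + i) mod n) + c))"

lemma sum_double_parity: "(\<Sum>k<2*n. f k) = (\<Sum>j<n. f (2*j)) + (\<Sum>j<n. f (2*j+1))" for f :: "nat => 'a::comm_monoid_add"
 by (induction n) (auto simp: add_ac)

lemma sum_double_halves: "(\<Sum>k<2*n. f k) = (\<Sum>j<n. f j) + (\<Sum>j<n. f (n + j))" for f :: "nat => 'a::comm_monoid_add"
proof -
 have "(\<Sum>k<n+m. f k) = (\<Sum>j<n. f j) + (\<Sum>j<m. f (n + j))" for m by (induction m) (auto simp: add_ac)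
 from this[of n] show ?thesis by (simp add: mult_2)
qed

lemma cn_alt: "cn n w x = (\<Sum>i<n. \<Sum>j<n. if i = j then 0 else w (x i) (x j))"
 unfolding cn_def by (intro sum.cong[OF refl] sum.mono_neutral_cong_left) auto

lemma cn_shift: "cn n w (alt n r c z) = cn n w (alt n 0 c z)"
proof -
 note b = bij_betw_add_mod[of r n]
 have "cn n w (alt n r c z) = (\<Sum>i<n. \<Sum>j<n. if (r + i) mod n = (r + j) mod n then 0 else w (z (2 * ((r + i) mod n) + c)) (z (2 * ((r + j) mod n) + c)))"
  unfolding cn_alt alt_def using bij_betw_imp_inj_on[OF b] by (intro sum.cong refl) (auto dest: inj_onD)
 also have "\<dots> = (\<Sum>i<n. \<Sum>j<n. if i = j then 0 else w (z (2 * i + c)) (z (2 * j + c)))"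
  by (subst sum.reindex_bij_betw[OF b, of "%j. if _ = j then 0 else w _ (z (2 * j + c))"])
   (rule sum.reindex_bij_betw[OF b, of "%i. \<Sum>j<n. if i = j then 0 else w (z (2 * i + c)) (z (2 * j + c))"])
 also have "\<dots> = cn n w (alt n 0 c z)" unfolding cn_alt by (intro sum.cong refl) (auto simp: alt_def)
 finally show ?thesis .
qed

lemma cnt_int: "int (cnt n t x) = (\<Sum>i<n. of_bool (x i <= t))"
proof -
 have "(\<Sum>i<n. of_bool (x i <= t) :: int) = (\<Sum>i\<in>{i. i < n \<and> x i <= t}. 1)"
  by (rule sum.mono_neutral_cong_right) auto
 thus ?thesis by (simp add: cnt_def)
qed

text \<open>The identity lists the pairing of neighbours and the second permutation lists
  \<open>a, d, b, c\<close>, the two pairings other than the crossing one. Strictly increasing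
  points and finite cost rule out the cases of equality.\<close>

lemma strict_crossing:
 assumes sw: "strictly_well_ordering w" and I: "a \<in> Iper" "b \<in> Iper" "c \<in> Iper" "d \<in> Iper"
  and o: "a < b" "b < c" "c < d" and fin: "w a c + w b d \<noteq> \<infinity>"
 shows "w a c + w b d < w a b + w c d" "w a c + w b d < w a d + w b c"
proof -
 let ?\<tau> = "Transposition.transpose 1 3 \<circ> Transposition.transpose 2 (3::nat)"
 have p: "id permutes {0..<4::nat}" "?\<tau> permutes {0..<4}"
  by (auto intro!: permutes_compose permutes_swap_id permutes_id)
 have ms: "{#a, c#} \<noteq> {#e, f#}" if "{a, c} \<noteq> {e, f}" for e f
 proof
  assume "{#a, c#} = {#e, f#}"
  from arg_cong[OF this, of set_mset] that show False by simp
 qed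
 have ne: "{#a, c#} \<noteq> {#a, b#}" "{#a, c#} \<noteq> {#c, d#}" "{#a, c#} \<noteq> {#a, d#}" "{#a, c#} \<noteq> {#b, c#}"
  by (rule ms; use o in \<open>auto simp: doubleton_eq_iff\<close>)+
 have pre: "a \<in> Iper \<and> b \<in> Iper \<and> c \<in> Iper \<and> d \<in> Iper \<and> a <= b \<and> b <= c \<and> c <= d" using I o by simp
 note S = sw[unfolded strictly_well_ordering_def, rule_format, OF pre, unfolded Let_def]
 have v: "[a, b, c, d] ! 0 = a" "[a, b, c, d] ! 1 = b" "[a, b, c, d] ! 2 = c" "[a, b, c, d] ! 3 = d" by simp_all
 have t: "?\<tau> 0 = 0" "?\<tau> 1 = 3" "?\<tau> 2 = 1" "?\<tau> 3 = 2" by (auto simp: Transposition.transpose_def)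
 show "w a c + w b d < w a b + w c d"
  using S[OF p(1), unfolded id_apply v] fin ne(1,2) unfolding order_less_le by metis
 show "w a c + w b d < w a d + w b c"
  using S[OF p(2), unfolded t v] fin ne(3,4) unfolding order_less_le by metis
qed

lemma join_In: "x \<in> In n ==> y \<in> In n ==> join n x y \<in> In (2*n)"
 by (auto simp: join_def In_def PiE_def Pi_def)

text \<open>Colour the sorted \<open>2n\<close> points by the sample they come from. The cost within
  the colours is half of the total interaction plus half of a quadratic form in the colour signs, so
  comparing splittings means comparing that form. In the case of equality the partial sums of the
  signs, which are differences of the counting functions, are controlled.\<close>

lemma alternating_split_cost:
 assumes n1: "1 <= n" and w: "assumptionA w" and sw: "strictly_well_ordering w" and xy: "x \<in> In n" "y \<in> In n"
  and sep: "!!k l. k < 2*n ==> l < 2*n ==> k \<noteq> l ==> dT (join n x y k) (join n x y l) \<noteq> 0"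
 defines "z \<equiv> srt (2*n) (join n x y)"
 shows "cn n w (alt n 0 0 z) + cn n w (alt n 0 1 z) <= cn n w x + cn n w y"
  and "cn n w x + cn n w y = cn n w (alt n 0 0 z) + cn n w (alt n 0 1 z) ==>
   \<bar>(int (cnt n t x) - int (cnt n s x)) - (int (cnt n t y) - int (cnt n s y))\<bar> <= 1"
proof -
 define u where "u = join n x y"
 have uI: "u \<in> In (2*n)" unfolding u_def by (rule join_In[OF xy])
 obtain \<tau> where \<tau>: "\<tau> permutes {..<2*n}" and z: "z = u \<circ> \<tau>"
  unfolding z_def u_def[symmetric] by (rule srt_permute[OF In_extensional[OF uI]])
 have b: "bij_betw \<tau> {..<2*n} {..<2*n}" by (rule permutes_imp_bij[OF \<tau>])
 have \<tau>l: "\<tau> k < 2*n \<longleftrightarrow> k < 2*n" for k by (rule perm_lt[OF \<tau>])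
 have \<tau>i: "\<tau> k = \<tau> l \<longleftrightarrow> k = l" for k l using permutes_inj[OF \<tau>] by (auto dest: injD)
 have zI: "z k \<in> Iper" if "k < 2*n" for k unfolding z using In_coord[OF uI] that \<tau>l by simp
 have zn: "dT (z k) (z l) \<noteq> 0" if "k < 2*n" "l < 2*n" "k \<noteq> l" for k l
  unfolding z comp_apply u_def using that by (intro sep) (auto simp: \<tau>l \<tau>i)
 have zl: "z k < z l" if "k < l" "l < 2*n" for k l
  using srt_mono[of k l "2*n" u] zn[of k l] that by (auto simp: z_def u_def order_less_le)
 have fin: "w (z k) (z l) \<noteq> \<infinity>" if "k < 2*n" "l < 2*n" "k \<noteq> l" for k l
  using w_inf_iff[OF w zI zI] zn that by blast
 \<comment> \<open>The diagonal, where \<open>w\<close> is infinite, is set to 0.\<close>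
 define W where "W k l = (if k = l then 0 else enn2real (w (z k) (z l)))" for k l
 have We: "ennreal (W k l) = w (z k) (z l)" if "k < 2*n" "l < 2*n" "k \<noteq> l" for k l
  using fin[OF that] that by (simp add: W_def less_top)
 have W0: "0 <= W k l" for k l by (simp add: W_def)
 have sym: "W k l = W l k" if "k < 2*n" "l < 2*n" for k l
  using w zI that by (auto simp: W_def assumptionA_def)
 have cross: "W i k + W j l < W i j + W k l \<and> W i k + W j l < W i l + W j k" if o: "i < j" "j < k" "k < l" "l < 2*n" for i j k l
 proof -
  have "w (z i) (z k) + w (z j) (z l) \<noteq> \<infinity>" using fin o by (simp add: ennreal_add_eq_top)
  hence "w (z i) (z k) + w (z j) (z l) < w (z i) (z j) + w (z k) (z l)" "w (z i) (z k) + w (z j) (z l) < w (z i) (z l) + w (z j) (z k)"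
   using o by (auto intro!: strict_crossing[OF sw] zI zl)
  thus ?thesis using o by (simp add: We[symmetric] W0 ennreal_less_iff flip: ennreal_plus)
 qed
 define \<epsilon> :: "nat => int" where "\<epsilon> k = (if \<tau> k < n then 1 else -1)" for k
 have \<epsilon>0: "(\<Sum>k<2*n. \<epsilon> k) = 0"
 proof -
  have "(\<Sum>k<2*n. \<epsilon> k) = (\<Sum>a<2*n. if a < n then 1 else -1)" unfolding \<epsilon>_def by (rule sum.reindex_bij_betw[OF b])
  also have "\<dots> = 0" unfolding sum_double_halves by simp
  finally show ?thesis .
 qed
 define H where "H P = (\<Sum>k<2*n. \<Sum>l<2*n. if k = l \<or> P k \<noteq> P l then 0 else w (z k) (z l))" for P :: "nat => bool"
 define q where "q e = (\<Sum>i<2*n. \<Sum>j<2*n. W i j * (real_of_int (e i) * real_of_int (e j)))" for e :: "nat => int"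
 have q0: "0 <= ((\<Sum>i<2*n. \<Sum>j<2*n. W i j) + q e) / 2" and H: "H P = ennreal (((\<Sum>i<2*n. \<Sum>j<2*n. W i j) + q e) / 2)"
  if e: "!!k. e k = (if P k then 1 else -1)" for e P
 proof -
  have s: "((\<Sum>i<2*n. \<Sum>j<2*n. W i j) + q e) / 2 = (\<Sum>i<2*n. \<Sum>j<2*n. W i j * (1 + real_of_int (e i) * real_of_int (e j)) / 2)"
   by (simp add: q_def distrib_left sum.distrib sum_divide_distrib add_divide_distrib)
  have nn: "0 <= W i j * (1 + real_of_int (e i) * real_of_int (e j)) / 2" for i j using W0 by (simp add: e)
  show "0 <= ((\<Sum>i<2*n. \<Sum>j<2*n. W i j) + q e) / 2" unfolding s by (intro sum_nonneg nn)
  have "H P = (\<Sum>i<2*n. \<Sum>j<2*n. ennreal (W i j * (1 + real_of_int (e i) * real_of_int (e j)) / 2))"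
   unfolding H_def by (intro sum.cong refl) (auto simp: e We W_def[of i i for i])
  thus "H P = ennreal (((\<Sum>i<2*n. \<Sum>j<2*n. W i j) + q e) / 2)"
   unfolding s by (simp only: sum_ennreal[OF nn] sum_ennreal[OF sum_nonneg[OF nn]])
 qed
 have f: "cn n w (alt n 0 0 z) + cn n w (alt n 0 1 z) = H even"
  unfolding H_def cn_alt sum_double_parity alt_def by (simp add: sum.distrib) (intro arg_cong2[where f="(+)"] sum.cong refl; auto)
 have "H (%k. \<tau> k < n) = (\<Sum>k<2*n. \<Sum>l<2*n. if \<tau> k = \<tau> l \<or> (\<tau> k < n) \<noteq> (\<tau> l < n) then 0 else w (u (\<tau> k)) (u (\<tau> l)))"
  unfolding H_def z comp_apply by (simp add: \<tau>i)
 also have "\<dots> = (\<Sum>k<2*n. \<Sum>l<2*n. if k = l \<or> (k < n) \<noteq> (l < n) then 0 else w (u k) (u l))"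
  by (subst sum.reindex_bij_betw[OF b, of "%l. if _ = l \<or> _ \<noteq> (l < n) then 0 else w _ (u l)"])
   (rule sum.reindex_bij_betw[OF b, of "%k. \<Sum>l<2*n. if k = l \<or> (k < n) \<noteq> (l < n) then 0 else w (u k) (u l)"])
 also have "\<dots> = cn n w x + cn n w y"
  unfolding cn_alt sum_double_halves by (simp add: sum.distrib) (intro arg_cong2[where f="(+)"] sum.cong refl; auto simp: u_def join_def)
 finally have g: "cn n w x + cn n w y = H (%k. \<tau> k < n)" ..
 have ea: "(-1) ^ k = (if even k then 1 else -1 :: int)" for k :: nat by simp
 have \<epsilon>1: "\<epsilon> i = 1 \<or> \<epsilon> i = -1" for i by (simp add: \<epsilon>_def)
 have alt1: "q (%i. (-1) ^ i) <= q \<epsilon>"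
  unfolding q_def by (rule alternating_signs_minimal(1)[OF n1 _ _ _ \<epsilon>0]) (fact sym, fact cross, rule \<epsilon>1)
 have alt2: "\<bar>(\<Sum>i<k. \<epsilon> i) - (\<Sum>i<l. \<epsilon> i)\<bar> <= 1" if "q \<epsilon> = q (%i. (-1) ^ i)" "k <= 2*n" "l <= 2*n" for k l
  by (rule alternating_signs_minimal(2)[OF n1 _ _ _ \<epsilon>0 that(1)[unfolded q_def] that(2,3)]) (fact sym, fact cross, rule \<epsilon>1)
 note Hs = H[of "%i. (-1) ^ i", OF ea] H[of \<epsilon>, OF \<epsilon>_def] and qs = q0[of "%i. (-1) ^ i", OF ea] q0[of \<epsilon>, OF \<epsilon>_def]
 show "cn n w (alt n 0 0 z) + cn n w (alt n 0 1 z) <= cn n w x + cn n w y"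
  unfolding f g Hs by (intro ennreal_leI divide_right_mono add_left_mono alt1) auto
 assume "cn n w x + cn n w y = cn n w (alt n 0 0 z) + cn n w (alt n 0 1 z)"
 hence qe: "q \<epsilon> = q (%i. (-1) ^ i)" unfolding f g Hs using ennreal_inj[OF qs(2) qs(1)] by simp
 \<comment> \<open>A point counts \<open>+1\<close> in the first sample and \<open>-1\<close> in the
   second; in sorted order the points at most \<open>t\<close> form an initial segment.\<close>
 have e: "int (cnt n t x) - int (cnt n t y) = (\<Sum>k<cnt (2*n) t u. \<epsilon> k)" for t
 proof -
  have "int (cnt n t x) - int (cnt n t y) = (\<Sum>a<2*n. (if a < n then 1 else -1) * of_bool (u a <= t))"
   unfolding cnt_int sum_double_halves by (simp add: u_def join_def sum_negf)
  also have "\<dots> = (\<Sum>k<2*n. \<epsilon> k * of_bool (z k <= t))"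
   unfolding \<epsilon>_def z comp_apply by (rule sum.reindex_bij_betw[OF b, symmetric])
  also have "\<dots> = (\<Sum>k<2*n. \<epsilon> k * of_bool (k < cnt (2*n) t u))"
   by (intro sum.cong refl) (simp add: z_def u_def[symmetric] srt_le_iff[OF In_extensional[OF uI]])
  also have "\<dots> = (\<Sum>k<cnt (2*n) t u. \<epsilon> k)"
  proof (rule sum.mono_neutral_cong_right)
   have "cnt (2*n) t u <= card {..<2*n}" unfolding cnt_def by (rule card_mono) auto
   thus "{..<cnt (2*n) t u} \<subseteq> {..<2*n}" by auto
  qed auto
  finally show ?thesis .
 qed
 have c: "cnt (2*n) t u <= 2*n" for t
 proof -
  have "cnt (2*n) t u <= card {..<2*n}" unfolding cnt_def by (rule card_mono) auto
  thus ?thesis by simp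
 qed
 show "\<bar>(int (cnt n t x) - int (cnt n s x)) - (int (cnt n t y) - int (cnt n s y))\<bar> <= 1"
  using alt2[OF qe c c, of t s] e[of t] e[of s] by linarith
qed

text \<open>Averaging over the \<open>2n\<close> cyclic relabellings of the two halves turns them into a competitor in \<open>\<Pi>(\<rho>)\<close>.\<close>
lemma relaxed_cost:
 assumes n1: "1 <= n" and w: "assumptionA w" and M: "prob_space M" and Z: "Z \<in> measurable M (Mn (2*n))"
  and marg: "!!A. A \<in> sets borel ==> (\<integral>\<^sup>+ \<omega>. (\<Sum>k<2*n. indicator A (Z \<omega> k)) \<partial>M) = of_nat (2*n) * emeasure (rho_measure \<rho>) A"
 shows "2 * F_OT n w \<rho> <= (\<integral>\<^sup>+ \<omega>. cn n w (alt n 0 0 (Z \<omega>)) + cn n w (alt n 0 1 (Z \<omega>)) \<partial>M)"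
proof -
 define K where "K = {..<n} \<times> {..<2::nat}"
 have K: "finite K" "K \<noteq> {}" "card K = 2*n" using n1 by (auto simp: K_def lessThan_empty_iff)
 define P where "P = measure_pmf (pmf_of_set K)"
 interpret M: prob_space M by (rule M)
 interpret P: prob_space P unfolding P_def by (rule measure_pmf.prob_space_axioms)
 \<comment> \<open>\<open>mod 2\<close> keeps the selected index below \<open>2*n\<close> for every
   natural number, so that \<Phi> maps the whole product space into the cube.\<close>
 define \<Phi> where "\<Phi> \<omega> = alt n (fst (snd \<omega>)) (snd (snd \<omega>) mod 2) (Z (fst \<omega>))" for \<omega>
 have zc: "(%\<omega>. Z \<omega> k) \<in> borel_measurable M" for k by (rule measurable_compose[OF Z measurable_coord])
 have am: "(%\<omega>. alt n r (c mod 2) (Z \<omega>)) \<in> measurable M (Mn n)" for r c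
 proof (rule measurable_into_Mn)
  fix \<omega> assume "\<omega> \<in> space M"
  hence "Z \<omega> \<in> In (2*n)" using measurable_space[OF Z] by simp
  moreover have "2 * ((r + i) mod n) + c mod 2 < 2*n" for i
  proof -
   have "(r + i) mod n < n" "c mod 2 < 2" using n1 by auto
   thus ?thesis by linarith
  qed
  ultimately show "alt n r (c mod 2) (Z \<omega>) \<in> In n" by (auto simp: alt_def In_def PiE_def Pi_def)
 qed (simp add: alt_def zc)
 have \<Phi>m: "\<Phi> \<in> measurable (M \<Otimes>\<^sub>M P) (Mn n)"
 proof -
  have "(%\<omega>. (%k \<omega>. alt n (fst k) (snd k mod 2) (Z (fst \<omega>))) (snd \<omega>) \<omega>) \<in> measurable (M \<Otimes>\<^sub>M count_space UNIV) (Mn n)"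
   by (rule measurable_compose_countable[OF measurable_compose[OF measurable_fst am] measurable_snd])
  hence "\<Phi> \<in> measurable (M \<Otimes>\<^sub>M count_space UNIV) (Mn n)" by (simp add: \<Phi>_def[abs_def])
  moreover have "sets (M \<Otimes>\<^sub>M P) = sets (M \<Otimes>\<^sub>M count_space UNIV)" by (intro sets_pair_measure_cong) (auto simp: P_def)
  ultimately show ?thesis using measurable_cong_sets by blast
 qed
 define \<pi> where "\<pi> = distr (M \<Otimes>\<^sub>M P) (Mn n) \<Phi>"
 have int: "integral\<^sup>N \<pi> g = (\<integral>\<^sup>+ \<omega>. (\<Sum>k\<in>K. g (alt n (fst k) (snd k) (Z \<omega>))) / of_nat (2*n) \<partial>M)" if g: "g \<in> borel_measurable (Mn n)" for g
 proof -
  have "integral\<^sup>N \<pi> g = (\<integral>\<^sup>+ \<omega>. g (\<Phi> \<omega>) \<partial>(M \<Otimes>\<^sub>M P))" unfolding \<pi>_def by (rule nn_integral_distr[OF \<Phi>m]) (simp add: g)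
  also have "\<dots> = (\<integral>\<^sup>+ \<omega>. \<integral>\<^sup>+ k. g (\<Phi> (\<omega>, k)) \<partial>P \<partial>M)"
   by (rule P.nn_integral_fst[symmetric]) (rule measurable_compose[OF \<Phi>m g])
  also have "\<dots> = (\<integral>\<^sup>+ \<omega>. (\<Sum>k\<in>K. g (\<Phi> (\<omega>, k))) / of_nat (2*n) \<partial>M)"
   unfolding P_def nn_integral_pmf_of_set[OF K(2,1)] K(3) ..
  also have "\<dots> = (\<integral>\<^sup>+ \<omega>. (\<Sum>k\<in>K. g (alt n (fst k) (snd k) (Z \<omega>))) / of_nat (2*n) \<partial>M)"
   by (intro nn_integral_cong arg_cong2[where f="(/)"] sum.cong refl) (auto simp: \<Phi>_def K_def)
  finally show ?thesis .
 qed
 have sK: "sum h K = (\<Sum>r<n. h (r, 0)) + (\<Sum>r<n. h (r, 1))" for h :: "nat \<times> nat => ennreal"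
 proof -
  have "sum h K = (\<Sum>r<n. \<Sum>c<2. h (r, c))" unfolding K_def by (simp add: sum.cartesian_product)
  thus ?thesis by (simp add: eval_nat_numeral sum.distrib)
 qed
 have n2: "(of_nat (2*n) :: ennreal) \<noteq> 0" "(of_nat (2*n) :: ennreal) \<noteq> \<top>"
  using n1 unfolding ennreal_of_nat_eq_real_of_nat by (auto simp: ennreal_eq_0_iff)
 have "\<pi> \<in> Pi_rho n \<rho>"
  unfolding Pi_rho_def
 proof (intro CollectI conjI allI impI)
  interpret MP: pair_prob_space M P ..
  show "prob_space \<pi>" unfolding \<pi>_def by (rule MP.prob_space_distr[OF \<Phi>m])
  fix i assume i: "i < n"
  show "distr \<pi> borel (%x. x i) = rho_measure \<rho>"
  proof (rule measure_eqI)
   fix A assume "A \<in> sets (distr \<pi> borel (%x. x i))"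
   hence A[measurable]: "A \<in> sets borel" by simp
   have m: "(%x. x i) \<in> measurable \<pi> borel" unfolding \<pi>_def using measurable_coord by simp
   have m': "(%x. indicator A (x i) :: ennreal) \<in> borel_measurable (Mn n)"
    by (rule measurable_compose[OF measurable_coord borel_measurable_indicator[OF A]])
   have "emeasure (distr \<pi> borel (%x. x i)) A = (\<integral>\<^sup>+ x. indicator A x \<partial>distr \<pi> borel (%x. x i))" by simp
   also have "\<dots> = (\<integral>\<^sup>+ x. indicator A (x i) \<partial>\<pi>)" by (rule nn_integral_distr[OF m]) simp
   also have "\<dots> = (\<integral>\<^sup>+ \<omega>. (\<Sum>k<2*n. indicator A (Z \<omega> k)) / of_nat (2*n) \<partial>M)"
    unfolding int[OF m'] sK
   proof (intro nn_integral_cong arg_cong2[where f="(/)"] refl)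
    fix \<omega>
    have "(\<Sum>r<n. indicator A (alt n r c (Z \<omega>) i)) = (\<Sum>j<n. indicator A (Z \<omega> (2*j + c)) :: ennreal)" for c
     using i sum.reindex_bij_betw[OF bij_betw_add_mod[of i n], of "%j. indicator A (Z \<omega> (2*j + c)) :: ennreal"]
     by (simp add: alt_def add.commute)
    thus "(\<Sum>r<n. indicator A (alt n (fst (r, 0)) (snd (r, 0)) (Z \<omega>) i)) + (\<Sum>r<n. indicator A (alt n (fst (r, 1)) (snd (r, 1)) (Z \<omega>) i)) = (\<Sum>k<2*n. indicator A (Z \<omega> k) :: ennreal)"
     unfolding sum_double_parity by simp
   qed
   also have "\<dots> = (\<integral>\<^sup>+ \<omega>. (\<Sum>k<2*n. indicator A (Z \<omega> k)) \<partial>M) / of_nat (2*n)"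
    using zc by (intro nn_integral_divide borel_measurable_sum measurable_compose[OF _ borel_measurable_indicator[OF A]]) auto
   also have "\<dots> = emeasure (rho_measure \<rho>) A"
    unfolding marg[OF A] by (subst mult.commute) (rule ennreal_mult_divide_eq[OF n2])
   finally show "emeasure (distr \<pi> borel (%x. x i)) A = emeasure (rho_measure \<rho>) A" .
  qed simp
 qed (simp add: \<pi>_def)
 hence "F_OT n w \<rho> <= integral\<^sup>N \<pi> (cn n w)" unfolding F_OT_def by (intro INF_lower2[of \<pi>]) auto
 also have "\<dots> = (\<integral>\<^sup>+ \<omega>. (of_nat n * (cn n w (alt n 0 0 (Z \<omega>)) + cn n w (alt n 0 1 (Z \<omega>)))) / of_nat (2*n) \<partial>M)"
 proof -
  have "(\<Sum>r<n. cn n w (alt n r c z)) = (\<Sum>r<n. cn n w (alt n 0 c z))" for c z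
   by (rule sum.cong[OF refl]) (rule cn_shift)
  thus ?thesis unfolding int[OF measurable_cn[OF w]] sK fst_conv snd_conv by (simp add: distrib_left)
 qed
 also have "\<dots> = (\<integral>\<^sup>+ \<omega>. (cn n w (alt n 0 0 (Z \<omega>)) + cn n w (alt n 0 1 (Z \<omega>))) / 2 \<partial>M)"
 proof (intro nn_integral_cong)
  fix \<omega>
  have "of_nat n * a / of_nat (2*n) = a / 2" for a :: ennreal
  proof -
   have n0: "0 < real n" using n1 by simp
   have n2': "of_nat n = ennreal (real n)" "of_nat (2*n) = ennreal (2 * real n)" "(2::ennreal) = ennreal 2"
    by (simp_all only: ennreal_of_nat_eq_real_of_nat of_nat_mult of_nat_numeral ennreal_numeral)
   show ?thesis
   proof (cases a)
    case (real b)
    have "ennreal (real n) * ennreal b / ennreal (2 * real n) = ennreal (real n * b / (2 * real n))"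
    proof -
     have "ennreal (real n) * ennreal b = ennreal (real n * b)" using n0 real by (intro ennreal_mult[symmetric]) auto
     thus ?thesis by (simp only:) (rule divide_ennreal, use n0 real in auto)
    qed
    moreover have "ennreal b / ennreal 2 = ennreal (b / 2)" using real by (intro divide_ennreal) auto
    ultimately show ?thesis unfolding n2' real(2) using n0 by simp
   next
    case top
    thus ?thesis unfolding n2' using n0 by (simp add: ennreal_mult_top ennreal_top_divide)
   qed
  qed
  thus "of_nat n * (cn n w (alt n 0 0 (Z \<omega>)) + cn n w (alt n 0 1 (Z \<omega>))) / of_nat (2*n) = (cn n w (alt n 0 0 (Z \<omega>)) + cn n w (alt n 0 1 (Z \<omega>))) / 2" .
 qed
 finally have F: "F_OT n w \<rho> <= (\<integral>\<^sup>+ \<omega>. (cn n w (alt n 0 0 (Z \<omega>)) + cn n w (alt n 0 1 (Z \<omega>))) / 2 \<partial>M)" .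
 have "2 * F_OT n w \<rho> <= 2 * (\<integral>\<^sup>+ \<omega>. (cn n w (alt n 0 0 (Z \<omega>)) + cn n w (alt n 0 1 (Z \<omega>))) / 2 \<partial>M)"
  using F by (rule mult_left_mono) simp
 also have "\<dots> = (\<integral>\<^sup>+ \<omega>. 2 * ((cn n w (alt n 0 0 (Z \<omega>)) + cn n w (alt n 0 1 (Z \<omega>))) / 2) \<partial>M)"
 proof (rule nn_integral_cmult[symmetric])
  have "(%\<omega>. cn n w (alt n 0 c (Z \<omega>))) \<in> borel_measurable M" if "c < 2" for c
   using measurable_compose[OF am[of 0 c] measurable_cn[OF w]] that by simp
  from this[of 0] this[of 1] show "(%\<omega>. (cn n w (alt n 0 0 (Z \<omega>)) + cn n w (alt n 0 1 (Z \<omega>))) / 2) \<in> borel_measurable M" by simp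
 qed
 also have "\<dots> = (\<integral>\<^sup>+ \<omega>. cn n w (alt n 0 0 (Z \<omega>)) + cn n w (alt n 0 1 (Z \<omega>)) \<partial>M)"
 proof (intro nn_integral_cong)
  have "2 * (a / 2) = a" for a :: ennreal unfolding ennreal_times_divide mult.commute[of 2 a] by (rule ennreal_mult_divide_eq) auto
  thus "2 * ((cn n w (alt n 0 0 (Z \<omega>)) + cn n w (alt n 0 1 (Z \<omega>))) / 2) = cn n w (alt n 0 0 (Z \<omega>)) + cn n w (alt n 0 1 (Z \<omega>))" for \<omega> .
 qed
 finally show ?thesis .
qed

text \<open>For two independent samples the alternate splitting costs no more pointwise and, by
  \<open>relaxed_cost\<close>, no less on average. The means are finite, so the costs agree almost
  surely and the equality case of \<open>alternating_split_cost\<close> applies.\<close>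

lemma optimizer_balanced:
 assumes n1: "1 <= n" and w: "assumptionA w" and sw: "strictly_well_ordering w" and \<rho>: "prob_density_on_I \<rho>"
  and opt: "OT_optimizer n w \<rho> \<gamma>" and fin: "F_OT n w \<rho> < \<infinity>"
 shows "balanced n \<gamma>"
proof -
 have \<gamma>: "\<gamma> \<in> Pi_rho n \<rho>" "(\<integral>\<^sup>+ x. cn n w x \<partial>\<gamma>) = F_OT n w \<rho>" using opt by (auto simp: OT_optimizer_def)
 note P = Pi_rhoD[OF \<gamma>(1)]
 interpret G: prob_space \<gamma> by (rule P(3))
 interpret GG: pair_prob_space \<gamma> \<gamma> ..
 interpret D: real_distribution "rho_measure \<rho>" by (rule real_distribution_rho[OF \<rho>])
 define M where "M = \<gamma> \<Otimes>\<^sub>M \<gamma>"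
 have sp: "fst \<omega> \<in> In n" "snd \<omega> \<in> In n" if "\<omega> \<in> space M" for \<omega> using that by (auto simp: M_def space_pair_measure P(2))
 have fm: "(%\<omega>. f (fst \<omega>)) \<in> measurable M N" "(%\<omega>. f (snd \<omega>)) \<in> measurable M N" if "f \<in> measurable (Mn n) N" for f N
  unfolding M_def using measurable_compose[OF measurable_fst P(5)[OF that]] measurable_compose[OF measurable_snd P(5)[OF that]] by auto
 have fi: "(\<integral>\<^sup>+ \<omega>. f (fst \<omega>) \<partial>M) = integral\<^sup>N \<gamma> f" "(\<integral>\<^sup>+ \<omega>. f (snd \<omega>) \<partial>M) = integral\<^sup>N \<gamma> f" if "f \<in> borel_measurable (Mn n)" for f
  using G.nn_integral_fst[OF fm(1)[OF that, unfolded M_def]] G.nn_integral_fst[OF fm(2)[OF that, unfolded M_def]]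
  by (simp_all add: M_def G.emeasure_space_1)
 define Z where "Z \<omega> = srt (2*n) (join n (fst \<omega>) (snd \<omega>))" for \<omega>
 have jm: "(%\<omega>. join n (fst \<omega>) (snd \<omega>)) \<in> measurable M (Mn (2*n))"
 proof (rule measurable_into_Mn)
  fix i assume "i < 2*n"
  thus "(%\<omega>. join n (fst \<omega>) (snd \<omega>) i) \<in> borel_measurable M"
   using fm[OF measurable_coord] by (cases "i < n") (simp_all add: join_def)
 qed (simp add: join_In sp)
 have Zm: "Z \<in> measurable M (Mn (2*n))" unfolding Z_def by (rule measurable_compose[OF jm measurable_srt])
 define f where "f \<omega> = cn n w (alt n 0 0 (Z \<omega>)) + cn n w (alt n 0 1 (Z \<omega>))" for \<omega>
 define g where "g \<omega> = cn n w (fst \<omega>) + cn n w (snd \<omega>)" for \<omega>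
 have pM: "prob_space M" unfolding M_def by (rule GG.prob_space_axioms)
 have lower: "2 * F_OT n w \<rho> <= integral\<^sup>N M f"
  unfolding f_def
 proof (rule relaxed_cost[OF n1 w pM Zm])
  fix A :: "real set" assume A: "A \<in> sets borel"
  have mi: "(%x. indicator A (x i) :: ennreal) \<in> borel_measurable (Mn n)" for i
   by (rule measurable_compose[OF measurable_coord borel_measurable_indicator[OF A]])
  have one: "(\<integral>\<^sup>+ x. indicator A (x i) \<partial>\<gamma>) = emeasure (rho_measure \<rho>) A" if "i < n" for i
  proof -
   have "emeasure (rho_measure \<rho>) A = (\<integral>\<^sup>+ x. indicator A x \<partial>distr \<gamma> borel (%x. x i))" using P(4)[OF that] A by simp
   also have "\<dots> = (\<integral>\<^sup>+ x. indicator A (x i) \<partial>\<gamma>)" using A by (intro nn_integral_distr P(5)[OF measurable_coord]) simp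
   finally show ?thesis by simp
  qed
  have "(\<integral>\<^sup>+ \<omega>. (\<Sum>k<2*n. indicator A (Z \<omega> k)) \<partial>M) = (\<integral>\<^sup>+ \<omega>. (\<Sum>i<n. indicator A (fst \<omega> i)) + (\<Sum>i<n. indicator A (snd \<omega> i)) \<partial>M)"
  proof (rule nn_integral_cong)
   fix \<omega> assume "\<omega> \<in> space M"
   then obtain \<tau> where t: "\<tau> permutes {..<2*n}" "Z \<omega> = join n (fst \<omega>) (snd \<omega>) \<circ> \<tau>"
    unfolding Z_def using srt_permute[OF In_extensional[OF join_In]] sp by metis
   have "(\<Sum>k<2*n. indicator A (Z \<omega> k)) = (\<Sum>k<2*n. indicator A (join n (fst \<omega>) (snd \<omega>) k) :: ennreal)"
    unfolding t(2) comp_apply by (rule sum.reindex_bij_betw[OF permutes_imp_bij[OF t(1)]])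
   thus "(\<Sum>k<2*n. indicator A (Z \<omega> k)) = (\<Sum>i<n. indicator A (fst \<omega> i)) + (\<Sum>i<n. indicator A (snd \<omega> i) :: ennreal)"
    unfolding sum_double_halves by (simp add: join_def)
  qed
  also have "\<dots> = (\<Sum>i<n. \<integral>\<^sup>+ \<omega>. indicator A (fst \<omega> i) \<partial>M) + (\<Sum>i<n. \<integral>\<^sup>+ \<omega>. indicator A (snd \<omega> i) \<partial>M)"
   using fm[OF mi] by (subst nn_integral_add) (auto simp: nn_integral_sum intro!: borel_measurable_sum)
  also have "\<dots> = of_nat (2*n) * emeasure (rho_measure \<rho>) A"
   by (simp add: fi[OF mi] one mult_2 distrib_right)
  finally show "(\<integral>\<^sup>+ \<omega>. (\<Sum>k<2*n. indicator A (Z \<omega> k)) \<partial>M) = of_nat (2*n) * emeasure (rho_measure \<rho>) A" .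
 qed
 note mc = measurable_cn[OF w, of n]
 have gi: "integral\<^sup>N M g = 2 * F_OT n w \<rho>"
  unfolding g_def using fm[OF mc] by (subst nn_integral_add) (simp_all add: fi[OF mc] \<gamma>(2) mult_2)
 have fin1: "AE \<omega> in M. cn n w (fst \<omega>) \<noteq> \<infinity>" "AE \<omega> in M. cn n w (snd \<omega>) \<noteq> \<infinity>"
  by (rule nn_integral_PInf_AE[OF fm(1)[OF mc]] nn_integral_PInf_AE[OF fm(2)[OF mc]]; use fi[OF mc] fin \<gamma>(2) in simp)+
 \<comment> \<open>By independence and the absence of atoms a point of one sample almost surely
   misses the points of the other, across the seam included.\<close>
 have ne: "AE \<omega> in M. dT (fst \<omega> i) (snd \<omega> j) \<noteq> 0" if ij: "i < n" "j < n" for i j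
  unfolding M_def
 proof (rule GG.AE_pair_measure)
  note [measurable] = fm(1)[OF measurable_coord[of i], unfolded M_def] fm(2)[OF measurable_coord[of j], unfolded M_def]
  show "{x \<in> space (\<gamma> \<Otimes>\<^sub>M \<gamma>). dT (fst x i) (snd x j) \<noteq> 0} \<in> sets (\<gamma> \<Otimes>\<^sub>M \<gamma>)" by measurable
  have "AE y in \<gamma>. dT s (y j) \<noteq> 0" for s
  proof -
   have "AE t in rho_measure \<rho>. t \<notin> {a}" for a
    using rho_measure_singleton[OF \<rho>, of a] by (intro AE_not_in null_setsI) (auto simp: D.emeasure_eq_measure)
   hence "AE t in rho_measure \<rho>. t \<notin> {s} \<and> t \<notin> {s + 2*pi} \<and> t \<notin> {s - 2*pi}" by (intro AE_conjI)
   hence "AE t in rho_measure \<rho>. dT s t \<noteq> 0" by (elim AE_mp) (auto intro!: AE_I2 simp: dT_def min_def abs_if split: if_splits)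
   thus ?thesis unfolding P(4)[OF ij(2), symmetric] by (rule AE_distrD[OF P(5)[OF measurable_coord]])
  qed
  thus "AE x in \<gamma>. AE y in \<gamma>. dT (fst (x, y) i) (snd (x, y) j) \<noteq> 0" by simp
 qed
 have "AE \<omega> in M. \<forall>i\<in>{..<n}. \<forall>j\<in>{..<n}. dT (fst \<omega> i) (snd \<omega> j) \<noteq> 0"
  by (intro AE_finite_allI) (auto intro: ne)
 hence sep: "AE \<omega> in M. \<forall>k l. k < 2*n --> l < 2*n --> k \<noteq> l --> dT (join n (fst \<omega>) (snd \<omega>) k) (join n (fst \<omega>) (snd \<omega>) l) \<noteq> 0"
  using fin1 AE_space
 proof (eventually_elim, intro allI impI)
  fix \<omega> k l
  assume mix: "\<forall>i\<in>{..<n}. \<forall>j\<in>{..<n}. dT (fst \<omega> i) (snd \<omega> j) \<noteq> 0" and c: "cn n w (fst \<omega>) \<noteq> \<infinity>" "cn n w (snd \<omega>) \<noteq> \<infinity>"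
   and \<omega>: "\<omega> \<in> space M" and kl: "k < 2*n" "l < 2*n" "k \<noteq> l"
  have own: "dT (x i) (x j) \<noteq> 0" if "cn n w x \<noteq> \<infinity>" "x \<in> In n" "i < n" "j < n" "i \<noteq> j" for x i j
  proof -
   have "w (x i) (x j) <= (\<Sum>j<n. if i = j then 0 else w (x i) (x j))"
    using that member_le_sum[of j "{..<n}" "%j. if i = j then 0 else w (x i) (x j)"] by simp
   also have "\<dots> <= cn n w x" unfolding cn_alt using that by (intro member_le_sum) auto
   finally have "w (x i) (x j) \<noteq> \<infinity>" using that(1) by (auto simp: top_unique)
   thus ?thesis using w_inf_iff[OF w] In_coord that by blast
  qed
  show "dT (join n (fst \<omega>) (snd \<omega>) k) (join n (fst \<omega>) (snd \<omega>) l) \<noteq> 0"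
  proof (cases "k < n"; cases "l < n")
   assume "k < n" "l < n"
   thus ?thesis using own[OF c(1) sp(1)[OF \<omega>]] kl by (simp add: join_def)
  next
   assume "k < n" "\<not> l < n"
   thus ?thesis using mix kl by (simp add: join_def)
  next
   assume "\<not> k < n" "l < n"
   thus ?thesis using mix kl dT_sym[of "snd \<omega> (k - n)"] by (simp add: join_def)
  next
   assume "\<not> k < n" "\<not> l < n"
   thus ?thesis using own[OF c(2) sp(2)[OF \<omega>]] kl by (simp add: join_def)
  qed
 qed
 have le: "AE \<omega> in M. f \<omega> <= g \<omega>"
  using sep AE_space
 proof eventually_elim
  case (elim \<omega>)
  thus ?case unfolding f_def g_def Z_def by (intro alternating_split_cost(1)[OF n1 w sw sp(1) sp(2)]) auto
 qed
 have fmeas: "f \<in> borel_measurable M"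
 proof -
  have "(%\<omega>. cn n w (alt n 0 c (Z \<omega>))) \<in> borel_measurable M" if c: "c < 2" for c
  proof (rule measurable_compose[OF measurable_into_Mn mc])
   fix i assume "i < n"
   thus "(%\<omega>. alt n 0 c (Z \<omega>) i) \<in> borel_measurable M" using measurable_compose[OF Zm measurable_coord] by (simp add: alt_def)
  next
   fix \<omega> assume "\<omega> \<in> space M"
   hence "Z \<omega> \<in> In (2*n)" using measurable_space[OF Zm] by simp
   moreover have "2 * i + c < 2*n" if "i < n" for i using c that by linarith
   ultimately show "alt n 0 c (Z \<omega>) \<in> In n" by (auto simp: alt_def In_def PiE_def Pi_def)
  qed
  from this[of 0] this[of 1] show ?thesis unfolding f_def by simp
 qed
 have gmeas: "g \<in> borel_measurable M" unfolding g_def using fm[OF mc] by simp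
 have F2: "2 * F_OT n w \<rho> \<noteq> \<infinity>" using fin by (simp add: ennreal_mult_eq_top_iff)
 have fi2: "integral\<^sup>N M f \<noteq> \<infinity>"
  using nn_integral_mono_AE[OF le] F2 unfolding gi by (auto simp: top_unique)
 have eq: "AE \<omega> in M. g \<omega> <= f \<omega>"
  using nn_integral_less[OF fmeas gmeas fi2 le] lower unfolding gi by (auto simp: not_less[symmetric])
 show ?thesis
  unfolding balanced_def
 proof (intro allI)
  fix s t
  define A where "A x = int (cnt n t x) - int (cnt n s x)" for x
  have "AE \<omega> in M. \<bar>A (fst \<omega>) - A (snd \<omega>)\<bar> <= 1"
   using sep le eq AE_space
  proof eventually_elim
   case (elim \<omega>)
   thus ?case unfolding A_def
    by (intro alternating_split_cost(2)[OF n1 w sw sp(1) sp(2)]) (auto simp: f_def g_def Z_def intro: antisym)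
  qed
  hence AA: "AE x in \<gamma>. AE y in \<gamma>. \<bar>A x - A y\<bar> <= 1" unfolding M_def using GG.AE_pair by fastforce
  \<comment> \<open>An integer variable whose independent copies differ by at most 1 takes at most
    two consecutive values: almost every sample is a valid reference \<open>x0\<close>, and either
    there is a valid reference one below it or that value is almost surely not taken.\<close>
  from eventually_happens'[OF G.ae_filter_bot AA] obtain x0 where x0: "AE y in \<gamma>. \<bar>A x0 - A y\<bar> <= 1" by blast
  show "\<exists>k. AE x in \<gamma>. int (cnt n t x) - int (cnt n s x) \<in> {k, k + 1}"
   unfolding A_def[symmetric]
  proof (cases "\<exists>x1. A x1 = A x0 - 1 \<and> (AE y in \<gamma>. \<bar>A x1 - A y\<bar> <= 1)")
   case True
   then obtain x1 where x1: "A x1 = A x0 - 1" "AE y in \<gamma>. \<bar>A x1 - A y\<bar> <= 1" by blast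
   have "AE y in \<gamma>. A y \<in> {A x0 - 1, A x0 - 1 + 1}" using x0 x1(2) by eventually_elim (use x1(1) in auto)
   thus "\<exists>k. AE x in \<gamma>. A x \<in> {k, k + 1}" ..
  next
   case False
   have "AE y in \<gamma>. A y \<in> {A x0, A x0 + 1}" using x0 AA
   proof eventually_elim
    case (elim y)
    hence "A y \<noteq> A x0 - 1" using False by blast
    thus ?case using elim(1) by auto
   qed
   thus "\<exists>k. AE x in \<gamma>. A x \<in> {k, k + 1}" ..
  qed
 qed
qed

text \<open>The density of a minimizer is a plan of cost at most \<open>F_per\<close>, which tends
  to \<open>F_OT\<close>; lower semicontinuity then makes a weak limit optimal.\<close>

lemma minimizers_subsequence:
 assumes n1: "1 <= n" and w: "assumptionA w" and \<rho>: "prob_density_on_I \<rho>"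
  and H: "H1per 1 (%x. complex_of_real (sqrt (\<rho> (x 0))))"
  and min: "!!j. lieb_minimizer n w (e j) \<rho> (lam j) (Psi j)" and e: "!!j::nat. 0 < e j" "e \<longlonglongrightarrow> 0"
 shows "\<exists>r \<gamma>. strict_mono r \<and> OT_optimizer n w \<rho> \<gamma> \<and> sym_plan n \<gamma> \<and>
  weak_conv_In n (%j. Gamma_dens n (lam (r j)) (Psi (r j))) \<gamma> sequentially"
proof -
 define \<mu> where "\<mu> j = Gamma_dens n (lam j) (Psi j)" for j
 have \<mu>: "\<mu> j \<in> Pi_rho n \<rho>" "sym_plan n (\<mu> j)" "(\<integral>\<^sup>+ x. cn n w x \<partial>\<mu> j) <= F_per n w (e j) \<rho>" for j
 proof -
  obtain G where G: "lieb_admissible n \<rho> (lam j) (Psi j) G" "lieb_energy n w (e j) (lam j) (Psi j) G = F_per n w (e j) \<rho>"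
   using min[of j] unfolding lieb_minimizer_def by blast
  interpret lieb_state n \<rho> "lam j" "Psi j" G by unfold_locales (use n1 \<rho> G in auto)
  show "\<mu> j \<in> Pi_rho n \<rho>" "sym_plan n (\<mu> j)" "(\<integral>\<^sup>+ x. cn n w x \<partial>\<mu> j) <= F_per n w (e j) \<rho>"
   unfolding \<mu>_def G(2)[symmetric] by (rule Gamma_in_Pi sym_Gamma cost_Gamma_le[OF w])+
 qed
 note P = Pi_rhoD[OF \<mu>(1)]
 from weakly_compact_In[of \<mu>, OF P(1) P(3)] obtain r \<gamma> where r: "strict_mono r" and \<gamma>: "sets \<gamma> = sets (Mn n)" "prob_space \<gamma>"
  and wc: "weak_conv_In n (%j. \<mu> (r j)) \<gamma> sequentially" by blast
 have "filterlim e (at_right 0) sequentially" using e by (intro tendsto_imp_filterlim_at_right) auto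
 hence "(%j. F_per n w (e (r j)) \<rho>) \<longlonglongrightarrow> F_OT n w \<rho>"
  using filterlim_compose[OF F_per_tendsto[OF n1 w \<rho> H]] filterlim_compose[OF _ filterlim_subseq[OF r]] by blast
 hence "(\<integral>\<^sup>+ x. cn n w x \<partial>\<gamma>) <= F_OT n w \<rho>"
  by (rule weak_limit_cost[OF w P(1) P(3) \<gamma> wc \<mu>(3)])
 moreover have gP: "\<gamma> \<in> Pi_rho n \<rho>" by (rule weak_limit_in_Pi[OF \<rho> \<mu>(1) \<gamma> wc])
 moreover have "F_OT n w \<rho> <= (\<integral>\<^sup>+ x. cn n w x \<partial>\<gamma>)" unfolding F_OT_def by (rule INF_lower[OF gP])
 ultimately have "OT_optimizer n w \<rho> \<gamma>" unfolding OT_optimizer_def by (auto intro: antisym)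
 moreover have "sym_plan n \<gamma>" by (rule weak_limit_sym[OF P(1) \<mu>(2) \<gamma> wc])
 ultimately show ?thesis using r wc unfolding \<mu>_def by blast
qed

theorem theorem2p3:
  fixes n :: nat and w :: "real \<Rightarrow> real \<Rightarrow> ennreal" and \<rho> :: "real \<Rightarrow> real"
  assumes "1 \<le> n"
    and "assumptionA w"
    and "prob_density_on_I \<rho>"
    and "H1per 1 (\<lambda>x. complex_of_real (sqrt (\<rho> (x 0))))"
  shows "((\<lambda>\<epsilon>. F_per n w \<epsilon> \<rho>) \<longlongrightarrow> F_OT n w \<rho>) (at_right 0)
    \<and> (\<forall>(lam :: real \<Rightarrow> nat \<Rightarrow> real) (Psi :: real \<Rightarrow> nat \<Rightarrow> (nat \<Rightarrow> real) \<Rightarrow> complex).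
         (\<forall>\<epsilon>>0. lieb_minimizer n w \<epsilon> \<rho> (lam \<epsilon>) (Psi \<epsilon>)) \<longrightarrow>
         (\<forall>e :: nat \<Rightarrow> real. (\<forall>j. 0 < e j) \<and> e \<longlonglongrightarrow> 0 \<longrightarrow>
            (\<exists>r \<gamma>. strict_mono r \<and> OT_optimizer n w \<rho> \<gamma> \<and> sym_plan n \<gamma> \<and>
               weak_conv_In n (\<lambda>j. Gamma_dens n (lam (e (r j))) (Psi (e (r j)))) \<gamma> sequentially)) \<and>
         (strictly_well_ordering w \<longrightarrow>
            (\<exists>\<gamma>. seidl_plan n \<rho> \<gamma> \<and>
               weak_conv_In n (\<lambda>\<epsilon>. Gamma_dens n (lam \<epsilon>) (Psi \<epsilon>)) (symmetrization n \<gamma>) (at_right 0))))"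
proof (intro conjI allI impI)
 show "((%\<epsilon>. F_per n w \<epsilon> \<rho>) \<longlongrightarrow> F_OT n w \<rho>) (at_right 0)" by (rule F_per_tendsto[OF assms])
 fix lam :: "real => nat => real" and Psi :: "real => nat => (nat => real) => complex"
 assume min: "\<forall>\<epsilon>>0. lieb_minimizer n w \<epsilon> \<rho> (lam \<epsilon>) (Psi \<epsilon>)"
 have sub: "\<exists>r \<gamma>. strict_mono r \<and> OT_optimizer n w \<rho> \<gamma> \<and> sym_plan n \<gamma> \<and>
   weak_conv_In n (%j. Gamma_dens n (lam (e (r j))) (Psi (e (r j)))) \<gamma> sequentially"
  if "!!j. 0 < e j" "e \<longlonglongrightarrow> 0" for e :: "nat => real"
  using minimizers_subsequence[OF assms, of e "%j. lam (e j)" "%j. Psi (e j)"] min that by simp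
 show "\<exists>r \<gamma>. strict_mono r \<and> OT_optimizer n w \<rho> \<gamma> \<and> sym_plan n \<gamma> \<and>
   weak_conv_In n (%j. Gamma_dens n (lam (e (r j))) (Psi (e (r j)))) \<gamma> sequentially"
  if "(\<forall>j. 0 < e j) \<and> e \<longlonglongrightarrow> 0" for e :: "nat => real" using sub[of e] that by blast
 assume sw: "strictly_well_ordering w"
 interpret seidl n \<rho> by unfold_locales (use assms in auto)
 \<comment> \<open>Optimality gives balance, balance fixes the sorted law, and symmetry recovers the
   plan from it.\<close>
 have uniq: "\<gamma> = symmetrization n plan" if opt: "OT_optimizer n w \<rho> \<gamma>" and sym: "sym_plan n \<gamma>" for \<gamma>
 proof -
  have \<gamma>: "\<gamma> \<in> Pi_rho n \<rho>" using opt by (simp add: OT_optimizer_def)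
  have "balanced n \<gamma>" by (rule optimizer_balanced[OF assms(1,2) sw assms(3) opt F_OT_finite[OF assms(2)]])
  hence "distr plan (Mn n) (srt n) = distr \<gamma> (Mn n) (srt n)"
   by (intro balanced_sorted_unique[OF assms(1) plan_Pi plan_balanced \<gamma>])
  thus ?thesis by (intro symmetrization_unique[OF Pi_rhoD(1)[OF plan_Pi] Pi_rhoD(1)[OF \<gamma>] _ sym, symmetric])
 qed
 have "weak_conv_In n (%\<epsilon>. Gamma_dens n (lam \<epsilon>) (Psi \<epsilon>)) (symmetrization n plan) (at_right 0)"
  unfolding weak_conv_In_def
 proof (intro allI impI)
  fix f :: "(nat => real) => real" assume f: "continuous_on (In n) f"
  let ?X = "%\<epsilon>. integral\<^sup>L (Gamma_dens n (lam \<epsilon>) (Psi \<epsilon>)) f" and ?L = "integral\<^sup>L (symmetrization n plan) f"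
  show "(?X \<longlongrightarrow> ?L) (at_right 0)"
  proof (rule tendsto_at_right_sequentially[of 0 1])
   fix S :: "nat => real" assume S: "!!j. 0 < S j" "S \<longlonglongrightarrow> 0"
   show "(%j. ?X (S j)) \<longlonglongrightarrow> ?L"
   proof (rule ccontr)
    \<comment> \<open>A subsequence staying away from the limit would itself have a subsequence
      converging to the only possible limit.\<close>
    assume "\<not> (%j. ?X (S j)) \<longlonglongrightarrow> ?L"
    then obtain d where d: "0 < d" "!!N. \<exists>j\<ge>N. d <= dist (?X (S j)) ?L" unfolding lim_sequentially not_all not_ex not_imp not_less by blast
    hence "infinite {j. d <= dist (?X (S j)) ?L}" unfolding infinite_nat_iff_unbounded_le by blast
    then obtain r :: "nat => nat" where r: "strict_mono r" "!!j. d <= dist (?X (S (r j))) ?L"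
     using infinite_enumerate by blast
    have "(%j. S (r j)) \<longlonglongrightarrow> 0" using LIMSEQ_subseq_LIMSEQ[OF S(2) r(1)] by (simp add: comp_def)
    then obtain r' \<gamma> where g: "OT_optimizer n w \<rho> \<gamma>" "sym_plan n \<gamma>"
     "weak_conv_In n (%j. Gamma_dens n (lam (S (r (r' j)))) (Psi (S (r (r' j))))) \<gamma> sequentially"
     using sub[of "%j. S (r j)"] S(1) by blast
    from g(3) f have "(%j. ?X (S (r (r' j)))) \<longlonglongrightarrow> ?L" unfolding uniq[OF g(1,2)] weak_conv_In_def by blast
    then obtain N where "dist (?X (S (r (r' N)))) ?L < d" using d(1) unfolding lim_sequentially by blast
    thus False using r(2)[of "r' N"] by simp
   qed
  qed simp
 qed
 thus "\<exists>\<gamma>. seidl_plan n \<rho> \<gamma> \<and> weak_conv_In n (%\<epsilon>. Gamma_dens n (lam \<epsilon>) (Psi \<epsilon>)) (symmetrization n \<gamma>) (at_right 0)"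
  using seidl_plan_plan by blast
qed

end
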